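(* Let $(M,\Psi)$ be a $Spin(7)$ manifold with Lee form $\theta$ and torsion connection $\nabla$, with torsion 3-form $T$ and curvature $R$. If the Lee form is closed, $d\theta=0$, the curvature $R$ is a $Spin(7)$-instanton, and $d^{\nabla}T=0$ (equivalently, $dT=2\sigma^T$), then the torsion 3-form is parallel with respect to the torsion connection, $\nabla T=0$. In this case the Ricci tensor of the torsion connection is symmetric and $\nabla$-parallel, and $\nabla dT=0$.
   Context: Manifolds are smooth. A $Spin(7)$ manifold $(M,\Psi)$ is an 8-manifold with a 4-form $\Psi$ that near each point can be written, in a local coframe $e_0,\dots,e_7$, as $\Psi=-e_{0127}+e_{0236}-e_{0347}-e_{0567}+e_{0146}+e_{0245}-e_{0135}-e_{3456}-e_{1457}-e_{1256}-e_{1234}-e_{2357}-e_{1367}+e_{2467}$, where $e_{ijkl}=e_i\wedge e_j\wedge e_k\wedge e_l$. It induces the metric $g$ and orientation for which such coframes are oriented orthonormal; $*$ is the Hodge star and $\delta=-*d*$ the codifferential. Vectors and covectors are identified via $g$, indices refer to a local orthonormal frame, and repeated indices are summed. The Lee form is $\theta=-\frac17*( *d\Psi\wedge\Psi)$, i.e. $\theta_a=\frac1{42}(\delta\Psi)_{ijk}\Psi_{ijka}$. There is a unique linear connection $\nabla$ (the torsion connection) with $\nabla g=0$, $\nabla\Psi=0$ and totally skew-symmetric torsion, i.e. $T(X,Y,Z)=g(\nabla_XY-\nabla_YX-[X,Y],Z)$ is a 3-form. Curvature: $R(X,Y)Z=[\nabla_X,\nabla_Y]Z-\nabla_{[X,Y]}Z$,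 $R(X,Y,Z,V)=g(R(X,Y)Z,V)$, and $Ric(X,Y)=\sum_a R(e_a,X,Y,e_a)$. $R$ is a $Spin(7)$-instanton if $R_{abij}\Psi_{abkl}=2R_{klij}$ for all $i,j,k,l$, i.e. the curvature 2-form lies in $\mathfrak{spin}(7)\cong\{\alpha\in\Lambda^2:\alpha_{ij}\Psi_{ijkl}=2\alpha_{kl}\}$; equivalently (since $\nabla\Psi=0$) $R\in\mathfrak{spin}(7)\otimes\mathfrak{spin}(7)$. The 4-form $d^\nabla T$ is $d^{\nabla}T(X,Y,Z,V)=(\nabla_XT)(Y,Z,V)+(\nabla_YT)(Z,X,V)+(\nabla_ZT)(X,Y,V)-(\nabla_VT)(X,Y,Z)$, and $\sigma^T=\frac12\sum_j(e_j\lrcorner T)\wedge(e_j\lrcorner T)$ for an orthonormal frame, where $(e_j\lrcorner T)(X,Y)=T(e_j,X,Y)$. One always has $dT=d^{\nabla}T+2\sigma^T$. *)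

theory Defs
  imports "HOL-Analysis.Analysis"
begin

text \<open>
  Smooth 8-manifolds are given by an atlas. A tensor field is the family of its local
  representatives, one for each chart, living on the image of the chart in $\mathbb{R}^8$ and
  related by the transition maps. A covariant k-tensor at a point is a function on lists of
  vectors; only lists of length k matter.
\<close>

type_synonym r8 = "real^8"
type_synonym tensor = "r8 list \<Rightarrow> real"
type_synonym local_field = "r8 \<Rightarrow> tensor"
type_synonym local_connection = "r8 \<Rightarrow> r8 \<Rightarrow> r8 \<Rightarrow> r8"
type_synonym 'a chart = "'a set \<times> ('a \<Rightarrow> r8)"

subsection \<open>Manifolds\<close>

text \<open>On an open set, \<open>k_smooth_on k\<close> is being of class $C^k$.\<close>

primrec k_smooth_on :: "nat \<Rightarrow> r8 set \<Rightarrow> (r8 \<Rightarrow> 'b::real_normed_vector) \<Rightarrow> bool" where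
  "k_smooth_on 0 W f \<longleftrightarrow> continuous_on W f"
| "k_smooth_on (Suc k) W f \<longleftrightarrow> (\<forall>x\<in>W. f differentiable (at x)) \<and>
     (\<forall>v. k_smooth_on k W (\<lambda>x. frechet_derivative f (at x) v))"

definition smooth_on :: "r8 set \<Rightarrow> (r8 \<Rightarrow> 'b::real_normed_vector) \<Rightarrow> bool" where
  "smooth_on W f \<longleftrightarrow> (\<forall>k. k_smooth_on k W f)"

definition img :: "'a chart \<Rightarrow> r8 set" where
  "img c = snd c ` fst c"

definition transition :: "'a chart \<Rightarrow> 'a chart \<Rightarrow> r8 \<Rightarrow> r8" where
  "transition c c' = snd c' \<circ> inv_into (fst c) (snd c)"

definition overlap :: "'a chart \<Rightarrow> 'a chart \<Rightarrow> r8 set" where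
  "overlap c c' = snd c ` (fst c \<inter> fst c')"

definition smooth_atlas :: "('a::{t2_space, second_countable_topology}) chart set \<Rightarrow> bool" where
  "smooth_atlas A \<longleftrightarrow>
     (\<Union>c\<in>A. fst c) = UNIV \<and>
     (\<forall>c\<in>A. open (fst c) \<and> open (img c) \<and> (\<exists>\<psi>. homeomorphism (fst c) (img c) (snd c) \<psi>)) \<and>
     (\<forall>c\<in>A. \<forall>c'\<in>A. smooth_on (overlap c c') (transition c c'))"

subsection \<open>Exterior algebra at a point\<close>

definition is_form :: "nat \<Rightarrow> tensor \<Rightarrow> bool" where
  "is_form k \<alpha> \<longleftrightarrow>
     (\<forall>vs i. length vs = k \<longrightarrow> i < k \<longrightarrow> linear (\<lambda>v. \<alpha> (vs[i := v]))) \<and>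
     (\<forall>vs i j. length vs = k \<longrightarrow> i < j \<longrightarrow> j < k \<longrightarrow> vs ! i = vs ! j \<longrightarrow> \<alpha> vs = 0)"

definition wedge :: "nat \<Rightarrow> nat \<Rightarrow> tensor \<Rightarrow> tensor \<Rightarrow> tensor" where
  "wedge k l \<alpha> \<beta> = (\<lambda>vs. (\<Sum>\<sigma> | \<sigma> permutes {..<k + l}. of_int (sign \<sigma>)
       * \<alpha> (map (\<lambda>i. vs ! \<sigma> i) [0..<k]) * \<beta> (map (\<lambda>i. vs ! \<sigma> i) [k..<k + l]))
     / (fact k * fact l))"

text \<open>
  The wedge product of a list of covectors, as a determinant; this is the iterated product for
  the normalisation chosen in \<open>wedge\<close>.
\<close>

definition covector_wedge :: "(r8 \<Rightarrow> real) list \<Rightarrow> tensor" where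
  "covector_wedge \<alpha>s = (\<lambda>vs. \<Sum>\<sigma> | \<sigma> permutes {..<length \<alpha>s}. of_int (sign \<sigma>)
     * (\<Prod>m<length \<alpha>s. (\<alpha>s ! m) (vs ! \<sigma> m)))"

definition coframe :: "(8 \<Rightarrow> r8 \<Rightarrow> real) \<Rightarrow> bool" where
  "coframe \<epsilon> \<longleftrightarrow> (\<forall>i. linear (\<epsilon> i)) \<and> (\<forall>v. (\<forall>i. \<epsilon> i v = 0) \<longrightarrow> v = 0)"

definition orthonormal_frame :: "tensor \<Rightarrow> (8 \<Rightarrow> r8) \<Rightarrow> bool" where
  "orthonormal_frame g e \<longleftrightarrow> (\<forall>i j. g [e i, e j] = (if i = j then 1 else 0))"

definition some_frame :: "tensor \<Rightarrow> 8 \<Rightarrow> r8" where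
  "some_frame g = (SOME e. orthonormal_frame g e)"

text \<open>
  The Hodge star of a k-form for the metric \<open>g\<close> and the volume form \<open>vol\<close>:
  $(*\alpha)_{j\ldots} = \frac{1}{k!}\,\alpha_{i_1\ldots i_k}\, vol_{i_1\ldots i_k j\ldots}$, so that
  $\alpha\wedge *\beta = g(\alpha,\beta)\, vol$. The value does not depend on the orthonormal frame,
  whose orientation plays no role either.
\<close>

definition hodge :: "tensor \<Rightarrow> tensor \<Rightarrow> nat \<Rightarrow> tensor \<Rightarrow> tensor" where
  "hodge g vol k \<alpha> = (\<lambda>ws. (\<Sum>is | length is = k.
       \<alpha> (map (some_frame g) is) * vol (map (some_frame g) is @ ws)) / fact k)"

subsection \<open>Differential forms and connections\<close>

definition ext_d :: "local_field \<Rightarrow> local_field" where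
  "ext_d \<omega> = (\<lambda>x vs. \<Sum>i<length vs. (- 1) ^ i
     * frechet_derivative (\<lambda>y. \<omega> y (take i vs @ drop (Suc i) vs)) (at x) (vs ! i))"

definition differential_form ::
    "('a::{t2_space, second_countable_topology}) chart set \<Rightarrow> nat \<Rightarrow> ('a chart \<Rightarrow> local_field) \<Rightarrow> bool" where
  "differential_form A k \<omega> \<longleftrightarrow>
     (\<forall>c\<in>A. (\<forall>x\<in>img c. is_form k (\<omega> c x)) \<and>
            (\<forall>vs. length vs = k \<longrightarrow> smooth_on (img c) (\<lambda>x. \<omega> c x vs))) \<and>
     (\<forall>c\<in>A. \<forall>c'\<in>A. \<forall>x\<in>overlap c c'. \<forall>vs. length vs = k \<longrightarrow>
        \<omega> c x vs = \<omega> c' (transition c c' x)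
          (map (frechet_derivative (transition c c') (at x)) vs))"

text \<open>
  A linear connection is given in a chart by \<open>\<Gamma> x u v\<close>, the covariant derivative at \<open>x\<close>, in
  direction \<open>u\<close>, of the vector field with constant coordinates \<open>v\<close>.
\<close>

definition linear_connection ::
    "('a::{t2_space, second_countable_topology}) chart set \<Rightarrow> ('a chart \<Rightarrow> local_connection) \<Rightarrow> bool" where
  "linear_connection A \<Gamma> \<longleftrightarrow>
     (\<forall>c\<in>A. (\<forall>x\<in>img c. (\<forall>v. linear (\<lambda>u. \<Gamma> c x u v)) \<and> (\<forall>u. linear (\<Gamma> c x u))) \<and>
            (\<forall>u v. smooth_on (img c) (\<lambda>x. \<Gamma> c x u v))) \<and>
     (\<forall>c\<in>A. \<forall>c'\<in>A. \<forall>x\<in>overlap c c'. \<forall>u v.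
        (let \<tau> = transition c c'; J = (\<lambda>y. frechet_derivative \<tau> (at y)) in
          J x (\<Gamma> c x u v) = frechet_derivative (\<lambda>y. J y v) (at x) u + \<Gamma> c' (\<tau> x) (J x u) (J x v)))"

definition lie_bracket :: "(r8 \<Rightarrow> r8) \<Rightarrow> (r8 \<Rightarrow> r8) \<Rightarrow> r8 \<Rightarrow> r8" where
  "lie_bracket X Y = (\<lambda>x. frechet_derivative Y (at x) (X x) - frechet_derivative X (at x) (Y x))"

definition cov :: "local_connection \<Rightarrow> (r8 \<Rightarrow> r8) \<Rightarrow> (r8 \<Rightarrow> r8) \<Rightarrow> r8 \<Rightarrow> r8" where
  "cov \<Gamma> X Y = (\<lambda>x. frechet_derivative Y (at x) (X x) + \<Gamma> x (X x) (Y x))"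

text \<open>
  The operators below are tensorial: their values on vectors at \<open>x\<close> are obtained by extending
  the vectors to vector fields with constant coordinates in the chart.
\<close>

definition torsion :: "local_field \<Rightarrow> local_connection \<Rightarrow> local_field" where
  "torsion g \<Gamma> = (\<lambda>x vs. let X = (\<lambda>_. vs ! 0); Y = (\<lambda>_. vs ! 1) in
     g x [cov \<Gamma> X Y x - cov \<Gamma> Y X x - lie_bracket X Y x, vs ! 2])"

definition curvature :: "local_field \<Rightarrow> local_connection \<Rightarrow> local_field" where
  "curvature g \<Gamma> = (\<lambda>x vs. let X = (\<lambda>_. vs ! 0); Y = (\<lambda>_. vs ! 1); Z = (\<lambda>_. vs ! 2) in
     g x [cov \<Gamma> X (cov \<Gamma> Y Z) x - cov \<Gamma> Y (cov \<Gamma> X Z) x - cov \<Gamma> (lie_bracket X Y) Z x, vs ! 3])"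

definition ricci :: "local_field \<Rightarrow> local_connection \<Rightarrow> local_field" where
  "ricci g \<Gamma> = (\<lambda>x vs. \<Sum>a\<in>UNIV.
     curvature g \<Gamma> x [some_frame (g x) a, vs ! 0, vs ! 1, some_frame (g x) a])"

text \<open>\<open>nabla \<Gamma> \<omega> x (u # vs)\<close> is $(\nabla_u\omega)(vs)$ at \<open>x\<close>.\<close>

definition nabla :: "local_connection \<Rightarrow> local_field \<Rightarrow> local_field" where
  "nabla \<Gamma> \<omega> = (\<lambda>x us. let u = hd us; vs = tl us in
     frechet_derivative (\<lambda>y. \<omega> y vs) (at x) u
     - (\<Sum>i<length vs. \<omega> x (vs[i := cov \<Gamma> (\<lambda>_. u) (\<lambda>_. vs ! i) x])))"

definition d_nabla_T :: "local_field \<Rightarrow> local_connection \<Rightarrow> local_field" where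
  "d_nabla_T g \<Gamma> = (\<lambda>x vs. let X = vs ! 0; Y = vs ! 1; Z = vs ! 2; V = vs ! 3;
       D = nabla \<Gamma> (torsion g \<Gamma>) x in
     D [X, Y, Z, V] + D [Y, Z, X, V] + D [Z, X, Y, V] - D [V, X, Y, Z])"

definition sigma_T :: "local_field \<Rightarrow> local_connection \<Rightarrow> local_field" where
  "sigma_T g \<Gamma> = (\<lambda>x vs. (1 / 2) * (\<Sum>j\<in>UNIV.
     let \<beta> = (\<lambda>ws. torsion g \<Gamma> x (some_frame (g x) j # ws)) in wedge 2 2 \<beta> \<beta> vs))"

definition vanishes :: "'a chart set \<Rightarrow> nat \<Rightarrow> ('a chart \<Rightarrow> local_field) \<Rightarrow> bool" where
  "vanishes A k \<omega> \<longleftrightarrow> (\<forall>c\<in>A. \<forall>x\<in>img c. \<forall>vs. length vs = k \<longrightarrow> \<omega> c x vs = 0)"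

definition parallel ::
    "'a chart set \<Rightarrow> nat \<Rightarrow> ('a chart \<Rightarrow> local_connection) \<Rightarrow> ('a chart \<Rightarrow> local_field) \<Rightarrow> bool" where
  "parallel A k \<Gamma> \<omega> \<longleftrightarrow> vanishes A (Suc k) (\<lambda>c. nabla (\<Gamma> c) (\<omega> c))"

subsection \<open>Spin(7) structures\<close>

definition spin7_model :: "(8 \<Rightarrow> r8 \<Rightarrow> real) \<Rightarrow> tensor" where
  "spin7_model \<epsilon> = (\<lambda>vs.
     let E = (\<lambda>i j k l. covector_wedge [\<epsilon> i, \<epsilon> j, \<epsilon> k, \<epsilon> l] vs) in
       - E 0 1 2 7 + E 0 2 3 6 - E 0 3 4 7 - E 0 5 6 7 + E 0 1 4 6 + E 0 2 4 5 - E 0 1 3 5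
       - E 3 4 5 6 - E 1 4 5 7 - E 1 2 5 6 - E 1 2 3 4 - E 2 3 5 7 - E 1 3 6 7 + E 2 4 6 7)"

definition adapted_coframe :: "tensor \<Rightarrow> (8 \<Rightarrow> r8 \<Rightarrow> real) \<Rightarrow> bool" where
  "adapted_coframe \<psi> \<epsilon> \<longleftrightarrow> coframe \<epsilon> \<and> (\<forall>vs. length vs = 4 \<longrightarrow> \<psi> vs = spin7_model \<epsilon> vs)"

definition spin7_structure ::
    "('a::{t2_space, second_countable_topology}) chart set \<Rightarrow> ('a chart \<Rightarrow> local_field) \<Rightarrow> bool" where
  "spin7_structure A \<Psi> \<longleftrightarrow> differential_form A 4 \<Psi> \<and>
     (\<forall>c\<in>A. \<forall>x\<in>img c. \<exists>W \<epsilon>. open W \<and> x \<in> W \<and> W \<subseteq> img c \<and>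
        (\<forall>i v. smooth_on W (\<lambda>y. \<epsilon> y i v)) \<and> (\<forall>y\<in>W. adapted_coframe (\<Psi> c y) (\<epsilon> y)))"

text \<open>
  The metric and the volume form for which the adapted coframes are oriented orthonormal. The
  4-form determines both of them, since its stabiliser in GL(8) is Spin(7), a subgroup of SO(8).
\<close>

definition induced_metric_volume ::
    "'a chart set \<Rightarrow> ('a chart \<Rightarrow> local_field) \<Rightarrow> ('a chart \<Rightarrow> local_field) \<Rightarrow> ('a chart \<Rightarrow> local_field) \<Rightarrow> bool" where
  "induced_metric_volume A \<Psi> g vol \<longleftrightarrow>
     (\<forall>c\<in>A. \<forall>x\<in>img c. \<forall>\<epsilon>. adapted_coframe (\<Psi> c x) \<epsilon> \<longrightarrow>
        (\<forall>u v. g c x [u, v] = (\<Sum>i\<in>UNIV. \<epsilon> i u * \<epsilon> i v)) \<and>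
        (\<forall>vs. length vs = 8 \<longrightarrow>
           vol c x vs = covector_wedge [\<epsilon> 0, \<epsilon> 1, \<epsilon> 2, \<epsilon> 3, \<epsilon> 4, \<epsilon> 5, \<epsilon> 6, \<epsilon> 7] vs))"

definition lee_form :: "local_field \<Rightarrow> local_field \<Rightarrow> local_field \<Rightarrow> local_field" where
  "lee_form \<Psi> g vol = (\<lambda>x ws. - (1 / 7) *
     hodge (g x) (vol x) 7 (wedge 3 4 (hodge (g x) (vol x) 5 (ext_d \<Psi> x)) (\<Psi> x)) ws)"

definition torsion_connection ::
    "('a::{t2_space, second_countable_topology}) chart set \<Rightarrow> ('a chart \<Rightarrow> local_field) \<Rightarrow> ('a chart \<Rightarrow> local_field)
      \<Rightarrow> ('a chart \<Rightarrow> local_connection) \<Rightarrow> bool" where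
  "torsion_connection A \<Psi> g \<Gamma> \<longleftrightarrow>
     linear_connection A \<Gamma> \<and> parallel A 2 \<Gamma> g \<and> parallel A 4 \<Gamma> \<Psi> \<and>
     (\<forall>c\<in>A. \<forall>x\<in>img c. is_form 3 (torsion (g c) (\<Gamma> c) x))"

definition spin7_instanton ::
    "'a chart set \<Rightarrow> ('a chart \<Rightarrow> local_field) \<Rightarrow> ('a chart \<Rightarrow> local_field)
      \<Rightarrow> ('a chart \<Rightarrow> local_connection) \<Rightarrow> bool" where
  "spin7_instanton A \<Psi> g \<Gamma> \<longleftrightarrow>
     (\<forall>c\<in>A. \<forall>x\<in>img c. \<forall>e. orthonormal_frame (g c x) e \<longrightarrow> (\<forall>i j k l.
        (\<Sum>a\<in>UNIV. \<Sum>b\<in>UNIV.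
           curvature (g c) (\<Gamma> c) x [e a, e b, e i, e j] * \<Psi> c x [e a, e b, e k, e l])
        = 2 * curvature (g c) (\<Gamma> c) x [e k, e l, e i, e j]))"

end

theory Submission
  imports Defs
begin

text \<open>
  Write $T$ for the torsion, $D = \nabla T$, and $t_j = T_{abc}\Psi_{abcj}$, which is $-7\theta_j$. If
  $d^\nabla T = 0$, the first Bianchi identity gives
  $A_{xyzv} := D_{xyzv} - D_{yxzv} = R_{xyzv} - R_{zvxy}$, so by the instanton condition $A$ lies in
  $\mathfrak{spin}(7)$ in both pairs, and $A$ determines $D$. Hence $\nabla t$ is skew and kills $\Psi$, and $dt = 0$
  reads $2\nabla_i t_j = - T_{ijk}t_k$; comparing with the Ricci identity for $t$ forces $\nabla t = 0$.

  Alternating the Ricci identity for $T$ gives a 5-form identity in $T \otimes D$ whose contractions with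
  $\Psi$ and $\Psi \otimes T$ show that $|T|^2$ is constant and that the torsion terms drop out of
  $\langle T, \nabla^*\nabla T\rangle$. This pairing is then computed in two ways, from $d^\nabla T = 0$ and
  from the self-duality of $A$, as two different multiples of the same curvature term. So the
  pairing vanishes, and the constancy of $|T|^2$ gives $|D|^2 = 0$.

  The computations take place in a smooth adapted orthonormal frame, where $\Psi$ has constant
  components and the connection coefficients are skew and annihilate $\Psi$.
\<close>

subsection \<open>Determinants of covectors\<close>

text \<open>Compactness of M is not assumed, so the pairing of T with its rough Laplacian cannot be
  integrated away. It has to vanish pointwise, and this is why |T|^2 must first be shown to be
  constant.

  Most unwanted terms disappear by one mechanism: A changes sign when its two index pairs are
  exchanged, so its contraction with anything symmetric under that exchange is zero. The quadratic
  torsion expressions that occur have this symmetry; one only has to arrange that D enters through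
  A, either by antisymmetry in the first two indices or by self-duality.

  The two multiples at the end come from counting. Closedness replaces each second derivative in the
  Laplacian by three mixed ones, and each of these is a commutator, since the divergence of T is a
  third of nabla t and vanishes. Self-duality replaces it instead by one such mixed derivative and a
  contraction with Psi that is again a commutator. The result is three in the one case and two in
  the other.

  Identities special to Psi, such as the description of spin(7) and the self-duality of Psi, are
  reduced by alternation to finitely many increasing index tuples and evaluated there.\<close>

lemma UNIV_8: "(UNIV :: 8 set) = {0, 1, 2, 3, 4, 5, 6, 7}"
proof -
  have "card {0, 1, 2, 3, 4, 5, 6, 7 :: 8} = CARD(8)"
    by simp
  then show ?thesis
    by (metis card_subset_eq finite subset_UNIV)
qed

lemma sum_8: "sum f (UNIV :: 8 set) = f 0 + f 1 + f 2 + f 3 + f 4 + f 5 + f 6 + f 7"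
  unfolding UNIV_8 by (simp add: ac_simps)

lemma forall_8: "(\<forall>i::8. P i) \<longleftrightarrow> P 0 \<and> P 1 \<and> P 2 \<and> P 3 \<and> P 4 \<and> P 5 \<and> P 6 \<and> P 7"
proof -
  have "(\<forall>i::8. P i) \<longleftrightarrow> (\<forall>i\<in>{0, 1, 2, 3, 4, 5, 6, 7}. P i)"
    unfolding UNIV_8[symmetric] by simp
  then show ?thesis
    by simp
qed

text \<open>The size is an argument and not a type, so that expansion along the last row can descend
  from \<open>Suc n\<close> to \<open>n\<close>.\<close>

definition leibniz_det :: "nat \<Rightarrow> (nat \<Rightarrow> nat \<Rightarrow> real) \<Rightarrow> real" where
  "leibniz_det n M = (\<Sum>\<sigma> | \<sigma> permutes {..<n}. of_int (sign \<sigma>) * (\<Prod>m<n. M m (\<sigma> m)))"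

lemma covector_wedge_det:
  "covector_wedge \<alpha>s vs = leibniz_det (length \<alpha>s) (\<lambda>m s. (\<alpha>s ! m) (vs ! s))"
  by (simp add: covector_wedge_def leibniz_det_def)

lemma leibniz_det_cong:
  assumes "\<And>i j. i < n \<Longrightarrow> j < n \<Longrightarrow> M i j = M' i j"
  shows "leibniz_det n M = leibniz_det n M'"
  unfolding leibniz_det_def
proof (intro sum.cong refl arg_cong2[where f="(*)"] prod.cong)
  fix \<sigma> m assume "\<sigma> \<in> {\<sigma>. \<sigma> permutes {..<n}}" "m \<in> {..<n}"
  then show "M m (\<sigma> m) = M' m (\<sigma> m)"
    using assms[of m "\<sigma> m"] permutes_in_image[of \<sigma> "{..<n}" m] by auto
qed

lemma leibniz_det_transpose: "leibniz_det n (\<lambda>i j. M j i) = leibniz_det n M"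
proof -
  have "leibniz_det n (\<lambda>i j. M j i) =
     (\<Sum>\<sigma> | \<sigma> permutes {..<n}. of_int (sign (inv \<sigma>)) * (\<Prod>m<n. M (inv \<sigma> m) m))"
    unfolding leibniz_det_def by (rule sum_permutations_inverse)
  also have "\<dots> = leibniz_det n M"
    unfolding leibniz_det_def
  proof (rule sum.cong[OF refl])
    fix \<sigma> assume "\<sigma> \<in> {\<sigma>. \<sigma> permutes {..<n}}"
    then have p: "\<sigma> permutes {..<n}" by simp
    have "(\<Prod>m<n. M (inv \<sigma> m) m) = (\<Prod>m<n. M (inv \<sigma> (\<sigma> m)) (\<sigma> m))"
      using prod.permute[OF p, of "\<lambda>m. M (inv \<sigma> m) m"] by (simp add: o_def)
    moreover have "sign (inv \<sigma>) = sign \<sigma>"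
      using p by (simp add: permutes_imp_permutation[of "{..<n}"] sign_inverse)
    ultimately show "real_of_int (sign (inv \<sigma>)) * (\<Prod>m<n. M (inv \<sigma> m) m) =
        real_of_int (sign \<sigma>) * (\<Prod>m<n. M m (\<sigma> m))"
      using permutes_inverses(2)[OF p] by simp
  qed
  finally show ?thesis .
qed

lemma leibniz_det_permute:
  assumes p: "p permutes {..<n}"
  shows "leibniz_det n (\<lambda>m s. M m (p s)) = of_int (sign p) * leibniz_det n M"
proof -
  have "of_int (sign p) * leibniz_det n M =
     (\<Sum>\<sigma> | \<sigma> permutes {..<n}. of_int (sign p) * (of_int (sign (p \<circ> \<sigma>)) * (\<Prod>m<n. M m ((p \<circ> \<sigma>) m))))"
    unfolding leibniz_det_def sum_distrib_left by (rule setum_permutations_compose_left[OF p])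
  also have "\<dots> = leibniz_det n (\<lambda>m s. M m (p s))"
    unfolding leibniz_det_def
  proof (rule sum.cong[OF refl])
    fix \<sigma> assume "\<sigma> \<in> {\<sigma>. \<sigma> permutes {..<n}}"
    then have "sign (p \<circ> \<sigma>) = sign p * sign \<sigma>"
      using p by (intro sign_compose permutes_imp_permutation[of "{..<n}"]) auto
    moreover have "of_int (sign p) * of_int (sign p) = (1 :: real)"
      by (metis of_int_1 of_int_mult sign_idempotent)
    then have "of_int (sign p) * (of_int (sign p) * x) = x" for x :: real
      by (metis mult.assoc mult_1)
    ultimately show "of_int (sign p) * (of_int (sign (p \<circ> \<sigma>)) * (\<Prod>m<n. M m ((p \<circ> \<sigma>) m)))
        = of_int (sign \<sigma>) * (\<Prod>m<n. M m (p (\<sigma> m)))"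
      by (simp only: of_int_mult mult.assoc o_apply)
  qed
  finally show ?thesis by simp
qed

text \<open>Permutations are sorted by the image of \<open>n\<close>, that is, by the transposition
  of \<open>n\<close> and \<open>b\<close> that is split off. The minor does not delete column
  \<open>b\<close> but puts column \<open>n\<close> in its place, which is why all signs off the
  diagonal term are the same.\<close>

lemma leibniz_det_expand:
  "leibniz_det (Suc n) M = M n n * leibniz_det n M
     - (\<Sum>b<n. M n b * leibniz_det n (\<lambda>m s. M m (if s = b then n else s)))"
proof -
  define f where "f \<sigma> = of_int (sign \<sigma>) * (\<Prod>m<Suc n. M m (\<sigma> m))" for \<sigma>
  have "leibniz_det (Suc n) M = sum f {\<sigma>. \<sigma> permutes insert n {..<n}}"
    unfolding leibniz_det_def f_def lessThan_Suc ..
  also have "\<dots> = (\<Sum>b\<in>insert n {..<n}. \<Sum>q | q permutes {..<n}. f (Transposition.transpose n b \<circ> q))"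
    by (rule sum_over_permutations_insert) auto
  also have "\<dots> = (\<Sum>q | q permutes {..<n}. f q)
      + (\<Sum>b<n. \<Sum>q | q permutes {..<n}. f (Transposition.transpose n b \<circ> q))"
    by simp
  also have "(\<Sum>q | q permutes {..<n}. f q) = M n n * leibniz_det n M"
    unfolding leibniz_det_def sum_distrib_left f_def
  proof (intro sum.cong refl)
    fix q assume "q \<in> {\<sigma>. \<sigma> permutes {..<n}}"
    then have "q n = n" by (simp add: permutes_def)
    then show "real_of_int (sign q) * (\<Prod>m<Suc n. M m (q m))
        = M n n * (real_of_int (sign q) * (\<Prod>m<n. M m (q m)))" by simp
  qed
  also have "(\<Sum>b<n. \<Sum>q | q permutes {..<n}. f (Transposition.transpose n b \<circ> q))
     = (\<Sum>b<n. - (M n b * leibniz_det n (\<lambda>m s. M m (if s = b then n else s))))"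
  proof (rule sum.cong[OF refl])
    fix b assume "b \<in> {..<n}"
    then have b: "b < n" by simp
    have "f (Transposition.transpose n b \<circ> q) = - (M n b *
        (real_of_int (sign q) * (\<Prod>m<n. M m (if q m = b then n else q m))))"
      if q: "q permutes {..<n}" for q
    proof -
      have "q n = n" using q by (simp add: permutes_def)
      moreover have "sign (Transposition.transpose n b \<circ> q) = - sign q"
        using b q by (subst sign_compose) (auto simp: sign_swap_id permutation_swap_id
          intro: permutes_imp_permutation[of "{..<n}"])
      moreover have "(\<Prod>m<n. M m (Transposition.transpose n b (q m))) = (\<Prod>m<n. M m (if q m = b then n else q m))"
      proof (rule prod.cong[OF refl])
        fix m assume "m \<in> {..<n}"
        then have "q m < n" using permutes_in_image[OF q, of m] by simp
        then show "M m (Transposition.transpose n b (q m)) = M m (if q m = b then n else q m)"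
          by (auto simp: Transposition.transpose_def)
      qed
      ultimately show ?thesis unfolding f_def by simp
    qed
    then show "(\<Sum>q | q permutes {..<n}. f (Transposition.transpose n b \<circ> q))
        = - (M n b * leibniz_det n (\<lambda>m s. M m (if s = b then n else s)))"
      unfolding leibniz_det_def sum_distrib_left sum_negf[symmetric] by (intro sum.cong) auto
  qed
  finally show ?thesis by (simp add: sum_negf)
qed

lemma covector_wedge_permute:
  assumes "p permutes {..<length vs}" "length \<alpha>s = length vs"
  shows "covector_wedge \<alpha>s (permute_list p vs) = of_int (sign p) * covector_wedge \<alpha>s vs"
  unfolding covector_wedge_det assms(2) leibniz_det_permute[OF assms(1), symmetric]
  by (rule leibniz_det_cong) (use assms in \<open>simp add: permute_list_nth\<close>)

text \<open>Transposing first lets the expansion run over the covectors: the one that is paired with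
  \<open>v\<close> is overwritten by \<open>\<alpha>\<close>, and the rest of the list stays as it
  is.\<close>

lemma covector_wedge_snoc:
  assumes "length \<alpha>s = length us"
  shows "covector_wedge (\<alpha>s @ [\<alpha>]) (us @ [v]) = \<alpha> v * covector_wedge \<alpha>s us
    - (\<Sum>b<length us. (\<alpha>s ! b) v * covector_wedge (\<alpha>s[b := \<alpha>]) us)"
proof -
  let ?n = "length us"
  let ?\<beta> = "\<lambda>i. (\<alpha>s @ [\<alpha>]) ! i" and ?w = "\<lambda>i. (us @ [v]) ! i"
  have "covector_wedge (\<alpha>s @ [\<alpha>]) (us @ [v]) = leibniz_det (Suc ?n) (\<lambda>s m. ?\<beta> m (?w s))"
    unfolding covector_wedge_det using assms
    by (simp add: leibniz_det_transpose[of "Suc ?n" "\<lambda>s m. ?\<beta> m (?w s)"])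
  also have "\<dots> = ?\<beta> ?n (?w ?n) * leibniz_det ?n (\<lambda>s m. ?\<beta> m (?w s))
     - (\<Sum>b<?n. ?\<beta> b (?w ?n) * leibniz_det ?n (\<lambda>s m. ?\<beta> (if m = b then ?n else m) (?w s)))"
    by (rule leibniz_det_expand)
  also have "?\<beta> ?n (?w ?n) = \<alpha> v"
    using assms by (simp add: nth_append)
  also have "leibniz_det ?n (\<lambda>s m. ?\<beta> m (?w s)) = covector_wedge \<alpha>s us"
    unfolding covector_wedge_det assms leibniz_det_transpose[of ?n "\<lambda>m s. (\<alpha>s ! m) (us ! s)", symmetric]
    by (rule leibniz_det_cong) (use assms in \<open>simp add: nth_append\<close>)
  also have "(\<Sum>b<?n. ?\<beta> b (?w ?n) * leibniz_det ?n (\<lambda>s m. ?\<beta> (if m = b then ?n else m) (?w s)))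
     = (\<Sum>b<?n. (\<alpha>s ! b) v * covector_wedge (\<alpha>s[b := \<alpha>]) us)"
  proof (rule sum.cong[OF refl])
    fix b assume "b \<in> {..<?n}"
    moreover have "leibniz_det ?n (\<lambda>s m. ?\<beta> (if m = b then ?n else m) (?w s))
        = covector_wedge (\<alpha>s[b := \<alpha>]) us"
      unfolding covector_wedge_det length_list_update assms
        leibniz_det_transpose[of ?n "\<lambda>m s. (\<alpha>s[b := \<alpha>] ! m) (us ! s)", symmetric]
      by (rule leibniz_det_cong) (use assms in \<open>auto simp: nth_append nth_list_update\<close>)
    ultimately show "?\<beta> b (?w ?n) * leibniz_det ?n (\<lambda>s m. ?\<beta> (if m = b then ?n else m) (?w s))
       = (\<alpha>s ! b) v * covector_wedge (\<alpha>s[b := \<alpha>]) us"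
      using assms by (simp add: nth_append)
  qed
  finally show ?thesis .
qed

lemma covector_wedge_Nil [simp]: "covector_wedge [] vs = 1"
  by (simp add: covector_wedge_def)

lemma covector_wedge_1: "covector_wedge [a] [x] = a x"
  using covector_wedge_snoc[of "[]" "[]" a x] by simp

lemma covector_wedge_2:
  "covector_wedge [a, b] [x, y] = b y * a x - a y * b x"
  using covector_wedge_snoc[of "[a]" "[x]" b y] by (simp add: covector_wedge_1)

lemma covector_wedge_3:
  "covector_wedge [a, b, c] [x, y, z] = c z * covector_wedge [a, b] [x, y]
     - a z * covector_wedge [c, b] [x, y] - b z * covector_wedge [a, c] [x, y]"
  using covector_wedge_snoc[of "[a, b]" "[x, y]" c z] by (simp add: lessThan_Suc)

lemma covector_wedge_4:
  "covector_wedge [a, b, c, d] [x, y, z, w] = d w * covector_wedge [a, b, c] [x, y, z]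
     - a w * covector_wedge [d, b, c] [x, y, z] - b w * covector_wedge [a, d, c] [x, y, z]
     - c w * covector_wedge [a, b, d] [x, y, z]"
  using covector_wedge_snoc[of "[a, b, c]" "[x, y, z]" d w] by (simp add: lessThan_Suc)

subsection \<open>The model 4-form\<close>
definition psi :: "8 \<Rightarrow> 8 \<Rightarrow> 8 \<Rightarrow> 8 \<Rightarrow> real" where
  "psi i j k l = spin7_model (\<lambda>a v. v $ a) (map (\<lambda>a. axis a 1) [i, j, k, l])"

definition dual_frames :: "(8 \<Rightarrow> r8 \<Rightarrow> real) \<Rightarrow> (8 \<Rightarrow> r8) \<Rightarrow> bool" where
  "dual_frames \<epsilon> e \<longleftrightarrow> (\<forall>i j. \<epsilon> i (e j) = (if i = j then 1 else 0))"

lemma covector_wedge_dual: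
  assumes "dual_frames \<epsilon> e" "dual_frames \<epsilon>' e'" "length is = length js"
  shows "covector_wedge (map \<epsilon> is) (map e js) = covector_wedge (map \<epsilon>' is) (map e' js)"
  using assms unfolding covector_wedge_det by (auto intro!: leibniz_det_cong simp: dual_frames_def)

lemma dual_frames_axis: "dual_frames (\<lambda>a v. v $ a) (\<lambda>a. axis a 1)"
  by (auto simp: dual_frames_def axis_def)

text \<open>All adapted frames give the 4-form the same constant components; these constants are
  what the algebra below works with.\<close>

lemma spin7_model_dual:
  assumes "dual_frames \<epsilon> e"
  shows "spin7_model \<epsilon> [e i, e j, e k, e l] = psi i j k l"
proof -
  have "covector_wedge [\<epsilon> a, \<epsilon> b, \<epsilon> c, \<epsilon> d] [e i, e j, e k, e l]
     = covector_wedge [\<lambda>v. v $ a, \<lambda>v. v $ b, \<lambda>v. v $ c, \<lambda>v. v $ d]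
         [axis i 1, axis j 1, axis k 1, axis l 1]" for a b c d
    using covector_wedge_dual[OF assms dual_frames_axis, of "[a, b, c, d]" "[i, j, k, l]"] by simp
  then show ?thesis
    by (simp add: psi_def spin7_model_def)
qed

lemma covector_wedge_swap:
  assumes "i < length vs" "j < length vs" "i \<noteq> j" "length \<alpha>s = length vs"
  shows "covector_wedge \<alpha>s (vs[i := vs ! j, j := vs ! i]) = - covector_wedge \<alpha>s vs"
proof -
  let ?p = "Transposition.transpose i j"
  have p: "?p permutes {..<length vs}"
    using assms by (simp add: permutes_swap_id)
  have "permute_list ?p vs = vs[i := vs ! j, j := vs ! i]"
    by (rule nth_equalityI)
      (use assms p in \<open>auto simp: permute_list_nth nth_list_update Transposition.transpose_def\<close>)
  then show ?thesis
    using covector_wedge_permute[OF p assms(4)] assms(3) by (simp add: sign_swap_id)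
qed

lemma psi_swap:
  "psi j i k l = - psi i j k l" "psi i k j l = - psi i j k l" "psi i j l k = - psi i j k l"
proof -
  have "covector_wedge [a, b, c, d] [y, x, z, w] = - covector_wedge [a, b, c, d] [x, y, z, w]"
    "covector_wedge [a, b, c, d] [x, z, y, w] = - covector_wedge [a, b, c, d] [x, y, z, w]"
    "covector_wedge [a, b, c, d] [x, y, w, z] = - covector_wedge [a, b, c, d] [x, y, z, w]"
    for a b c d and x y z w :: r8
    using covector_wedge_swap[of 0 "[x, y, z, w]" 1 "[a, b, c, d]"]
      covector_wedge_swap[of 1 "[x, y, z, w]" 2 "[a, b, c, d]"]
      covector_wedge_swap[of 2 "[x, y, z, w]" 3 "[a, b, c, d]"]
    by (simp_all add: numeral_2_eq_2 numeral_3_eq_3)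
  note * = this
  show "psi j i k l = - psi i j k l" "psi i k j l = - psi i j k l" "psi i j l k = - psi i j k l"
    unfolding psi_def spin7_model_def Let_def list.map
    by (simp_all only: *(1)[of _ _ _ _ "axis j 1" "axis i 1"] *(2)[of _ _ _ _ _ "axis k 1" "axis j 1"]
        *(3)[of _ _ _ _ _ _ "axis l 1" "axis k 1"])
qed

lemma psi_refl: "psi i i k l = 0" "psi i j i l = 0" "psi i j k i = 0" "psi i j j l = 0" "psi i j k j = 0" "psi i j k k = 0"
proof -
  show *: "psi i i k l = 0" for i k l using psi_swap(1)[of i i k l] by simp
  show **: "psi i j i l = 0" for i j l using psi_swap(2)[of i i j l] * by simp
  show "psi i j k i = 0" using psi_swap(3)[of i j k i] ** by simp
  show *: "psi i j j l = 0" for i j l using psi_swap(2)[of i j j l] by simp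
  show "psi i j k j = 0" using psi_swap(3)[of i j k j] * by simp
  show "psi i j k k = 0" using psi_swap(3)[of i j k k] by simp
qed

text \<open>A rank for the indices that evaluates on numerals, so that the sorting rules are
  oriented and their conditions decidable by rewriting.\<close>

definition idx :: "8 \<Rightarrow> nat" where
  "idx i = (if i = 0 then 0 else if i = 1 then 1 else if i = 2 then 2 else if i = 3 then 3
     else if i = 4 then 4 else if i = 5 then 5 else if i = 6 then 6 else 7)"

lemma idx_simps [simp]: "idx 0 = 0" "idx 1 = 1" "idx 2 = 2" "idx 3 = 3" "idx 4 = 4" "idx 5 = 5"
  "idx 6 = 6" "idx 7 = 7"
  by (simp_all add: idx_def)

lemma idx_inj: "idx i = idx j \<longleftrightarrow> i = j"
proof -
  have "\<forall>i j. idx i = idx j \<longrightarrow> i = j" unfolding forall_8 by simp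
  then show ?thesis by blast
qed

lemma psi_sort:
  "idx j < idx i \<Longrightarrow> psi i j k l = - psi j i k l"
  "idx k < idx j \<Longrightarrow> psi i j k l = - psi i k j l"
  "idx l < idx k \<Longrightarrow> psi i j k l = - psi i j l k"
  by (rule psi_swap)+

lemma covector_wedge_axis_4:
  "covector_wedge [\<lambda>v. v $ a, \<lambda>v. v $ b, \<lambda>v. v $ c, \<lambda>v. v $ d]
     [axis i 1 :: r8, axis j 1, axis k 1, axis l 1] = 
   (if l = d then if k = c then if j = b then if i = a then 1 else 0 else if j = a then if i = b then -1 else 0 else 0
     else 0 else 0)" if "idx a < idx b" "idx b < idx c" "idx c < idx d" "idx i < idx j" "idx j < idx k" "idx k < idx l"
  using that by (auto simp add: covector_wedge_4 covector_wedge_3 covector_wedge_2 axis_def)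

lemma all_greater_8:
  "(\<forall>j. 0 < idx j \<longrightarrow> P j) \<longleftrightarrow> P 1 \<and> P 2 \<and> P 3 \<and> P 4 \<and> P 5 \<and> P 6 \<and> P 7"
  "(\<forall>j. 1 < idx j \<longrightarrow> P j) \<longleftrightarrow> P 2 \<and> P 3 \<and> P 4 \<and> P 5 \<and> P 6 \<and> P 7"
  "(\<forall>j. 2 < idx j \<longrightarrow> P j) \<longleftrightarrow> P 3 \<and> P 4 \<and> P 5 \<and> P 6 \<and> P 7"
  "(\<forall>j. 3 < idx j \<longrightarrow> P j) \<longleftrightarrow> P 4 \<and> P 5 \<and> P 6 \<and> P 7"
  "(\<forall>j. 4 < idx j \<longrightarrow> P j) \<longleftrightarrow> P 5 \<and> P 6 \<and> P 7"
  "(\<forall>j. 5 < idx j \<longrightarrow> P j) \<longleftrightarrow> P 6 \<and> P 7"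
  "(\<forall>j. 6 < idx j \<longrightarrow> P j) \<longleftrightarrow> P 7"
  "(\<forall>j. 7 < idx j \<longrightarrow> P j) \<longleftrightarrow> True"
  by (simp_all add: forall_8)

text \<open>All 70 increasing quadruples. Together with \<open>psi_sort\<close> and
  \<open>psi_refl\<close> this evaluates \<open>psi\<close> on any four numerals.\<close>

lemma psi_increasing:
  "psi 0 1 2 3 = 0"
  "psi 0 1 2 4 = 0"
  "psi 0 1 2 5 = 0"
  "psi 0 1 2 6 = 0"
  "psi 0 1 2 7 = -1"
  "psi 0 1 3 4 = 0"
  "psi 0 1 3 5 = -1"
  "psi 0 1 3 6 = 0"
  "psi 0 1 3 7 = 0"
  "psi 0 1 4 5 = 0"
  "psi 0 1 4 6 = 1"
  "psi 0 1 4 7 = 0"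
  "psi 0 1 5 6 = 0"
  "psi 0 1 5 7 = 0"
  "psi 0 1 6 7 = 0"
  "psi 0 2 3 4 = 0"
  "psi 0 2 3 5 = 0"
  "psi 0 2 3 6 = 1"
  "psi 0 2 3 7 = 0"
  "psi 0 2 4 5 = 1"
  "psi 0 2 4 6 = 0"
  "psi 0 2 4 7 = 0"
  "psi 0 2 5 6 = 0"
  "psi 0 2 5 7 = 0"
  "psi 0 2 6 7 = 0"
  "psi 0 3 4 5 = 0"
  "psi 0 3 4 6 = 0"
  "psi 0 3 4 7 = -1"
  "psi 0 3 5 6 = 0"
  "psi 0 3 5 7 = 0"
  "psi 0 3 6 7 = 0"
  "psi 0 4 5 6 = 0"
  "psi 0 4 5 7 = 0"
  "psi 0 4 6 7 = 0"
  "psi 0 5 6 7 = -1"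
  "psi 1 2 3 4 = -1"
  "psi 1 2 3 5 = 0"
  "psi 1 2 3 6 = 0"
  "psi 1 2 3 7 = 0"
  "psi 1 2 4 5 = 0"
  "psi 1 2 4 6 = 0"
  "psi 1 2 4 7 = 0"
  "psi 1 2 5 6 = -1"
  "psi 1 2 5 7 = 0"
  "psi 1 2 6 7 = 0"
  "psi 1 3 4 5 = 0"
  "psi 1 3 4 6 = 0"
  "psi 1 3 4 7 = 0"
  "psi 1 3 5 6 = 0"
  "psi 1 3 5 7 = 0"
  "psi 1 3 6 7 = -1"
  "psi 1 4 5 6 = 0"
  "psi 1 4 5 7 = -1"
  "psi 1 4 6 7 = 0"
  "psi 1 5 6 7 = 0"
  "psi 2 3 4 5 = 0"
  "psi 2 3 4 6 = 0"
  "psi 2 3 4 7 = 0"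
  "psi 2 3 5 6 = 0"
  "psi 2 3 5 7 = -1"
  "psi 2 3 6 7 = 0"
  "psi 2 4 5 6 = 0"
  "psi 2 4 5 7 = 0"
  "psi 2 4 6 7 = 1"
  "psi 2 5 6 7 = 0"
  "psi 3 4 5 6 = -1"
  "psi 3 4 5 7 = 0"
  "psi 3 4 6 7 = 0"
  "psi 3 5 6 7 = 0"
  "psi 4 5 6 7 = 0"
  by (simp_all add: psi_def spin7_model_def covector_wedge_axis_4)

text \<open>An alternating expression is determined by its values on increasing quadruples, so 70
  cases replace 4096.\<close>

lemma alternating_eq_0:
  fixes f :: "8 \<Rightarrow> 8 \<Rightarrow> 8 \<Rightarrow> 8 \<Rightarrow> real"
  assumes s: "\<And>i j k l. f j i k l = - f i j k l" "\<And>i j k l. f i k j l = - f i j k l" "\<And>i j k l. f i j l k = - f i j k l"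
    and 0: "\<forall>i j. idx i < idx j \<longrightarrow> (\<forall>k. idx j < idx k \<longrightarrow> (\<forall>l. idx k < idx l \<longrightarrow> f i j k l = 0))"
  shows "f i j k l = 0"
proof -
  have r: "f i i k l = 0" "f i j j l = 0" "f i j k k = 0" for i j k l
    using s(1)[of i i k l] s(2)[of i j j l] s(3)[of i j k k] by auto
  have tri: "idx a < idx b \<or> a = b \<or> idx b < idx a" for a b
    using idx_inj[of a b] by linarith
  \<comment> \<open>Insertion sort from the right: here the first index is inserted into a sorted
    triple, in \<open>2\<close> the second index into a sorted pair.\<close>
  have 1: "f i j k l = 0" if "idx j < idx k" "idx k < idx l" for i j k l
    using 0 that tri[of i j] tri[of i k] tri[of i l] s(1)[of i j k l] s(2)[of j i k l] s(3)[of j k i l] r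
    by (smt (verit))
  have 2: "f i j k l = 0" if "idx k < idx l" for i j k l
    using 1[of j k l i] 1[of k j l i] 1[of k l j i] that tri[of j k] tri[of j l] s(2)[of i j k l] s(3)[of i k j l] r
    by (smt (verit))
  show ?thesis
    using 2[of k l i j] 2[of l k i j] tri[of k l] s(3)[of i j k l] r by (smt (verit))
qed

lemma alternating_eq_0_3:
  fixes f :: "8 \<Rightarrow> 8 \<Rightarrow> 8 \<Rightarrow> real"
  assumes s: "\<And>i j k. f j i k = - f i j k" "\<And>i j k. f i k j = - f i j k"
    and 0: "\<forall>i j. idx i < idx j \<longrightarrow> (\<forall>k. idx j < idx k \<longrightarrow> f i j k = 0)"
  shows "f i j k = 0"
proof -
  have r: "f i i k = 0" "f i j j = 0" for i j k
    using s(1)[of i i k] s(2)[of i j j] by auto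
  have tri: "idx a < idx b \<or> a = b \<or> idx b < idx a" for a b
    using idx_inj[of a b] by linarith
  have 1: "f i j k = 0" if "idx j < idx k" for i j k
    using 0 that tri[of i j] tri[of i k] s(1)[of i j k] s(2)[of j i k] r
    by (smt (verit))
  show ?thesis
    using 1[of j k i] 1[of k j i] tri[of j k] s(2)[of i j k] r by (smt (verit))
qed

section \<open>Two-forms: spin(7) as an eigenspace and as the stabiliser of the 4-form\<close>

definition self_dual :: "(8 \<Rightarrow> 8 \<Rightarrow> real) \<Rightarrow> bool" where
  "self_dual a \<longleftrightarrow> (\<forall>k l. (\<Sum>i\<in>UNIV. \<Sum>j\<in>UNIV. a i j * psi i j k l) = 2 * a k l)"

definition psi_action :: "(8 \<Rightarrow> 8 \<Rightarrow> real) \<Rightarrow> 8 \<Rightarrow> 8 \<Rightarrow> 8 \<Rightarrow> 8 \<Rightarrow> real" where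
  "psi_action a i j k l = (\<Sum>m\<in>UNIV. a i m * psi m j k l + a j m * psi i m k l
     + a k m * psi i j m l + a l m * psi i j k m)"

lemma psi_action_swap:
  "psi_action a j i k l = - psi_action a i j k l"
  "psi_action a i k j l = - psi_action a i j k l"
  "psi_action a i j l k = - psi_action a i j k l"
  unfolding psi_action_def sum_negf[symmetric]
  subgoal
    by (rule sum.cong[OF refl], subst (1) psi_swap(1), subst (3) psi_swap(1), subst (5) psi_swap(1), subst (7) psi_swap(1)) simp
  subgoal
    by (rule sum.cong[OF refl], subst (1) psi_swap(2), subst (3) psi_swap(2), subst (5) psi_swap(2), subst (7) psi_swap(2)) simp
  subgoal
    by (rule sum.cong[OF refl], subst (1) psi_swap(3), subst (3) psi_swap(3), subst (5) psi_swap(3), subst (7) psi_swap(3)) simp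
  done

text \<open>On 2-forms, contraction with \<open>psi\<close> has the eigenvalue 2 in dimension 21 and
  -6 in dimension 7. The equations with \<open>k = 0\<close> alone express the seven components
  \<open>a 0 l\<close> by the others, which cuts 28 dimensions down to 21; substituting them makes
  every component of the action vanish.\<close>

lemma self_dual_imp_action_eq_0:
  assumes skew: "\<And>i j. a j i = - a i j" and sd: "self_dual a"
  shows "psi_action a i j k l = 0"
proof (rule alternating_eq_0[where f="psi_action a"])
  show "psi_action a j i k l = - psi_action a i j k l" "psi_action a i k j l = - psi_action a i j k l"
    "psi_action a i j l k = - psi_action a i j k l" for i j k l
    by (rule psi_action_swap)+
  have [simp]: "a i i = 0" for i
    using skew[of i i] by simp
  have sort: "idx j < idx i \<Longrightarrow> a i j = - a j i" for i j
    by (rule skew)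
  note ev = sum_8 psi_sort psi_increasing psi_refl sort
  have e: "(\<Sum>i\<in>UNIV. \<Sum>j\<in>UNIV. a i j * psi i j 0 l) = 2 * a 0 l" for l
    using sd by (simp add: self_dual_def)
  have eqs: "a 0 1 = - a 2 7 - a 3 5 + a 4 6" "a 0 2 = a 1 7 + a 3 6 + a 4 5" "a 0 3 = a 1 5 - a 2 6 - a 4 7" "a 0 4 = - a 1 6 - a 2 5 + a 3 7" "a 0 5 = - a 1 3 + a 2 4 - a 6 7" "a 0 6 = a 1 4 + a 2 3 + a 5 7" "a 0 7 = - a 1 2 - a 3 4 - a 5 6"
    using e[of 1] e[of 2] e[of 3] e[of 4] e[of 5] e[of 6] e[of 7] by (simp_all add: ev)
  show "\<forall>i j. idx i < idx j \<longrightarrow> (\<forall>k. idx j < idx k \<longrightarrow> (\<forall>l. idx k < idx l \<longrightarrow> psi_action a i j k l = 0))"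
    by (subst forall_8, unfold idx_simps all_greater_8 psi_action_def, intro conjI TrueI)
      (simp_all add: ev eqs)
qed

text \<open>Seven well chosen components of the action give back the same seven equations, hence the
  same 21-dimensional space.\<close>

lemma action_eq_0_imp_self_dual:
  assumes skew: "\<And>i j. a j i = - a i j" and act: "\<And>i j k l. psi_action a i j k l = 0"
  shows "self_dual a"
proof -
  have [simp]: "a i i = 0" for i
    using skew[of i i] by simp
  have sort: "idx j < idx i \<Longrightarrow> a i j = - a j i" for i j
    by (rule skew)
  note ev = sum_8 psi_sort psi_increasing psi_refl sort
  have eqs: "a 0 1 = - a 2 7 - a 3 5 + a 4 6" "a 0 2 = a 1 7 + a 3 6 + a 4 5" "a 0 3 = a 1 5 - a 2 6 - a 4 7" "a 0 4 = - a 1 6 - a 2 5 + a 3 7" "a 0 5 = - a 1 3 + a 2 4 - a 6 7" "a 0 6 = a 1 4 + a 2 3 + a 5 7" "a 0 7 = - a 1 2 - a 3 4 - a 5 6"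
    using act[of 0 2 3 4] act[of 0 1 3 4] act[of 0 1 2 4] act[of 0 1 2 3] act[of 0 1 2 6] act[of 0 1 2 5] act[of 0 1 3 6]
    by (simp_all add: psi_action_def ev)
  show ?thesis
    unfolding self_dual_def forall_8
    by (intro conjI) (simp_all add: ev eqs)
qed

section \<open>Three-forms and their contraction with the 4-form\<close>

definition alternating3 :: "(8 \<Rightarrow> 8 \<Rightarrow> 8 \<Rightarrow> real) \<Rightarrow> bool" where
  "alternating3 S \<longleftrightarrow> (\<forall>i j k. S j i k = - S i j k \<and> S i k j = - S i j k)"

text \<open>Up to a factor this is the projection of 3-forms onto their 8-dimensional component,
  identified with vectors.\<close>

definition psi_trace :: "(8 \<Rightarrow> 8 \<Rightarrow> 8 \<Rightarrow> real) \<Rightarrow> 8 \<Rightarrow> real" where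
  "psi_trace S d = (\<Sum>a\<in>UNIV. \<Sum>b\<in>UNIV. \<Sum>c\<in>UNIV. S a b c * psi a b c d)"

lemma alternating3_sort:
  assumes "alternating3 S"
  shows "S i i k = 0" "S i j i = 0" "S i j j = 0"
    "idx j < idx i \<Longrightarrow> S i j k = - S j i k" "idx k < idx j \<Longrightarrow> S i j k = - S i k j"
proof -
  have s: "S j i k = - S i j k" "S i k j = - S i j k" for i j k
    using assms unfolding alternating3_def by blast+
  show r: "S i i k = 0" "S i j j = 0" for i j k
    using s(1)[of i i k] s(2)[of i j j] by auto
  show "S i j i = 0"
    using s(2)[of i i j] r(1)[of i j] by simp
  show "S i j k = - S j i k" "S i j k = - S i k j" 
    by (rule s)+
qed

lemma psi_trace_explicit:
  assumes "alternating3 S"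
  shows
    "psi_trace S 0 = 6 * (S 1 2 7 + S 1 3 5 - S 1 4 6 - S 2 3 6 - S 2 4 5 + S 3 4 7 + S 5 6 7)"
    "psi_trace S 1 = 6 * (- S 0 2 7 - S 0 3 5 + S 0 4 6 + S 2 3 4 + S 2 5 6 + S 3 6 7 + S 4 5 7)"
    "psi_trace S 2 = 6 * (S 0 1 7 + S 0 3 6 + S 0 4 5 - S 1 3 4 - S 1 5 6 + S 3 5 7 - S 4 6 7)"
    "psi_trace S 3 = 6 * (S 0 1 5 - S 0 2 6 - S 0 4 7 + S 1 2 4 - S 1 6 7 - S 2 5 7 + S 4 5 6)"
    "psi_trace S 4 = 6 * (- S 0 1 6 - S 0 2 5 + S 0 3 7 - S 1 2 3 - S 1 5 7 + S 2 6 7 - S 3 5 6)"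
    "psi_trace S 5 = 6 * (- S 0 1 3 + S 0 2 4 - S 0 6 7 + S 1 2 6 + S 1 4 7 + S 2 3 7 + S 3 4 6)"
    "psi_trace S 6 = 6 * (S 0 1 4 + S 0 2 3 + S 0 5 7 - S 1 2 5 + S 1 3 7 - S 2 4 7 - S 3 4 5)"
    "psi_trace S 7 = 6 * (- S 0 1 2 - S 0 3 4 - S 0 5 6 - S 1 3 6 - S 1 4 5 - S 2 3 5 + S 2 4 6)"
  by (simp_all add: psi_trace_def sum_8 psi_sort psi_increasing psi_refl alternating3_sort[OF assms])

text \<open>The left side is an equivariant map on 3-forms. It is multiplication by 2 on the
  48-dimensional component, where the trace vanishes, and by -12 on the 8-dimensional one:
  contracting \<open>psi\<close> with itself in three indices gives 42, and 2 - 42 / 3 = -12. The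
  proof compares both sides on increasing triples.\<close>

lemma psi_contraction_alternation:
  assumes S: "alternating3 S"
  shows "(\<Sum>c\<in>UNIV. \<Sum>i\<in>UNIV. S m c i * psi c i a b + S a c i * psi c i b m + S b c i * psi c i m a)
    = 2 * S m a b - (\<Sum>d\<in>UNIV. psi m a b d * psi_trace S d) / 3"
proof -
  define f where "f m a b = (\<Sum>c\<in>UNIV. \<Sum>i\<in>UNIV. S m c i * psi c i a b + S a c i * psi c i b m + S b c i * psi c i m a)
    - 2 * S m a b + (\<Sum>d\<in>UNIV. psi m a b d * psi_trace S d) / 3" for m a b
  have s: "S j i k = - S i j k" "S i k j = - S i j k" for i j k
    using S unfolding alternating3_def by blast+
  have "f m a b = 0"
  proof (rule alternating_eq_0_3[where f=f])
    fix i j k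
    have "(\<Sum>c\<in>UNIV. \<Sum>l\<in>UNIV. S j c l * psi c l i k + S i c l * psi c l k j + S k c l * psi c l j i)
      = - (\<Sum>c\<in>UNIV. \<Sum>l\<in>UNIV. S i c l * psi c l j k + S j c l * psi c l k i + S k c l * psi c l i j)"
      unfolding sum_negf[symmetric]
      by (intro sum.cong refl) (use psi_swap(3)[of _ _ i k] psi_swap(3)[of _ _ k j] psi_swap(3)[of _ _ i j] in \<open>simp add: algebra_simps\<close>)
    moreover have "(\<Sum>d\<in>UNIV. psi j i k d * psi_trace S d) = - (\<Sum>d\<in>UNIV. psi i j k d * psi_trace S d)"
      unfolding sum_negf[symmetric] by (intro sum.cong refl) (use psi_swap(1)[of j i k] in simp)
    ultimately show "f j i k = - f i j k"
      unfolding f_def using s(1)[of j i k] by simp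
    have "(\<Sum>c\<in>UNIV. \<Sum>l\<in>UNIV. S i c l * psi c l k j + S k c l * psi c l j i + S j c l * psi c l i k)
      = - (\<Sum>c\<in>UNIV. \<Sum>l\<in>UNIV. S i c l * psi c l j k + S j c l * psi c l k i + S k c l * psi c l i j)"
      unfolding sum_negf[symmetric]
      by (intro sum.cong refl) (use psi_swap(3)[of _ _ i k] psi_swap(3)[of _ _ k j] psi_swap(3)[of _ _ i j] in \<open>simp add: algebra_simps\<close>)
    moreover have "(\<Sum>d\<in>UNIV. psi i k j d * psi_trace S d) = - (\<Sum>d\<in>UNIV. psi i j k d * psi_trace S d)"
      unfolding sum_negf[symmetric] by (intro sum.cong refl) (use psi_swap(2)[of i k j] in simp)
    ultimately show "f i k j = - f i j k"
      unfolding f_def using s(2)[of i k j] by simp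
  next
    show "\<forall>i j. idx i < idx j \<longrightarrow> (\<forall>k. idx j < idx k \<longrightarrow> f i j k = 0)"
      by (subst forall_8, unfold idx_simps all_greater_8 f_def psi_trace_explicit[OF S], intro conjI TrueI)
        (simp_all add: sum_8 psi_sort psi_increasing psi_refl alternating3_sort[OF S] psi_trace_explicit[OF S] field_simps)
  qed
  then show ?thesis
    unfolding f_def by simp
qed

subsection \<open>Algebra of torsion and curvature at a point\<close>
lemma sum3_213: "(\<Sum>a::8\<in>UNIV. \<Sum>b::8\<in>UNIV. \<Sum>c::8\<in>UNIV. f a b c :: real) = (\<Sum>a\<in>UNIV. \<Sum>b\<in>UNIV. \<Sum>c\<in>UNIV. f b a c)"
  by (rule sum.swap)

lemma sum3_132: "(\<Sum>a::8\<in>UNIV. \<Sum>b::8\<in>UNIV. \<Sum>c::8\<in>UNIV. f a b c :: real) = (\<Sum>a\<in>UNIV. \<Sum>b\<in>UNIV. \<Sum>c\<in>UNIV. f a c b)"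
  by (rule sum.cong[OF refl], rule sum.swap)

lemma sum3_231: "(\<Sum>a::8\<in>UNIV. \<Sum>b::8\<in>UNIV. \<Sum>c::8\<in>UNIV. f a b c :: real) = (\<Sum>a\<in>UNIV. \<Sum>b\<in>UNIV. \<Sum>c\<in>UNIV. f b c a)"
  by (simp only: sum.cartesian_product,
      rule sum.reindex_bij_witness[of _ "\<lambda>(a, b, c). (b, c, a)" "\<lambda>(a, b, c). (c, a, b)"]) auto

lemma sum3_312: "(\<Sum>a::8\<in>UNIV. \<Sum>b::8\<in>UNIV. \<Sum>c::8\<in>UNIV. f a b c :: real) = (\<Sum>a\<in>UNIV. \<Sum>b\<in>UNIV. \<Sum>c\<in>UNIV. f c a b)"
  by (simp only: sum.cartesian_product,
      rule sum.reindex_bij_witness[of _ "\<lambda>(a, b, c). (c, a, b)" "\<lambda>(a, b, c). (b, c, a)"]) auto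

lemma antisym_contract:
  fixes X :: "8 \<Rightarrow> 8 \<Rightarrow> real"
  assumes "\<And>i j. X j i = - X i j" "\<And>i j. Y j i = Y i j"
  shows "(\<Sum>i\<in>UNIV. \<Sum>j\<in>UNIV. X i j * Y i j) = 0"
proof -
  have "(\<Sum>i\<in>UNIV. \<Sum>j\<in>UNIV. X i j * Y i j) = (\<Sum>i\<in>UNIV. \<Sum>j\<in>UNIV. X j i * Y j i)"
    by (rule sum.swap)
  also have "\<dots> = - (\<Sum>i\<in>UNIV. \<Sum>j\<in>UNIV. X i j * Y i j)"
    unfolding sum_negf[symmetric] by (intro sum.cong refl) (metis assms minus_mult_left)
  finally show ?thesis by simp
qed

lemma psi_cyc: "psi b c a j = psi a b c j"
  using psi_swap(2)[of b a c j] psi_swap(1)[of b a c j] by simp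

lemma psi_front: "psi j a b c = - psi a b c j"
  using psi_swap(1)[of a j b c] psi_swap(2)[of a b j c] psi_swap(3)[of a b c j] by simp

lemma alternating3D:
  assumes "alternating3 S"
  shows "S j i k = - S i j k" "S i k j = - S i j k" "S k j i = - S i j k" "S j k i = S i j k" "S k i j = S i j k"
proof -
  have s: "S j i k = - S i j k" "S i k j = - S i j k" for i j k
    using assms unfolding alternating3_def by blast+
  show "S j i k = - S i j k" "S i k j = - S i j k" "S k j i = - S i j k" "S j k i = S i j k" "S k i j = S i j k"
    using s(1)[of i j k] s(2)[of i j k] s(1)[of j k i] s(2)[of j i k] s(1)[of i k j] s(2)[of k i j] by simp_all
qed

lemma self_dualD: "self_dual a \<Longrightarrow> (\<Sum>i\<in>UNIV. \<Sum>j\<in>UNIV. a i j * psi i j k l) = 2 * a k l"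
  by (simp add: self_dual_def)

text \<open>Pairing the vanishing action of \<open>a\<close> on \<open>psi\<close> with \<open>S\<close> moves \<open>a\<close> from \<open>psi\<close> to the trace.\<close>

lemma action_eq_0_psi_trace:
  assumes act: "\<And>i j k l. psi_action a i j k l = 0" and S: "alternating3 S"
  shows "3 * (\<Sum>m\<in>UNIV. \<Sum>b\<in>UNIV. \<Sum>c\<in>UNIV. \<Sum>i\<in>UNIV. a m i * psi i b c j * S m b c)
    = - (\<Sum>i\<in>UNIV. a j i * psi_trace S i)"
proof -
  let ?G = "\<lambda>f. \<Sum>m\<in>UNIV. \<Sum>b\<in>UNIV. \<Sum>c\<in>UNIV. \<Sum>i\<in>UNIV. f m b c i :: real"
  have "0 = (\<Sum>m\<in>UNIV. \<Sum>b\<in>UNIV. \<Sum>c\<in>UNIV. S m b c * psi_action a m b c j)"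
    using act by simp
  also have "\<dots> = ?G (\<lambda>m b c i. a m i * psi i b c j * S m b c) + ?G (\<lambda>m b c i. a b i * psi m i c j * S m b c)
      + ?G (\<lambda>m b c i. a c i * psi m b i j * S m b c) + ?G (\<lambda>m b c i. a j i * psi m b c i * S m b c)"
    by (simp add: psi_action_def sum_distrib_left sum.distrib algebra_simps)
  also have "?G (\<lambda>m b c i. a b i * psi m i c j * S m b c) = ?G (\<lambda>m b c i. a m i * psi b i c j * S b m c)"
    by (rule sum3_213)
  also have "\<dots> = ?G (\<lambda>m b c i. a m i * psi i b c j * S m b c)"
  proof -
    have *: "a m i * psi b i c j * S b m c = a m i * psi i b c j * S m b c" for m b c i
      using alternating3D(1)[OF S, of b m c] psi_swap(1)[of b i c j] by simp
    show ?thesis by (intro sum.cong refl *)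
  qed
  also have "?G (\<lambda>m b c i. a c i * psi m b i j * S m b c) = ?G (\<lambda>m b c i. a m i * psi c b i j * S c b m)"
    by (simp only: sum.cartesian_product,
      rule sum.reindex_bij_witness[of _ "\<lambda>(a, b, c, d). (c, b, a, d)" "\<lambda>(a, b, c, d). (c, b, a, d)"]) auto
  also have "\<dots> = ?G (\<lambda>m b c i. a m i * psi i b c j * S m b c)"
  proof -
    have *: "a m i * psi c b i j * S c b m = a m i * psi i b c j * S m b c" for m b c i
      using alternating3D(3)[OF S, of m b c] psi_swap(1)[of b c i j] psi_cyc[of b c i j] by simp
    show ?thesis by (intro sum.cong refl *)
  qed
  also have "?G (\<lambda>m b c i. a j i * psi m b c i * S m b c) = (\<Sum>i\<in>UNIV. a j i * psi_trace S i)"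
    unfolding psi_trace_def sum_distrib_left 
    by (simp only: sum.cartesian_product,
      rule sum.reindex_bij_witness[of _ "\<lambda>(d, a, b, c). (a, b, c, d)" "\<lambda>(a, b, c, d). (d, a, b, c)"]) auto
  finally show ?thesis by simp
qed

text \<open>
  The components at a point, in an adapted orthonormal frame, of the torsion (\<open>T\<close>), of its covariant
  derivative (\<open>D p i j k\<close> is $(\nabla_{e_p}T)_{ijk}$) and of the curvature.
\<close>

locale instanton_jet =
  fixes T :: "8 \<Rightarrow> 8 \<Rightarrow> 8 \<Rightarrow> real" and D R :: "8 \<Rightarrow> 8 \<Rightarrow> 8 \<Rightarrow> 8 \<Rightarrow> real"
  assumes T_alt: "alternating3 T" and D_alt: "alternating3 (D p)"
    and R_skew1: "R q p i j = - R p q i j" and R_skew2: "R p q j i = - R p q i j"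
    and R_psi: "psi_action (R p q) i j k l = 0"
    and instanton: "self_dual (\<lambda>k l. R k l i j)"
    and bianchi: "R x y z v + R y z x v + R z x y v = D x y z v + D y z x v + D z x y v
      + (\<Sum>m\<in>UNIV. T x y m * T m z v) + (\<Sum>m\<in>UNIV. T y z m * T m x v) + (\<Sum>m\<in>UNIV. T z x m * T m y v)"
    and D_closed: "D x y z v + D y z x v + D z x y v = D v x y z"
begin

text \<open>
  By the first Bianchi identity, \<open>A x y z v = R x y z v - R z v x y\<close>; \<open>t\<close> is $-7$ times the Lee form,
  \<open>dt i j\<close> its covariant derivative $\nabla_i t_j$, and \<open>F\<close> the contraction of \<open>t\<close> with the torsion.
\<close>

definition A :: "8 \<Rightarrow> 8 \<Rightarrow> 8 \<Rightarrow> 8 \<Rightarrow> real" where "A x y z v = D x y z v - D y x z v"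
definition t :: "8 \<Rightarrow> real" where "t = psi_trace T"
definition dt :: "8 \<Rightarrow> 8 \<Rightarrow> real" where "dt i = psi_trace (D i)"
definition F :: "8 \<Rightarrow> 8 \<Rightarrow> real" where "F i j = (\<Sum>m\<in>UNIV. T i j m * t m)"

lemmas T_perm = alternating3D[OF T_alt]
lemmas D_perm = alternating3D[OF D_alt]

text \<open>The classical derivation of pair symmetry from four instances of the first Bianchi
  identity. It isolates twice the difference of the two pair orders for any tensor that is skew in
  both pairs. The quadratic torsion terms \<open>P\<close> are symmetric in the pairs and drop out;
  the derivative terms stay.\<close>

lemma A_eq: "A x y z v = R x y z v - R z v x y"
proof -
  define P where "P x y z v = (\<Sum>m\<in>UNIV. T x y m * T m z v)" for x y z v
  have P1: "P y x z v = - P x y z v" for x y z v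
    unfolding P_def sum_negf[symmetric] by (intro sum.cong refl) (simp add: T_perm(1)[of y x])
  have P2: "P x y v z = - P x y z v" for x y z v
    unfolding P_def sum_negf[symmetric] by (intro sum.cong refl) (simp add: T_perm(2)[of _ v z])
  have P3: "P z v x y = P x y z v" for x y z v
    unfolding P_def
  proof (intro sum.cong refl)
    fix m show "T z v m * T m x y = T x y m * T m z v"
      using T_perm(4)[of z v m] T_perm(4)[of x y m] by simp
  qed
  have b: "R x y z v + R y z x v + R z x y v = D v x y z + P x y z v + P y z x v + P z x y v" for x y z v
    using bianchi[of x y z v] D_closed[of x y z v] unfolding P_def by simp
  have r: "R y z v x = - R y z x v" "R z v y x = - R z v x y" "R v y z x = - R y v z x"
    "R v x z y = R x v y z" "R x z v y = R z x y v"
    "R v x y z = - R x v y z" "R x y v z = - R x y z v" "R y v x z = - R y v z x"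
    using R_skew2[of y z x v] R_skew2[of z v x y] R_skew1[of y v z x] R_skew1[of x v z y] R_skew2[of x v y z]
      R_skew1[of z x v y] R_skew2[of z x y v] R_skew1[of x v y z] R_skew2[of x y z v] R_skew2[of y v z x] by auto
  have p: "P y z v x = - P y z x v" "P z v y x = - P x y z v" "P v y z x = - P z x y v"
    "P z v x y = P x y z v" "P v x z y = P y z x v" "P x z v y = P z x y v"
    "P v x y z = - P y z x v" "P x y v z = - P x y z v" "P y v x z = - P z x y v"
    using P2[of y z x v] P2[of z v x y] P3[of z v x y] P1[of y v z x] P3[of y v z x]
      P1[of x v z y] P2[of x v y z] P3[of x v y z] P1[of z x v y] P2[of z x y v] P1[of x v y z]
      P2[of x y z v] P2[of y v z x] by auto
  have d: "D y z v x = D y x z v" "D z v x y = D z x y v" "D y z x v = - D y x z v"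
    by (rule D_perm)+
  have "2 * R x y z v - 2 * R z v x y = 2 * D x y z v - 2 * D y x z v"
    using b[of x y z v] b[of y z v x] b[of z v x y] b[of v x y z] D_closed[of x y z v]
    unfolding r p d by linarith
  then show ?thesis
    unfolding A_def by linarith
qed

lemma A_skew1: "A y x z v = - A x y z v"
  by (simp add: A_def)

lemma A_skew2: "A x y v z = - A x y z v"
  using D_perm(2)[of x y z v] D_perm(2)[of y x z v] by (simp add: A_def)

lemma A_pair: "A z v x y = - A x y z v"
  by (simp add: A_eq)

text \<open>The two curvature terms in \<open>A_eq\<close> lie in spin(7) for different reasons: the
  first because the connection preserves the 4-form, the second by the instanton condition, which
  concerns the first index pair.\<close>

lemma A_psi: "psi_action (A x y) i j k l = 0"
proof -
  have *: "psi_action (\<lambda>k l. R k l x y) i j k l = 0"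
    by (rule self_dual_imp_action_eq_0[OF _ instanton]) (rule R_skew1)
  have "psi_action (A x y) i j k l = psi_action (R x y) i j k l - psi_action (\<lambda>k l. R k l x y) i j k l"
    unfolding psi_action_def sum_subtractf[symmetric] by (intro sum.cong refl) (simp add: A_eq algebra_simps)
  then show ?thesis
    using * R_psi by simp
qed

lemma A_self_dual: "self_dual (A x y)"
  by (rule action_eq_0_imp_self_dual) (use A_skew2 A_psi in blast)+

lemma A_self_dual1: "self_dual (\<lambda>x y. A x y z v)"
proof -
  have "(\<lambda>x y. A x y z v) = (\<lambda>x y. - A z v x y)"
    using A_pair by (metis (no_types) minus_minus)
  then show ?thesis
    using A_self_dual[of z v] by (simp add: self_dual_def sum_negf)
qed

text \<open>Skewness in the last three indices makes the cyclic sum of \<open>A\<close> twice the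
  cyclic sum of \<open>D\<close>, and closedness identifies the latter with a single
  \<open>D\<close>.\<close>

lemma D_eq_A: "D v x y z = (A x y z v + A y z x v + A z x y v) / 2"
  using D_closed[of x y z v] D_perm(1)[of x z y v] D_perm(1)[of y z x v] D_perm(1)[of z y x v] unfolding A_def by simp

text \<open>The three terms of \<open>D_eq_A\<close> contribute equally, and self-duality in the
  first pair removes \<open>psi\<close> at the price of a factor 2.\<close>

lemma dt_eq_A: "dt i j = 3 * (\<Sum>c\<in>UNIV. A c j c i)"
proof -
  let ?S = "\<lambda>f. \<Sum>a\<in>UNIV. \<Sum>b\<in>UNIV. \<Sum>c\<in>UNIV. f a b c :: real"
  have "dt i j = ?S (\<lambda>a b c. A a b c i * psi a b c j / 2) + ?S (\<lambda>a b c. A b c a i * psi a b c j / 2)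
      + ?S (\<lambda>a b c. A c a b i * psi a b c j / 2)"
    unfolding dt_def psi_trace_def sum.distrib[symmetric] by (intro sum.cong refl) (simp add: D_eq_A[of i] field_simps)
  also have "?S (\<lambda>a b c. A b c a i * psi a b c j / 2) = ?S (\<lambda>a b c. A a b c i * psi a b c j / 2)"
    by (subst sum3_312) (simp only: psi_cyc)
  also have "?S (\<lambda>a b c. A c a b i * psi a b c j / 2) = ?S (\<lambda>a b c. A a b c i * psi a b c j / 2)"
    by (subst sum3_231) (simp only: psi_cyc)
  also have "?S (\<lambda>a b c. A a b c i * psi a b c j / 2) = ?S (\<lambda>c a b. A a b c i * psi a b c j / 2)"
    by (rule sum3_231)
  also have "\<dots> = (\<Sum>c\<in>UNIV. A c j c i)"
    using self_dualD[OF A_self_dual1] by (simp flip: sum_divide_distrib)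
  finally show ?thesis by simp
qed

lemma dt_skew: "dt j i = - dt i j"
  unfolding dt_eq_A using A_pair[of _ i _ j] by (simp add: sum_negf)

text \<open>One half of \<open>A c j c i\<close> repeats an index of the 3-form and vanishes. The
  torsion is therefore divergence free once \<open>t\<close> is parallel.\<close>

lemma dt_eq_div: "dt i j = 3 * (\<Sum>c\<in>UNIV. D c c i j)"
proof -
  have "A c j c i = D c c i j" for c
    using alternating3_sort(2)[OF D_alt, of j c i] D_perm(4)[of c i c j] alternating3_sort(1)[OF D_alt, of j c i]
      D_perm[of c c i j] by (simp add: A_def)
  then show ?thesis by (simp add: dt_eq_A)
qed

definition B :: "8 \<Rightarrow> 8 \<Rightarrow> real" where "B x v = (\<Sum>a\<in>UNIV. A x a a v)"

text \<open>In this shape the derivative of \<open>t\<close> is seen to lie in spin(7), by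
  \<open>B_psi\<close>.\<close>

lemma dt_eq_B: "dt i j = 3 * B i j"
proof -
  have "A c j c i = A i c c j" for c
    using A_pair[of c j c i] A_skew1[of i c c j] A_skew1[of c j c i] A_skew2[of c i j c] by simp
  then show ?thesis by (simp add: dt_eq_A B_def)
qed

text \<open>Acting on \<open>psi\<close> in both pairs of \<open>A\<close>, only the terms with both pairs in the same slot survive,
  since \<open>A\<close> is antisymmetric under the exchange of its pairs.\<close>

lemma B_psi: "psi_action B k l m n = 0"
proof -
  have off: "(\<Sum>a\<in>UNIV. \<Sum>v\<in>UNIV. A k a l v * G a v) + (\<Sum>a\<in>UNIV. \<Sum>v\<in>UNIV. A l a k v * G v a) = 0" for k l G
  proof -
    have "(\<Sum>a\<in>UNIV. \<Sum>v\<in>UNIV. A l a k v * G v a) = (\<Sum>a\<in>UNIV. \<Sum>v\<in>UNIV. A l v k a * G a v)"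
      by (rule sum.swap)
    then show ?thesis
      using A_pair[of l _ k _] by (simp add: sum_negf)
  qed
  have "0 = (\<Sum>a\<in>UNIV. psi_action (A k a) a l m n + psi_action (A l a) k a m n
      + psi_action (A m a) k l a n + psi_action (A n a) k l m a)"
    by (simp add: A_psi)
  also have "\<dots> = (\<Sum>a\<in>UNIV. \<Sum>v\<in>UNIV. A k a a v * psi v l m n + A l a a v * psi k v m n + A m a a v * psi k l v n
       + A n a a v * psi k l m v)
     + ((\<Sum>a\<in>UNIV. \<Sum>v\<in>UNIV. A k a l v * psi a v m n) + (\<Sum>a\<in>UNIV. \<Sum>v\<in>UNIV. A l a k v * psi v a m n))
     + ((\<Sum>a\<in>UNIV. \<Sum>v\<in>UNIV. A k a m v * psi a l v n) + (\<Sum>a\<in>UNIV. \<Sum>v\<in>UNIV. A m a k v * psi v l a n))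
     + ((\<Sum>a\<in>UNIV. \<Sum>v\<in>UNIV. A k a n v * psi a l m v) + (\<Sum>a\<in>UNIV. \<Sum>v\<in>UNIV. A n a k v * psi v l m a))
     + ((\<Sum>a\<in>UNIV. \<Sum>v\<in>UNIV. A l a m v * psi k a v n) + (\<Sum>a\<in>UNIV. \<Sum>v\<in>UNIV. A m a l v * psi k v a n))
     + ((\<Sum>a\<in>UNIV. \<Sum>v\<in>UNIV. A l a n v * psi k a m v) + (\<Sum>a\<in>UNIV. \<Sum>v\<in>UNIV. A n a l v * psi k v m a))
     + ((\<Sum>a\<in>UNIV. \<Sum>v\<in>UNIV. A m a n v * psi k l a v) + (\<Sum>a\<in>UNIV. \<Sum>v\<in>UNIV. A n a m v * psi k l v a))"
    unfolding psi_action_def sum.distrib[symmetric] by (intro sum.cong refl) simp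
  also have "\<dots> = (\<Sum>a\<in>UNIV. \<Sum>v\<in>UNIV. A k a a v * psi v l m n + A l a a v * psi k v m n + A m a a v * psi k l v n
       + A n a a v * psi k l m v)"
    by (simp only: off add_0_right)
  also have "\<dots> = psi_action B k l m n"
    unfolding psi_action_def B_def sum_distrib_right sum.distrib[symmetric] by (rule sum.swap)
  finally show ?thesis by simp
qed

end

text \<open>\<open>psi\<close> is invariant under cyclic permutations of its first three indices, so
  the three terms contract to the same number.\<close>

lemma cyc_contract:
  "(\<Sum>a\<in>UNIV. \<Sum>b\<in>UNIV. \<Sum>c\<in>UNIV. (f a b c + f b c a + f c a b) * psi a b c j)
    = 3 * (\<Sum>a\<in>UNIV. \<Sum>b\<in>UNIV. \<Sum>c\<in>UNIV. f a b c * psi a b c j)"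
proof -
  let ?S = "\<lambda>f. \<Sum>a\<in>UNIV. \<Sum>b\<in>UNIV. \<Sum>c\<in>UNIV. f a b c :: real"
  have "?S (\<lambda>a b c. f b c a * psi a b c j) = ?S (\<lambda>a b c. f a b c * psi a b c j)"
    by (subst sum3_312) (simp only: psi_cyc)
  moreover have "?S (\<lambda>a b c. f c a b * psi a b c j) = ?S (\<lambda>a b c. f a b c * psi a b c j)"
    by (subst sum3_231) (simp only: psi_cyc)
  ultimately show ?thesis
    by (simp add: distrib_right sum.distrib)
qed

section \<open>The Ricci identity, and why the Lee form is parallel\<close>

context instanton_jet
begin

text \<open>\<open>D2 p q\<close> stands for the second covariant derivative of the torsion, with
  \<open>p\<close> the direction of the outer derivative. It is an argument because the locale fixes
  only the first derivative.\<close>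

definition ricci_id :: "(8 \<Rightarrow> 8 \<Rightarrow> 8 \<Rightarrow> 8 \<Rightarrow> 8 \<Rightarrow> real) \<Rightarrow> bool" where
  "ricci_id D2 \<longleftrightarrow> (\<forall>p q i j k. D2 p q i j k - D2 q p i j k
     = - (\<Sum>m\<in>UNIV. R p q i m * T m j k + R p q j m * T i m k + R p q k m * T i j m)
       - (\<Sum>m\<in>UNIV. T p q m * D m i j k))"

text \<open>In the sign convention of the theorem this is minus the Ricci tensor.\<close>

definition \<rho> :: "8 \<Rightarrow> 8 \<Rightarrow> real" where "\<rho> j v = (\<Sum>c\<in>UNIV. R c j c v)"

definition Z :: "8 \<Rightarrow> 8 \<Rightarrow> real" where
  "Z j v = (\<Sum>a\<in>UNIV. \<Sum>b\<in>UNIV. \<Sum>c\<in>UNIV. (\<Sum>m\<in>UNIV. T a b m * T m c v) * psi a b c j)"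

text \<open>Contraction of the first Bianchi identity with \<open>psi\<close>: three equal curvature
  terms, each reduced by the instanton condition to \<open>2 * \<rho>\<close>. Once
  \<open>dt\<close> vanishes, the Ricci tensor is thus a quadratic expression in the
  torsion.\<close>

lemma \<rho>_eq: "6 * \<rho> j v = dt v j + 3 * Z j v"
proof -
  let ?S = "\<lambda>f. \<Sum>a\<in>UNIV. \<Sum>b\<in>UNIV. \<Sum>c\<in>UNIV. f a b c :: real"
  define s where "s a b c = (\<Sum>m\<in>UNIV. T a b m * T m c v)" for a b c
  have "3 * ?S (\<lambda>a b c. R a b c v * psi a b c j) = ?S (\<lambda>a b c. (R a b c v + R b c a v + R c a b v) * psi a b c j)"
    by (rule cyc_contract[symmetric])
  also have "\<dots> = ?S (\<lambda>a b c. D v a b c * psi a b c j + (s a b c + s b c a + s c a b) * psi a b c j)"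
    unfolding bianchi D_closed s_def by (simp only: distrib_right add.assoc)
  also have "\<dots> = dt v j + 3 * Z j v"
    unfolding sum.distrib cyc_contract by (simp add: Z_def dt_def psi_trace_def s_def)
  finally have "3 * ?S (\<lambda>a b c. R a b c v * psi a b c j) = dt v j + 3 * Z j v" .
  moreover have "?S (\<lambda>a b c. R a b c v * psi a b c j) = ?S (\<lambda>c a b. R a b c v * psi a b c j)"
    by (rule sum3_231)
  moreover have "\<dots> = 2 * \<rho> j v"
    unfolding \<rho>_def using self_dualD[OF instanton] by (simp flip: sum_distrib_left)
  ultimately show ?thesis by simp
qed

lemma F_skew: "F j i = - F i j"
  unfolding F_def sum_negf[symmetric] by (intro sum.cong refl) (simp add: T_perm(1)[of j i])

lemma F_t: "(\<Sum>j\<in>UNIV. F i j * t j) = 0"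
proof -
  have "(\<Sum>j\<in>UNIV. F i j * t j) = (\<Sum>j\<in>UNIV. \<Sum>m\<in>UNIV. T i j m * (t j * t m))"
    by (simp add: F_def sum_distrib_right sum_distrib_left algebra_simps)
  also have "\<dots> = 0"
    by (rule antisym_contract) (rule T_perm, simp)
  finally show ?thesis .
qed

text \<open>The curvature annihilates \<open>psi\<close>, so its action on the torsion passes
  through the contraction and becomes its action on the vector \<open>t\<close>.\<close>

lemma ricci_trace:
  assumes "ricci_id D2"
  shows "psi_trace (D2 p q) l - psi_trace (D2 q p) l = - (\<Sum>a\<in>UNIV. R p q l a * t a) - (\<Sum>m\<in>UNIV. T p q m * dt m l)"
proof -
  let ?S = "\<lambda>f. \<Sum>a\<in>UNIV. \<Sum>b\<in>UNIV. \<Sum>c\<in>UNIV. f a b c :: real"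
  define f where "f i j k = (\<Sum>m\<in>UNIV. R p q i m * T m j k)" for i j k
  have f: "(\<Sum>m\<in>UNIV. R p q i m * T m j k + R p q j m * T i m k + R p q k m * T i j m) = f i j k + f j k i + f k i j" for i j k
    unfolding f_def sum.distrib[symmetric] 
    by (intro sum.cong refl) (simp add: T_perm(4)[of _ k i] T_perm(4)[of i j])
  have r: "D2 p q i j k - D2 q p i j k = - (f i j k + f j k i + f k i j) - (\<Sum>m\<in>UNIV. T p q m * D m i j k)" for i j k
    using assms unfolding ricci_id_def f[symmetric] by blast
  have "psi_trace (D2 p q) l - psi_trace (D2 q p) l = ?S (\<lambda>a b c. (D2 p q a b c - D2 q p a b c) * psi a b c l)"
    by (simp add: psi_trace_def sum_subtractf left_diff_distrib)
  also have "\<dots> = - ?S (\<lambda>a b c. (f a b c + f b c a + f c a b) * psi a b c l)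
       - ?S (\<lambda>a b c. (\<Sum>m\<in>UNIV. T p q m * D m a b c) * psi a b c l)"
    unfolding r by (simp only: left_diff_distrib sum_subtractf mult_minus_left sum_negf)
  also have "?S (\<lambda>a b c. (f a b c + f b c a + f c a b) * psi a b c l) = 3 * ?S (\<lambda>a b c. f a b c * psi a b c l)"
    by (rule cyc_contract)
  also have "?S (\<lambda>a b c. f a b c * psi a b c l)
     = (\<Sum>m\<in>UNIV. \<Sum>b\<in>UNIV. \<Sum>c\<in>UNIV. \<Sum>i\<in>UNIV. R p q i m * psi i b c l * T m b c)"
    unfolding f_def sum_distrib_right
    by (simp only: sum.cartesian_product,
      rule sum.reindex_bij_witness[of _ "\<lambda>(a, b, c, d). (d, b, c, a)" "\<lambda>(a, b, c, d). (d, b, c, a)"]) auto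
  also have "\<dots> = - (\<Sum>m\<in>UNIV. \<Sum>b\<in>UNIV. \<Sum>c\<in>UNIV. \<Sum>i\<in>UNIV. R p q m i * psi i b c l * T m b c)"
    unfolding sum_negf[symmetric] by (intro sum.cong refl, subst R_skew2) simp
  also have "3 * (- (\<Sum>m\<in>UNIV. \<Sum>b\<in>UNIV. \<Sum>c\<in>UNIV. \<Sum>i\<in>UNIV. R p q m i * psi i b c l * T m b c))
     = (\<Sum>a\<in>UNIV. R p q l a * t a)"
    using action_eq_0_psi_trace[OF R_psi[of p q] T_alt, of l] by (simp add: t_def)
  also have "?S (\<lambda>a b c. (\<Sum>m\<in>UNIV. T p q m * D m a b c) * psi a b c l) = (\<Sum>m\<in>UNIV. T p q m * dt m l)"
    unfolding dt_def psi_trace_def sum_distrib_right sum_distrib_left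
    by (simp only: sum.cartesian_product,
      rule sum.reindex_bij_witness[of _ "\<lambda>(d, a, b, c). (a, b, c, d)" "\<lambda>(a, b, c, d). (d, a, b, c)"]) auto
  finally show ?thesis .
qed

text \<open>
  The Ricci identity for \<open>t\<close>, traced and paired with \<open>t\<close>, evaluates $|F|^2$ in two incompatible ways.
\<close>

lemma F_eq_0:
  assumes closed: "\<And>i j. dt i j - dt j i + F i j = 0" and ric: "ricci_id D2"
    and t2: "\<And>p q j. psi_trace (D2 p q) j = - (\<Sum>m\<in>UNIV. D p q j m * t m + T q j m * dt p m) / 2"
  shows "F i j = 0"
proof -
  have dtF: "dt i j = - F i j / 2" for i j
    using closed[of i j] dt_skew[of i j] by simp
  have F_B: "F = (\<lambda>i j. - 6 * B i j)"
  proof (intro ext)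
    fix i j show "F i j = - 6 * B i j" using dtF[of i j] dt_eq_B[of i j] by simp
  qed
  \<comment> \<open>\<open>F\<close> inherits membership of spin(7) from \<open>B\<close>, of which
    it is a multiple.\<close>
  have F_psi: "psi_action F i j k l = 0" for i j k l
  proof -
    have "psi_action F i j k l = - 6 * psi_action B i j k l"
      unfolding F_B psi_action_def sum_distrib_left by (intro sum.cong refl) (simp add: algebra_simps)
    then show ?thesis by (simp add: B_psi)
  qed
  \<comment> \<open>Contraction with \<open>t\<close> turns one torsion factor into
    \<open>F\<close>. As \<open>F\<close> annihilates \<open>psi\<close>, it can be moved onto
    \<open>t\<close>, where \<open>F_t\<close> gives zero.\<close>
  have Zt: "(\<Sum>v\<in>UNIV. Z j v * t v) = 0" for j
  proof -
    have "(\<Sum>v\<in>UNIV. Z j v * t v) = (\<Sum>v\<in>UNIV. \<Sum>a\<in>UNIV. \<Sum>b\<in>UNIV. \<Sum>c\<in>UNIV. \<Sum>m\<in>UNIV. T a b m * T m c v * psi a b c j * t v)"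
      by (simp add: Z_def sum_distrib_right)
    also have "\<dots> = (\<Sum>m\<in>UNIV. \<Sum>a\<in>UNIV. \<Sum>b\<in>UNIV. \<Sum>c\<in>UNIV. \<Sum>v\<in>UNIV. T a b m * T m c v * psi a b c j * t v)"
      by (simp only: sum.cartesian_product,
        rule sum.reindex_bij_witness[of _ "\<lambda>(v, a, b, c, m). (m, a, b, c, v)" "\<lambda>(v, a, b, c, m). (m, a, b, c, v)"]) auto
    also have "\<dots> = (\<Sum>m\<in>UNIV. \<Sum>a\<in>UNIV. \<Sum>b\<in>UNIV. \<Sum>c\<in>UNIV. F m c * psi c a b j * T m a b)"
    proof (intro sum.cong refl)
      fix m a b c
      have "psi c a b j = psi a b c j" "T m a b = T a b m"
        using psi_cyc[of a b c j] T_perm(4)[of a b m] by auto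
      then show "(\<Sum>v\<in>UNIV. T a b m * T m c v * psi a b c j * t v) = F m c * psi c a b j * T m a b"
        by (simp add: F_def sum_distrib_left sum_distrib_right algebra_simps)
    qed
    also have "\<dots> = 0"
      using action_eq_0_psi_trace[OF F_psi T_alt, of j] F_t[of j] by (simp add: t_def)
    finally show ?thesis .
  qed
  have \<rho>t: "(\<Sum>v\<in>UNIV. \<rho> j v * t v) * 6 = (\<Sum>v\<in>UNIV. dt v j * t v)" for j
  proof -
    have "(\<Sum>v\<in>UNIV. \<rho> j v * t v) * 6 = (\<Sum>v\<in>UNIV. (6 * \<rho> j v) * t v)"
      by (simp add: sum_distrib_right sum_distrib_left algebra_simps)
    also have "\<dots> = (\<Sum>v\<in>UNIV. dt v j * t v) + 3 * (\<Sum>v\<in>UNIV. Z j v * t v)"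
      unfolding \<rho>_eq by (simp add: sum.distrib sum_distrib_left algebra_simps)
    finally show ?thesis by (simp add: Zt)
  qed
  have \<rho>t0: "(\<Sum>v\<in>UNIV. \<rho> j v * t v) = 0" for j
  proof -
    have "(\<Sum>v\<in>UNIV. dt v j * t v) = (\<Sum>v\<in>UNIV. F j v * t v) / 2"
      unfolding sum_divide_distrib by (intro sum.cong refl) (simp add: dtF F_skew[of j])
    then show ?thesis using \<rho>t[of j] F_t[of j] by simp
  qed
  have D0: "D q p p m = 0" "T p p m = 0" for q p m
    using alternating3_sort(1)[OF D_alt] alternating3_sort(1)[OF T_alt] by auto
  have q: "psi_trace (D2 p q) p = - (\<Sum>m\<in>UNIV. D p q p m * t m + T q p m * dt p m) / 2 " for p q
    by (rule t2)
  \<comment> \<open>First evaluation, from the derivative of the equation for \<open>dt\<close>: the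
    pairing is a quarter of |F|^2.\<close>
  have "(\<Sum>q\<in>UNIV. \<Sum>p\<in>UNIV. psi_trace (D2 p q) p * t q)
     = - (\<Sum>q\<in>UNIV. \<Sum>p\<in>UNIV. \<Sum>m\<in>UNIV. D p q p m * (t m * t q)) / 2
       - (\<Sum>q\<in>UNIV. \<Sum>p\<in>UNIV. \<Sum>m\<in>UNIV. T q p m * t q * dt p m) / 2"
    unfolding q by (simp add: sum.distrib sum_distrib_right sum_distrib_left sum_divide_distrib sum_negf algebra_simps add_divide_distrib sum_subtractf diff_divide_distrib)
  also have "(\<Sum>q\<in>UNIV. \<Sum>p\<in>UNIV. \<Sum>m\<in>UNIV. D p q p m * (t m * t q)) = 
     (\<Sum>p\<in>UNIV. \<Sum>q\<in>UNIV. \<Sum>m\<in>UNIV. D p q p m * (t m * t q))"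
    by (rule sum.swap)
  also have "\<dots> = 0"
    by (intro sum.neutral ballI antisym_contract) (rule D_perm, simp)
  also have "(\<Sum>q\<in>UNIV. \<Sum>p\<in>UNIV. \<Sum>m\<in>UNIV. T q p m * t q * dt p m) = (\<Sum>p\<in>UNIV. \<Sum>m\<in>UNIV. \<Sum>q\<in>UNIV. T q p m * t q * dt p m)"
    by (rule sum3_312)
  also have "\<dots> = - (\<Sum>p\<in>UNIV. \<Sum>m\<in>UNIV. F p m * F p m) / 2"
    unfolding sum_divide_distrib sum_negf[symmetric]
  proof (intro sum.cong refl)
    fix p m
    have "(\<Sum>q\<in>UNIV. T q p m * t q * dt p m) = F p m * dt p m"
      unfolding F_def sum_distrib_right by (intro sum.cong refl) (simp add: T_perm(4)[of p m])
    then show "(\<Sum>q\<in>UNIV. T q p m * t q * dt p m) = - (F p m * F p m) / 2"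
      by (simp add: dtF)
  qed
  finally have l1: "(\<Sum>q\<in>UNIV. \<Sum>p\<in>UNIV. psi_trace (D2 p q) p * t q) = (\<Sum>p\<in>UNIV. \<Sum>m\<in>UNIV. F p m * F p m) / 4"
    by simp
  have l2: "psi_trace (D2 q p) p = 0" for p q
    unfolding t2 by (simp add: D0)
  \<comment> \<open>Second evaluation, as a commutator, since the term with exchanged derivatives is
    zero by \<open>l2\<close>. The curvature part is \<open>\<rho>\<close> applied to
    \<open>t\<close>, which is zero, and the torsion part gives half of |F|^2.\<close>
  have "(\<Sum>q\<in>UNIV. \<Sum>p\<in>UNIV. psi_trace (D2 p q) p * t q)
    = (\<Sum>q\<in>UNIV. \<Sum>p\<in>UNIV. (psi_trace (D2 p q) p - psi_trace (D2 q p) p) * t q)"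
    by (simp add: l2)
  also have "\<dots> = - (\<Sum>q\<in>UNIV. \<Sum>p\<in>UNIV. \<Sum>a\<in>UNIV. R p q p a * t a * t q) - (\<Sum>q\<in>UNIV. \<Sum>p\<in>UNIV. \<Sum>m\<in>UNIV. T p q m * dt m p * t q)"
    unfolding ricci_trace[OF ric] by (simp add: left_diff_distrib sum_subtractf sum_negf sum_distrib_right)
  also have "(\<Sum>q\<in>UNIV. \<Sum>p\<in>UNIV. \<Sum>a\<in>UNIV. R p q p a * t a * t q) = (\<Sum>q\<in>UNIV. \<Sum>a\<in>UNIV. \<Sum>p\<in>UNIV. R p q p a * t a * t q)"
    by (rule sum3_132)
  also have "\<dots> = (\<Sum>q\<in>UNIV. (\<Sum>a\<in>UNIV. \<rho> q a * t a) * t q)"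
    by (simp add: \<rho>_def sum_distrib_right)
  also have "\<dots> = 0" by (simp add: \<rho>t0)
  also have "(\<Sum>q\<in>UNIV. \<Sum>p\<in>UNIV. \<Sum>m\<in>UNIV. T p q m * dt m p * t q) = (\<Sum>p\<in>UNIV. \<Sum>m\<in>UNIV. \<Sum>q\<in>UNIV. T p q m * dt m p * t q)"
    by (rule sum3_312)
  also have "\<dots> = - (\<Sum>p\<in>UNIV. \<Sum>m\<in>UNIV. F p m * F p m) / 2"
    unfolding sum_divide_distrib sum_negf[symmetric]
  proof (intro sum.cong refl)
    fix p m
    have "(\<Sum>q\<in>UNIV. T p q m * dt m p * t q) = F m p * dt m p"
      unfolding F_def sum_distrib_right by (intro sum.cong refl) (simp add: T_perm(5)[of m p])
    then show "(\<Sum>q\<in>UNIV. T p q m * dt m p * t q) = - (F p m * F p m) / 2"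
      by (simp add: dtF F_skew[of p m])
  qed
  finally have "(\<Sum>p\<in>UNIV. \<Sum>m\<in>UNIV. F p m * F p m) = 0"
    unfolding l1 by simp
  then show ?thesis
    by (simp add: sum_nonneg_eq_0_iff sum_nonneg)
qed

end

section \<open>The alternated Ricci identity\<close>

context instanton_jet
begin

definition Y :: "8 \<Rightarrow> 8 \<Rightarrow> 8 \<Rightarrow> 8 \<Rightarrow> 8 \<Rightarrow> real" where
  "Y a b c d e = (\<Sum>m\<in>UNIV. T a b m * D m c d e)"

text \<open>
  The Ricci identity alternated over all five indices, where the curvature enters through the first
  Bianchi identity only. This is the content of $d\sigma^T = 0$.
\<close>

lemma alternate_ricci_id:
  assumes ric: "ricci_id D2"
    and D2_closed: "\<And>p x y z v. D2 p x y z v + D2 p y z x v + D2 p z x y v = D2 p v x y z"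
    and D2_alt: "\<And>p q. alternating3 (D2 p q)"
  shows "Y a b c d e - Y a c b d e + Y a d b c e - Y a e b c d + Y b c a d e - Y b d a c e + Y b e a c d + Y c d a b e - Y c e a b d + Y d e a b c = 0"
proof -
  define f where "f p q i j k = (\<Sum>m\<in>UNIV. R p q i m * T m j k)" for p q i j k
  define S where "S p q i j k = (\<Sum>m\<in>UNIV. \<Sum>n\<in>UNIV. T p q n * T n i m * T m j k)" for p q i j k
  have T4: "T x y m = T m x y" for x y m
    by (rule T_perm)
  \<comment> \<open>A cubic torsion term changes sign when its outer pairs are exchanged, so these
    terms cancel in twos under alternation.\<close>
  have S_swap: "S j k i p q = - S p q i j k" for p q i j k
  proof -
    have "S j k i p q = (\<Sum>n\<in>UNIV. \<Sum>m\<in>UNIV. T j k n * T n i m * T m p q)"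
      unfolding S_def by (rule sum.swap)
    also have "\<dots> = - S p q i j k"
      unfolding S_def sum_negf[symmetric]
    proof (intro sum.cong refl)
      fix n m show "T j k n * T n i m * T m p q = - (T p q m * T m i n * T n j k)"
        using T_perm(3)[of n i m] T4[of j k n] T4[of p q m] by simp
    qed
    finally show ?thesis .
  qed
  have N: "Y p q i j k = - (D2 p q i j k - D2 q p i j k) - (f p q i j k - f p q j i k + f p q k i j)" for p q i j k
  proof -
    have "(\<Sum>m\<in>UNIV. R p q i m * T m j k + R p q j m * T i m k + R p q k m * T i j m)
      = f p q i j k - f p q j i k + f p q k i j"
      unfolding f_def sum.distrib[symmetric] sum_subtractf[symmetric]
      by (intro sum.cong refl) (simp add: T_perm(1)[of _ i k] T_perm(4)[of i j])
    then show ?thesis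
      using ric[unfolded ricci_id_def, rule_format, of p q i j k] unfolding Y_def by linarith
  qed
  have K: "D2 p x y z v - D2 p y x z v + D2 p z x y v - D2 p v x y z = 0" for p x y z v
    using D2_closed[of p x y z v] alternating3D(1)[OF D2_alt, of p y z x v] by linarith
  \<comment> \<open>Alternating the curvature term over three indices calls up the Bianchi identity,
    which returns a term \<open>Y\<close> whose pair is the remaining \<open>j k\<close>.\<close>
  have bf: "f x y z j k - f x z y j k + f y z x j k = Y j k x y z + (S x y z j k - S x z y j k + S y z x j k)" for x y z j k
  proof -
    have "f x y z j k - f x z y j k + f y z x j k
      = (\<Sum>m\<in>UNIV. (R x y z m + R y z x m + R z x y m) * T m j k)"
      unfolding f_def sum.distrib[symmetric] sum_subtractf[symmetric]
      by (intro sum.cong refl) (simp add: R_skew1[of z x] algebra_simps)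
    also have "\<dots> = (\<Sum>m\<in>UNIV. T j k m * D m x y z + ((\<Sum>n\<in>UNIV. T x y n * T n z m * T m j k)
        + (\<Sum>n\<in>UNIV. T y z n * T n x m * T m j k) - (\<Sum>n\<in>UNIV. T x z n * T n y m * T m j k)))"
    proof (intro sum.cong refl)
      fix m
      have "(\<Sum>n\<in>UNIV. T z x n * T n y m) = - (\<Sum>n\<in>UNIV. T x z n * T n y m)"
        unfolding sum_negf[symmetric] by (intro sum.cong refl) (simp add: T_perm(1)[of z x])
      then have eq: "R x y z m + R y z x m + R z x y m = D m x y z + (\<Sum>n\<in>UNIV. T x y n * T n z m)
        + (\<Sum>n\<in>UNIV. T y z n * T n x m) - (\<Sum>n\<in>UNIV. T x z n * T n y m)"
        using bianchi[of x y z m] D_closed[of x y z m] by linarith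
      show "(R x y z m + R y z x m + R z x y m) * T m j k
         = T j k m * D m x y z + ((\<Sum>n\<in>UNIV. T x y n * T n z m * T m j k)
        + (\<Sum>n\<in>UNIV. T y z n * T n x m * T m j k) - (\<Sum>n\<in>UNIV. T x z n * T n y m * T m j k))"
        unfolding eq T4[of j k m] by (simp add: distrib_right left_diff_distrib sum_distrib_right mult.commute[of _ "D m x y z"])
    qed
    also have "\<dots> = Y j k x y z + (S x y z j k - S x z y j k + S y z x j k)"
      by (simp add: Y_def S_def sum.distrib sum_subtractf)
    finally show ?thesis .
  qed
  \<comment> \<open>The ten summands are the splittings of five indices into a pair and a triple,
    with the signs of the shuffles. The second derivatives group by their outer index into instances
    of \<open>K\<close>, and the curvature terms return the same sum of \<open>Y\<close> once more,
    so that it equals its own negative.\<close>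
  have "Y a b c d e - Y a c b d e + Y a d b c e - Y a e b c d + Y b c a d e - Y b d a c e + Y b e a c d + Y c d a b e - Y c e a b d + Y d e a b c = - ((D2 a b c d e - D2 b a c d e) - (D2 a c b d e - D2 c a b d e) + (D2 a d b c e - D2 d a b c e) - (D2 a e b c d - D2 e a b c d) + (D2 b c a d e - D2 c b a d e) - (D2 b d a c e - D2 d b a c e) + (D2 b e a c d - D2 e b a c d) + (D2 c d a b e - D2 d c a b e) - (D2 c e a b d - D2 e c a b d) + (D2 d e a b c - D2 e d a b c)) - ((f a b c d e - f a b d c e + f a b e c d) - (f a c b d e - f a c d b e + f a c e b d) + (f a d b c e - f a d c b e + f a d e b c) - (f a e b c d - f a e c b d + f a e d b c) + (f b c a d e - f b c d a e + f b c e a d) - (f b d a c e - f b d c a e + f b d e a c) + (f b e a c d - f b e c a d + f b e d a c) + (f c d a b e - f c d b a e + f c d e a b) - (f c e a b d - f c e b a d + f c e d a b) + (f d e a b c - f d e b a c + f d e c a b))"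
    unfolding N by simp
  also have "(D2 a b c d e - D2 b a c d e) - (D2 a c b d e - D2 c a b d e) + (D2 a d b c e - D2 d a b c e) - (D2 a e b c d - D2 e a b c d) + (D2 b c a d e - D2 c b a d e) - (D2 b d a c e - D2 d b a c e) + (D2 b e a c d - D2 e b a c d) + (D2 c d a b e - D2 d c a b e) - (D2 c e a b d - D2 e c a b d) + (D2 d e a b c - D2 e d a b c) = 0"
    using K[of a b c d e] K[of b a c d e] K[of c a b d e] K[of d a b c e] K[of e a b c d] by linarith
  also have "(f a b c d e - f a b d c e + f a b e c d) - (f a c b d e - f a c d b e + f a c e b d) + (f a d b c e - f a d c b e + f a d e b c) - (f a e b c d - f a e c b d + f a e d b c) + (f b c a d e - f b c d a e + f b c e a d) - (f b d a c e - f b d c a e + f b d e a c) + (f b e a c d - f b e c a d + f b e d a c) + (f c d a b e - f c d b a e + f c d e a b) - (f c e a b d - f c e b a d + f c e d a b) + (f d e a b c - f d e b a c + f d e c a b) = Y a b c d e - Y a c b d e + Y a d b c e - Y a e b c d + Y b c a d e - Y b d a c e + Y b e a c d + Y c d a b e - Y c e a b d + Y d e a b c + ((S c d e a b - S c e d a b + S d e c a b) - (S b d e a c - S b e d a c + S d e b a c) + (S b c e a d - S b e c a d + S c e b a d) - (S b c d a e - S b d c a e + S c d b a e) + (S a d e b c - S a e d b c + S d e a b c) - (S a c e b d - S a e c b d + S c e a b d) + (S a c d b e - S a d c b e + S c d a b e) + (S a b e c d - S a e b c d + S b e a c d) - (S a b d c e - S a d b c e + S b d a c e) + (S a b c d e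 - S a c b d e + S b c a d e))"
    using bf[of c d e a b] bf[of b d e a c] bf[of b c e a d] bf[of b c d a e] bf[of a d e b c] bf[of a c e b d] bf[of a c d b e] bf[of a b e c d] bf[of a b d c e] bf[of a b c d e] by linarith
  also have "(S c d e a b - S c e d a b + S d e c a b) - (S b d e a c - S b e d a c + S d e b a c) + (S b c e a d - S b e c a d + S c e b a d) - (S b c d a e - S b d c a e + S c d b a e) + (S a d e b c - S a e d b c + S d e a b c) - (S a c e b d - S a e c b d + S c e a b d) + (S a c d b e - S a d c b e + S c d a b e) + (S a b e c d - S a e b c d + S b e a c d) - (S a b d c e - S a d b c e + S b d a c e) + (S a b c d e - S a c b d e + S b c a d e) = 0"
    using S_swap[of b c a d e] S_swap[of b d a c e] S_swap[of b e a c d] S_swap[of a c b d e] S_swap[of a d b c e] S_swap[of a e b c d] S_swap[of a b c d e] S_swap[of a d c b e] S_swap[of a e c b d] S_swap[of a b d c e] S_swap[of a c d b e] S_swap[of a e d b c] S_swap[of a b e c d] S_swap[of a c e b d] S_swap[of a d e b c] by linarith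
  finally show ?thesis by linarith
qed

end

lemma psi_pair: "psi c d a b = psi a b c d"
  using psi_swap(2)[of c a d b] psi_swap(1)[of a c d b] psi_swap(3)[of a c b d] psi_swap(2)[of a b c d] by simp

section \<open>First contraction: the norm of the torsion is constant\<close>

context instanton_jet
begin

text \<open>Half the derivative in direction \<open>j\<close> of the squared norm, the norm being
  summed over all index triples.\<close>

definition w :: "8 \<Rightarrow> real" where
  "w j = (\<Sum>m\<in>UNIV. \<Sum>a\<in>UNIV. \<Sum>b\<in>UNIV. T m a b * D j m a b)"

text \<open>Closedness writes \<open>D j m a b\<close> as three terms that agree when paired with
  the alternating \<open>T\<close>.\<close>

lemma T_D_trace: "(\<Sum>m\<in>UNIV. \<Sum>a\<in>UNIV. \<Sum>b\<in>UNIV. T m a b * D m j a b) = w j / 3"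
proof -
  let ?S = "\<lambda>f. \<Sum>m\<in>UNIV. \<Sum>a\<in>UNIV. \<Sum>b\<in>UNIV. f m a b :: real"
  have "w j = ?S (\<lambda>m a b. T m a b * D m a b j) + ?S (\<lambda>m a b. T m a b * D a b m j) + ?S (\<lambda>m a b. T m a b * D b m a j)"
    unfolding w_def sum.distrib[symmetric]
  proof (intro sum.cong refl)
    fix m a b show "T m a b * D j m a b = T m a b * D m a b j + T m a b * D a b m j + T m a b * D b m a j"
      using D_closed[of m a b j] by (simp flip: distrib_left)
  qed
  also have "?S (\<lambda>m a b. T m a b * D a b m j) = ?S (\<lambda>m a b. T m a b * D m a b j)"
  proof (subst sum3_312, intro sum.cong refl)
    fix m a b show "T b m a * D m a b j = T m a b * D m a b j"
      using T_perm(4)[of m a b] by simp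
  qed
  also have "?S (\<lambda>m a b. T m a b * D b m a j) = ?S (\<lambda>m a b. T m a b * D m a b j)"
  proof (subst sum3_231, intro sum.cong refl)
    fix m a b show "T a b m * D m a b j = T m a b * D m a b j"
      using T_perm(5)[of m a b] by simp
  qed
  also have "?S (\<lambda>m a b. T m a b * D m a b j) = ?S (\<lambda>m a b. T m a b * D m j a b)"
    by (intro sum.cong refl) (simp add: D_perm(5)[of _ j])
  finally show ?thesis by simp
qed

lemma T_A_trace: "(\<Sum>m\<in>UNIV. \<Sum>a\<in>UNIV. \<Sum>b\<in>UNIV. T m a b * A m j a b) = - (2 * w j / 3)"
  using T_D_trace[of j] by (simp add: A_def right_diff_distrib sum_subtractf w_def)

text \<open>A five-fold sum as a function of its summand: renaming summation indices becomes
  rewriting by transpositions.\<close>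

definition sum5 :: "(8 \<Rightarrow> 8 \<Rightarrow> 8 \<Rightarrow> 8 \<Rightarrow> 8 \<Rightarrow> real) \<Rightarrow> real" where
  "sum5 f = (\<Sum>a\<in>UNIV. \<Sum>b\<in>UNIV. \<Sum>c\<in>UNIV. \<Sum>d\<in>UNIV. \<Sum>e\<in>UNIV. f a b c d e)"

lemma sum5_12: "sum5 f = sum5 (\<lambda>a b c d e. f b a c d e)"
  unfolding sum5_def by (rule sum.swap)
lemma sum5_23: "sum5 f = sum5 (\<lambda>a b c d e. f a c b d e)"
  unfolding sum5_def by (rule sum.cong[OF refl], rule sum.swap)
lemma sum5_34: "sum5 f = sum5 (\<lambda>a b c d e. f a b d c e)"
  unfolding sum5_def by (rule sum.cong[OF refl], rule sum.cong[OF refl], rule sum.swap)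
lemma sum5_45: "sum5 f = sum5 (\<lambda>a b c d e. f a b c e d)"
  unfolding sum5_def by (rule sum.cong[OF refl], rule sum.cong[OF refl], rule sum.cong[OF refl], rule sum.swap)
lemma sum5_13: "sum5 f = sum5 (\<lambda>a b c d e. f c b a d e)"
  by (subst sum5_12, subst sum5_23, subst sum5_12) simp

lemma sum5_cong: "(\<And>a b c d e. f a b c d e = g a b c d e) \<Longrightarrow> sum5 f = sum5 g"
  by (simp add: sum5_def)
lemma sum5_add: "sum5 (\<lambda>a b c d e. f a b c d e + g a b c d e) = sum5 f + sum5 g"
  by (simp add: sum5_def sum.distrib)
lemma sum5_minus: "sum5 (\<lambda>a b c d e. - f a b c d e) = - sum5 f"
  by (simp add: sum5_def sum_negf)
lemma sum5_diff: "sum5 (\<lambda>a b c d e. f a b c d e - g a b c d e) = sum5 f - sum5 g"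
  by (simp add: sum5_def sum_subtractf)

lemma Y_perm: "Y b a c d e = - Y a b c d e" "Y a b d c e = - Y a b c d e" "Y a b c e d = - Y a b c d e"
  unfolding Y_def sum_negf[symmetric]
  by (intro sum.cong refl, simp add: T_perm(1)[of b a] D_perm(1)[of _ d c] D_perm(2)[of _ c e d])+

text \<open>Here \<open>psi\<close> is contracted with the whole 3-form in \<open>D\<close>, which
  leaves the derivative of \<open>t\<close>.\<close>

lemma psi_Y_dt: "(\<Sum>b\<in>UNIV. \<Sum>c\<in>UNIV. \<Sum>i\<in>UNIV. psi b c i d * Y x y b c i) = (\<Sum>m\<in>UNIV. T x y m * dt m d)"
proof -
  have "(\<Sum>b\<in>UNIV. \<Sum>c\<in>UNIV. \<Sum>i\<in>UNIV. psi b c i d * Y x y b c i)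
    = (\<Sum>b\<in>UNIV. \<Sum>c\<in>UNIV. \<Sum>i\<in>UNIV. \<Sum>m\<in>UNIV. T x y m * (D m b c i * psi b c i d))"
    by (simp add: Y_def sum_distrib_left algebra_simps)
  also have "\<dots> = (\<Sum>m\<in>UNIV. \<Sum>b\<in>UNIV. \<Sum>c\<in>UNIV. \<Sum>i\<in>UNIV. T x y m * (D m b c i * psi b c i d))"
    by (simp only: sum.cartesian_product,
      rule sum.reindex_bij_witness[of _ "\<lambda>(d, a, b, c). (a, b, c, d)" "\<lambda>(a, b, c, d). (d, a, b, c)"]) auto
  also have "\<dots> = (\<Sum>m\<in>UNIV. T x y m * dt m d)"
    by (simp add: dt_def psi_trace_def sum_distrib_left)
  finally show ?thesis .
qed

text \<open>The derivative index of \<open>D\<close> is exchanged with \<open>j\<close> at the cost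
  of a term \<open>A\<close>. Self-duality and \<open>T_A_trace\<close> make that term -4/3 of
  \<open>w\<close>. The rest is 2/3 of \<open>w\<close>, by
  \<open>psi_contraction_alternation\<close> with vanishing trace.\<close>

lemma psi_Y_w:
  assumes dt: "\<And>i j. dt i j = 0"
  shows "(\<Sum>a\<in>UNIV. \<Sum>b\<in>UNIV. \<Sum>c\<in>UNIV. \<Sum>i\<in>UNIV. psi a b c i * Y a b c i j) = - (2 / 3) * w j"
proof -
  have "(\<Sum>a\<in>UNIV. \<Sum>b\<in>UNIV. \<Sum>c\<in>UNIV. \<Sum>i\<in>UNIV. psi a b c i * Y a b c i j)
    = sum5 (\<lambda>a b c i m. psi a b c i * (T a b m * D m c i j))"
    by (simp add: Y_def sum_distrib_left sum5_def)
  also have "\<dots> = sum5 (\<lambda>m a b c i. psi a b c i * (T a b m * D m c i j))"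
    by (subst sum5_45, subst sum5_34, subst sum5_23, subst sum5_12) simp
  also have "\<dots> = sum5 (\<lambda>m a b c i. T m a b * (A m j c i * psi c i a b)) + sum5 (\<lambda>m a b c i. T m a b * (D j m c i * psi c i a b))"
    unfolding sum5_add[symmetric]
  proof (rule sum5_cong)
    fix m a b c i
    have "T a b m = T m a b" "D m c i j = A m j c i + D j m c i"
      using D_perm(5)[of m j c i] by (auto simp: T_perm(4) A_def)
    then show "psi a b c i * (T a b m * D m c i j) = T m a b * (A m j c i * psi c i a b) + T m a b * (D j m c i * psi c i a b)"
      using psi_pair[of c i a b] by (simp add: algebra_simps)
  qed
  also have "sum5 (\<lambda>m a b c i. T m a b * (A m j c i * psi c i a b))
    = (\<Sum>m\<in>UNIV. \<Sum>a\<in>UNIV. \<Sum>b\<in>UNIV. T m a b * (2 * A m j a b))"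
    unfolding sum5_def self_dualD[OF A_self_dual, symmetric] by (simp add: sum_distrib_left)
  also have "\<dots> = 2 * (\<Sum>m\<in>UNIV. \<Sum>a\<in>UNIV. \<Sum>b\<in>UNIV. T m a b * A m j a b)"
    by (simp add: sum_distrib_left algebra_simps)
  also have "\<dots> = - (4 / 3) * w j"
    by (simp add: T_A_trace)
  also have "sum5 (\<lambda>m a b c i. T m a b * (D j m c i * psi c i a b)) = 2 / 3 * w j"
  proof -
    define q where "q m a b = (\<Sum>c\<in>UNIV. \<Sum>i\<in>UNIV. D j m c i * psi c i a b)" for m a b
    let ?S = "\<lambda>f. \<Sum>m\<in>UNIV. \<Sum>a\<in>UNIV. \<Sum>b\<in>UNIV. f m a b :: real"
    have q: "q m a b + q a b m + q b m a = 2 * D j m a b" for m a b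
    proof -
      have "psi_trace (D j) d = 0" for d using dt by (simp add: dt_def)
      then show ?thesis
        unfolding q_def sum.distrib[symmetric] using psi_contraction_alternation[OF D_alt, of j m a b] by simp
    qed
    have 1: "?S (\<lambda>m a b. T m a b * q a b m) = ?S (\<lambda>m a b. T m a b * q m a b)"
    proof (subst sum3_312, intro sum.cong refl)
      fix m a b show "T b m a * q m a b = T m a b * q m a b"
        using T_perm(4)[of m a b] by simp
    qed
    have 2: "?S (\<lambda>m a b. T m a b * q b m a) = ?S (\<lambda>m a b. T m a b * q m a b)"
    proof (subst sum3_231, intro sum.cong refl)
      fix m a b show "T a b m * q m a b = T m a b * q m a b"
        using T_perm(5)[of m a b] by simp
    qed
    have "3 * ?S (\<lambda>m a b. T m a b * q m a b) = ?S (\<lambda>m a b. T m a b * q m a b) + ?S (\<lambda>m a b. T m a b * q a b m) + ?S (\<lambda>m a b. T m a b * q b m a)"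
      unfolding 1 2 by simp
    also have "\<dots> = ?S (\<lambda>m a b. T m a b * (q m a b + q a b m + q b m a))"
      by (simp add: sum.distrib distrib_left)
    also have "\<dots> = 2 * w j"
      unfolding q w_def by (simp add: sum_distrib_left algebra_simps)
    finally have "?S (\<lambda>m a b. T m a b * q m a b) = 2 / 3 * w j" by simp
    then show ?thesis
      by (simp add: sum5_def q_def sum_distrib_left)
  qed
  finally show ?thesis by simp
qed

end

context instanton_jet
begin

definition sum4 :: "(8 \<Rightarrow> 8 \<Rightarrow> 8 \<Rightarrow> 8 \<Rightarrow> real) \<Rightarrow> real" where
  "sum4 f = (\<Sum>a\<in>UNIV. \<Sum>b\<in>UNIV. \<Sum>c\<in>UNIV. \<Sum>d\<in>UNIV. f a b c d)"

lemma sum4_12: "sum4 f = sum4 (\<lambda>a b c d. f b a c d)"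
  unfolding sum4_def by (rule sum.swap)
lemma sum4_23: "sum4 f = sum4 (\<lambda>a b c d. f a c b d)"
  unfolding sum4_def by (rule sum.cong[OF refl], rule sum.swap)
lemma sum4_34: "sum4 f = sum4 (\<lambda>a b c d. f a b d c)"
  unfolding sum4_def by (rule sum.cong[OF refl], rule sum.cong[OF refl], rule sum.swap)
lemma sum4_cong: "(\<And>a b c d. f a b c d = g a b c d) \<Longrightarrow> sum4 f = sum4 g"
  by (simp add: sum4_def)
lemma sum4_minus: "sum4 (\<lambda>a b c d. - f a b c d) = - sum4 f"
  by (simp add: sum4_def sum_negf)
lemma sum4_add: "sum4 (\<lambda>a b c d. f a b c d + g a b c d) = sum4 f + sum4 g"
  by (simp add: sum4_def sum.distrib)
lemma sum4_diff: "sum4 (\<lambda>a b c d. f a b c d - g a b c d) = sum4 f - sum4 g"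
  by (simp add: sum4_def sum_subtractf)

text \<open>The conclusion of \<open>alternate_ricci_id\<close>, kept as a predicate so that its two
  contractions do not carry \<open>D2\<close> along.\<close>

definition Y_closed :: bool where
  "Y_closed \<longleftrightarrow> (\<forall>a b c d e. Y a b c d e - Y a c b d e + Y a d b c e - Y a e b c d + Y b c a d e - Y b d a c e
     + Y b e a c d + Y c d a b e - Y c e a b d + Y d e a b c = 0)"

text \<open>Contract four of the five indices with \<open>psi\<close> and keep \<open>j\<close>. In
  six of the ten terms \<open>j\<close> belongs to the triple, and each of them is \<open>X\<close>
  up to sign. In the other four it belongs to the pair, so \<open>psi\<close> meets a full triple
  and the result is a contraction of \<open>dt\<close>. Hence \<open>X\<close> vanishes, and
  \<open>X\<close> is a multiple of \<open>w\<close>.\<close>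

lemma w_eq_0:
  assumes dt: "\<And>i j. dt i j = 0" and Y: Y_closed
  shows "w j = 0"
proof -
  define X where "X = sum4 (\<lambda>a b c d. psi a b c d * Y a b c d j)"
  define X' where "X' = sum4 (\<lambda>a b c d. psi a b c d * Y a j b c d)"
  have X': "X' = 0"
  proof -
    have "(\<Sum>b\<in>UNIV. \<Sum>c\<in>UNIV. \<Sum>d\<in>UNIV. psi a b c d * Y a j b c d) = 0" for a
      unfolding psi_front[of a] using psi_Y_dt[of a a j] by (simp add: dt sum_negf)
    then show ?thesis by (simp add: X'_def sum4_def)
  qed
  have r2: "sum4 (\<lambda>a b c d. psi a b c d * Y a c b d j) = - X"
    unfolding X_def sum4_minus[symmetric]
    by (subst sum4_23, rule sum4_cong, subst psi_swap(2)) simp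
  have r3: "sum4 (\<lambda>a b c d. psi a b c d * Y a d b c j) = X"
    unfolding X_def
    by (subst sum4_34, subst sum4_23, rule sum4_cong, subst psi_swap(3), subst psi_swap(2)) simp
  have r5: "sum4 (\<lambda>a b c d. psi a b c d * Y b c a d j) = X"
    unfolding X_def
    by (subst sum4_12, subst sum4_23, rule sum4_cong, subst psi_swap(1), subst psi_swap(2)) simp
  have r6: "sum4 (\<lambda>a b c d. psi a b c d * Y b d a c j) = - X"
    unfolding r3[symmetric] sum4_minus[symmetric]
    by (subst sum4_12, rule sum4_cong, subst psi_swap(1)) simp
  have r8: "sum4 (\<lambda>a b c d. psi a b c d * Y c d a b j) = X"
    unfolding X_def 
    by (subst sum4_23, subst sum4_12, subst sum4_34, subst sum4_23, rule sum4_cong, subst psi_pair) simp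
  have s7: "sum4 (\<lambda>a b c d. psi a b c d * Y b j a c d) = - X'"
    unfolding X'_def sum4_minus[symmetric]
    by (subst sum4_12, rule sum4_cong, subst psi_swap(1)) simp
  have s9: "sum4 (\<lambda>a b c d. psi a b c d * Y c j a b d) = X'"
    unfolding X'_def
    by (subst sum4_23, subst sum4_12, rule sum4_cong, subst psi_swap(2), subst psi_swap(1)) simp
  have s10: "sum4 (\<lambda>a b c d. psi a b c d * Y d j a b c) = - X'"
    unfolding s9[symmetric] sum4_minus[symmetric]
    by (subst sum4_34, rule sum4_cong, subst psi_swap(3)) simp
  have "0 = sum4 (\<lambda>a b c d. psi a b c d * (Y a b c d j - Y a c b d j + Y a d b c j - Y a j b c d + Y b c a d j - Y b d a c j
     + Y b j a c d + Y c d a b j - Y c j a b d + Y d j a b c))"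
    using Y by (simp add: Y_closed_def sum4_def)
  also have "\<dots> = 6 * X - 4 * X'"
    unfolding distrib_left right_diff_distrib sum4_add sum4_diff r2 r3 r5 r6 r8 s7 s9 s10
    unfolding X_def[symmetric] X'_def[symmetric] by simp
  finally have "X = 0" using X' by simp
  then show ?thesis
    using psi_Y_w[OF dt, of j] by (simp add: X_def sum4_def)
qed

definition W :: "8 \<Rightarrow> 8 \<Rightarrow> 8 \<Rightarrow> 8 \<Rightarrow> 8 \<Rightarrow> real" where
  "W a b c i j = (\<Sum>d\<in>UNIV. psi a b c d * T d i j)"

lemma W_perm: "W b a c i j = - W a b c i j" "W a c b i j = - W a b c i j" "W a b c j i = - W a b c i j" "W c b a i j = - W a b c i j"
proof -
  show 1: "W b a c i j = - W a b c i j" for a b c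
    unfolding W_def sum_negf[symmetric] by (intro sum.cong refl, subst psi_swap(1)) simp
  show 2: "W a c b i j = - W a b c i j" for a b c
    unfolding W_def sum_negf[symmetric] by (intro sum.cong refl, subst psi_swap(2)) simp
  show "W a b c j i = - W a b c i j"
    unfolding W_def sum_negf[symmetric] by (intro sum.cong refl, subst T_perm(2)) simp
  show "W c b a i j = - W a b c i j"
    using 1[of b c a] 2[of b a c] 1[of a b c] by linarith
qed

text \<open>The product \<open>K\<close> is unchanged when \<open>a\<close>, \<open>d\<close> and
  \<open>j\<close>, \<open>m\<close> are transposed at the same time. As \<open>H\<close> is skew in
  \<open>d a\<close>, only its part skew in \<open>m j\<close> counts, and self-duality turns that
  part into \<open>A\<close>. Since \<open>K\<close> is also symmetric under exchange of the two
  pairs, where \<open>A\<close> is skew, the sum is zero.\<close>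

lemma W_Y_mixed: "sum5 (\<lambda>a b c i j. W a b c i j * Y a i b c j) = 0"
proof -
  define H where "H m j d a = (\<Sum>b\<in>UNIV. \<Sum>c\<in>UNIV. D m j b c * psi b c d a)" for m j d a
  define K where "K a d j m = (\<Sum>i\<in>UNIV. T d i j * T a i m)" for a d j m
  have "sum5 (\<lambda>a b c i j. W a b c i j * Y a i b c j)
    = (\<Sum>a\<in>UNIV. \<Sum>b\<in>UNIV. \<Sum>c\<in>UNIV. \<Sum>i\<in>UNIV. \<Sum>j\<in>UNIV. \<Sum>d\<in>UNIV. \<Sum>m\<in>UNIV. psi a b c d * T d i j * (T a i m * D m b c j))"
    by (simp add: sum5_def W_def Y_def sum_product)
  also have "\<dots> = (\<Sum>a\<in>UNIV. \<Sum>d\<in>UNIV. \<Sum>j\<in>UNIV. \<Sum>m\<in>UNIV. \<Sum>i\<in>UNIV. \<Sum>b\<in>UNIV. \<Sum>c\<in>UNIV. psi a b c d * T d i j * (T a i m * D m b c j))"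
    by (simp only: sum.cartesian_product,
      rule sum.reindex_bij_witness[of _ "\<lambda>(a, d, j, m, i, b, c). (a, b, c, i, j, d, m)" "\<lambda>(a, b, c, i, j, d, m). (a, d, j, m, i, b, c)"]) auto
  also have "\<dots> = (\<Sum>a\<in>UNIV. \<Sum>d\<in>UNIV. \<Sum>j\<in>UNIV. \<Sum>m\<in>UNIV. \<Sum>i\<in>UNIV. \<Sum>b\<in>UNIV. \<Sum>c\<in>UNIV. - (T d i j * T a i m * (D m j b c * psi b c d a)))"
  proof (intro sum.cong refl)
    fix a d j m i b c show "psi a b c d * T d i j * (T a i m * D m b c j) = - (T d i j * T a i m * (D m j b c * psi b c d a))"
      using psi_front[of a b c d] D_perm(4)[of m b c j] by simp
  qed
  also have "\<dots> = - sum4 (\<lambda>a d j m. K a d j m * H m j d a)"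
    unfolding sum4_def K_def H_def sum_negf sum_distrib_right unfolding sum_distrib_left ..
  also have "sum4 (\<lambda>a d j m. K a d j m * H m j d a) = sum4 (\<lambda>a d j m. K a d j m * A m j d a)"
  proof -
    have "sum4 (\<lambda>a d j m. K a d j m * H m j d a) = sum4 (\<lambda>a d j m. - (K a d j m * H j m d a))"
    proof (subst sum4_12, subst sum4_34, rule sum4_cong)
      fix a d j m
      have "K d a m j = K a d j m" unfolding K_def by (simp add: mult.commute)
      moreover have "H j m a d = - H j m d a"
        unfolding H_def sum_negf[symmetric] by (intro sum.cong refl, subst psi_swap(3)) simp
      ultimately show "K d a m j * H j m a d = - (K a d j m * H j m d a)" by simp
    qed
    then have "2 * sum4 (\<lambda>a d j m. K a d j m * H m j d a) = sum4 (\<lambda>a d j m. K a d j m * H m j d a) + sum4 (\<lambda>a d j m. - (K a d j m * H j m d a))"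
      by simp
    also have "\<dots> = sum4 (\<lambda>a d j m. 2 * (K a d j m * A m j d a))"
      unfolding sum4_add[symmetric]
    proof (rule sum4_cong)
      fix a d j m
      have "H m j d a - H j m d a = 2 * A m j d a"
        using self_dualD[OF A_self_dual, of m j d a]
        by (simp add: H_def A_def left_diff_distrib sum_subtractf)
      then show "K a d j m * H m j d a + - (K a d j m * H j m d a) = 2 * (K a d j m * A m j d a)"
        by (metis add_uminus_conv_diff mult.left_commute right_diff_distrib)
    qed
    also have "\<dots> = 2 * sum4 (\<lambda>a d j m. K a d j m * A m j d a)"
      by (simp add: sum4_def sum_distrib_left)
    finally show ?thesis by simp
  qed
  also have "\<dots> = 0"
  proof -
    have "sum4 (\<lambda>a d j m. K a d j m * A m j d a) = sum4 (\<lambda>a d j m. K j m a d * A d a m j)"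
      by (subst sum4_23, subst sum4_12, subst sum4_34, subst sum4_23) simp
    also have "\<dots> = sum4 (\<lambda>a d j m. - (K a d j m * A m j d a))"
    proof (rule sum4_cong)
      fix a d j m
      have "K j m a d = K a d j m"
        unfolding K_def
      proof (intro sum.cong refl)
        fix i show "T m i a * T j i d = T d i j * T a i m"
          using T_perm(3)[of m i a] T_perm(3)[of j i d] by simp
      qed
      then show "K j m a d * A d a m j = - (K a d j m * A m j d a)"
        using A_pair[of d a m j] by simp
    qed
    finally show ?thesis by (simp add: sum4_minus)
  qed
  finally show ?thesis by simp
qed

text \<open>Second contraction, with the torsion on the last two indices. Three of the ten terms
  have their pair inside \<open>a b c\<close> and repeat the sum in question; in six the pair is
  split between \<open>a b c\<close> and \<open>i j\<close>, which is \<open>W_Y_mixed\<close>; the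
  one with pair \<open>i j\<close> contracts to \<open>dt\<close>.\<close>

lemma W_Y_eq_0:
  assumes dt: "\<And>i j. dt i j = 0" and Y: Y_closed
  shows "sum5 (\<lambda>a b c i j. W a b c i j * Y a b c i j) = 0"
proof -
  let ?P = "sum5 (\<lambda>a b c i j. W a b c i j * Y a b c i j)"
  note M = W_Y_mixed
  have r2: "sum5 (\<lambda>a b c i j. W a b c i j * Y a c b i j) = - ?P"
    unfolding sum5_minus[symmetric] by (subst sum5_23, rule sum5_cong, subst W_perm(2)) simp
  have r5: "sum5 (\<lambda>a b c i j. W a b c i j * Y b c a i j) = ?P"
    by (subst sum5_13, rule sum5_cong, subst W_perm(4), subst Y_perm(1)) simp
  have r10: "sum5 (\<lambda>a b c i j. W a b c i j * Y i j a b c) = 0"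
  proof -
    have "sum5 (\<lambda>a b c i j. W a b c i j * Y i j a b c)
      = (\<Sum>i\<in>UNIV. \<Sum>j\<in>UNIV. \<Sum>d\<in>UNIV. T d i j * (\<Sum>a\<in>UNIV. \<Sum>b\<in>UNIV. \<Sum>c\<in>UNIV. psi a b c d * Y i j a b c))"
      unfolding sum5_def W_def sum_distrib_left sum_distrib_right
      by (simp only: sum.cartesian_product,
        rule sum.reindex_bij_witness[of _ "\<lambda>(i, j, d, a, b, c). (a, b, c, i, j, d)" "\<lambda>(a, b, c, i, j, d). (i, j, d, a, b, c)"]) auto
    also have "\<dots> = 0" by (simp add: psi_Y_dt dt)
    finally show ?thesis .
  qed
  have r4: "sum5 (\<lambda>a b c i j. W a b c i j * Y a j b c i) = 0"
    using M by (subst sum5_45, subst W_perm(3)) (simp add: sum5_minus)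
  have r6: "sum5 (\<lambda>a b c i j. W a b c i j * Y b i a c j) = 0"
    using M by (subst sum5_12, subst W_perm(1)) (simp add: sum5_minus)
  have r7: "sum5 (\<lambda>a b c i j. W a b c i j * Y b j a c i) = 0"
    using r4 by (subst sum5_12, subst W_perm(1)) (simp add: sum5_minus)
  have r8: "sum5 (\<lambda>a b c i j. W a b c i j * Y c i a b j) = 0"
    using r6 by (subst sum5_23, subst W_perm(2)) (simp add: sum5_minus)
  have r9: "sum5 (\<lambda>a b c i j. W a b c i j * Y c j a b i) = 0"
    using r7 by (subst sum5_23, subst W_perm(2)) (simp add: sum5_minus)
  have "0 = sum5 (\<lambda>a b c i j. W a b c i j * (Y a b c i j - Y a c b i j + Y a i b c j - Y a j b c i + Y b c a i j - Y b i a c j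
     + Y b j a c i + Y c i a b j - Y c j a b i + Y i j a b c))"
    using Y by (simp add: Y_closed_def sum5_def)
  also have "\<dots> = 3 * ?P"
    unfolding distrib_left right_diff_distrib sum5_add sum5_diff r2 r4 r5 r6 r7 r8 r9 r10 M by simp
  finally show ?thesis by simp
qed

end

section \<open>The torsion paired with its rough Laplacian\<close>

context instanton_jet
begin

definition curvature_bracket :: "8 \<Rightarrow> 8 \<Rightarrow> 8 \<Rightarrow> 8 \<Rightarrow> 8 \<Rightarrow> real" where
  "curvature_bracket a d b i j = (\<Sum>m\<in>UNIV. R a d b m * T m i j + R a d i m * T b m j + R a d j m * T b i m)"

lemma ricci_id_bracket:
  assumes "ricci_id D2"
  shows "D2 p q i j k - D2 q p i j k = - curvature_bracket p q i j k - Y p q i j k"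
  using assms unfolding ricci_id_def curvature_bracket_def Y_def by blast

text \<open>\<open>T d m p\<close> is skew in \<open>m p\<close> and so replaces \<open>D\<close> by
  half of \<open>A\<close>; the product of the two torsions is symmetric under exchange of the pairs
  \<open>i j\<close> and \<open>m p\<close>, where \<open>A\<close> is skew.\<close>

lemma T_Y_trace: "sum4 (\<lambda>p d i j. T d i j * Y p d p i j) = 0"
proof -
  define Q where "Q = sum5 (\<lambda>d i j m p. T d i j * T d m p * D m p i j)"
  define Q' where "Q' = sum5 (\<lambda>d i j m p. T d i j * T d m p * A m p i j)"
  have "sum4 (\<lambda>p d i j. T d i j * Y p d p i j)
    = (\<Sum>p\<in>UNIV. \<Sum>d\<in>UNIV. \<Sum>i\<in>UNIV. \<Sum>j\<in>UNIV. \<Sum>m\<in>UNIV. T d i j * T d m p * D m p i j)"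
    by (simp add: sum4_def Y_def sum_distrib_left T_perm(4)[of _ _ p for p] mult.assoc)
  also have "\<dots> = Q"
    unfolding Q_def sum5_def
    by (simp only: sum.cartesian_product,
      rule sum.reindex_bij_witness[of _ "\<lambda>(d, i, j, m, p). (p, d, i, j, m)" "\<lambda>(p, d, i, j, m). (d, i, j, m, p)"]) auto
  finally have e: "sum4 (\<lambda>p d i j. T d i j * Y p d p i j) = Q" .
  have "2 * Q = Q'"
  proof -
    have "Q = sum5 (\<lambda>d i j m p. - (T d i j * T d m p * D p m i j))"
      unfolding Q_def by (subst sum5_45, rule sum5_cong, subst (2) T_perm(2)) simp
    then have "2 * Q = Q + sum5 (\<lambda>d i j m p. - (T d i j * T d m p * D p m i j))" by simp
    also have "\<dots> = Q'"
      unfolding Q_def Q'_def sum5_add[symmetric] by (rule sum5_cong) (simp add: A_def algebra_simps)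
    finally show ?thesis .
  qed
  moreover have "Q' = - Q'"
  proof -
    have "Q' = sum5 (\<lambda>d i j m p. T d m p * T d i j * A i j m p)"
      unfolding Q'_def
      by (subst sum5_34, subst sum5_23, subst sum5_45, subst sum5_34) simp
    also have "\<dots> = - Q'"
      unfolding Q'_def sum5_minus[symmetric] by (rule sum5_cong, subst A_pair) simp
    finally show ?thesis .
  qed
  ultimately show ?thesis using e by simp
qed

text \<open>
  \<open>E\<close> and \<open>V\<close> are the pairings of \<open>T\<close> with the curvature term of the Ricci identity and with the rough
  Laplacian of \<open>T\<close>. Closedness of \<open>D\<close> gives \<open>V = - 3 * E\<close> and self-duality of \<open>A\<close> gives \<open>V = - 2 * E\<close>.
\<close>

lemma D_eq_0:
  assumes ric: "ricci_id D2"
    and D2_closed: "\<And>p x y z v. D2 p x y z v + D2 p y z x v + D2 p z x y v = D2 p v x y z"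
    and D2_alt: "\<And>p q. alternating3 (D2 p q)"
    and dt: "\<And>i j. dt i j = 0" and div2: "\<And>p i j. (\<Sum>c\<in>UNIV. D2 p c c i j) = 0"
    and w2: "(\<Sum>p\<in>UNIV. \<Sum>i\<in>UNIV. \<Sum>j\<in>UNIV. \<Sum>k\<in>UNIV. D p i j k * D p i j k + T i j k * D2 p p i j k) = 0"
    and sd2: "\<And>p a d i j. (\<Sum>b\<in>UNIV. \<Sum>c\<in>UNIV. D2 p b c i j * psi b c a d) = D2 p a d i j - D2 p d a i j"
  shows "D p i j k = 0"
proof -
  have Y: Y_closed
    unfolding Y_closed_def using alternate_ricci_id[OF ric D2_closed D2_alt] by blast
  define E where "E = sum4 (\<lambda>p d i j. T d i j * curvature_bracket p d p i j)"
  define V where "V = sum4 (\<lambda>p i j k. T i j k * D2 p p i j k)"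
  \<comment> \<open>Commuting the derivatives produces a divergence, which is zero by
    \<open>div2\<close>, and a torsion term, which is zero by \<open>T_Y_trace\<close>.\<close>
  have M: "sum4 (\<lambda>p d i j. T d i j * D2 p d p i j) = - E"
  proof -
    have "sum4 (\<lambda>p d i j. T d i j * D2 p d p i j)
       = sum4 (\<lambda>p d i j. T d i j * D2 d p p i j) - E - sum4 (\<lambda>p d i j. T d i j * Y p d p i j)"
      unfolding E_def sum4_diff[symmetric]
    proof (rule sum4_cong)
      fix p d i j
      have "D2 p d p i j = D2 d p p i j - curvature_bracket p d p i j - Y p d p i j"
        using ricci_id_bracket[OF ric, of p d p i j] by simp
      then show "T d i j * D2 p d p i j = T d i j * D2 d p p i j - T d i j * curvature_bracket p d p i j - T d i j * Y p d p i j"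
        by (simp add: right_diff_distrib)
    qed
    also have "sum4 (\<lambda>p d i j. T d i j * D2 d p p i j) = sum4 (\<lambda>d i j p. T d i j * D2 d p p i j)"
      by (subst sum4_12, subst sum4_23, subst sum4_34) simp
    also have "\<dots> = 0"
      by (simp add: sum4_def div2 flip: sum_distrib_left)
    finally show ?thesis by (simp add: T_Y_trace)
  qed
  \<comment> \<open>Closedness replaces the Laplacian by three mixed derivatives. They agree against
    the alternating \<open>T\<close>, and each is the quantity of \<open>M\<close>.\<close>
  have "V = - 3 * E"
  proof -
    define v where "v = sum4 (\<lambda>p i j k. T i j k * D2 p i j k p)"
    have "V = v + sum4 (\<lambda>p i j k. T i j k * D2 p j k i p) + sum4 (\<lambda>p i j k. T i j k * D2 p k i j p)"
      unfolding V_def v_def sum4_add[symmetric]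
    proof (rule sum4_cong)
      fix p i j k show "T i j k * D2 p p i j k = T i j k * D2 p i j k p + T i j k * D2 p j k i p + T i j k * D2 p k i j p"
        using D2_closed[of p i j k p] by (simp flip: distrib_left)
    qed
    also have "sum4 (\<lambda>p i j k. T i j k * D2 p j k i p) = v"
      unfolding v_def
    proof (subst sum4_23, subst sum4_34, subst sum4_cong)
      fix p i j k show "T k i j * D2 p i j k p = T i j k * D2 p i j k p"
        using T_perm(4)[of i j k] by simp
    qed simp
    also have "sum4 (\<lambda>p i j k. T i j k * D2 p k i j p) = v"
      unfolding v_def
    proof (subst sum4_34, subst sum4_23, subst sum4_cong)
      fix p i j k show "T j k i * D2 p i j k p = T i j k * D2 p i j k p"
        using T_perm(5)[of i j k] by simp
    qed simp
    also have "v = - E"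
      unfolding M[symmetric] v_def
    proof (rule sum4_cong)
      fix p i j k show "T i j k * D2 p i j k p = T i j k * D2 p i p j k"
        using alternating3D(4)[OF D2_alt, of p i j k p] by simp
    qed
    finally show ?thesis by simp
  qed
  \<comment> \<open>By \<open>sd2\<close> the Laplacian minus the mixed derivative of
    \<open>M\<close> is a contraction with \<open>psi\<close>. It is skew in the two derivative
    directions, so half a commutator enters; the instanton condition supplies a factor 2 for its
    curvature part, and the torsion part is \<open>W_Y_eq_0\<close>.\<close>
  moreover have "V + E = - E"
  proof -
    have "V + E = sum4 (\<lambda>p d i j. T d i j * D2 p p d i j) - sum4 (\<lambda>p d i j. T d i j * D2 p d p i j)"
      unfolding M V_def by simp
    also have "\<dots> = sum4 (\<lambda>p d i j. T d i j * (\<Sum>b\<in>UNIV. \<Sum>c\<in>UNIV. D2 p b c i j * psi b c p d))"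
      unfolding sum4_diff[symmetric] sd2 by (rule sum4_cong) (simp add: right_diff_distrib)
    also have "\<dots> = (\<Sum>d\<in>UNIV. \<Sum>i\<in>UNIV. \<Sum>j\<in>UNIV. T d i j * (\<Sum>c\<in>UNIV. \<Sum>p\<in>UNIV. \<Sum>b\<in>UNIV. D2 p b c i j * psi b c p d))"
      unfolding sum4_def sum_distrib_left
      by (simp only: sum.cartesian_product,
        rule sum.reindex_bij_witness[of _ "\<lambda>(d, i, j, c, p, b). (p, d, i, j, b, c)" "\<lambda>(p, d, i, j, b, c). (d, i, j, c, p, b)"]) auto
    also have "\<dots> = (\<Sum>d\<in>UNIV. \<Sum>i\<in>UNIV. \<Sum>j\<in>UNIV. T d i j * (\<Sum>c\<in>UNIV. - curvature_bracket c d c i j - (\<Sum>p\<in>UNIV. \<Sum>b\<in>UNIV. Y p b c i j * psi p b c d) / 2))"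
    proof (intro sum.cong refl arg_cong2[where f="(*)"])
      fix d i j c
      let ?S = "\<lambda>f. \<Sum>p\<in>UNIV. \<Sum>b\<in>UNIV. f p b :: real"
      have cyc: "?S (\<lambda>p b. D2 p b c i j * psi b c p d) = ?S (\<lambda>p b. D2 p b c i j * psi p b c d)"
        by (simp only: psi_cyc)
      have "2 * ?S (\<lambda>p b. D2 p b c i j * psi p b c d) = ?S (\<lambda>p b. D2 p b c i j * psi p b c d) + ?S (\<lambda>p b. D2 b p c i j * psi b p c d)"
        using sum.swap[of "\<lambda>p b. D2 p b c i j * psi p b c d" UNIV UNIV] by simp
      also have "\<dots> = ?S (\<lambda>p b. (D2 p b c i j - D2 b p c i j) * psi p b c d)"
        unfolding sum.distrib[symmetric]
      proof (intro sum.cong refl)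
        fix p b show "D2 p b c i j * psi p b c d + D2 b p c i j * psi b p c d = (D2 p b c i j - D2 b p c i j) * psi p b c d"
          using psi_swap(1)[of p b c d] by (simp add: left_diff_distrib)
      qed
      also have "\<dots> = - ?S (\<lambda>p b. curvature_bracket p b c i j * psi p b c d) - ?S (\<lambda>p b. Y p b c i j * psi p b c d)"
        unfolding ricci_id_bracket[OF ric] by (simp add: left_diff_distrib sum_subtractf sum_negf)
      also have "?S (\<lambda>p b. curvature_bracket p b c i j * psi p b c d) = 2 * curvature_bracket c d c i j"
      proof -
        have "?S (\<lambda>p b. curvature_bracket p b c i j * psi p b c d)
          = (\<Sum>m\<in>UNIV. (?S (\<lambda>p b. R p b c m * psi p b c d)) * T m i j + (?S (\<lambda>p b. R p b i m * psi p b c d)) * T c m j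
             + (?S (\<lambda>p b. R p b j m * psi p b c d)) * T c i m)"
          unfolding curvature_bracket_def sum_distrib_right sum.distrib[symmetric]
          by (subst sum3_231) (simp add: algebra_simps)
        also have "\<dots> = 2 * curvature_bracket c d c i j"
          unfolding self_dualD[OF instanton] curvature_bracket_def sum_distrib_left by (simp add: algebra_simps)
        finally show ?thesis .
      qed
      finally show "?S (\<lambda>p b. D2 p b c i j * psi b c p d) = - curvature_bracket c d c i j - ?S (\<lambda>p b. Y p b c i j * psi p b c d) / 2"
        unfolding cyc by simp
    qed
    also have "\<dots> = - (\<Sum>d\<in>UNIV. \<Sum>i\<in>UNIV. \<Sum>j\<in>UNIV. \<Sum>c\<in>UNIV. T d i j * curvature_bracket c d c i j)
       - (\<Sum>d\<in>UNIV. \<Sum>i\<in>UNIV. \<Sum>j\<in>UNIV. \<Sum>c\<in>UNIV. \<Sum>p\<in>UNIV. \<Sum>b\<in>UNIV. T d i j * (Y p b c i j * psi p b c d)) / 2"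
      by (simp add: sum_distrib_left sum_divide_distrib sum_subtractf sum_negf right_diff_distrib)
    also have "(\<Sum>d\<in>UNIV. \<Sum>i\<in>UNIV. \<Sum>j\<in>UNIV. \<Sum>c\<in>UNIV. T d i j * curvature_bracket c d c i j) = E"
      unfolding E_def sum4_def
      by (simp only: sum.cartesian_product,
        rule sum.reindex_bij_witness[of _ "\<lambda>(c, d, i, j). (d, i, j, c)" "\<lambda>(d, i, j, c). (c, d, i, j)"]) auto
    also have "(\<Sum>d\<in>UNIV. \<Sum>i\<in>UNIV. \<Sum>j\<in>UNIV. \<Sum>c\<in>UNIV. \<Sum>p\<in>UNIV. \<Sum>b\<in>UNIV. T d i j * (Y p b c i j * psi p b c d))
       = sum5 (\<lambda>a b c i j. W a b c i j * Y a b c i j)"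
      unfolding sum5_def W_def sum_distrib_right
      by (simp only: sum.cartesian_product,
        rule sum.reindex_bij_witness[of _ "\<lambda>(p, b, c, i, j, d). (d, i, j, c, p, b)" "\<lambda>(d, i, j, c, p, b). (p, b, c, i, j, d)"]) auto
    also have "\<dots> = 0" by (rule W_Y_eq_0[OF dt Y])
    finally show ?thesis by simp
  qed
  \<comment> \<open>With \<open>V = 0\<close>, the hypothesis \<open>w2\<close>, the second
    derivative of constant |T|^2, says that a sum of squares vanishes.\<close>
  ultimately have "V = 0" by simp
  then have "(\<Sum>p\<in>UNIV. \<Sum>i\<in>UNIV. \<Sum>j\<in>UNIV. \<Sum>k\<in>UNIV. D p i j k * D p i j k) = 0"
    using w2 by (simp add: sum.distrib V_def sum4_def)
  then show ?thesis
    by (simp add: sum_nonneg_eq_0_iff sum_nonneg)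
qed

end

subsection \<open>Smooth functions\<close>
abbreviation fd :: "(r8 \<Rightarrow> 'b::real_normed_vector) \<Rightarrow> r8 \<Rightarrow> r8 \<Rightarrow> 'b" where
  "fd f x \<equiv> frechet_derivative f (at x)"

lemma fd_eqI: "(f has_derivative f') (at x) \<Longrightarrow> fd f x v = f' v"
  by (metis frechet_derivative_at)

lemma has_derivative_fd: "f differentiable (at x) \<Longrightarrow> (f has_derivative fd f x) (at x)"
  by (simp add: frechet_derivative_works)

lemma fd_cong:
  assumes "open W" "x \<in> W" "\<And>y. y \<in> W \<Longrightarrow> f y = g y"
  shows "fd f x = fd g x"
proof -
  have "(f has_derivative h) (at x) = (g has_derivative h) (at x)" for h
    using has_derivative_transform_within_open[OF _ assms(1,2), of f h UNIV g]
      has_derivative_transform_within_open[OF _ assms(1,2), of g h UNIV f] assms(3) by auto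
  then show ?thesis by (simp add: frechet_derivative_def)
qed

lemma differentiable_cong:
  assumes "open W" "x \<in> W" "\<And>y. y \<in> W \<Longrightarrow> f y = g y"
  shows "f differentiable (at x) \<longleftrightarrow> g differentiable (at x)"
proof -
  have "(f has_derivative h) (at x) = (g has_derivative h) (at x)" for h
    using has_derivative_transform_within_open[OF _ assms(1,2), of f h UNIV g]
      has_derivative_transform_within_open[OF _ assms(1,2), of g h UNIV f] assms(3) by auto
  then show ?thesis by (simp add: differentiable_def)
qed

lemma k_smooth_on_cong:
  assumes "open W" "\<And>y. y \<in> W \<Longrightarrow> f y = g y"
  shows "k_smooth_on k W f \<longleftrightarrow> k_smooth_on k W g"
  using assms(2)
proof (induction k arbitrary: f g)
  case 0
  then show ?case by (simp cong: continuous_on_cong)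
next
  case (Suc k)
  have "k_smooth_on k W (\<lambda>x. fd f x v) \<longleftrightarrow> k_smooth_on k W (\<lambda>x. fd g x v)" for v
    by (rule Suc.IH) (simp add: fd_cong[OF assms(1) _ Suc.prems])
  then show ?case
    using differentiable_cong[OF assms(1) _ Suc.prems] by auto
qed

lemma k_smooth_on_Suc: "k_smooth_on (Suc k) W f \<Longrightarrow> k_smooth_on k W f"
proof (induction k arbitrary: f)
  case 0
  then show ?case
    by (auto intro!: continuous_at_imp_continuous_on differentiable_imp_continuous_within)
next
  case (Suc k)
  then show ?case by auto
qed

lemma smooth_on_cong:
  assumes "open W" "\<And>y. y \<in> W \<Longrightarrow> f y = g y"
  shows "smooth_on W f \<longleftrightarrow> smooth_on W g"
  by (simp add: smooth_on_def k_smooth_on_cong[OF assms])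

lemma smooth_on_subset:
  assumes "V \<subseteq> W" "smooth_on W f"
  shows "smooth_on V f"
proof -
  have "k_smooth_on k V f" if "k_smooth_on k W f" for k
    using that
  proof (induction k arbitrary: f)
    case 0
    then show ?case using assms(1) by (auto intro: continuous_on_subset)
  next
    case (Suc k)
    then show ?case using assms(1) by auto
  qed
  then show ?thesis using assms(2) by (simp add: smooth_on_def)
qed

lemma smooth_on_differentiable: "smooth_on W f \<Longrightarrow> x \<in> W \<Longrightarrow> f differentiable (at x)"
  unfolding smooth_on_def by (metis k_smooth_on.simps(2))

lemma smooth_on_fd: "smooth_on W f \<Longrightarrow> smooth_on W (\<lambda>x. fd f x v)"
  unfolding smooth_on_def by (metis k_smooth_on.simps(2))

lemma smooth_on_continuous: "smooth_on W f \<Longrightarrow> continuous_on W f"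
  unfolding smooth_on_def by (metis k_smooth_on.simps(1))

lemma k_smooth_on_const: "k_smooth_on k W (\<lambda>x. c)"
  by (induction k arbitrary: c) auto

lemma k_smooth_on_add:
  assumes "open W" "k_smooth_on k W f" "k_smooth_on k W g"
  shows "k_smooth_on k W (\<lambda>x. f x + g x)"
  using assms(2,3)
proof (induction k arbitrary: f g)
  case 0
  then show ?case by (auto intro: continuous_on_add)
next
  case (Suc k)
  have "k_smooth_on k W (\<lambda>x. fd (\<lambda>x. f x + g x) x v)" for v
  proof -
    have "k_smooth_on k W (\<lambda>x. fd f x v + fd g x v)"
      using Suc by auto
    then show ?thesis
      by (rule k_smooth_on_cong[OF assms(1), THEN iffD1, rotated])
        (use Suc.prems in \<open>auto intro!: fd_eqI[symmetric] has_derivative_add has_derivative_fd\<close>)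
  qed
  then show ?case using Suc.prems by (auto intro: differentiable_add)
qed

lemma k_smooth_on_mult:
  fixes f g :: "r8 \<Rightarrow> real"
  assumes "open W" "k_smooth_on k W f" "k_smooth_on k W g"
  shows "k_smooth_on k W (\<lambda>x. f x * g x)"
  using assms(2,3)
proof (induction k arbitrary: f g)
  case 0
  then show ?case by (auto intro: continuous_on_mult)
next
  case (Suc k)
  have "k_smooth_on k W (\<lambda>x. fd (\<lambda>x. f x * g x) x v)" for v
  proof -
    have "k_smooth_on k W (\<lambda>x. f x * fd g x v + fd f x v * g x)"
      using Suc k_smooth_on_Suc[OF Suc.prems(1)] k_smooth_on_Suc[OF Suc.prems(2)]
      by (intro k_smooth_on_add[OF assms(1)] Suc.IH) auto
    then show ?thesis
      by (rule k_smooth_on_cong[OF assms(1), THEN iffD1, rotated])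
        (use Suc.prems in \<open>auto intro!: fd_eqI[symmetric] has_derivative_mult has_derivative_fd\<close>)
  qed
  then show ?case using Suc.prems by (auto intro: differentiable_mult)
qed

lemma k_smooth_on_inverse:
  fixes f :: "r8 \<Rightarrow> real"
  assumes "open W" "k_smooth_on k W f" "\<And>x. x \<in> W \<Longrightarrow> f x \<noteq> 0"
  shows "k_smooth_on k W (\<lambda>x. inverse (f x))"
  using assms(2,3)
proof (induction k arbitrary: f)
  case 0
  then show ?case by (auto intro: continuous_on_inverse)
next
  case (Suc k)
  have d: "((\<lambda>x. inverse (f x)) has_derivative (\<lambda>h. - (inverse (f x) * fd f x h * inverse (f x)))) (at x)" if "x \<in> W" for x
    using Suc.prems that by (intro Deriv.has_derivative_inverse has_derivative_fd) auto
  have "k_smooth_on k W (\<lambda>x. fd (\<lambda>x. inverse (f x)) x v)" for v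
  proof -
    have "k_smooth_on k W (\<lambda>x. (- 1) * (inverse (f x) * fd f x v * inverse (f x)))"
      using Suc.prems Suc.IH[OF k_smooth_on_Suc[OF Suc.prems(1)] Suc.prems(2)]
      by (intro k_smooth_on_mult[OF assms(1)] k_smooth_on_const) auto
    then show ?thesis
      by (rule k_smooth_on_cong[OF assms(1), THEN iffD1, rotated]) (use fd_eqI[OF d] in auto)
  qed
  then show ?case using d by (auto simp: differentiable_def)
qed

lemma smooth_on_const: "smooth_on W (\<lambda>x. c)"
  by (simp add: smooth_on_def k_smooth_on_const)

lemma smooth_on_add: "open W \<Longrightarrow> smooth_on W f \<Longrightarrow> smooth_on W g \<Longrightarrow> smooth_on W (\<lambda>x. f x + g x)"
  by (simp add: smooth_on_def k_smooth_on_add)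

lemma smooth_on_mult:
  fixes f g :: "r8 \<Rightarrow> real"
  shows "open W \<Longrightarrow> smooth_on W f \<Longrightarrow> smooth_on W g \<Longrightarrow> smooth_on W (\<lambda>x. f x * g x)"
  by (simp add: smooth_on_def k_smooth_on_mult)

lemma smooth_on_divide:
  fixes f g :: "r8 \<Rightarrow> real"
  assumes "open W" "smooth_on W f" "smooth_on W g" "\<And>x. x \<in> W \<Longrightarrow> g x \<noteq> 0"
  shows "smooth_on W (\<lambda>x. f x / g x)"
proof -
  have "smooth_on W (\<lambda>x. inverse (g x))"
    using assms by (simp add: smooth_on_def k_smooth_on_inverse)
  then show ?thesis
    unfolding divide_inverse by (intro smooth_on_mult assms)
qed

lemma smooth_on_uminus:
  fixes f :: "r8 \<Rightarrow> real"
  shows "open W \<Longrightarrow> smooth_on W f \<Longrightarrow> smooth_on W (\<lambda>x. - f x)"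
  using smooth_on_mult[of W "\<lambda>x. - 1" f] smooth_on_const[of W "- 1 :: real"] by simp

lemma smooth_on_diff:
  fixes f g :: "r8 \<Rightarrow> real"
  shows "open W \<Longrightarrow> smooth_on W f \<Longrightarrow> smooth_on W g \<Longrightarrow> smooth_on W (\<lambda>x. f x - g x)"
  using smooth_on_add[of W f "\<lambda>x. - g x"] smooth_on_uminus[of W g] by simp

lemma smooth_on_sum:
  assumes "open W" "\<And>i. i \<in> I \<Longrightarrow> smooth_on W (f i)"
  shows "smooth_on W (\<lambda>x. \<Sum>i\<in>I. f i x)"
  using assms(2)
  by (induction I rule: infinite_finite_induct) (auto simp: smooth_on_const intro: smooth_on_add[OF assms(1)])

lemma smooth_on_prod:
  fixes f :: "'i \<Rightarrow> r8 \<Rightarrow> real"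
  assumes "open W" "\<And>i. i \<in> I \<Longrightarrow> smooth_on W (f i)"
  shows "smooth_on W (\<lambda>x. \<Prod>i\<in>I. f i x)"
  using assms(2)
  by (induction I rule: infinite_finite_induct) (auto simp: smooth_on_const intro: smooth_on_mult[OF assms(1)])

lemma fd_nth:
  fixes f :: "r8 \<Rightarrow> r8"
  assumes "f differentiable (at x)"
  shows "((\<lambda>x. f x $ i) has_derivative (\<lambda>v. fd f x v $ i)) (at x)"
  by (rule bounded_linear.has_derivative[OF bounded_linear_vec_nth has_derivative_fd[OF assms]])

lemma smooth_on_nth:
  fixes f :: "r8 \<Rightarrow> r8"
  assumes "open W" "smooth_on W f"
  shows "smooth_on W (\<lambda>x. f x $ i)"
proof -
  have "k_smooth_on k W (\<lambda>x. f x $ i)" if "k_smooth_on k W f" for k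
    using that
  proof (induction k arbitrary: f)
    case 0
    then show ?case by (auto intro: continuous_on_component)
  next
    case (Suc k)
    have "k_smooth_on k W (\<lambda>x. fd (\<lambda>x. f x $ i) x v)" for v
    proof -
      have "k_smooth_on k W (\<lambda>x. fd f x v $ i)"
        using Suc by auto
      then show ?thesis
        by (rule k_smooth_on_cong[OF assms(1), THEN iffD1, rotated])
          (use Suc.prems in \<open>auto intro!: fd_eqI[symmetric] fd_nth\<close>)
    qed
    then show ?case using Suc.prems by (auto intro: differentiableI[OF fd_nth])
  qed
  then show ?thesis using assms(2) by (simp add: smooth_on_def)
qed

lemma has_derivative_vec_nth:
  fixes f :: "r8 \<Rightarrow> r8"
  assumes "\<And>i. ((\<lambda>x. f x $ i) has_derivative (\<lambda>v. f' v $ i)) (at x)"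
  shows "(f has_derivative f') (at x)"
  using assms by (subst has_derivative_componentwise_within) (auto simp: Basis_vec_def inner_axis)

section \<open>Symmetry of second derivatives\<close>

lemma has_real_derivative_line:
  fixes f :: "r8 \<Rightarrow> real"
  assumes "f differentiable (at (p + s *\<^sub>R u))"
  shows "((\<lambda>s. f (p + s *\<^sub>R u)) has_real_derivative fd f (p + s *\<^sub>R u) u) (at s)"
proof -
  have 1: "((\<lambda>s. p + s *\<^sub>R u) has_derivative (\<lambda>h. h *\<^sub>R u)) (at s)"
    by (auto intro!: derivative_eq_intros)
  have "((\<lambda>s. f (p + s *\<^sub>R u)) has_derivative (\<lambda>h. fd f (p + s *\<^sub>R u) (h *\<^sub>R u))) (at s)"
    by (rule has_derivative_compose[OF 1 has_derivative_fd[OF assms]])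
  moreover have "(\<lambda>h. fd f (p + s *\<^sub>R u) (h *\<^sub>R u)) = (*) (fd f (p + s *\<^sub>R u) u)"
    using linear_scale[OF linear_frechet_derivative[OF assms]] by (auto simp: mult.commute)
  ultimately show ?thesis
    by (simp add: has_field_derivative_def)
qed

text \<open>The mean value theorem is applied along \<open>u\<close> to the difference in direction
  \<open>v\<close>, and then along \<open>v\<close>. The left side is symmetric in \<open>u\<close>
  and \<open>v\<close>, and this symmetry carries over to the mixed derivatives in the
  limit.\<close>

lemma second_difference:
  fixes f :: "r8 \<Rightarrow> real"
  assumes W: "ball x r \<subseteq> W" and f: "smooth_on W f" and h: "0 < h" "h * (norm u + norm v) < r"
  shows "\<exists>y\<in>ball x r. f (x + h *\<^sub>R u + h *\<^sub>R v) - f (x + h *\<^sub>R u) - f (x + h *\<^sub>R v) + f x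
     = h * (h * fd (\<lambda>y. fd f y u) y v)"
proof -
  have in_ball: "x + s *\<^sub>R u + t *\<^sub>R v \<in> ball x r" if "0 \<le> s" "s \<le> h" "0 \<le> t" "t \<le> h" for s t
  proof -
    have "norm (s *\<^sub>R u + t *\<^sub>R v) \<le> s * norm u + t * norm v"
      using that by (intro norm_triangle_le) auto
    also have "\<dots> \<le> h * norm u + h * norm v"
      using that by (intro add_mono mult_right_mono) auto
    finally show ?thesis
      using h by (simp add: dist_norm algebra_simps norm_minus_commute)
  qed
  have d1: "f differentiable (at y)" "(\<lambda>y. fd f y u) differentiable (at y)" if "y \<in> ball x r" for y
    using that W smooth_on_differentiable[OF f] smooth_on_differentiable[OF smooth_on_fd[OF f]] by auto
  have "\<exists>z>0. z < h \<and> (f ((x + h *\<^sub>R v) + h *\<^sub>R u) - f (x + h *\<^sub>R u)) - (f ((x + h *\<^sub>R v) + 0 *\<^sub>R u) - f (x + 0 *\<^sub>R u))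
     = (h - 0) * (fd f ((x + h *\<^sub>R v) + z *\<^sub>R u) u - fd f (x + z *\<^sub>R u) u)"
  proof (rule MVT2[OF h(1)])
    fix s :: real assume "0 \<le> s" "s \<le> h"
    then show "((\<lambda>s. f ((x + h *\<^sub>R v) + s *\<^sub>R u) - f (x + s *\<^sub>R u)) has_real_derivative
        fd f ((x + h *\<^sub>R v) + s *\<^sub>R u) u - fd f (x + s *\<^sub>R u) u) (at s)"
      using in_ball[of s h] in_ball[of s 0] h(1)
      by (intro DERIV_diff has_real_derivative_line d1) (auto simp: algebra_simps)
  qed
  then obtain z where z: "0 < z" "z < h"
    and 1: "f (x + h *\<^sub>R u + h *\<^sub>R v) - f (x + h *\<^sub>R u) - f (x + h *\<^sub>R v) + f x
      = h * (fd f (x + z *\<^sub>R u + h *\<^sub>R v) u - fd f (x + z *\<^sub>R u + 0 *\<^sub>R v) u)"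
    by (auto simp: algebra_simps)
  have "\<exists>t>0. t < h \<and> fd f (x + z *\<^sub>R u + h *\<^sub>R v) u - fd f (x + z *\<^sub>R u + 0 *\<^sub>R v) u
     = (h - 0) * fd (\<lambda>y. fd f y u) (x + z *\<^sub>R u + t *\<^sub>R v) v"
    using z by (intro MVT2[OF h(1)] has_real_derivative_line d1 in_ball) auto
  then obtain t where t: "0 < t" "t < h"
    and 2: "fd f (x + z *\<^sub>R u + h *\<^sub>R v) u - fd f (x + z *\<^sub>R u + 0 *\<^sub>R v) u = h * fd (\<lambda>y. fd f y u) (x + z *\<^sub>R u + t *\<^sub>R v) v"
    by auto
  show ?thesis
    using in_ball[of z t] z t 1 2 by (intro bexI[of _ "x + z *\<^sub>R u + t *\<^sub>R v"]) auto
qed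

lemma fd_fd_commute:
  fixes f :: "r8 \<Rightarrow> real"
  assumes "open W" "x \<in> W" and f: "smooth_on W f"
  shows "fd (\<lambda>y. fd f y u) x v = fd (\<lambda>y. fd f y v) x u"
proof (rule ccontr)
  let ?G = "\<lambda>u v y. fd (\<lambda>y. fd f y u) y v"
  assume ne: "?G u v x \<noteq> ?G v u x"
  define \<epsilon> where "\<epsilon> = \<bar>?G u v x - ?G v u x\<bar> / 2"
  have \<epsilon>: "\<epsilon> > 0" using ne by (simp add: \<epsilon>_def)
  have c: "continuous (at x) (?G u v)" for u v
    using smooth_on_continuous[OF smooth_on_fd[OF smooth_on_fd[OF f]]] assms(1,2)
    by (simp add: continuous_on_eq_continuous_at)
  obtain d1 where d1: "d1 > 0" "\<And>y. dist y x < d1 \<Longrightarrow> dist (?G u v y) (?G u v x) < \<epsilon>"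
    using c[of u v] \<epsilon> unfolding continuous_at_eps_delta by blast
  obtain d2 where d2: "d2 > 0" "\<And>y. dist y x < d2 \<Longrightarrow> dist (?G v u y) (?G v u x) < \<epsilon>"
    using c[of v u] \<epsilon> unfolding continuous_at_eps_delta by blast
  obtain d3 where d3: "d3 > 0" "ball x d3 \<subseteq> W"
    using assms(1,2) openE by blast
  define r where "r = min d1 (min d2 d3)"
  have r: "r > 0" "ball x r \<subseteq> W" using d1 d2 d3 by (auto simp: r_def)
  \<comment> \<open>The summand 1 keeps the denominator positive even for zero vectors and makes the
    bounds strict.\<close>
  define h where "h = r / (norm u + norm v + 1)"
  have h: "h > 0" "h * (norm u + norm v) < r" "h * (norm v + norm u) < r"
    using r(1) by (auto simp: h_def field_simps add_nonneg_pos add_pos_nonneg)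
  obtain y where y: "y \<in> ball x r" "f (x + h *\<^sub>R u + h *\<^sub>R v) - f (x + h *\<^sub>R u) - f (x + h *\<^sub>R v) + f x
     = h * (h * ?G u v y)"
    using second_difference[OF r(2) f h(1,2)] by blast
  obtain z where z: "z \<in> ball x r" "f (x + h *\<^sub>R v + h *\<^sub>R u) - f (x + h *\<^sub>R v) - f (x + h *\<^sub>R u) + f x
     = h * (h * ?G v u z)"
    using second_difference[OF r(2) f h(1,3)] by blast
  have "h * (h * ?G u v y) = h * (h * ?G v u z)"
    using y(2) z(2) by (simp add: algebra_simps)
  then have "?G u v y = ?G v u z" using h(1) by simp
  moreover have "dist (?G u v y) (?G u v x) < \<epsilon>"
    using y(1) by (intro d1(2)) (simp add: r_def dist_commute)
  moreover have "dist (?G v u z) (?G v u x) < \<epsilon>"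
    using z(1) by (intro d2(2)) (simp add: r_def dist_commute)
  ultimately have "\<bar>?G u v x - ?G v u x\<bar> < \<epsilon> + \<epsilon>"
    unfolding dist_real_def by linarith
  then show False
    by (simp add: \<epsilon>_def)
qed

subsection \<open>Tensor fields and covariant derivatives\<close>
definition multilinear :: "nat \<Rightarrow> tensor \<Rightarrow> bool" where
  "multilinear n \<alpha> \<longleftrightarrow> (\<forall>vs i. length vs = n \<longrightarrow> i < n \<longrightarrow> linear (\<lambda>v. \<alpha> (vs[i := v])))"

definition tensor_field :: "r8 set \<Rightarrow> nat \<Rightarrow> local_field \<Rightarrow> bool" where
  "tensor_field W n \<omega> \<longleftrightarrow> (\<forall>x\<in>W. multilinear n (\<omega> x)) \<and> (\<forall>vs. length vs = n \<longrightarrow> smooth_on W (\<lambda>x. \<omega> x vs))"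

definition smooth_connection :: "r8 set \<Rightarrow> local_connection \<Rightarrow> bool" where
  "smooth_connection W \<Gamma> \<longleftrightarrow> (\<forall>x\<in>W. (\<forall>v. linear (\<lambda>u. \<Gamma> x u v)) \<and> (\<forall>u. linear (\<Gamma> x u))) \<and>
     (\<forall>u v. smooth_on W (\<lambda>x. \<Gamma> x u v))"

lemma linear_expand_axis:
  fixes f :: "r8 \<Rightarrow> 'b::real_vector"
  assumes "linear f"
  shows "f v = (\<Sum>k\<in>UNIV. v $ k *\<^sub>R f (axis k 1))"
proof -
  have "f v = f (\<Sum>k\<in>UNIV. v $ k *\<^sub>R axis k 1)"
    by (subst basis_expansion[of v, symmetric]) (simp add: scalar_mult_eq_scaleR)
  also have "\<dots> = (\<Sum>k\<in>UNIV. v $ k *\<^sub>R f (axis k 1))"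
    using assms by (simp add: linear_sum linear_scale)
  finally show ?thesis .
qed

lemma multilinearD: "multilinear n \<alpha> \<Longrightarrow> length vs = n \<Longrightarrow> i < n \<Longrightarrow> linear (\<lambda>v. \<alpha> (vs[i := v]))"
  by (simp add: multilinear_def)

lemma tensor_fieldD:
  assumes "tensor_field W n \<omega>"
  shows "x \<in> W \<Longrightarrow> multilinear n (\<omega> x)" "length vs = n \<Longrightarrow> smooth_on W (\<lambda>x. \<omega> x vs)"
  using assms by (simp_all add: tensor_field_def)

context
  fixes W :: "r8 set"
  assumes W: "open W"
begin

lemma smooth_on_slot:
  assumes \<omega>: "tensor_field W n \<omega>" and vs: "length vs = n" "i < n" and f: "smooth_on W f"
  shows "smooth_on W (\<lambda>y. \<omega> y (vs[i := f y]))"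
proof -
  have "smooth_on W (\<lambda>y. \<Sum>k\<in>UNIV. f y $ k * \<omega> y (vs[i := axis k 1]))"
    using vs by (intro smooth_on_sum[OF W] smooth_on_mult[OF W] smooth_on_nth[OF W f] tensor_fieldD(2)[OF \<omega>]) simp
  then show ?thesis
    by (rule smooth_on_cong[OF W, THEN iffD1, rotated])
      (simp add: linear_expand_axis[OF multilinearD[OF tensor_fieldD(1)[OF \<omega>] vs], symmetric, simplified])
qed

text \<open>Expanding the varying argument in the standard basis reduces the claim to the product
  rule for scalar functions.\<close>

lemma has_derivative_slot:
  assumes \<omega>: "tensor_field W n \<omega>" and vs: "length vs = n" "i < n" and x: "x \<in> W" and f: "f differentiable (at x)"
  shows "((\<lambda>y. \<omega> y (vs[i := f y])) has_derivative
    (\<lambda>v. fd (\<lambda>y. \<omega> y (vs[i := f x])) x v + \<omega> x (vs[i := fd f x v]))) (at x)"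
proof -
  have ex: "(\<Sum>k\<in>UNIV. v $ k * \<omega> y (vs[i := axis k 1])) = \<omega> y (vs[i := v])" if "y \<in> W" for y v
    using linear_expand_axis[OF multilinearD[OF tensor_fieldD(1)[OF \<omega> that] vs], of v] by simp
  have d: "((\<lambda>y. \<omega> y (vs[i := axis k 1])) has_derivative fd (\<lambda>y. \<omega> y (vs[i := axis k 1])) x) (at x)" for k
    using vs by (intro has_derivative_fd smooth_on_differentiable[OF tensor_fieldD(2)[OF \<omega>] x]) simp
  have 1: "((\<lambda>y. \<Sum>k\<in>UNIV. f y $ k * \<omega> y (vs[i := axis k 1])) has_derivative
     (\<lambda>v. \<Sum>k\<in>UNIV. f x $ k * fd (\<lambda>y. \<omega> y (vs[i := axis k 1])) x v + fd f x v $ k * \<omega> x (vs[i := axis k 1]))) (at x)"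
    by (intro has_derivative_sum has_derivative_mult fd_nth f d)
  have "((\<lambda>y. \<Sum>k\<in>UNIV. f x $ k * \<omega> y (vs[i := axis k 1])) has_derivative
     (\<lambda>v. \<Sum>k\<in>UNIV. f x $ k * fd (\<lambda>y. \<omega> y (vs[i := axis k 1])) x v)) (at x)"
    by (intro has_derivative_sum has_derivative_mult_right d)
  then have "((\<lambda>y. \<omega> y (vs[i := f x])) has_derivative
     (\<lambda>v. \<Sum>k\<in>UNIV. f x $ k * fd (\<lambda>y. \<omega> y (vs[i := axis k 1])) x v)) (at x)"
    by (rule has_derivative_transform_within_open[OF _ W x]) (rule ex)
  then have 2: "fd (\<lambda>y. \<omega> y (vs[i := f x])) x v = (\<Sum>k\<in>UNIV. f x $ k * fd (\<lambda>y. \<omega> y (vs[i := axis k 1])) x v)" for v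
    by (rule fd_eqI)
  have "((\<lambda>y. \<omega> y (vs[i := f y])) has_derivative
     (\<lambda>v. \<Sum>k\<in>UNIV. f x $ k * fd (\<lambda>y. \<omega> y (vs[i := axis k 1])) x v + fd f x v $ k * \<omega> x (vs[i := axis k 1]))) (at x)"
    by (rule has_derivative_transform_within_open[OF 1 W x]) (rule ex)
  then show ?thesis
    by (simp add: 2 sum.distrib ex[OF x])
qed

text \<open>\<open>us\<close> holds arguments already replaced by constant vectors, so that the
  induction can treat the varying arguments one at a time.\<close>

lemma has_derivative_slots:
  assumes \<omega>: "tensor_field W (length us + length fs) \<omega>" and x: "x \<in> W"
    and f: "\<And>f. f \<in> set fs \<Longrightarrow> f differentiable (at x)"
  shows "((\<lambda>y. \<omega> y (us @ map (\<lambda>f. f y) fs)) has_derivative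
    (\<lambda>v. fd (\<lambda>y. \<omega> y (us @ map (\<lambda>f. f x) fs)) x v
      + (\<Sum>i<length fs. \<omega> x (us @ (map (\<lambda>f. f x) fs)[i := fd (fs ! i) x v])))) (at x)"
  using \<omega> f
proof (induction fs arbitrary: us)
  case Nil
  then show ?case
    using smooth_on_differentiable[OF tensor_fieldD(2)[OF Nil(1), of us] x] by (simp add: has_derivative_fd)
next
  case (Cons f fs)
  let ?n = "length us + length (f # fs)"
  note \<omega> = Cons.prems(1)
  let ?vs = "\<lambda>y. map (\<lambda>f. f y) fs"
  have df: "f differentiable (at x)" using Cons.prems by simp
  have ex: "(\<Sum>k\<in>UNIV. v $ k * \<omega> y (us @ axis k 1 # ws)) = \<omega> y (us @ v # ws)" if "y \<in> W" "length ws = length fs" for y v ws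
    using linear_expand_axis[OF multilinearD[OF tensor_fieldD(1)[OF \<omega> that(1)], of "us @ 0 # ws" "length us"], of v] that by simp
  let ?D = "\<lambda>k v. fd (\<lambda>y. \<omega> y (us @ axis k 1 # ?vs x)) x v
      + (\<Sum>i<length fs. \<omega> x (us @ axis k 1 # (?vs x)[i := fd (fs ! i) x v]))"
  have d: "((\<lambda>y. \<omega> y (us @ axis k 1 # ?vs y)) has_derivative ?D k) (at x)" for k
    using Cons.IH[of "us @ [axis k 1]"] Cons.prems by simp
  have 1: "((\<lambda>y. \<Sum>k\<in>UNIV. f y $ k * \<omega> y (us @ axis k 1 # ?vs y)) has_derivative
     (\<lambda>v. \<Sum>k\<in>UNIV. f x $ k * ?D k v + fd f x v $ k * \<omega> x (us @ axis k 1 # ?vs x))) (at x)"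
    by (intro has_derivative_sum has_derivative_mult fd_nth df d)
  have "((\<lambda>y. \<Sum>k\<in>UNIV. f x $ k * \<omega> y (us @ axis k 1 # ?vs x)) has_derivative
     (\<lambda>v. \<Sum>k\<in>UNIV. f x $ k * fd (\<lambda>y. \<omega> y (us @ axis k 1 # ?vs x)) x v)) (at x)"
    by (intro has_derivative_sum has_derivative_mult_right has_derivative_fd
        smooth_on_differentiable[OF tensor_fieldD(2)[OF \<omega>] x]) simp
  then have "((\<lambda>y. \<omega> y (us @ f x # ?vs x)) has_derivative
     (\<lambda>v. \<Sum>k\<in>UNIV. f x $ k * fd (\<lambda>y. \<omega> y (us @ axis k 1 # ?vs x)) x v)) (at x)"
    by (rule has_derivative_transform_within_open[OF _ W x]) (simp add: ex)
  then have 2: "fd (\<lambda>y. \<omega> y (us @ f x # ?vs x)) x v = (\<Sum>k\<in>UNIV. f x $ k * fd (\<lambda>y. \<omega> y (us @ axis k 1 # ?vs x)) x v)" for v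
    by (rule fd_eqI)
  have 3: "((\<lambda>y. \<omega> y (us @ f y # ?vs y)) has_derivative
     (\<lambda>v. \<Sum>k\<in>UNIV. f x $ k * ?D k v + fd f x v $ k * \<omega> x (us @ axis k 1 # ?vs x))) (at x)"
    by (rule has_derivative_transform_within_open[OF 1 W x]) (simp add: ex)
  have 4: "(\<Sum>k\<in>UNIV. f x $ k * (\<Sum>i<length fs. \<omega> x (us @ axis k 1 # (?vs x)[i := fd (fs ! i) x v])))
     = (\<Sum>i<length fs. \<omega> x (us @ f x # (?vs x)[i := fd (fs ! i) x v]))" for v
    unfolding sum_distrib_left by (subst sum.swap) (simp add: ex[OF x])
  show ?case
    using 3 by (simp add: distrib_left sum.distrib 4 ex[OF x] 2[symmetric] sum.lessThan_Suc_shift add.commute add.left_commute del: sum.lessThan_Suc)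
qed

end

lemma nabla_Cons: "nabla \<Gamma> \<omega> x (u # vs) = fd (\<lambda>y. \<omega> y vs) x u - (\<Sum>i<length vs. \<omega> x (vs[i := \<Gamma> x u (vs ! i)]))"
  by (simp add: nabla_def cov_def Let_def)

section \<open>Curvature and torsion operators; the Ricci and Bianchi identities\<close>

definition curv_op :: "local_connection \<Rightarrow> r8 \<Rightarrow> r8 \<Rightarrow> r8 \<Rightarrow> r8 \<Rightarrow> r8" where
  "curv_op \<Gamma> x u v z = fd (\<lambda>y. \<Gamma> y v z) x u + \<Gamma> x u (\<Gamma> x v z) - fd (\<lambda>y. \<Gamma> y u z) x v - \<Gamma> x v (\<Gamma> x u z)"

definition tor :: "local_connection \<Rightarrow> r8 \<Rightarrow> r8 \<Rightarrow> r8 \<Rightarrow> r8" where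
  "tor \<Gamma> x u v = \<Gamma> x u v - \<Gamma> x v u"

lemma torsion_eq: "torsion g \<Gamma> x [u, v, z] = g x [tor \<Gamma> x u v, z]"
  by (simp add: torsion_def cov_def lie_bracket_def Let_def tor_def)

lemma smooth_connectionD:
  assumes "smooth_connection W \<Gamma>"
  shows "x \<in> W \<Longrightarrow> linear (\<lambda>u. \<Gamma> x u v)" "x \<in> W \<Longrightarrow> linear (\<Gamma> x u)" "smooth_on W (\<lambda>x. \<Gamma> x u v)"
  using assms by (simp_all add: smooth_connection_def)

lemma curvature_eq:
  assumes "smooth_connection W \<Gamma>" "x \<in> W"
  shows "curvature g \<Gamma> x [u, v, z, a] = g x [curv_op \<Gamma> x u v z, a]"
proof -
  have "\<Gamma> x 0 z = 0"
    using linear_0[OF smooth_connectionD(1)[OF assms]] .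
  then show ?thesis
    by (simp add: curvature_def cov_def lie_bracket_def Let_def curv_op_def algebra_simps)
qed

lemma multilinear_add:
  assumes "multilinear n \<alpha>" "length vs = n" "i < n"
  shows "\<alpha> (vs[i := a + b]) = \<alpha> (vs[i := a]) + \<alpha> (vs[i := b])"
    "\<alpha> (vs[i := a - b]) = \<alpha> (vs[i := a]) - \<alpha> (vs[i := b])"
  using linear_add[OF multilinearD[OF assms]] linear_diff[OF multilinearD[OF assms]] by auto

lemma linear_fd_slot:
  assumes W: "open W" and \<omega>: "tensor_field W n \<omega>" and x: "x \<in> W" and vs: "length vs = n" and i: "i < n"
  shows "linear (\<lambda>v. fd (\<lambda>y. \<omega> y (vs[i := v])) x u)"
proof
  fix a b and r :: real
  have d: "(\<lambda>y. \<omega> y (vs[i := v])) differentiable (at x)" for v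
    using vs by (intro smooth_on_differentiable[OF tensor_fieldD(2)[OF \<omega>] x]) simp
  have "fd (\<lambda>y. \<omega> y (vs[i := a + b])) x u = fd (\<lambda>y. \<omega> y (vs[i := a]) + \<omega> y (vs[i := b])) x u"
    by (subst fd_cong[OF W x, of _ "\<lambda>y. \<omega> y (vs[i := a]) + \<omega> y (vs[i := b])"])
      (simp_all add: multilinear_add[OF tensor_fieldD(1)[OF \<omega>] vs i])
  then show "fd (\<lambda>y. \<omega> y (vs[i := a + b])) x u = fd (\<lambda>y. \<omega> y (vs[i := a])) x u + fd (\<lambda>y. \<omega> y (vs[i := b])) x u"
    by (simp add: fd_eqI[OF has_derivative_add[OF has_derivative_fd[OF d] has_derivative_fd[OF d]]])
  have "fd (\<lambda>y. \<omega> y (vs[i := r *\<^sub>R a])) x u = fd (\<lambda>y. r *\<^sub>R \<omega> y (vs[i := a])) x u"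
    using linear_scale[OF multilinearD[OF tensor_fieldD(1)[OF \<omega>] vs i]]
    by (subst fd_cong[OF W x, of _ "\<lambda>y. r *\<^sub>R \<omega> y (vs[i := a])"]) simp_all
  then show "fd (\<lambda>y. \<omega> y (vs[i := r *\<^sub>R a])) x u = r *\<^sub>R fd (\<lambda>y. \<omega> y (vs[i := a])) x u"
    by (simp add: fd_eqI[OF has_derivative_mult_right[OF has_derivative_fd[OF d]]])
qed

context
  fixes W :: "r8 set" and \<Gamma> :: local_connection
  assumes W: "open W" and \<Gamma>: "smooth_connection W \<Gamma>"
begin

lemma tensor_field_nabla:
  assumes \<omega>: "tensor_field W n \<omega>"
  shows "tensor_field W (Suc n) (nabla \<Gamma> \<omega>)"
  unfolding tensor_field_def
proof (intro conjI ballI allI impI)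
  fix ws :: "r8 list" assume "length ws = Suc n"
  then obtain u vs where ws: "ws = u # vs" "length vs = n"
    by (cases ws) auto
  show "smooth_on W (\<lambda>x. nabla \<Gamma> \<omega> x ws)"
    unfolding ws(1) nabla_Cons
    using ws(2) by (intro smooth_on_diff[OF W] smooth_on_sum[OF W] smooth_on_fd tensor_fieldD(2)[OF \<omega>]
        smooth_on_slot[OF W \<omega>] smooth_connectionD(3)[OF \<Gamma>]) auto
next
  fix x assume x: "x \<in> W"
  note lin = multilinearD[OF tensor_fieldD(1)[OF \<omega> x]]
  show "multilinear (Suc n) (nabla \<Gamma> \<omega> x)"
    unfolding multilinear_def
  proof (intro allI impI)
    fix ws :: "r8 list" and j assume "length ws = Suc n" and j: "j < Suc n"
    then obtain u vs where ws: "ws = u # vs" "length vs = n"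
      by (cases ws) auto
    show "linear (\<lambda>v. nabla \<Gamma> \<omega> x (ws[j := v]))"
    proof (cases j)
      case 0
      have "linear (fd (\<lambda>y. \<omega> y vs) x)"
        by (intro linear_frechet_derivative smooth_on_differentiable[OF tensor_fieldD(2)[OF \<omega>] x] ws)
      moreover have "linear (\<lambda>v. \<omega> x (vs[i := \<Gamma> x v (vs ! i)]))" if "i < n" for i
        using linear_compose[OF smooth_connectionD(1)[OF \<Gamma> x] lin[OF ws(2) that]] by (simp add: o_def)
      ultimately show ?thesis
        using ws(2) by (simp add: ws(1) 0 nabla_Cons linear_compose_sub linear_compose_sum)
    next
      case (Suc i)
      with j have i: "i < n" by simp
      have 1: "linear (\<lambda>v. fd (\<lambda>y. \<omega> y (vs[i := v])) x u)"
        by (rule linear_fd_slot[OF W \<omega> x ws(2) i])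
      have 2: "linear (\<lambda>v. \<omega> x (vs[i := v, k := \<Gamma> x u (vs[i := v] ! k)]))" if "k < n" for k
      proof (cases "k = i")
        case True
        then show ?thesis
          using linear_compose[OF smooth_connectionD(2)[OF \<Gamma> x] lin[OF ws(2) i]] ws(2) i by (simp add: o_def)
      next
        case False
        then show ?thesis
          using lin[of "vs[k := \<Gamma> x u (vs ! k)]" i] ws(2) i by (simp add: list_update_swap[of i k])
      qed
      show ?thesis
        using 1 2 ws(2) by (simp add: ws(1) Suc nabla_Cons linear_compose_sub linear_compose_sum)
    qed
  qed
qed

lemma nabla_nabla:
  assumes \<omega>: "tensor_field W n \<omega>" and x: "x \<in> W" and vs: "length vs = n"
  shows "nabla \<Gamma> (nabla \<Gamma> \<omega>) x (p # q # vs) = fd (\<lambda>y. fd (\<lambda>z. \<omega> z vs) y q) x p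
    - (\<Sum>i<n. fd (\<lambda>y. \<omega> y (vs[i := \<Gamma> x q (vs ! i)])) x p) - (\<Sum>i<n. fd (\<lambda>y. \<omega> y (vs[i := \<Gamma> x p (vs ! i)])) x q)
    - (\<Sum>i<n. \<omega> x (vs[i := fd (\<lambda>y. \<Gamma> y q (vs ! i)) x p])) - nabla \<Gamma> \<omega> x (\<Gamma> x p q # vs)
    + (\<Sum>j<n. \<Sum>i<n. \<omega> x (vs[j := \<Gamma> x p (vs ! j), i := \<Gamma> x q (vs[j := \<Gamma> x p (vs ! j)] ! i)]))"
proof -
  have "((\<lambda>y. nabla \<Gamma> \<omega> y (q # vs)) has_derivative (\<lambda>p. fd (\<lambda>y. fd (\<lambda>z. \<omega> z vs) y q) x p
      - (\<Sum>i<length vs. fd (\<lambda>y. \<omega> y (vs[i := \<Gamma> x q (vs ! i)])) x p + \<omega> x (vs[i := fd (\<lambda>y. \<Gamma> y q (vs ! i)) x p])))) (at x)"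
    unfolding nabla_Cons
    using vs by (intro has_derivative_diff has_derivative_sum has_derivative_slot[OF W \<omega> _ _ x] has_derivative_fd
        smooth_on_differentiable[OF smooth_on_fd[OF tensor_fieldD(2)[OF \<omega>]] x]
        smooth_on_differentiable[OF smooth_connectionD(3)[OF \<Gamma>] x]) auto
  then have "fd (\<lambda>y. nabla \<Gamma> \<omega> y (q # vs)) x p = fd (\<lambda>y. fd (\<lambda>z. \<omega> z vs) y q) x p
      - (\<Sum>i<n. fd (\<lambda>y. \<omega> y (vs[i := \<Gamma> x q (vs ! i)])) x p) - (\<Sum>i<n. \<omega> x (vs[i := fd (\<lambda>y. \<Gamma> y q (vs ! i)) x p]))"
    using vs by (simp add: fd_eqI sum.distrib)
  then show ?thesis
    unfolding nabla_Cons[of \<Gamma> "nabla \<Gamma> \<omega>"]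
    using vs by (simp add: sum.lessThan_Suc_shift nabla_Cons[of _ _ _ q] sum_subtractf del: sum.lessThan_Suc)
qed

lemma ricci_identity:
  assumes \<omega>: "tensor_field W n \<omega>" and x: "x \<in> W" and vs: "length vs = n"
  shows "nabla \<Gamma> (nabla \<Gamma> \<omega>) x (p # q # vs) - nabla \<Gamma> (nabla \<Gamma> \<omega>) x (q # p # vs)
    = - (\<Sum>i<n. \<omega> x (vs[i := curv_op \<Gamma> x p q (vs ! i)])) - nabla \<Gamma> \<omega> x (tor \<Gamma> x p q # vs)"
proof -
  \<comment> \<open>The connection acting in two different slots is symmetric in \<open>p\<close>
    and \<open>q\<close> and cancels. What remains acts twice in one slot and, with the derivatives
    of \<open>\<Gamma>\<close>, makes up the curvature.\<close>
  define c where "c p q = (\<Sum>j<n. \<Sum>i<n. if i = j then 0 else \<omega> x (vs[j := \<Gamma> x p (vs ! j), i := \<Gamma> x q (vs ! i)]))" for p q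
  have c: "c p q = c q p" for p q
    unfolding c_def by (subst sum.swap, intro sum.cong refl) (auto simp: list_update_swap)
  have d: "(\<Sum>j<n. \<Sum>i<n. \<omega> x (vs[j := \<Gamma> x p (vs ! j), i := \<Gamma> x q (vs[j := \<Gamma> x p (vs ! j)] ! i)]))
     = c p q + (\<Sum>j<n. \<omega> x (vs[j := \<Gamma> x q (\<Gamma> x p (vs ! j))]))" for p q
    unfolding c_def sum.distrib[symmetric]
  proof (rule sum.cong[OF refl])
    fix j assume "j \<in> {..<n}"
    then have j: "j < n" by simp
    have "(\<Sum>i<n. \<omega> x (vs[j := \<Gamma> x p (vs ! j), i := \<Gamma> x q (vs[j := \<Gamma> x p (vs ! j)] ! i)]))
       = (\<Sum>i<n. (if i = j then 0 else \<omega> x (vs[j := \<Gamma> x p (vs ! j), i := \<Gamma> x q (vs ! i)]))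
           + (if i = j then \<omega> x (vs[j := \<Gamma> x q (\<Gamma> x p (vs ! j))]) else 0))"
      using j vs by (intro sum.cong) auto
    then show "(\<Sum>i<n. \<omega> x (vs[j := \<Gamma> x p (vs ! j), i := \<Gamma> x q (vs[j := \<Gamma> x p (vs ! j)] ! i)]))
       = (\<Sum>i<n. if i = j then 0 else \<omega> x (vs[j := \<Gamma> x p (vs ! j), i := \<Gamma> x q (vs ! i)]))
           + \<omega> x (vs[j := \<Gamma> x q (\<Gamma> x p (vs ! j))])"
      using j by (simp add: sum.distrib)
  qed
  have s: "fd (\<lambda>y. fd (\<lambda>z. \<omega> z vs) y q) x p = fd (\<lambda>y. fd (\<lambda>z. \<omega> z vs) y p) x q"
    by (rule fd_fd_commute[OF W x tensor_fieldD(2)[OF \<omega> vs]])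
  have r: "(\<Sum>i<n. \<omega> x (vs[i := curv_op \<Gamma> x p q (vs ! i)]))
    = (\<Sum>i<n. \<omega> x (vs[i := fd (\<lambda>y. \<Gamma> y q (vs ! i)) x p])) + (\<Sum>i<n. \<omega> x (vs[i := \<Gamma> x p (\<Gamma> x q (vs ! i))]))
    - (\<Sum>i<n. \<omega> x (vs[i := fd (\<lambda>y. \<Gamma> y p (vs ! i)) x q])) - (\<Sum>i<n. \<omega> x (vs[i := \<Gamma> x q (\<Gamma> x p (vs ! i))]))"
    by (simp add: curv_op_def multilinear_add[OF tensor_fieldD(1)[OF \<omega> x] vs] sum.distrib sum_subtractf)
  have t: "nabla \<Gamma> \<omega> x (tor \<Gamma> x p q # vs) = nabla \<Gamma> \<omega> x (\<Gamma> x p q # vs) - nabla \<Gamma> \<omega> x (\<Gamma> x q p # vs)"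
    using multilinear_add(2)[OF tensor_fieldD(1)[OF tensor_field_nabla[OF \<omega>] x], of "0 # vs" 0] vs by (simp add: tor_def)
  show ?thesis
    unfolding nabla_nabla[OF assms] d s r t c[of p q] by simp
qed

text \<open>As \<open>g\<close> is parallel, the covariant derivative passes through it to the
  vector-valued torsion.\<close>

lemma nabla_torsion:
  assumes g: "tensor_field W 2 g" and par: "\<And>u v z. nabla \<Gamma> g x [u, v, z] = 0" and x: "x \<in> W"
  shows "nabla \<Gamma> (torsion g \<Gamma>) x [a, u, v, z] = g x [fd (\<lambda>y. tor \<Gamma> y u v) x a + \<Gamma> x a (tor \<Gamma> x u v)
     - tor \<Gamma> x (\<Gamma> x a u) v - tor \<Gamma> x u (\<Gamma> x a v), z]"
proof -
  have d: "(\<lambda>y. tor \<Gamma> y u v) differentiable (at x)"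
    unfolding tor_def by (intro differentiable_diff smooth_on_differentiable[OF smooth_connectionD(3)[OF \<Gamma>] x])
  have "fd (\<lambda>y. g y [tor \<Gamma> y u v, z]) x a = fd (\<lambda>y. g y [tor \<Gamma> x u v, z]) x a + g x [fd (\<lambda>y. tor \<Gamma> y u v) x a, z]"
    using fd_eqI[OF has_derivative_slot[OF W g _ _ x d, of "[0, z]" 0], of a] by simp
  also have "fd (\<lambda>y. g y [tor \<Gamma> x u v, z]) x a = g x [\<Gamma> x a (tor \<Gamma> x u v), z] + g x [tor \<Gamma> x u v, \<Gamma> x a z]"
    using par[of a "tor \<Gamma> x u v" z] by (simp add: nabla_Cons lessThan_Suc)
  finally show ?thesis
    using multilinear_add[OF tensor_fieldD(1)[OF g x], of "[0, z]" 0]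
    by (simp add: nabla_Cons torsion_eq lessThan_Suc numeral_3_eq_3 numeral_2_eq_2)
qed

lemma first_bianchi:
  assumes g: "tensor_field W 2 g" and par: "\<And>u v z. nabla \<Gamma> g x [u, v, z] = 0" and x: "x \<in> W"
  defines "R \<equiv> curvature g \<Gamma> x" and "D \<equiv> nabla \<Gamma> (torsion g \<Gamma>) x" and "T \<equiv> torsion g \<Gamma> x"
  shows "R [u, v, z, a] + R [v, z, u, a] + R [z, u, v, a] = D [u, v, z, a] + D [v, z, u, a] + D [z, u, v, a]
     + T [tor \<Gamma> x u v, z, a] + T [tor \<Gamma> x v z, u, a] + T [tor \<Gamma> x z u, v, a]"
proof -
  have df: "fd (\<lambda>y. tor \<Gamma> y u v) x w = fd (\<lambda>y. \<Gamma> y u v) x w - fd (\<lambda>y. \<Gamma> y v u) x w" for u v w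
    unfolding tor_def by (intro fd_eqI has_derivative_diff has_derivative_fd smooth_on_differentiable[OF smooth_connectionD(3)[OF \<Gamma>] x])
  note l = linear_diff[OF smooth_connectionD(1)[OF \<Gamma> x]] linear_diff[OF smooth_connectionD(2)[OF \<Gamma> x]]
  let ?t = "\<lambda>a u v. fd (\<lambda>y. tor \<Gamma> y u v) x a + \<Gamma> x a (tor \<Gamma> x u v) - tor \<Gamma> x (\<Gamma> x a u) v - tor \<Gamma> x u (\<Gamma> x a v)"
  \<comment> \<open>At the level of vectors this is an identity for any connection; the metric
    enters afterwards, to lower the last index.\<close>
  have "curv_op \<Gamma> x u v z + curv_op \<Gamma> x v z u + curv_op \<Gamma> x z u v = ?t u v z + ?t v z u + ?t z u v
     + tor \<Gamma> x (tor \<Gamma> x u v) z + tor \<Gamma> x (tor \<Gamma> x v z) u + tor \<Gamma> x (tor \<Gamma> x z u) v"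
    unfolding df curv_op_def by (simp add: tor_def l algebra_simps)
  then have "g x [curv_op \<Gamma> x u v z + curv_op \<Gamma> x v z u + curv_op \<Gamma> x z u v, a] = g x [?t u v z + ?t v z u + ?t z u v
     + tor \<Gamma> x (tor \<Gamma> x u v) z + tor \<Gamma> x (tor \<Gamma> x v z) u + tor \<Gamma> x (tor \<Gamma> x z u) v, a]"
    by simp
  then show ?thesis
    unfolding R_def D_def T_def curvature_eq[OF \<Gamma> x] torsion_eq nabla_torsion[OF g par x]
    using multilinear_add(1)[OF tensor_fieldD(1)[OF g x], of "[0, a]" 0] by simp
qed

end

subsection \<open>Adapted frames\<close>
lemma is_form_multilinear: "is_form k \<alpha> \<Longrightarrow> multilinear k \<alpha>"
  by (simp add: is_form_def multilinear_def)

lemma is_form_eq_0: "is_form k \<alpha> \<Longrightarrow> length vs = k \<Longrightarrow> i < j \<Longrightarrow> j < k \<Longrightarrow> vs ! i = vs ! j \<Longrightarrow> \<alpha> vs = 0"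
  by (simp add: is_form_def)

lemma is_form_swap:
  assumes \<alpha>: "is_form k \<alpha>" and "length vs = k" "i < j" "j < k"
  shows "\<alpha> (vs[i := b, j := a]) = - \<alpha> (vs[i := a, j := b])"
proof -
  let ?f = "\<lambda>a b. \<alpha> (vs[i := a, j := b])"
  have 0: "?f a a = 0" for a
    using assms by (intro is_form_eq_0[OF \<alpha>, of _ i j]) auto
  have l: "?f a (b + c) = ?f a b + ?f a c" "?f (a + b) c = ?f a c + ?f b c" for a b c
    using multilinear_add(1)[OF is_form_multilinear[OF \<alpha>], of "vs[i := a]" j]
      multilinear_add(1)[OF is_form_multilinear[OF \<alpha>], of "vs[j := c]" i] assms
    by (auto simp: list_update_swap[of i j])
  have "0 = ?f (a + b) (a + b)" using 0 by simp
  also have "\<dots> = ?f a a + ?f a b + (?f b a + ?f b b)"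
    by (simp only: l)
  finally show ?thesis using 0 by simp
qed

lemma is_form_nabla:
  assumes W: "open W" and \<Gamma>: "smooth_connection W \<Gamma>" and \<omega>: "tensor_field W n \<omega>"
    and form: "\<And>y. y \<in> W \<Longrightarrow> is_form n (\<omega> y)" and x: "x \<in> W"
  shows "is_form n (\<lambda>vs. nabla \<Gamma> \<omega> x (u # vs))"
  unfolding is_form_def
proof (intro conjI allI impI)
  fix vs :: "r8 list" and i assume "length vs = n" "i < n"
  then show "linear (\<lambda>v. nabla \<Gamma> \<omega> x (u # vs[i := v]))"
    using multilinearD[OF tensor_fieldD(1)[OF tensor_field_nabla[OF W \<Gamma> \<omega>] x], of "u # vs" "Suc i"] by simp
next
  fix vs :: "r8 list" and i j assume vs: "length vs = n" and ij: "i < j" "j < n" and eq: "vs ! i = vs ! j"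
  have "fd (\<lambda>y. \<omega> y vs) x = fd (\<lambda>y. 0) x"
    by (rule fd_cong[OF W x]) (rule is_form_eq_0[OF form vs ij eq])
  then have 1: "fd (\<lambda>y. \<omega> y vs) x u = 0" by simp
  \<comment> \<open>With equal arguments at \<open>i\<close> and \<open>j\<close>, a term survives
    only if the connection acts on one of these two slots, and the two survivors cancel by
    skewness.\<close>
  have "(\<Sum>k<n. \<omega> x (vs[k := \<Gamma> x u (vs ! k)])) = (\<Sum>k\<in>{i, j}. \<omega> x (vs[k := \<Gamma> x u (vs ! k)]))"
  proof (rule sum.mono_neutral_right)
    show "\<forall>k\<in>{..<n} - {i, j}. \<omega> x (vs[k := \<Gamma> x u (vs ! k)]) = 0"
      using vs ij eq by (intro ballI is_form_eq_0[OF form[OF x], of _ i j]) auto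
  qed (use ij in auto)
  also have "\<dots> = \<omega> x (vs[i := \<Gamma> x u (vs ! i)]) + \<omega> x (vs[j := \<Gamma> x u (vs ! i)])"
    using ij eq by simp
  also have "\<dots> = 0"
  proof -
    have "vs[i := \<Gamma> x u (vs ! i)] = vs[i := \<Gamma> x u (vs ! i), j := vs ! i]"
      "vs[j := \<Gamma> x u (vs ! i)] = vs[i := vs ! i, j := \<Gamma> x u (vs ! i)]"
      using ij vs eq by (auto simp: list_eq_iff_nth_eq nth_list_update)
    then show ?thesis
      using is_form_swap[OF form[OF x] vs ij, of "\<Gamma> x u (vs ! i)" "vs ! i"] by simp
  qed
  finally show "nabla \<Gamma> \<omega> x (u # vs) = 0"
    using vs by (simp add: nabla_Cons 1)
qed

lemma nabla_eq_0:
  assumes "open W" "x \<in> W" and "\<And>y vs. y \<in> W \<Longrightarrow> length vs = n \<Longrightarrow> \<omega> y vs = 0" and "length vs = n"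
  shows "nabla \<Gamma> \<omega> x (u # vs) = 0"
proof -
  have "fd (\<lambda>y. \<omega> y vs) x = fd (\<lambda>y. 0) x"
    by (rule fd_cong[OF assms(1,2)]) (simp add: assms)
  then show ?thesis
    by (simp add: nabla_Cons assms)
qed

lemma nabla_cong:
  assumes "open W" "x \<in> W" and "\<And>y vs. y \<in> W \<Longrightarrow> length vs = n \<Longrightarrow> \<omega> y vs = \<omega>' y vs" and "length vs = n"
  shows "nabla \<Gamma> \<omega> x (u # vs) = nabla \<Gamma> \<omega>' x (u # vs)"
proof -
  have "fd (\<lambda>y. \<omega> y vs) x = fd (\<lambda>y. \<omega>' y vs) x"
    by (rule fd_cong[OF assms(1,2)]) (simp add: assms)
  then show ?thesis
    by (simp add: nabla_Cons assms)
qed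

text \<open>The data of the theorem in one chart, over an open set that carries a smooth adapted
  coframe.\<close>

locale spin7_chart =
  fixes W :: "r8 set" and \<epsilon> :: "r8 \<Rightarrow> 8 \<Rightarrow> r8 \<Rightarrow> real" and \<Psi> g vol :: local_field and \<Gamma> :: local_connection
  assumes W: "open W"
    and \<epsilon>_smooth: "smooth_on W (\<lambda>y. \<epsilon> y i v)"
    and adapted: "y \<in> W \<Longrightarrow> adapted_coframe (\<Psi> y) (\<epsilon> y)"
    and g_eq: "y \<in> W \<Longrightarrow> g y [u, v] = (\<Sum>i\<in>UNIV. \<epsilon> y i u * \<epsilon> y i v)"
    and vol_eq: "y \<in> W \<Longrightarrow> length vs = 8 \<Longrightarrow> vol y vs = covector_wedge (map (\<epsilon> y) [0, 1, 2, 3, 4, 5, 6, 7]) vs"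
    and \<Psi>_field: "tensor_field W 4 \<Psi>"
    and \<Gamma>: "smooth_connection W \<Gamma>"
    and g_par: "y \<in> W \<Longrightarrow> nabla \<Gamma> g y [u, v, z] = 0"
    and \<Psi>_par: "y \<in> W \<Longrightarrow> length vs = 5 \<Longrightarrow> nabla \<Gamma> \<Psi> y vs = 0"
    and T_form: "y \<in> W \<Longrightarrow> is_form 3 (torsion g \<Gamma> y)"
begin

lemma \<epsilon>_linear: "y \<in> W \<Longrightarrow> linear (\<epsilon> y i)"
  using adapted by (simp add: adapted_coframe_def coframe_def)

definition coframe_matrix :: "r8 \<Rightarrow> real^8^8" where
  "coframe_matrix y = (\<chi> j k. \<epsilon> y j (axis k 1))"

text \<open>The dual frame by Cramer's rule: as a quotient of determinants its smoothness is visible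
  from the formula.\<close>

definition e :: "r8 \<Rightarrow> 8 \<Rightarrow> r8" where
  "e y i = (\<chi> k. Determinants.det (\<chi> a b. if b = k then axis i 1 $ a else coframe_matrix y $ a $ b) / Determinants.det (coframe_matrix y))"

lemma coframe_matrix_mult: "y \<in> W \<Longrightarrow> coframe_matrix y *v v = (\<chi> j. \<epsilon> y j v)"
  unfolding vec_eq_iff
proof
  fix j assume "y \<in> W"
  then show "(coframe_matrix y *v v) $ j = (\<chi> j. \<epsilon> y j v) $ j"
    using linear_expand_axis[OF \<epsilon>_linear, of y j v] by (simp add: coframe_matrix_def matrix_vector_mult_def mult.commute)
qed

lemma det_coframe_matrix: "y \<in> W \<Longrightarrow> Determinants.det (coframe_matrix y) \<noteq> 0"
proof -
  assume y: "y \<in> W"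
  have "inj ((*v) (coframe_matrix y))"
  proof (rule linear_injective_0[THEN iffD2])
    show "\<forall>x. coframe_matrix y *v x = 0 \<longrightarrow> x = 0"
      using adapted[OF y] unfolding coframe_matrix_mult[OF y]
      by (auto simp: adapted_coframe_def coframe_def vec_eq_iff)
  qed simp
  then show ?thesis
    using matrix_left_invertible_injective[of "coframe_matrix y"] invertible_left_inverse[of "coframe_matrix y"]
      invertible_det_nz[of "coframe_matrix y"] by blast
qed

lemma dual: "y \<in> W \<Longrightarrow> dual_frames (\<epsilon> y) (e y)"
proof -
  assume y: "y \<in> W"
  have "coframe_matrix y *v e y i = axis i 1" for i
    using cramer[OF det_coframe_matrix[OF y], of "e y i" "axis i 1"] by (simp add: e_def)
  then show ?thesis
    unfolding coframe_matrix_mult[OF y] by (auto simp: dual_frames_def vec_eq_iff axis_def)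
qed

lemma \<epsilon>_e: "y \<in> W \<Longrightarrow> \<epsilon> y i (e y j) = (if i = j then 1 else 0)"
  using dual by (simp add: dual_frames_def)

lemma smooth_on_det:
  assumes "\<And>i j. smooth_on W (\<lambda>y. M y $ i $ j)"
  shows "smooth_on W (\<lambda>y. Determinants.det (M y :: real^8^8))"
  unfolding Determinants.det_def by (intro smooth_on_sum smooth_on_mult smooth_on_prod smooth_on_const W assms)

lemma e_smooth: "smooth_on W (\<lambda>y. e y i $ k)"
proof -
  have 1: "smooth_on W (\<lambda>y. coframe_matrix y $ a $ b)" for a b
    by (simp add: coframe_matrix_def \<epsilon>_smooth)
  have 2: "smooth_on W (\<lambda>y. (\<chi> a b. if b = k then axis i 1 $ a else coframe_matrix y $ a $ b) $ a $ b)" for a b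
    using 1 by (cases "b = k") (simp_all add: smooth_on_const)
  show ?thesis
    unfolding e_def by (simp, intro smooth_on_divide smooth_on_det 1 2 W det_coframe_matrix)
qed

lemma e_differentiable: "y \<in> W \<Longrightarrow> (\<lambda>y. e y i) differentiable (at y)"
proof -
  assume y: "y \<in> W"
  have "((\<lambda>y. e y i) has_derivative (\<lambda>v. \<chi> k. fd (\<lambda>y. e y i $ k) y v)) (at y)"
    by (rule has_derivative_vec_nth) (simp add: has_derivative_fd smooth_on_differentiable[OF e_smooth y])
  then show ?thesis by (rule differentiableI)
qed

lemma expand: "y \<in> W \<Longrightarrow> v = (\<Sum>m\<in>UNIV. \<epsilon> y m v *\<^sub>R e y m)"
proof -
  assume y: "y \<in> W"
  have "\<epsilon> y i (v - (\<Sum>m\<in>UNIV. \<epsilon> y m v *\<^sub>R e y m)) = 0" for i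
    using \<epsilon>_linear[OF y, of i] by (simp add: linear_diff linear_sum linear_scale \<epsilon>_e[OF y] if_distrib[of "(*) _"] cong: if_cong)
  then have "v - (\<Sum>m\<in>UNIV. \<epsilon> y m v *\<^sub>R e y m) = 0"
    using adapted[OF y] unfolding adapted_coframe_def coframe_def by blast
  then show ?thesis by simp
qed

lemma g_e: "y \<in> W \<Longrightarrow> g y [u, e y i] = \<epsilon> y i u"
  by (simp add: g_eq \<epsilon>_e if_distrib[of "(*) _"] cong: if_cong)

lemma \<Psi>_e: "y \<in> W \<Longrightarrow> \<Psi> y [e y i, e y j, e y k, e y l] = psi i j k l"
  using adapted spin7_model_dual[OF dual] by (simp add: adapted_coframe_def)

lemma g_field: "tensor_field W 2 g"
  unfolding tensor_field_def multilinear_def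
proof (intro conjI ballI allI impI)
  fix vs :: "r8 list" assume "length vs = 2"
  then obtain u v where vs: "vs = [u, v]"
    by (auto simp: length_Suc_conv numeral_2_eq_2)
  have "smooth_on W (\<lambda>y. \<Sum>i\<in>UNIV. \<epsilon> y i u * \<epsilon> y i v)"
    by (intro smooth_on_sum smooth_on_mult \<epsilon>_smooth W)
  then show "smooth_on W (\<lambda>x. g x vs)"
    unfolding vs by (rule smooth_on_cong[OF W, THEN iffD1, rotated]) (simp add: g_eq)
next
  fix y and vs :: "r8 list" and i :: nat assume y: "y \<in> W" and "length vs = 2" and i: "i < 2"
  then obtain u v where vs: "vs = [u, v]"
    by (auto simp: length_Suc_conv numeral_2_eq_2)
  have "linear (\<lambda>v. c * \<epsilon> y i v)" "linear (\<lambda>v. \<epsilon> y i v * c)" for i c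
    using linear_compose_scale_right[OF \<epsilon>_linear[OF y, of i], of c] by (simp_all add: mult.commute)
  then show "linear (\<lambda>v. g y (vs[i := v]))"
    using i by (auto simp: vs g_eq[OF y] less_2_cases_iff intro!: linear_compose_sum)
qed

lemma multilinear_expand:
  assumes "y \<in> W" "multilinear n \<alpha>" "length vs = n" "i < n"
  shows "\<alpha> (vs[i := v]) = (\<Sum>m\<in>UNIV. \<epsilon> y m v * \<alpha> (vs[i := e y m]))"
proof -
  have l: "linear (\<lambda>v. \<alpha> (vs[i := v]))" by (rule multilinearD[OF assms(2-4)])
  have "\<alpha> (vs[i := v]) = \<alpha> (vs[i := \<Sum>m\<in>UNIV. \<epsilon> y m v *\<^sub>R e y m])"
    by (simp flip: expand[OF assms(1)])
  also have "\<dots> = (\<Sum>m\<in>UNIV. \<epsilon> y m v * \<alpha> (vs[i := e y m]))"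
    by (simp add: linear_sum[OF l] linear_scale[OF l])
  finally show ?thesis .
qed

lemma multilinear_eq_0:
  assumes y: "y \<in> W" and "multilinear n \<alpha>" and 0: "\<And>is. length is = n \<Longrightarrow> \<alpha> (map (e y) is) = 0" and "length vs = n"
  shows "\<alpha> vs = 0"
proof -
  have "\<alpha> (map (e y) is @ vs) = 0" if "length is + length vs = n" for "is" vs
    using that
  proof (induction vs arbitrary: "is")
    case Nil
    then show ?case using 0 by simp
  next
    case (Cons v vs)
    have "\<alpha> ((map (e y) is @ v # vs)[length is := e y m]) = 0" for m
      using Cons.IH[of "is @ [m]"] Cons.prems by (simp add: list_update_append)
    then have "\<alpha> ((map (e y) is @ v # vs)[length is := v]) = 0"
      using Cons.prems by (subst multilinear_expand[OF y assms(2)]) simp_all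
    then show ?case by (simp add: list_update_append)
  qed
  from this[of "[]" vs] show ?thesis using assms by simp
qed

section \<open>Differentiation of frame components\<close>

definition conn :: "r8 \<Rightarrow> 8 \<Rightarrow> 8 \<Rightarrow> 8 \<Rightarrow> real" where
  "conn y p i m = \<epsilon> y m (fd (\<lambda>y. e y i) y (e y p) + \<Gamma> y (e y p) (e y i))"

abbreviation frame_deriv :: "8 \<Rightarrow> (r8 \<Rightarrow> real) \<Rightarrow> r8 \<Rightarrow> real" ("\<partial>") where
  "\<partial> p f y \<equiv> fd f y (e y p)"

lemma has_derivative_components:
  assumes "tensor_field W n \<omega>" "y \<in> W" "length is = n"
  shows "((\<lambda>y. \<omega> y (map (e y) is)) has_derivative (\<lambda>v. fd (\<lambda>z. \<omega> z (map (e y) is)) y v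
     + (\<Sum>s<n. \<omega> y ((map (e y) is)[s := fd (\<lambda>y. e y (is ! s)) y v])))) (at y)"
  using has_derivative_slots[OF W, of "[]" "map (\<lambda>i y. e y i) is" \<omega> y] assms e_differentiable
  by (auto simp: o_def)

lemma smooth_on_components:
  assumes \<omega>: "tensor_field W n \<omega>" and "length is = n"
  shows "smooth_on W (\<lambda>y. \<omega> y (map (e y) is))"
proof -
  have "smooth_on W (\<lambda>y. \<omega> y (us @ map (e y) is))" if "length us + length is = n" for us
    using that
  proof (induction "is" arbitrary: us)
    case Nil
    then show ?case using tensor_fieldD(2)[OF \<omega>, of us] by simp
  next
    case (Cons i "is")
    have "smooth_on W (\<lambda>y. \<Sum>k\<in>UNIV. e y i $ k * \<omega> y ((us @ [axis k 1]) @ map (e y) is))"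
      using Cons by (intro smooth_on_sum smooth_on_mult e_smooth W Cons.IH) simp
    then show ?case
    proof (rule smooth_on_cong[OF W, THEN iffD1, rotated])
      fix y assume y: "y \<in> W"
      show "(\<Sum>k\<in>UNIV. e y i $ k * \<omega> y ((us @ [axis k 1]) @ map (e y) is)) = \<omega> y (us @ map (e y) (i # is))"
        using linear_expand_axis[OF multilinearD[OF tensor_fieldD(1)[OF \<omega> y], of "us @ 0 # map (e y) is" "length us"], of "e y i"]
          Cons.prems by simp
    qed
  qed
  from this[of "[]"] show ?thesis using assms by simp
qed

text \<open>The derivative of a component is the component of the covariant derivative plus one
  rotation by \<open>conn\<close> for each index. Differentiating a tensor identity in components
  therefore yields the identity for covariant derivatives, once the rotations are seen to
  cancel.\<close>

lemma frame_deriv_components: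
  assumes \<omega>: "tensor_field W n \<omega>" and y: "y \<in> W" and len: "length is = n"
  shows "\<partial> p (\<lambda>y. \<omega> y (map (e y) is)) y = nabla \<Gamma> \<omega> y (e y p # map (e y) is)
     + (\<Sum>s<n. \<Sum>m\<in>UNIV. conn y p (is ! s) m * \<omega> y (map (e y) (is[s := m])))"
proof -
  have "\<partial> p (\<lambda>y. \<omega> y (map (e y) is)) y = nabla \<Gamma> \<omega> y (e y p # map (e y) is)
    + (\<Sum>s<n. \<omega> y ((map (e y) is)[s := fd (\<lambda>y. e y (is ! s)) y (e y p) + \<Gamma> y (e y p) (e y (is ! s))]))"
    using len by (subst fd_eqI[OF has_derivative_components[OF assms]])
      (simp add: nabla_Cons multilinear_add[OF tensor_fieldD(1)[OF \<omega> y]] sum.distrib)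
  then show ?thesis
    using len by (simp add: multilinear_expand[OF y tensor_fieldD(1)[OF \<omega> y]] conn_def map_update)
qed

end

lemma skew_contract:
  fixes \<omega> :: "8 \<Rightarrow> 8 \<Rightarrow> real"
  assumes "\<And>i j. \<omega> j i = - \<omega> i j"
  shows "(\<Sum>i\<in>UNIV. (\<Sum>m\<in>UNIV. \<omega> i m * X m) * Y i) = - (\<Sum>i\<in>UNIV. X i * (\<Sum>m\<in>UNIV. \<omega> i m * Y m))"
proof -
  have "(\<Sum>i\<in>UNIV. (\<Sum>m\<in>UNIV. \<omega> i m * X m) * Y i) = (\<Sum>m\<in>UNIV. \<Sum>i\<in>UNIV. \<omega> i m * X m * Y i)"
    unfolding sum_distrib_right by (rule sum.swap)
  also have "\<dots> = (\<Sum>m\<in>UNIV. \<Sum>i\<in>UNIV. - (X m * (\<omega> m i * Y i)))"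
  proof (intro sum.cong refl)
    fix m i show "\<omega> i m * X m * Y i = - (X m * (\<omega> m i * Y i))"
      using assms[of i m] by simp
  qed
  finally show ?thesis
    by (simp add: sum_negf sum_distrib_left)
qed

definition rot3 :: "(8 \<Rightarrow> 8 \<Rightarrow> real) \<Rightarrow> (8 \<Rightarrow> 8 \<Rightarrow> 8 \<Rightarrow> real) \<Rightarrow> 8 \<Rightarrow> 8 \<Rightarrow> 8 \<Rightarrow> real" where
  "rot3 \<omega> X i j k = (\<Sum>m\<in>UNIV. \<omega> i m * X m j k) + (\<Sum>m\<in>UNIV. \<omega> j m * X i m k) + (\<Sum>m\<in>UNIV. \<omega> k m * X i j m)"

lemma skew_contract3:
  fixes X Y :: "8 \<Rightarrow> 8 \<Rightarrow> 8 \<Rightarrow> real"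
  assumes "\<And>i j. \<omega> j i = - \<omega> i j"
  shows "(\<Sum>i\<in>UNIV. \<Sum>j\<in>UNIV. \<Sum>k\<in>UNIV. rot3 \<omega> X i j k * Y i j k)
    = - (\<Sum>i\<in>UNIV. \<Sum>j\<in>UNIV. \<Sum>k\<in>UNIV. X i j k * rot3 \<omega> Y i j k)"
proof -
  let ?S = "\<lambda>f. \<Sum>i\<in>UNIV. \<Sum>j\<in>UNIV. \<Sum>k\<in>UNIV. f i j k :: real"
  note sk = skew_contract[of \<omega>, OF assms]
  have 3: "?S (\<lambda>i j k. (\<Sum>m\<in>UNIV. \<omega> k m * X i j m) * Y i j k) = - ?S (\<lambda>i j k. X i j k * (\<Sum>m\<in>UNIV. \<omega> k m * Y i j m))"
    by (simp add: sk sum_negf)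
  have 2: "?S (\<lambda>i j k. (\<Sum>m\<in>UNIV. \<omega> j m * X i m k) * Y i j k) = - ?S (\<lambda>i j k. X i j k * (\<Sum>m\<in>UNIV. \<omega> j m * Y i m k))"
    by (subst (1 2) sum3_132) (simp add: sk sum_negf)
  have 1: "?S (\<lambda>i j k. (\<Sum>m\<in>UNIV. \<omega> i m * X m j k) * Y i j k) = - ?S (\<lambda>i j k. X i j k * (\<Sum>m\<in>UNIV. \<omega> i m * Y m j k))"
    by (subst (1 2) sum3_312) (simp add: sk sum_negf)
  show ?thesis
    by (simp add: rot3_def distrib_right distrib_left sum.distrib 1 2 3)
qed

text \<open>Contraction with \<open>psi\<close> is equivariant: skewness moves the action from
  \<open>X\<close> to \<open>psi\<close>, and there invariance leaves only the rotation of the free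
  index.\<close>

lemma rot3_psi:
  assumes "\<And>i j. \<omega> j i = - \<omega> i j" "\<And>i j k l. psi_action \<omega> i j k l = 0"
  shows "(\<Sum>a\<in>UNIV. \<Sum>b\<in>UNIV. \<Sum>c\<in>UNIV. rot3 \<omega> X a b c * psi a b c j)
    = (\<Sum>m\<in>UNIV. \<omega> j m * (\<Sum>a\<in>UNIV. \<Sum>b\<in>UNIV. \<Sum>c\<in>UNIV. X a b c * psi a b c m))"
proof -
  have r: "rot3 \<omega> (\<lambda>a b c. psi a b c j) a b c = - (\<Sum>m\<in>UNIV. \<omega> j m * psi a b c m)" for a b c
    using assms(2)[of a b c j] by (simp add: psi_action_def rot3_def sum.distrib)
  show ?thesis
    unfolding skew_contract3[OF assms(1)] r
    by (simp add: sum_negf sum_distrib_left, simp only: sum.cartesian_product,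
        rule sum.reindex_bij_witness[of _ "\<lambda>(m, a, b, c). (a, b, c, m)" "\<lambda>(a, b, c, m). (m, a, b, c)"])
      (auto simp: algebra_simps)
qed

context spin7_chart
begin

definition Tc where "Tc y i j k = torsion g \<Gamma> y [e y i, e y j, e y k]"
definition Dc where "Dc y p i j k = nabla \<Gamma> (torsion g \<Gamma>) y [e y p, e y i, e y j, e y k]"
definition D2c where "D2c y p q i j k = nabla \<Gamma> (nabla \<Gamma> (torsion g \<Gamma>)) y [e y p, e y q, e y i, e y j, e y k]"
definition Rc where "Rc y p q i j = curvature g \<Gamma> y [e y p, e y q, e y i, e y j]"

lemma T_field: "tensor_field W 3 (torsion g \<Gamma>)"
  unfolding tensor_field_def
proof (intro conjI ballI allI impI)
  show "multilinear 3 (torsion g \<Gamma> y)" if "y \<in> W" for y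
    by (rule is_form_multilinear[OF T_form[OF that]])
  fix vs :: "r8 list" assume "length vs = 3"
  then obtain u v z where vs: "vs = [u, v, z]"
    by (auto simp: length_Suc_conv numeral_3_eq_3)
  have "smooth_on W (\<lambda>y. g y [\<Gamma> y u v, z] - g y [\<Gamma> y v u, z])"
    using smooth_on_slot[OF W g_field _ _ smooth_connectionD(3)[OF \<Gamma>], of "[0, z]" 0]
    by (intro smooth_on_diff W) simp_all
  then show "smooth_on W (\<lambda>y. torsion g \<Gamma> y vs)"
    unfolding vs torsion_eq tor_def
    by (rule smooth_on_cong[OF W, THEN iffD1, rotated])
      (use multilinear_add(2)[OF tensor_fieldD(1)[OF g_field], of _ "[0, z]" 0] in simp)
qed

lemma D_field: "tensor_field W 4 (nabla \<Gamma> (torsion g \<Gamma>))"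
  using tensor_field_nabla[OF W \<Gamma> T_field] by simp

lemma Tc_smooth: "smooth_on W (\<lambda>y. Tc y i j k)"
  using smooth_on_components[OF T_field, of "[i, j, k]"] by (simp add: Tc_def)

lemma Dc_smooth: "smooth_on W (\<lambda>y. Dc y p i j k)"
  using smooth_on_components[OF D_field, of "[p, i, j, k]"] by (simp add: Dc_def)

text \<open>\<open>g\<close> is parallel with constant frame components, so
  \<open>frame_deriv_components\<close> leaves nothing but the rotations. The same argument for the
  4-form gives \<open>conn_psi\<close>.\<close>

lemma conn_skew:
  assumes y: "y \<in> W"
  shows "conn y p j i = - conn y p i j"
proof -
  have "\<partial> p (\<lambda>y. g y (map (e y) [i, j])) y = 0"
    by (subst fd_cong[OF W y, of _ "\<lambda>y. if i = j then 1 else 0"]) (simp_all add: g_e \<epsilon>_e)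
  then show ?thesis
    using frame_deriv_components[OF g_field y, of "[i, j]" p] g_par[OF y, of "e y p" "e y i" "e y j"] y
    by (simp add: numeral_2_eq_2 lessThan_Suc g_e \<epsilon>_e if_distrib[of "(*) _"] cong: if_cong)
qed

lemma conn_psi:
  assumes y: "y \<in> W"
  shows "psi_action (conn y p) i j k l = 0"
proof -
  have "\<partial> p (\<lambda>y. \<Psi> y (map (e y) [i, j, k, l])) y = 0"
    by (subst fd_cong[OF W y, of _ "\<lambda>y. psi i j k l"]) (simp_all add: \<Psi>_e)
  then show ?thesis
    using frame_deriv_components[OF \<Psi>_field y, of "[i, j, k, l]" p]
      \<Psi>_par[OF y, of "e y p # map (e y) [i, j, k, l]"]
    by (simp add: psi_action_def eval_nat_numeral lessThan_Suc \<Psi>_e[OF y] sum.distrib)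
qed

lemma frame_deriv_Tc:
  assumes y: "y \<in> W"
  shows "\<partial> p (\<lambda>y. Tc y i j k) y = Dc y p i j k + rot3 (conn y p) (Tc y) i j k"
  using frame_deriv_components[OF T_field y, of "[i, j, k]" p]
  by (simp add: Tc_def Dc_def rot3_def eval_nat_numeral lessThan_Suc)

lemma frame_deriv_Dc:
  assumes y: "y \<in> W"
  shows "\<partial> p (\<lambda>y. Dc y q i j k) y = D2c y p q i j k + (\<Sum>m\<in>UNIV. conn y p q m * Dc y m i j k)
    + rot3 (conn y p) (Dc y q) i j k"
  using frame_deriv_components[OF D_field y, of "[q, i, j, k]" p]
  by (simp add: D2c_def Dc_def rot3_def eval_nat_numeral lessThan_Suc)

lemma frame_deriv_mult:
  assumes "smooth_on W X" "smooth_on W Y" "y \<in> W"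
  shows "\<partial> p (\<lambda>y. X y * Y y) y = X y * \<partial> p Y y + \<partial> p X y * Y y"
  by (intro fd_eqI has_derivative_mult has_derivative_fd smooth_on_differentiable[OF assms(1) assms(3)]
      smooth_on_differentiable[OF assms(2) assms(3)])

lemma frame_deriv_sum:
  assumes "\<And>i. smooth_on W (\<lambda>y. X i y)" "y \<in> W"
  shows "\<partial> p (\<lambda>y. \<Sum>i\<in>UNIV. X (i :: 8) y) y = (\<Sum>i\<in>UNIV. \<partial> p (X i) y)"
  by (intro fd_eqI has_derivative_sum has_derivative_fd smooth_on_differentiable[OF assms(1) assms(2)])

lemma frame_deriv_const:
  assumes "y \<in> W" "\<And>z. z \<in> W \<Longrightarrow> f z = c"
  shows "\<partial> p f y = 0"
  by (subst fd_cong[OF W assms(1), of _ "\<lambda>_. c"]) (simp_all add: assms(2))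

lemma frame_deriv_psi_trace:
  assumes X: "\<And>i j k. smooth_on W (\<lambda>y. X y i j k)" and y: "y \<in> W"
    and d: "\<And>i j k. \<partial> p (\<lambda>y. X y i j k) y = Y i j k + rot3 (conn y p) (X y) i j k"
  shows "\<partial> p (\<lambda>y. psi_trace (X y) l) y = psi_trace Y l + (\<Sum>m\<in>UNIV. conn y p l m * psi_trace (X y) m)"
proof -
  have m: "\<partial> p (\<lambda>y. X y i j k * psi i j k l) y = \<partial> p (\<lambda>y. X y i j k) y * psi i j k l" for i j k
    by (subst frame_deriv_mult[OF X smooth_on_const y]) simp
  have "\<partial> p (\<lambda>y. psi_trace (X y) l) y = (\<Sum>i\<in>UNIV. \<Sum>j\<in>UNIV. \<Sum>k\<in>UNIV. \<partial> p (\<lambda>y. X y i j k * psi i j k l) y)"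
    unfolding psi_trace_def
    by (simp add: frame_deriv_sum[OF _ y] smooth_on_sum[OF W] smooth_on_mult[OF W] X smooth_on_const)
  also have "\<dots> = psi_trace Y l + (\<Sum>i\<in>UNIV. \<Sum>j\<in>UNIV. \<Sum>k\<in>UNIV. rot3 (conn y p) (X y) i j k * psi i j k l)"
    by (simp add: m d psi_trace_def distrib_right sum.distrib)
  also have "(\<Sum>i\<in>UNIV. \<Sum>j\<in>UNIV. \<Sum>k\<in>UNIV. rot3 (conn y p) (X y) i j k * psi i j k l)
    = (\<Sum>m\<in>UNIV. conn y p l m * psi_trace (X y) m)"
    unfolding psi_trace_def by (rule rot3_psi[OF conn_skew[OF y] conn_psi[OF y]])
  finally show ?thesis .
qed

lemma psi_trace_smooth:
  assumes "\<And>i j k. smooth_on W (\<lambda>y. X y i j k)"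
  shows "smooth_on W (\<lambda>y. psi_trace (X y) l)"
  unfolding psi_trace_def by (intro smooth_on_sum smooth_on_mult smooth_on_const W assms)

lemma frame_deriv_psi_trace_Tc:
  assumes "y \<in> W"
  shows "\<partial> p (\<lambda>y. psi_trace (Tc y) l) y = psi_trace (Dc y p) l + (\<Sum>m\<in>UNIV. conn y p l m * psi_trace (Tc y) m)"
  by (rule frame_deriv_psi_trace[OF Tc_smooth assms frame_deriv_Tc[OF assms]])

lemma frame_deriv_psi_trace_Dc:
  assumes y: "y \<in> W"
  shows "\<partial> p (\<lambda>y. psi_trace (Dc y q) l) y = psi_trace (D2c y p q) l + (\<Sum>m\<in>UNIV. conn y p q m * psi_trace (Dc y m) l)
     + (\<Sum>m\<in>UNIV. conn y p l m * psi_trace (Dc y q) m)"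
proof -
  have "psi_trace (\<lambda>i j k. D2c y p q i j k + (\<Sum>m\<in>UNIV. conn y p q m * Dc y m i j k)) l
    = psi_trace (D2c y p q) l + (\<Sum>i\<in>UNIV. \<Sum>j\<in>UNIV. \<Sum>k\<in>UNIV. \<Sum>m\<in>UNIV. conn y p q m * (Dc y m i j k * psi i j k l))"
    by (simp add: psi_trace_def distrib_right sum.distrib sum_distrib_right mult.assoc)
  also have "(\<Sum>i\<in>UNIV. \<Sum>j\<in>UNIV. \<Sum>k\<in>UNIV. \<Sum>m\<in>UNIV. conn y p q m * (Dc y m i j k * psi i j k l))
    = (\<Sum>m\<in>UNIV. conn y p q m * psi_trace (Dc y m) l)"
    unfolding psi_trace_def sum_distrib_left
    by (simp only: sum.cartesian_product,
        rule sum.reindex_bij_witness[of _ "\<lambda>(m, a, b, c). (a, b, c, m)" "\<lambda>(a, b, c, m). (m, a, b, c)"]) auto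
  finally show ?thesis
    using frame_deriv_psi_trace[of "\<lambda>y. Dc y q", OF Dc_smooth y frame_deriv_Dc[OF y]] by simp
qed

end

lemma is_form_alternating3:
  assumes "is_form 3 \<alpha>"
  shows "alternating3 (\<lambda>i j k. \<alpha> [f i, f j, f k])"
  unfolding alternating3_def
proof (intro allI conjI)
  fix i j k
  show "\<alpha> [f j, f i, f k] = - \<alpha> [f i, f j, f k]"
    using is_form_swap[OF assms, of "[0, 0, f k]" 0 1 "f j" "f i"] by (simp add: numeral_3_eq_3)
  show "\<alpha> [f i, f k, f j] = - \<alpha> [f i, f j, f k]"
    using is_form_swap[OF assms, of "[f i, 0, 0]" 1 2 "f k" "f j"] by (simp add: numeral_3_eq_3 numeral_2_eq_2)
qed

text \<open>The first slot of \<open>N\<close> is split off: with its vector held constant, what is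
  differentiated is a tensor of lower rank.\<close>

lemma nabla_Cons_Cons:
  "nabla \<Gamma> N x (p # u # vs) = nabla \<Gamma> (\<lambda>y vs. N y (u # vs)) x (p # vs) - N x (\<Gamma> x p u # vs)"
  by (simp add: nabla_Cons sum.lessThan_Suc_shift del: sum.lessThan_Suc)

lemma tensor_field_Cons:
  assumes "tensor_field W (Suc n) N"
  shows "tensor_field W n (\<lambda>y vs. N y (u # vs))"
proof -
  have "linear (\<lambda>v. N y (u # vs[i := v]))" if "y \<in> W" "length vs = n" "i < n" for y vs i
    using multilinearD[OF tensor_fieldD(1)[OF assms that(1)], of "u # vs" "Suc i"] that by simp
  then show ?thesis
    using tensor_fieldD(2)[OF assms] by (simp add: tensor_field_def multilinear_def)
qed

section \<open>The frame components satisfy the algebraic hypotheses\<close>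

context spin7_chart
begin

lemma Tc_alt: "y \<in> W \<Longrightarrow> alternating3 (Tc y)"
  using is_form_alternating3[OF T_form] unfolding Tc_def by simp

lemma Dc_alt: "y \<in> W \<Longrightarrow> alternating3 (Dc y p)"
  using is_form_alternating3[OF is_form_nabla[OF W \<Gamma> T_field T_form]] unfolding Dc_def by simp

text \<open>With the inner direction held at its value at \<open>y\<close>,
  \<open>nabla_Cons_Cons\<close> writes the second derivative as the derivative of a field of
  3-forms minus a 3-form.\<close>

lemma D2c_alt:
  assumes y: "y \<in> W"
  shows "alternating3 (D2c y p q)"
proof -
  let ?N = "nabla \<Gamma> (torsion g \<Gamma>)"
  have N: "tensor_field W 3 (\<lambda>y vs. ?N y (e x q # vs))" for x
    using tensor_field_Cons[of W 3 ?N] D_field by simp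
  have "is_form 3 (\<lambda>vs. ?N y (u # vs))" if "y \<in> W" for y u
    by (rule is_form_nabla[OF W \<Gamma> T_field T_form that])
  then have a: "alternating3 (\<lambda>i j k. ?N y [u, e y i, e y j, e y k])"
    "alternating3 (\<lambda>i j k. nabla \<Gamma> (\<lambda>z vs. ?N z (e y q # vs)) y [e y p, e y i, e y j, e y k])" for u
    using is_form_alternating3[of "\<lambda>vs. ?N y (u # vs)"] is_form_alternating3[OF is_form_nabla[OF W \<Gamma> N _ y]] y by simp_all
  have s: "alternating3 (\<lambda>i j k. f i j k - h i j k)" if "alternating3 f" "alternating3 h" for f h
    unfolding alternating3_def
    using alternating3D(1,2)[OF that(1)] alternating3D(1,2)[OF that(2)] by (metis minus_diff_minus)
  show ?thesis
    using s[OF a(2) a(1)] by (simp add: D2c_def[abs_def] nabla_Cons_Cons)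
qed

lemma \<epsilon>_tor: "y \<in> W \<Longrightarrow> \<epsilon> y m (tor \<Gamma> y (e y p) (e y q)) = Tc y p q m"
  by (simp add: Tc_def torsion_eq g_e)

lemma \<epsilon>_curv_op: "y \<in> W \<Longrightarrow> \<epsilon> y m (curv_op \<Gamma> y (e y p) (e y q) (e y i)) = Rc y p q i m"
  by (simp add: Rc_def curvature_eq[OF \<Gamma>] g_e)

lemma Rc_skew1: "y \<in> W \<Longrightarrow> Rc y q p i j = - Rc y p q i j"
proof -
  assume y: "y \<in> W"
  have "curv_op \<Gamma> y (e y q) (e y p) (e y i) = - curv_op \<Gamma> y (e y p) (e y q) (e y i)"
    by (simp add: curv_op_def)
  then show ?thesis
    using linear_neg[OF \<epsilon>_linear[OF y]] by (simp add: \<epsilon>_curv_op[OF y, symmetric])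
qed

text \<open>For a parallel tensor the Ricci identity reduces to the action of the curvature, which
  must vanish. Applied to \<open>g\<close> it gives skewness of the last pair, applied to
  \<open>\<Psi>\<close> membership of spin(7).\<close>

lemma parallel_curvature:
  assumes \<omega>: "tensor_field W n \<omega>" and par: "\<And>y vs. y \<in> W \<Longrightarrow> length vs = Suc n \<Longrightarrow> nabla \<Gamma> \<omega> y vs = 0"
    and y: "y \<in> W" and len: "length is = n"
  shows "(\<Sum>s<n. \<Sum>m\<in>UNIV. Rc y p q (is ! s) m * \<omega> y (map (e y) (is[s := m]))) = 0"
proof -
  have "nabla \<Gamma> (nabla \<Gamma> \<omega>) y (u # vs) = 0" if "length vs = Suc n" for u vs
    by (rule nabla_eq_0[OF W y par that])
  then have "(\<Sum>s<n. \<omega> y ((map (e y) is)[s := curv_op \<Gamma> y (e y p) (e y q) (map (e y) is ! s)])) = 0"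
    using ricci_identity[OF W \<Gamma> \<omega> y, of "map (e y) is" "e y p" "e y q"] par[OF y] len by simp
  then show ?thesis
    using len by (simp add: multilinear_expand[OF y tensor_fieldD(1)[OF \<omega> y]] \<epsilon>_curv_op[OF y] map_update)
qed

lemma Rc_skew2:
  assumes y: "y \<in> W"
  shows "Rc y p q j i = - Rc y p q i j"
proof -
  have par: "nabla \<Gamma> g z vs = 0" if "z \<in> W" "length vs = Suc 2" for z vs
    using that g_par by (auto simp: length_Suc_conv numeral_2_eq_2)
  show ?thesis
    using parallel_curvature[OF g_field par y, of "[i, j]" p q] y
    by (simp add: numeral_2_eq_2 lessThan_Suc g_e \<epsilon>_e if_distrib[of "(*) _"] cong: if_cong)
qed

lemma Rc_psi:
  assumes y: "y \<in> W"
  shows "psi_action (Rc y p q) i j k l = 0"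
proof -
  have par: "nabla \<Gamma> \<Psi> z vs = 0" if "z \<in> W" "length vs = Suc 4" for z vs
    using that \<Psi>_par by simp
  show ?thesis
    using parallel_curvature[OF \<Psi>_field par y, of "[i, j, k, l]" p q]
    by (simp add: psi_action_def eval_nat_numeral lessThan_Suc \<Psi>_e[OF y] sum.distrib)
qed

lemma Rc_bianchi:
  assumes y: "y \<in> W"
  shows "Rc y u v z a + Rc y v z u a + Rc y z u v a = Dc y u v z a + Dc y v z u a + Dc y z u v a
      + (\<Sum>m\<in>UNIV. Tc y u v m * Tc y m z a) + (\<Sum>m\<in>UNIV. Tc y v z m * Tc y m u a) + (\<Sum>m\<in>UNIV. Tc y z u m * Tc y m v a)"
proof -
  have "torsion g \<Gamma> y [tor \<Gamma> y (e y p) (e y q), e y i, e y j] = (\<Sum>m\<in>UNIV. Tc y p q m * Tc y m i j)" for p q i j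
    using multilinear_expand[OF y tensor_fieldD(1)[OF T_field y], of "[0, e y i, e y j]" 0 "tor \<Gamma> y (e y p) (e y q)"]
    by (simp add: \<epsilon>_tor[OF y] Tc_def[of _ _ i j for i j])
  then show ?thesis
    using first_bianchi[OF W \<Gamma> g_field g_par y, of "e y u" "e y v" "e y z" "e y a"] y
    by (simp add: Rc_def Dc_def)
qed

lemma D2c_ricci:
  assumes y: "y \<in> W"
  shows "D2c y p q i j k - D2c y q p i j k
     = - (\<Sum>m\<in>UNIV. Rc y p q i m * Tc y m j k + Rc y p q j m * Tc y i m k + Rc y p q k m * Tc y i j m)
       - (\<Sum>m\<in>UNIV. Tc y p q m * Dc y m i j k)"
proof -
  have 1: "nabla \<Gamma> (torsion g \<Gamma>) y [tor \<Gamma> y (e y p) (e y q), e y i, e y j, e y k] = (\<Sum>m\<in>UNIV. Tc y p q m * Dc y m i j k)"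
    using multilinear_expand[OF y tensor_fieldD(1)[OF D_field y], of "[0, e y i, e y j, e y k]" 0 "tor \<Gamma> y (e y p) (e y q)"]
    by (simp add: \<epsilon>_tor[OF y] Dc_def)
  have T3: "torsion g \<Gamma> y (vs[s := v]) = (\<Sum>m\<in>UNIV. \<epsilon> y m v * torsion g \<Gamma> y (vs[s := e y m]))" if "length vs = 3" "s < 3" for vs s v
    by (rule multilinear_expand[OF y tensor_fieldD(1)[OF T_field y] that])
  have 2: "(\<Sum>s<3. torsion g \<Gamma> y ([e y i, e y j, e y k][s := curv_op \<Gamma> y (e y p) (e y q) ([e y i, e y j, e y k] ! s)]))
    = (\<Sum>m\<in>UNIV. Rc y p q i m * Tc y m j k + Rc y p q j m * Tc y i m k + Rc y p q k m * Tc y i j m)"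
    using T3[of "[e y i, e y j, e y k]" 0 "curv_op \<Gamma> y (e y p) (e y q) (e y i)"]
      T3[of "[e y i, e y j, e y k]" 1 "curv_op \<Gamma> y (e y p) (e y q) (e y j)"]
      T3[of "[e y i, e y j, e y k]" 2 "curv_op \<Gamma> y (e y p) (e y q) (e y k)"]
    by (simp add: \<epsilon>_curv_op[OF y] Tc_def sum.distrib lessThan_Suc eval_nat_numeral)
  show ?thesis
    using ricci_identity[OF W \<Gamma> T_field y, of "[e y i, e y j, e y k]" "e y p" "e y q"]
    unfolding 1 2 D2c_def by simp
qed

end

text \<open>The last assumption is the closedness of the Lee form in terms of covariant derivatives;
  the torsion term is what the antisymmetrised derivative differs by from the exterior one.\<close>

locale closed_instanton_chart = spin7_chart +
  assumes d_nabla_T_0: "y \<in> W \<Longrightarrow> d_nabla_T g \<Gamma> y [u, v, z, a] = 0"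
    and Rc_self_dual: "y \<in> W \<Longrightarrow> self_dual (\<lambda>k l. Rc y k l i j)"
    and lee_closed: "y \<in> W \<Longrightarrow> psi_trace (Dc y i) j - psi_trace (Dc y j) i
       + (\<Sum>m\<in>UNIV. Tc y i j m * psi_trace (Tc y) m) = 0"
begin

lemma nabla_T_closed:
  assumes "y \<in> W"
  defines "D \<equiv> nabla \<Gamma> (torsion g \<Gamma>) y"
  shows "D [u, v, z, a] + D [v, z, u, a] + D [z, u, v, a] - D [a, u, v, z] = 0"
  using d_nabla_T_0[OF assms(1), of u v z a] unfolding D_def d_nabla_T_def by (simp add: Let_def eval_nat_numeral)

text \<open>The identity \<open>nabla_T_closed\<close> holds for all vectors and all points of
  \<open>W\<close>. Its derivative is zero, and each connection term is another instance of it with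
  one argument replaced.\<close>

lemma D2c_closed:
  assumes y: "y \<in> W"
  shows "D2c y p u v z a + D2c y p v z u a + D2c y p z u v a = D2c y p a u v z"
proof -
  let ?N = "nabla \<Gamma> (torsion g \<Gamma>)"
  have d: "(\<lambda>z. ?N z vs) differentiable (at y)" if "length vs = 4" for vs
    by (rule smooth_on_differentiable[OF tensor_fieldD(2)[OF D_field that] y])
  have "fd (\<lambda>x. ?N x [u, v, z, a] + ?N x [v, z, u, a] + ?N x [z, u, v, a] - ?N x [a, u, v, z]) y p = 0" for p u v z a
    by (subst fd_cong[OF W y, of _ "\<lambda>_. 0"]) (simp_all add: nabla_T_closed)
  then have 1: "fd (\<lambda>x. ?N x [u, v, z, a]) y p + fd (\<lambda>x. ?N x [v, z, u, a]) y p + fd (\<lambda>x. ?N x [z, u, v, a]) y p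
      - fd (\<lambda>x. ?N x [a, u, v, z]) y p = 0" for p u v z a
    by (subst (asm) fd_eqI[OF has_derivative_diff[OF has_derivative_add[OF has_derivative_add[OF has_derivative_fd has_derivative_fd] has_derivative_fd] has_derivative_fd]])
      (simp_all add: d)
  show ?thesis
    unfolding D2c_def
    using 1[where p="e y p" and u="e y u" and v="e y v" and z="e y z" and a="e y a"]
      nabla_T_closed[OF y, of "\<Gamma> y (e y p) (e y u)" "e y v" "e y z" "e y a"]
      nabla_T_closed[OF y, of "e y u" "\<Gamma> y (e y p) (e y v)" "e y z" "e y a"]
      nabla_T_closed[OF y, of "e y u" "e y v" "\<Gamma> y (e y p) (e y z)" "e y a"]
      nabla_T_closed[OF y, of "e y u" "e y v" "e y z" "\<Gamma> y (e y p) (e y a)"]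
    by (simp add: nabla_Cons[of _ ?N] lessThan_Suc numeral_3_eq_3)
qed

lemma jet: "y \<in> W \<Longrightarrow> instanton_jet (Tc y) (Dc y) (Rc y)"
proof unfold_locales
  assume y: "y \<in> W"
  show "alternating3 (Tc y)" by (rule Tc_alt[OF y])
  show "alternating3 (Dc y p)" for p by (rule Dc_alt[OF y])
  show "Rc y q p i j = - Rc y p q i j" for p q i j by (rule Rc_skew1[OF y])
  show "Rc y p q j i = - Rc y p q i j" for p q i j by (rule Rc_skew2[OF y])
  show "psi_action (Rc y p q) i j k l = 0" for p q i j k l by (rule Rc_psi[OF y])
  show "self_dual (\<lambda>k l. Rc y k l i j)" for i j by (rule Rc_self_dual[OF y])
  show "Rc y u v z a + Rc y v z u a + Rc y z u v a = Dc y u v z a + Dc y v z u a + Dc y z u v a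
      + (\<Sum>m\<in>UNIV. Tc y u v m * Tc y m z a) + (\<Sum>m\<in>UNIV. Tc y v z m * Tc y m u a) + (\<Sum>m\<in>UNIV. Tc y z u m * Tc y m v a)" for u v z a
    by (rule Rc_bianchi[OF y])
  show "Dc y u v z a + Dc y v z u a + Dc y z u v a = Dc y a u v z" for u v z a
    using nabla_T_closed[OF y] by (simp add: Dc_def)
qed

end

subsection \<open>The torsion is parallel\<close>
context closed_instanton_chart
begin

lemma D2c_ricci_id: "y \<in> W \<Longrightarrow> instanton_jet.ricci_id (Tc y) (Dc y) (Rc y) (D2c y)"
  using instanton_jet.ricci_id_def[OF jet] D2c_ricci by blast

lemma dt_eq:
  assumes y: "y \<in> W"
  shows "psi_trace (Dc y q) j = - (\<Sum>m\<in>UNIV. Tc y q j m * psi_trace (Tc y) m) / 2"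
proof -
  interpret J: instanton_jet "Tc y" "Dc y" "Rc y" by (rule jet[OF y])
  show ?thesis
    using lee_closed[OF y, of q j] J.dt_skew[of j q] by (simp add: J.dt_def)
qed

text \<open>The covariant derivative of \<open>dt_eq\<close>. Rotations of the summed index cancel
  because \<open>conn\<close> is skew; those of \<open>q\<close> and \<open>j\<close> match the
  rotations on the left side, by \<open>dt_eq\<close> itself.\<close>

lemma psi_trace_D2c:
  assumes y: "y \<in> W"
  shows "psi_trace (D2c y p q) j
    = - (\<Sum>m\<in>UNIV. Dc y p q j m * psi_trace (Tc y) m + Tc y q j m * psi_trace (Dc y p) m) / 2"
proof -
  let ?\<omega> = "conn y p" and ?t = "psi_trace (Tc y)"
  have F: "(\<Sum>m\<in>UNIV. Tc y n i m * ?t m) = - 2 * psi_trace (Dc y n) i" for n i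
    by (simp add: dt_eq[OF y])
  have s: "smooth_on W (\<lambda>y. Tc y q j m * psi_trace (Tc y) m)" for m
    by (intro smooth_on_mult W Tc_smooth psi_trace_smooth)
  have "\<partial> p (\<lambda>y. psi_trace (Dc y q) j) y = \<partial> p (\<lambda>y. (- 1 / 2) * (\<Sum>m\<in>UNIV. Tc y q j m * psi_trace (Tc y) m)) y"
    by (subst fd_cong[OF W y, of _ "\<lambda>y. (- 1 / 2) * (\<Sum>m\<in>UNIV. Tc y q j m * psi_trace (Tc y) m)"]) (simp_all add: dt_eq)
  also have "\<dots> = (- 1 / 2) * (\<Sum>m\<in>UNIV. \<partial> p (\<lambda>y. Tc y q j m * psi_trace (Tc y) m) y)"
    by (subst frame_deriv_mult[OF smooth_on_const smooth_on_sum[OF W s] y]) (simp add: frame_deriv_sum[OF s y])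
  also have "(\<Sum>m\<in>UNIV. \<partial> p (\<lambda>y. Tc y q j m * psi_trace (Tc y) m) y)
    = (\<Sum>m\<in>UNIV. Tc y q j m * (psi_trace (Dc y p) m + (\<Sum>n\<in>UNIV. ?\<omega> m n * ?t n)) + (Dc y p q j m + rot3 ?\<omega> (Tc y) q j m) * ?t m)"
    by (simp add: frame_deriv_mult[OF Tc_smooth psi_trace_smooth[OF Tc_smooth] y] frame_deriv_psi_trace_Tc[OF y] frame_deriv_Tc[OF y])
  also have "\<dots> = (\<Sum>m\<in>UNIV. Dc y p q j m * ?t m + Tc y q j m * psi_trace (Dc y p) m)
     + (\<Sum>m\<in>UNIV. (\<Sum>n\<in>UNIV. ?\<omega> q n * Tc y n j m) * ?t m) + (\<Sum>m\<in>UNIV. (\<Sum>n\<in>UNIV. ?\<omega> j n * Tc y q n m) * ?t m)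
     + (\<Sum>m\<in>UNIV. Tc y q j m * (\<Sum>n\<in>UNIV. ?\<omega> m n * ?t n)) + (\<Sum>m\<in>UNIV. (\<Sum>n\<in>UNIV. ?\<omega> m n * Tc y q j n) * ?t m)"
    unfolding rot3_def distrib_left distrib_right sum.distrib by simp
  also have "(\<Sum>m\<in>UNIV. (\<Sum>n\<in>UNIV. ?\<omega> m n * Tc y q j n) * ?t m) = - (\<Sum>m\<in>UNIV. Tc y q j m * (\<Sum>n\<in>UNIV. ?\<omega> m n * ?t n))"
    by (rule skew_contract[OF conn_skew[OF y]])
  also have "(\<Sum>m\<in>UNIV. (\<Sum>n\<in>UNIV. ?\<omega> q n * Tc y n j m) * ?t m) = (\<Sum>n\<in>UNIV. ?\<omega> q n * (- 2 * psi_trace (Dc y n) j))"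
    unfolding sum_distrib_right by (subst sum.swap, unfold mult.assoc sum_distrib_left[symmetric] F) (rule refl)
  also have "(\<Sum>m\<in>UNIV. (\<Sum>n\<in>UNIV. ?\<omega> j n * Tc y q n m) * ?t m) = (\<Sum>n\<in>UNIV. ?\<omega> j n * (- 2 * psi_trace (Dc y q) n))"
    unfolding sum_distrib_right by (subst sum.swap, unfold mult.assoc sum_distrib_left[symmetric] F) (rule refl)
  finally show ?thesis
    using frame_deriv_psi_trace_Dc[OF y, of q j p]
    by (simp add: sum_distrib_left[of "-2", symmetric] sum_negf mult.left_commute[of _ "2"] sum_distrib_left[of 2, symmetric] diff_divide_distrib)
qed

lemma dt_eq_0:
  assumes y: "y \<in> W"
  shows "psi_trace (Dc y q) j = 0"
proof -
  interpret J: instanton_jet "Tc y" "Dc y" "Rc y" by (rule jet[OF y])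
  have "J.F i j = 0" for i j
  proof (rule J.F_eq_0[OF _ D2c_ricci_id[OF y]])
    show "J.dt i j - J.dt j i + J.F i j = 0" for i j
      using lee_closed[OF y] by (simp add: J.dt_def J.F_def J.t_def)
    show "psi_trace (D2c y p q) j = - (\<Sum>m\<in>UNIV. Dc y p q j m * J.t m + Tc y q j m * J.dt p m) / 2" for p q j
      using psi_trace_D2c[OF y] by (simp add: J.dt_def J.t_def)
  qed
  then show ?thesis
    using dt_eq[OF y, of q j] by (simp add: J.F_def J.t_def)
qed

text \<open>By \<open>dt_eq_0\<close> and \<open>J.dt_eq_div\<close> the divergence of the torsion
  vanishes on all of \<open>W\<close>, so it may be differentiated.\<close>

lemma div_D2c:
  assumes y: "y \<in> W"
  shows "(\<Sum>c\<in>UNIV. D2c y p c c i j) = 0"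
proof -
  have div: "(\<Sum>c\<in>UNIV. Dc y c c i j) = 0" if y: "y \<in> W" for y i j
  proof -
    interpret J: instanton_jet "Tc y" "Dc y" "Rc y" by (rule jet[OF y])
    show ?thesis using J.dt_eq_div[of i j] dt_eq_0[OF y] by (simp add: J.dt_def)
  qed
  let ?\<omega> = "conn y p"
  have "0 = \<partial> p (\<lambda>y. \<Sum>c\<in>UNIV. Dc y c c i j) y"
    by (rule frame_deriv_const[OF y div, symmetric])
  also have "\<dots> = (\<Sum>c\<in>UNIV. D2c y p c c i j + (\<Sum>m\<in>UNIV. ?\<omega> c m * Dc y m c i j) + rot3 ?\<omega> (Dc y c) c i j)"
    by (simp add: frame_deriv_sum[OF Dc_smooth y] frame_deriv_Dc[OF y])
  also have "\<dots> = (\<Sum>c\<in>UNIV. D2c y p c c i j) + (\<Sum>c\<in>UNIV. \<Sum>m\<in>UNIV. ?\<omega> c m * (Dc y m c i j + Dc y c m i j))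
     + (\<Sum>c\<in>UNIV. \<Sum>m\<in>UNIV. ?\<omega> i m * Dc y c c m j) + (\<Sum>c\<in>UNIV. \<Sum>m\<in>UNIV. ?\<omega> j m * Dc y c c i m)"
    by (simp add: rot3_def distrib_left sum.distrib)
  \<comment> \<open>The two contracted indices rotate together, which leaves a symmetric factor
    against the skew \<open>conn\<close>.\<close>
  also have "(\<Sum>c\<in>UNIV. \<Sum>m\<in>UNIV. ?\<omega> c m * (Dc y m c i j + Dc y c m i j)) = 0"
    by (rule antisym_contract) (rule conn_skew[OF y], simp)
  also have "(\<Sum>c\<in>UNIV. \<Sum>m\<in>UNIV. ?\<omega> i m * Dc y c c m j) = 0"
    by (subst sum.swap) (simp add: div[OF y] flip: sum_distrib_left)
  also have "(\<Sum>c\<in>UNIV. \<Sum>m\<in>UNIV. ?\<omega> j m * Dc y c c i m) = 0"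
    by (subst sum.swap) (simp add: div[OF y] flip: sum_distrib_left)
  finally show ?thesis by simp
qed

text \<open>The pairing of the torsion with its derivative is zero at every point of
  \<open>W\<close>. Differentiating it, the rotations of the three summed indices cancel, and the
  rotation of \<open>q\<close> multiplies pairings that are zero again.\<close>

lemma norm_D2c:
  assumes y: "y \<in> W"
  shows "(\<Sum>i\<in>UNIV. \<Sum>j\<in>UNIV. \<Sum>k\<in>UNIV. Dc y p i j k * Dc y q i j k + Tc y i j k * D2c y p q i j k) = 0"
proof -
  let ?S = "\<lambda>f. \<Sum>i\<in>UNIV. \<Sum>j\<in>UNIV. \<Sum>k\<in>UNIV. f i j k :: real"
  have w: "?S (\<lambda>i j k. Tc y i j k * Dc y q i j k) = 0" if y: "y \<in> W" for y q
  proof -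
    interpret J: instanton_jet "Tc y" "Dc y" "Rc y" by (rule jet[OF y])
    have J.Y_closed
      unfolding J.Y_closed_def using J.alternate_ricci_id[OF D2c_ricci_id[OF y] D2c_closed[OF y] D2c_alt[OF y]] by blast
    then show ?thesis
      using J.w_eq_0[of q] dt_eq_0[OF y] by (simp add: J.dt_def J.w_def)
  qed
  let ?\<omega> = "conn y p"
  have s: "smooth_on W (\<lambda>y. Tc y i j k * Dc y q i j k)" for i j k
    by (intro smooth_on_mult W Tc_smooth Dc_smooth)
  have "0 = \<partial> p (\<lambda>y. ?S (\<lambda>i j k. Tc y i j k * Dc y q i j k)) y"
    by (rule frame_deriv_const[OF y w, symmetric])
  also have "\<dots> = ?S (\<lambda>i j k. \<partial> p (\<lambda>y. Tc y i j k * Dc y q i j k) y)"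
    by (simp add: frame_deriv_sum[OF _ y] smooth_on_sum[OF W] s)
  also have "\<dots> = ?S (\<lambda>i j k. Tc y i j k * (D2c y p q i j k + (\<Sum>m\<in>UNIV. ?\<omega> q m * Dc y m i j k) + rot3 ?\<omega> (Dc y q) i j k)
     + (Dc y p i j k + rot3 ?\<omega> (Tc y) i j k) * Dc y q i j k)"
    by (simp add: frame_deriv_mult[OF Tc_smooth Dc_smooth y] frame_deriv_Tc[OF y] frame_deriv_Dc[OF y])
  also have "\<dots> = ?S (\<lambda>i j k. Dc y p i j k * Dc y q i j k + Tc y i j k * D2c y p q i j k)
     + ?S (\<lambda>i j k. \<Sum>m\<in>UNIV. ?\<omega> q m * (Tc y i j k * Dc y m i j k))
     + (?S (\<lambda>i j k. rot3 ?\<omega> (Tc y) i j k * Dc y q i j k) + ?S (\<lambda>i j k. Tc y i j k * rot3 ?\<omega> (Dc y q) i j k))"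
    unfolding distrib_left distrib_right sum.distrib by (simp add: sum_distrib_left mult.left_commute)
  also have "?S (\<lambda>i j k. rot3 ?\<omega> (Tc y) i j k * Dc y q i j k) + ?S (\<lambda>i j k. Tc y i j k * rot3 ?\<omega> (Dc y q) i j k) = 0"
    using skew_contract3[where \<omega>="?\<omega>" and X="Tc y" and Y="Dc y q", OF conn_skew[OF y]] by simp
  also have "?S (\<lambda>i j k. \<Sum>m\<in>UNIV. ?\<omega> q m * (Tc y i j k * Dc y m i j k))
     = (\<Sum>m\<in>UNIV. ?\<omega> q m * ?S (\<lambda>i j k. Tc y i j k * Dc y m i j k))"
    unfolding sum_distrib_left
    by (simp only: sum.cartesian_product,
        rule sum.reindex_bij_witness[of _ "\<lambda>(m, a, b, c). (a, b, c, m)" "\<lambda>(a, b, c, m). (m, a, b, c)"]) auto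
  also have "\<dots> = 0" by (simp add: w[OF y])
  finally show ?thesis by simp
qed

text \<open>This is the derivative of the self-duality of \<open>A\<close>, first restated for
  \<open>D\<close>: the skewness of \<open>psi\<close> in \<open>b c\<close> sees only the skew part
  of \<open>D\<close>, which is half of \<open>A\<close>.\<close>

lemma self_dual_D2c:
  assumes y: "y \<in> W"
  shows "(\<Sum>b\<in>UNIV. \<Sum>c\<in>UNIV. D2c y p b c i j * psi b c a d) = D2c y p a d i j - D2c y p d a i j"
proof -
  let ?S = "\<lambda>f. \<Sum>b\<in>UNIV. \<Sum>c\<in>UNIV. f b c :: real"
  have sd: "?S (\<lambda>b c. Dc y b c i j * psi b c a d) = Dc y a d i j - Dc y d a i j" if y: "y \<in> W" for y i j a d
  proof -
    interpret J: instanton_jet "Tc y" "Dc y" "Rc y" by (rule jet[OF y])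
    have "2 * ?S (\<lambda>b c. Dc y b c i j * psi b c a d) = ?S (\<lambda>b c. Dc y b c i j * psi b c a d) + ?S (\<lambda>b c. Dc y c b i j * psi c b a d)"
      using sum.swap[of "\<lambda>b c. Dc y b c i j * psi b c a d" UNIV UNIV] by simp
    also have "\<dots> = ?S (\<lambda>b c. J.A b c i j * psi b c a d)"
      unfolding sum.distrib[symmetric]
    proof (intro sum.cong refl)
      fix b c show "Dc y b c i j * psi b c a d + Dc y c b i j * psi c b a d = J.A b c i j * psi b c a d"
        using psi_swap(1)[of b c a d] by (simp add: J.A_def left_diff_distrib)
    qed
    also have "\<dots> = 2 * J.A a d i j" by (rule self_dualD[OF J.A_self_dual1])
    finally show ?thesis by (simp add: J.A_def)
  qed
  let ?\<omega> = "conn y p"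
  note sk = skew_contract[of ?\<omega>, OF conn_skew[OF y]]
  have s: "smooth_on W (\<lambda>y. Dc y b c i j * psi b c a d)" for b c
    by (intro smooth_on_mult W Dc_smooth smooth_on_const)
  have dd: "\<partial> p (\<lambda>y. Dc y b c i j * psi b c a d) y = \<partial> p (\<lambda>y. Dc y b c i j) y * psi b c a d" for b c
    by (subst frame_deriv_mult[OF Dc_smooth smooth_on_const y]) simp
  have D: "\<partial> p (\<lambda>y. Dc y b c i j) y = D2c y p b c i j + (\<Sum>m\<in>UNIV. ?\<omega> b m * Dc y m c i j) + (\<Sum>m\<in>UNIV. ?\<omega> c m * Dc y b m i j)
    + (\<Sum>m\<in>UNIV. ?\<omega> i m * Dc y b c m j) + (\<Sum>m\<in>UNIV. ?\<omega> j m * Dc y b c i m)" for b c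
    by (simp add: frame_deriv_Dc[OF y] rot3_def)
  have "?S (\<lambda>b c. \<partial> p (\<lambda>y. Dc y b c i j) y * psi b c a d) = \<partial> p (\<lambda>y. ?S (\<lambda>b c. Dc y b c i j * psi b c a d)) y"
    by (simp add: frame_deriv_sum[OF _ y] smooth_on_sum[OF W] s dd)
  also have "\<dots> = \<partial> p (\<lambda>y. Dc y a d i j - Dc y d a i j) y"
    by (rule arg_cong[where f="\<lambda>h. h (e y p)"], rule fd_cong[OF W y sd])
  also have "\<dots> = \<partial> p (\<lambda>y. Dc y a d i j) y - \<partial> p (\<lambda>y. Dc y d a i j) y"
    by (intro fd_eqI has_derivative_diff has_derivative_fd smooth_on_differentiable[OF Dc_smooth y])
  finally have main: "?S (\<lambda>b c. \<partial> p (\<lambda>y. Dc y b c i j) y * psi b c a d) = \<partial> p (\<lambda>y. Dc y a d i j) y - \<partial> p (\<lambda>y. Dc y d a i j) y" .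
  have i: "?S (\<lambda>b c. (\<Sum>m\<in>UNIV. ?\<omega> i m * Dc y b c m j) * psi b c a d) = (\<Sum>m\<in>UNIV. ?\<omega> i m * (Dc y a d m j - Dc y d a m j))"
    unfolding sd[OF y, symmetric] sum_distrib_left sum_distrib_right by (subst sum3_312) (simp add: mult.assoc)
  have j: "?S (\<lambda>b c. (\<Sum>m\<in>UNIV. ?\<omega> j m * Dc y b c i m) * psi b c a d) = (\<Sum>m\<in>UNIV. ?\<omega> j m * (Dc y a d i m - Dc y d a i m))"
    unfolding sd[OF y, symmetric] sum_distrib_left sum_distrib_right by (subst sum3_312) (simp add: mult.assoc)
  have b: "?S (\<lambda>b c. (\<Sum>m\<in>UNIV. ?\<omega> b m * Dc y m c i j) * psi b c a d) = - ?S (\<lambda>b c. Dc y b c i j * (\<Sum>m\<in>UNIV. ?\<omega> b m * psi m c a d))"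
    by (subst (1 2) sum.swap) (simp add: sk sum_negf)
  have c: "?S (\<lambda>b c. (\<Sum>m\<in>UNIV. ?\<omega> c m * Dc y b m i j) * psi b c a d) = - ?S (\<lambda>b c. Dc y b c i j * (\<Sum>m\<in>UNIV. ?\<omega> c m * psi b m a d))"
    by (simp add: sk sum_negf)
  \<comment> \<open>Rotations of the summed indices are moved onto \<open>psi\<close> and from
    there, by \<open>conn_psi\<close>, to the free indices \<open>a\<close> and
    \<open>d\<close>.\<close>
  have "- ?S (\<lambda>b c. Dc y b c i j * (\<Sum>m\<in>UNIV. ?\<omega> b m * psi m c a d)) - ?S (\<lambda>b c. Dc y b c i j * (\<Sum>m\<in>UNIV. ?\<omega> c m * psi b m a d))
    = ?S (\<lambda>b c. Dc y b c i j * ((\<Sum>m\<in>UNIV. ?\<omega> a m * psi b c m d) + (\<Sum>m\<in>UNIV. ?\<omega> d m * psi b c a m)))"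
    unfolding sum_negf[symmetric] sum_subtractf[symmetric]
  proof (intro sum.cong refl)
    fix b c
    have Z: "(\<Sum>m\<in>UNIV. ?\<omega> a m * psi b c m d) + (\<Sum>m\<in>UNIV. ?\<omega> d m * psi b c a m) = - ((\<Sum>m\<in>UNIV. ?\<omega> b m * psi m c a d) + (\<Sum>m\<in>UNIV. ?\<omega> c m * psi b m a d))"
      using conn_psi[OF y, of p b c a d] by (simp add: psi_action_def sum.distrib)
    show "- (Dc y b c i j * (\<Sum>m\<in>UNIV. ?\<omega> b m * psi m c a d)) - Dc y b c i j * (\<Sum>m\<in>UNIV. ?\<omega> c m * psi b m a d)
      = Dc y b c i j * ((\<Sum>m\<in>UNIV. ?\<omega> a m * psi b c m d) + (\<Sum>m\<in>UNIV. ?\<omega> d m * psi b c a m))"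
      unfolding Z distrib_left minus_add_distrib mult_minus_right by simp
  qed
  also have "\<dots> = (\<Sum>m\<in>UNIV. ?\<omega> a m * ?S (\<lambda>b c. Dc y b c i j * psi b c m d)) + (\<Sum>m\<in>UNIV. ?\<omega> d m * ?S (\<lambda>b c. Dc y b c i j * psi b c a m))"
    unfolding sum_distrib_left distrib_left sum.distrib by (subst (1 2) sum3_312) (simp add: mult.left_commute)
  also have "\<dots> = (\<Sum>m\<in>UNIV. ?\<omega> a m * (Dc y m d i j - Dc y d m i j)) + (\<Sum>m\<in>UNIV. ?\<omega> d m * (Dc y a m i j - Dc y m a i j))"
    by (simp add: sd[OF y])
  finally have ad: "- ?S (\<lambda>b c. Dc y b c i j * (\<Sum>m\<in>UNIV. ?\<omega> b m * psi m c a d)) - ?S (\<lambda>b c. Dc y b c i j * (\<Sum>m\<in>UNIV. ?\<omega> c m * psi b m a d))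
    = (\<Sum>m\<in>UNIV. ?\<omega> a m * (Dc y m d i j - Dc y d m i j)) + (\<Sum>m\<in>UNIV. ?\<omega> d m * (Dc y a m i j - Dc y m a i j))" .
  show ?thesis
    using main ad unfolding D distrib_right sum.distrib b c i j
    by (simp add: right_diff_distrib sum_subtractf)
qed

lemma Dc_eq_0:
  assumes y: "y \<in> W"
  shows "Dc y p i j k = 0"
proof -
  interpret J: instanton_jet "Tc y" "Dc y" "Rc y" by (rule jet[OF y])
  show ?thesis
  proof (rule J.D_eq_0[OF D2c_ricci_id[OF y] D2c_closed[OF y] D2c_alt[OF y] _ div_D2c[OF y] _ self_dual_D2c[OF y]])
    show "J.dt i j = 0" for i j using dt_eq_0[OF y] by (simp add: J.dt_def)
    show "(\<Sum>p\<in>UNIV. \<Sum>i\<in>UNIV. \<Sum>j\<in>UNIV. \<Sum>k\<in>UNIV. Dc y p i j k * Dc y p i j k + Tc y i j k * D2c y p p i j k) = 0"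
      by (simp only: norm_D2c[OF y] sum.neutral_const)
  qed
qed

lemma nabla_T_eq_0: "y \<in> W \<Longrightarrow> length vs = 4 \<Longrightarrow> nabla \<Gamma> (torsion g \<Gamma>) y vs = 0"
proof (rule multilinear_eq_0[OF _ tensor_fieldD(1)[OF D_field]])
  fix "is" :: "8 list" assume "y \<in> W" "length is = 4"
  then show "nabla \<Gamma> (torsion g \<Gamma>) y (map (e y) is) = 0"
    using Dc_eq_0 by (auto simp: length_Suc_conv eval_nat_numeral Dc_def)
qed

end

subsection \<open>The exterior derivative of the torsion and the Ricci tensor\<close>
lemma sum_permutes_4:
  fixes F :: "nat \<Rightarrow> nat \<Rightarrow> nat \<Rightarrow> nat \<Rightarrow> real"
  shows "(\<Sum>\<sigma> | \<sigma> permutes {..<4}. of_int (sign \<sigma>) * F (\<sigma> 0) (\<sigma> 1) (\<sigma> 2) (\<sigma> 3)) =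
    F 0 1 2 3 - F 1 0 2 3 - F 0 1 3 2 + F 1 0 3 2 - (F 0 2 1 3 - F 2 0 1 3 - F 0 2 3 1 + F 2 0 3 1)
    + (F 0 3 1 2 - F 3 0 1 2 - F 0 3 2 1 + F 3 0 2 1) + (F 1 2 0 3 - F 2 1 0 3 - F 1 2 3 0 + F 2 1 3 0)
    - (F 1 3 0 2 - F 3 1 0 2 - F 1 3 2 0 + F 3 1 2 0) + (F 2 3 0 1 - F 3 2 0 1 - F 2 3 1 0 + F 3 2 1 0)"
proof -
  have "{..<4} = {0, 1, 2, 3 :: nat}" by auto
  then show ?thesis
    by (simp add: sum_over_permutations_insert Transposition.transpose_def sign_compose sign_swap_id permutation_swap_id permutation_compose permutation_id sign_id)
qed

text \<open>Each of the three splittings into two pairs arises from eight of the 24 permutations;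
  division by \<open>fact 2 * fact 2\<close> leaves the factor 2.\<close>

lemma wedge_2_2:
  assumes skew: "\<And>u v. \<beta> [v, u] = - \<beta> [u, v]"
  shows "wedge 2 2 \<beta> \<beta> [X, Y, Z, V] = 2 * (\<beta> [X, Y] * \<beta> [Z, V] - \<beta> [X, Z] * \<beta> [Y, V] + \<beta> [X, V] * \<beta> [Y, Z])"
proof -
  let ?vs = "[X, Y, Z, V]"
  have m: "map (\<lambda>i. ?vs ! \<sigma> i) [0..<2] = [?vs ! \<sigma> 0, ?vs ! \<sigma> 1]"
    "map (\<lambda>i. ?vs ! \<sigma> i) [2..<2 + 2] = [?vs ! \<sigma> 2, ?vs ! \<sigma> 3]" for \<sigma> :: "nat \<Rightarrow> nat"
    by (simp_all add: upt_rec)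
  have s: "\<beta> [Y, X] = - \<beta> [X, Y]" "\<beta> [Z, X] = - \<beta> [X, Z]" "\<beta> [V, X] = - \<beta> [X, V]"
    "\<beta> [Z, Y] = - \<beta> [Y, Z]" "\<beta> [V, Y] = - \<beta> [Y, V]" "\<beta> [V, Z] = - \<beta> [Z, V]"
    by (rule skew)+
  have "(\<Sum>\<sigma> | \<sigma> permutes {..<4}. of_int (sign \<sigma>) * \<beta> [?vs ! \<sigma> 0, ?vs ! \<sigma> 1] * \<beta> [?vs ! \<sigma> 2, ?vs ! \<sigma> 3])
    = 8 * (\<beta> [X, Y] * \<beta> [Z, V] - \<beta> [X, Z] * \<beta> [Y, V] + \<beta> [X, V] * \<beta> [Y, Z])"
    using sum_permutes_4[of "\<lambda>a b c d. \<beta> [?vs ! a, ?vs ! b] * \<beta> [?vs ! c, ?vs ! d]"]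
    by (simp add: s mult.assoc eval_nat_numeral)
  then show ?thesis
    unfolding wedge_def m by (simp add: fact_numeral)
qed

context spin7_chart
begin

lemma orthonormal_e: "y \<in> W \<Longrightarrow> orthonormal_frame (g y) (e y)"
  by (simp add: orthonormal_frame_def g_e \<epsilon>_e)

lemma orthonormal_some_frame: "y \<in> W \<Longrightarrow> orthonormal_frame (g y) (some_frame (g y))"
  unfolding some_frame_def using orthonormal_e by (rule someI[of "orthonormal_frame (g y)"])

text \<open>\<open>some_frame\<close> is an arbitrary choice, so traces are carried over to
  \<open>e\<close>. The transition matrix is orthogonal, and its right inverse is also a left
  inverse.\<close>

lemma orthonormal_trace:
  assumes y: "y \<in> W" and f: "orthonormal_frame (g y) f"
    and l: "\<And>v. linear (\<lambda>u. b u v)" "\<And>u. linear (b u)"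
  shows "(\<Sum>a\<in>UNIV. b (f a) (f a)) = (\<Sum>a\<in>UNIV. b (e y a) (e y a :: r8) :: real)"
proof -
  define Q where "Q = (\<chi> a i. \<epsilon> y i (f a))"
  have "Q ** Finite_Cartesian_Product.transpose Q = mat 1"
    using f by (simp add: Q_def matrix_matrix_mult_def Finite_Cartesian_Product.transpose_def mat_def vec_eq_iff orthonormal_frame_def g_eq[OF y])
  then have "Finite_Cartesian_Product.transpose Q ** Q = mat 1"
    by (simp add: matrix_left_right_inverse)
  then have O: "(\<Sum>a\<in>UNIV. \<epsilon> y i (f a) * \<epsilon> y j (f a)) = (if i = j then 1 else 0)" for i j
    by (simp add: Q_def matrix_matrix_mult_def Finite_Cartesian_Product.transpose_def mat_def vec_eq_iff)
  have "b (f a) (f a) = (\<Sum>i\<in>UNIV. \<Sum>j\<in>UNIV. (\<epsilon> y i (f a) * \<epsilon> y j (f a)) * b (e y i) (e y j))" for a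
  proof -
    have 1: "b u v = (\<Sum>i\<in>UNIV. \<epsilon> y i u * b (e y i) v)" for u v
      by (subst expand[OF y, of u]) (simp add: linear_sum[OF l(1)] linear_scale[OF l(1)])
    have 2: "b u v = (\<Sum>j\<in>UNIV. \<epsilon> y j v * b u (e y j))" for u v
      by (subst expand[OF y, of v]) (simp add: linear_sum[OF l(2)] linear_scale[OF l(2)])
    show ?thesis
      by (subst 1, subst 2) (simp add: sum_distrib_left mult.assoc)
  qed
  then have "(\<Sum>a\<in>UNIV. b (f a) (f a)) = (\<Sum>a\<in>UNIV. \<Sum>i\<in>UNIV. \<Sum>j\<in>UNIV. (\<epsilon> y i (f a) * \<epsilon> y j (f a)) * b (e y i) (e y j))"
    by simp
  also have "\<dots> = (\<Sum>i\<in>UNIV. \<Sum>j\<in>UNIV. (\<Sum>a\<in>UNIV. \<epsilon> y i (f a) * \<epsilon> y j (f a)) * b (e y i) (e y j))"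
    unfolding sum_distrib_right by (rule sum3_312)
  also have "\<dots> = (\<Sum>a\<in>UNIV. b (e y a) (e y a))"
    by (simp add: O if_distrib[of "\<lambda>c. c * _"] cong: if_cong)
  finally show ?thesis .
qed

definition torsion_pairing :: "r8 \<Rightarrow> r8 \<Rightarrow> r8 \<Rightarrow> r8 \<Rightarrow> r8 \<Rightarrow> real" where
  "torsion_pairing y u v z a = g y [tor \<Gamma> y u v, tor \<Gamma> y z a]"

lemma g_sym: "y \<in> W \<Longrightarrow> g y [u, v] = g y [v, u]"
  by (simp add: g_eq mult.commute)

lemma T_perm3:
  assumes y: "y \<in> W"
  defines "T \<equiv> torsion g \<Gamma> y"
  shows "T [v, u, z] = - T [u, v, z]" "T [u, z, v] = - T [u, v, z]" "T [v, z, u] = T [u, v, z]" "T [z, u, v] = T [u, v, z]"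
proof -
  show 1: "T [v, u, z] = - T [u, v, z]" for u v z
    using is_form_swap[OF T_form[OF y], of "[0, 0, z]" 0 1 v u] by (simp add: T_def numeral_3_eq_3)
  show 2: "T [u, z, v] = - T [u, v, z]" for u v z
    using is_form_swap[OF T_form[OF y], of "[u, 0, 0]" 1 2 z v] by (simp add: T_def numeral_3_eq_3 numeral_2_eq_2)
  show "T [v, z, u] = T [u, v, z]" "T [z, u, v] = T [u, v, z]"
    using 1[of u v z] 2[of v z u] 1[of z u v] 2[of u v z] by simp_all
qed

lemma T_tor: "y \<in> W \<Longrightarrow> torsion g \<Gamma> y [tor \<Gamma> y u v, z, a] = torsion_pairing y u v z a"
  using T_perm3(3)[of y z a "tor \<Gamma> y u v"] by (simp add: torsion_eq torsion_pairing_def g_sym)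

lemma sigma_T_eq:
  assumes y: "y \<in> W"
  shows "sigma_T g \<Gamma> y [X, Y, Z, V] = torsion_pairing y X Y Z V - torsion_pairing y X Z Y V + torsion_pairing y X V Y Z"
proof -
  let ?f = "some_frame (g y)" and ?T = "torsion g \<Gamma> y"
  have l: "linear (\<lambda>u. ?T [u, a, b])" for a b
    using multilinearD[OF tensor_fieldD(1)[OF T_field y], of "[0, a, b]" 0] by simp
  have tr: "(\<Sum>j\<in>UNIV. ?T [?f j, a, b] * ?T [?f j, c, d]) = torsion_pairing y a b c d" for a b c d
  proof -
    have "linear (\<lambda>u. ?T [u, a, b] * r)" "linear (\<lambda>u. r * ?T [u, c, d])" for r
      using linear_compose_scale_right[OF l, of r] by (simp_all add: mult.commute)
    then have "(\<Sum>j\<in>UNIV. ?T [?f j, a, b] * ?T [?f j, c, d]) = (\<Sum>j\<in>UNIV. ?T [e y j, a, b] * ?T [e y j, c, d])"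
      by (intro orthonormal_trace[OF y orthonormal_some_frame[OF y]])
    also have "\<dots> = (\<Sum>j\<in>UNIV. \<epsilon> y j (tor \<Gamma> y a b) * \<epsilon> y j (tor \<Gamma> y c d))"
    proof (intro sum.cong refl)
      fix j
      have "?T [e y j, a, b] = \<epsilon> y j (tor \<Gamma> y a b)" for a b
        using T_perm3(3)[OF y, of a b "e y j"] by (simp add: torsion_eq g_e[OF y])
      then show "?T [e y j, a, b] * ?T [e y j, c, d] = \<epsilon> y j (tor \<Gamma> y a b) * \<epsilon> y j (tor \<Gamma> y c d)"
        by simp
    qed
    finally show ?thesis by (simp add: torsion_pairing_def g_eq[OF y])
  qed
  have "sigma_T g \<Gamma> y [X, Y, Z, V] = (1 / 2) * (\<Sum>j\<in>UNIV. 2 * (?T [?f j, X, Y] * ?T [?f j, Z, V]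
     - ?T [?f j, X, Z] * ?T [?f j, Y, V] + ?T [?f j, X, V] * ?T [?f j, Y, Z]))"
    unfolding sigma_T_def Let_def
    by (intro arg_cong2[where f="(*)"] sum.cong refl wedge_2_2) (rule T_perm3(2)[OF y])
  then show ?thesis
    by (simp add: sum.distrib sum_subtractf tr flip: sum_distrib_left)
qed

text \<open>The covariant derivatives make up \<open>d_nabla_T\<close>. The connection terms combine
  in twos into the torsion of two arguments, one for each of the six pairs among four, and
  complementary pairs give the same value.\<close>

lemma ext_d_torsion:
  assumes y: "y \<in> W"
  shows "ext_d (torsion g \<Gamma>) y [X, Y, Z, V] = d_nabla_T g \<Gamma> y [X, Y, Z, V]
    + 2 * (torsion_pairing y X Y Z V - torsion_pairing y X Z Y V + torsion_pairing y X V Y Z)"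
proof -
  let ?T = "torsion g \<Gamma>" and ?G = "\<Gamma> y"
  let ?D = "nabla \<Gamma> ?T y"
  have d: "fd (\<lambda>y. ?T y [b, c, d]) y a = ?D [a, b, c, d] + ?T y [?G a b, c, d] + ?T y [b, ?G a c, d] + ?T y [b, c, ?G a d]" for a b c d
    by (simp add: nabla_Cons lessThan_Suc numeral_3_eq_3)
  have D: "?D [a, c, b, d] = - ?D [a, b, c, d]" for a b c d
    using is_form_swap[OF is_form_nabla[OF W \<Gamma> T_field T_form y], of "[0, 0, d]" 0 1 a c b] by (simp add: numeral_3_eq_3)
  have t: "?T y [tor \<Gamma> y a b, c, d] = ?T y [?G a b, c, d] - ?T y [?G b a, c, d]" for a b c d
    using multilinear_add(2)[OF tensor_fieldD(1)[OF T_field y], of "[0, c, d]" 0] by (simp add: tor_def)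
  have torsion_pairing: "torsion_pairing y a b c d = ?T y [?G a b, c, d] - ?T y [?G b a, c, d]" for a b c d
    using T_tor[OF y] t by simp
  have sym: "torsion_pairing y a b c d = torsion_pairing y c d a b" for a b c d
    by (simp add: torsion_pairing_def g_sym[OF y])
  have "2 * (torsion_pairing y X Y Z V - torsion_pairing y X Z Y V + torsion_pairing y X V Y Z)
    = torsion_pairing y X Y Z V + torsion_pairing y Z V X Y - torsion_pairing y X Z Y V - torsion_pairing y Y V X Z + torsion_pairing y X V Y Z + torsion_pairing y Y Z X V"
    using sym[of Z V X Y] sym[of Y V X Z] sym[of Y Z X V] by simp
  then show ?thesis
    unfolding torsion_pairing d_nabla_T_def ext_d_def
    using D[of Y Z X V]
      T_perm3(1)[OF y, of Y "?G X Z" V] T_perm3(3)[OF y, of Y Z "?G X V"]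
      T_perm3(1)[OF y, of X "?G Y Z" V] T_perm3(3)[OF y, of X Z "?G Y V"]
      T_perm3(1)[OF y, of X "?G Z Y" V] T_perm3(3)[OF y, of X Y "?G Z V"]
      T_perm3(1)[OF y, of X "?G V Y" Z] T_perm3(3)[OF y, of X Y "?G V Z"]
    by (simp add: Let_def lessThan_Suc d eval_nat_numeral)
qed

end

section \<open>Parallelism of the Ricci tensor and of dT\<close>

lemma linear_fd:
  fixes f :: "r8 \<Rightarrow> r8 \<Rightarrow> r8"
  assumes W: "open W" "x \<in> W" and l: "\<And>y. y \<in> W \<Longrightarrow> linear (f y)" and d: "\<And>v. (\<lambda>y. f y v) differentiable (at x)"
  shows "linear (\<lambda>v. fd (\<lambda>y. f y v) x u)"
proof
  fix a b and r :: real
  have "fd (\<lambda>y. f y (a + b)) x u = fd (\<lambda>y. f y a + f y b) x u"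
    by (subst fd_cong[OF W, of _ "\<lambda>y. f y a + f y b"]) (simp_all add: linear_add[OF l])
  then show "fd (\<lambda>y. f y (a + b)) x u = fd (\<lambda>y. f y a) x u + fd (\<lambda>y. f y b) x u"
    by (simp add: fd_eqI[OF has_derivative_add[OF has_derivative_fd[OF d] has_derivative_fd[OF d]]])
  have "fd (\<lambda>y. f y (r *\<^sub>R a)) x u = fd (\<lambda>y. r *\<^sub>R f y a) x u"
    by (subst fd_cong[OF W, of _ "\<lambda>y. r *\<^sub>R f y a"]) (simp_all add: linear_scale[OF l])
  then show "fd (\<lambda>y. f y (r *\<^sub>R a)) x u = r *\<^sub>R fd (\<lambda>y. f y a) x u"
    by (simp add: fd_eqI[OF has_derivative_scaleR_right[OF has_derivative_fd[OF d]]])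
qed

definition rot4 :: "(8 \<Rightarrow> 8 \<Rightarrow> real) \<Rightarrow> (8 \<Rightarrow> 8 \<Rightarrow> 8 \<Rightarrow> 8 \<Rightarrow> real) \<Rightarrow> 8 \<Rightarrow> 8 \<Rightarrow> 8 \<Rightarrow> 8 \<Rightarrow> real" where
  "rot4 \<omega> X i j k l = (\<Sum>m\<in>UNIV. \<omega> i m * X m j k l) + (\<Sum>m\<in>UNIV. \<omega> j m * X i m k l)
     + (\<Sum>m\<in>UNIV. \<omega> k m * X i j m l) + (\<Sum>m\<in>UNIV. \<omega> l m * X i j k m)"

context spin7_chart
begin

lemma curv_op_linear:
  assumes y: "y \<in> W"
  shows "linear (\<lambda>u. curv_op \<Gamma> y u v z)" "linear (\<lambda>v. curv_op \<Gamma> y u v z)" "linear (\<lambda>z. curv_op \<Gamma> y u v z)"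
proof -
  note G = smooth_connectionD[OF \<Gamma>]
  have d: "(\<lambda>y. \<Gamma> y u v) differentiable (at y)" for u v
    by (rule smooth_on_differentiable[OF G(3) y])
  have 1: "linear (fd (\<lambda>y. \<Gamma> y v z) y)" for v z
    by (rule linear_frechet_derivative[OF d])
  have 2: "linear (\<lambda>v. fd (\<lambda>y. \<Gamma> y v z) y u)" for u z
    by (rule linear_fd[OF W y G(1) d])
  have 3: "linear (\<lambda>z. fd (\<lambda>y. \<Gamma> y v z) y u)" for u v
    by (rule linear_fd[OF W y G(2) d])
  have 4: "linear (\<lambda>u. \<Gamma> y v (\<Gamma> y u z))" "linear (\<lambda>z. \<Gamma> y v (\<Gamma> y u z))" for u v z
    using linear_compose[OF G(1)[OF y] G(2)[OF y]] linear_compose[OF G(2)[OF y] G(2)[OF y]] by (simp_all add: o_def)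
  show "linear (\<lambda>u. curv_op \<Gamma> y u v z)" "linear (\<lambda>v. curv_op \<Gamma> y u v z)" "linear (\<lambda>z. curv_op \<Gamma> y u v z)"
    unfolding curv_op_def by (intro linear_compose_add linear_compose_sub 1 2 3 4 G(1)[OF y])+
qed

lemma ricci_eq:
  assumes y: "y \<in> W"
  shows "ricci g \<Gamma> y [u, v] = (\<Sum>i\<in>UNIV. \<Sum>j\<in>UNIV. \<epsilon> y i u * \<epsilon> y j v * (\<Sum>a\<in>UNIV. Rc y a i j a))"
proof -
  have g: "linear (\<lambda>u. g y [u, b])" "linear (\<lambda>u. g y [b, u])" for b
    using multilinearD[OF tensor_fieldD(1)[OF g_field y], of "[0, b]" 0]
      multilinearD[OF tensor_fieldD(1)[OF g_field y], of "[b, 0]" 1] by simp_all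
  let ?C = "curvature g \<Gamma> y"
  have l: "linear (\<lambda>a. ?C [a, u, v, b])" "linear (\<lambda>b. ?C [a, u, v, b])" "linear (\<lambda>u. ?C [a, u, v, b])" "linear (\<lambda>v. ?C [a, u, v, b])" for a b u v
    unfolding curvature_eq[OF \<Gamma> y]
    using linear_compose[OF curv_op_linear(1)[OF y] g(1)] linear_compose[OF curv_op_linear(2)[OF y] g(1)]
      linear_compose[OF curv_op_linear(3)[OF y] g(1)] g(2) by (simp_all add: o_def)
  have 1: "?C [a, u, v, b] = (\<Sum>i\<in>UNIV. \<epsilon> y i u * ?C [a, e y i, v, b])" for a u v b
    by (subst expand[OF y, of u]) (simp add: linear_sum[OF l(3)] linear_scale[OF l(3)])
  have 2: "?C [a, u, v, b] = (\<Sum>j\<in>UNIV. \<epsilon> y j v * ?C [a, u, e y j, b])" for a u v b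
    by (subst expand[OF y, of v]) (simp add: linear_sum[OF l(4)] linear_scale[OF l(4)])
  have "ricci g \<Gamma> y [u, v] = (\<Sum>a\<in>UNIV. ?C [e y a, u, v, e y a])"
    using orthonormal_trace[OF y orthonormal_some_frame[OF y], of "\<lambda>a b. ?C [a, u, v, b]"] l by (simp add: ricci_def)
  also have "\<dots> = (\<Sum>a\<in>UNIV. \<Sum>i\<in>UNIV. \<Sum>j\<in>UNIV. \<epsilon> y i u * \<epsilon> y j v * Rc y a i j a)"
    by (subst 1, subst 2) (simp add: Rc_def sum_distrib_left mult.assoc)
  also have "\<dots> = (\<Sum>i\<in>UNIV. \<Sum>j\<in>UNIV. \<Sum>a\<in>UNIV. \<epsilon> y i u * \<epsilon> y j v * Rc y a i j a)"
    by (rule sum3_312)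
  finally show ?thesis by (simp add: sum_distrib_left)
qed

text \<open>The common building block: for parallel torsion both the Ricci tensor and dT are linear
  in \<open>Qc\<close>.\<close>

definition Qc where "Qc y i j k l = (\<Sum>m\<in>UNIV. Tc y i j m * Tc y m k l)"

lemma Qc_smooth: "smooth_on W (\<lambda>y. Qc y i j k l)"
  unfolding Qc_def by (intro smooth_on_sum smooth_on_mult Tc_smooth W)

lemma torsion_pairing_eq_Qc: "y \<in> W \<Longrightarrow> torsion_pairing y (e y i) (e y j) (e y k) (e y l) = Qc y i j k l"
proof -
  assume y: "y \<in> W"
  have "Tc y k l m = Tc y m k l" for m
    by (rule alternating3D(4)[OF Tc_alt[OF y]])
  then show ?thesis
    by (simp add: torsion_pairing_def g_eq[OF y] \<epsilon>_tor[OF y] Qc_def)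
qed

end

context closed_instanton_chart
begin

text \<open>With \<open>Dc\<close> zero the product rule leaves rotations only, and those of the
  summed index cancel; in components this says that \<open>Qc\<close> is parallel.\<close>

lemma frame_deriv_Qc:
  assumes y: "y \<in> W"
  shows "\<partial> p (\<lambda>y. Qc y i j k l) y = rot4 (conn y p) (Qc y) i j k l"
proof -
  let ?\<omega> = "conn y p" and ?T = "Tc y"
  have s: "smooth_on W (\<lambda>y. Tc y i j m * Tc y m k l)" for m
    by (intro smooth_on_mult Tc_smooth W)
  have "\<partial> p (\<lambda>y. Qc y i j k l) y = (\<Sum>m\<in>UNIV. \<partial> p (\<lambda>y. Tc y i j m * Tc y m k l) y)"
    unfolding Qc_def by (rule frame_deriv_sum[OF s y])
  also have "\<dots> = (\<Sum>m\<in>UNIV. ?T i j m * rot3 ?\<omega> ?T m k l + rot3 ?\<omega> ?T i j m * ?T m k l)"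
    by (simp add: frame_deriv_mult[OF Tc_smooth Tc_smooth y] frame_deriv_Tc[OF y] Dc_eq_0[OF y])
  also have "\<dots> = (\<Sum>m\<in>UNIV. (\<Sum>n\<in>UNIV. ?\<omega> i n * ?T n j m) * ?T m k l) + (\<Sum>m\<in>UNIV. (\<Sum>n\<in>UNIV. ?\<omega> j n * ?T i n m) * ?T m k l)
     + (\<Sum>m\<in>UNIV. ?T i j m * (\<Sum>n\<in>UNIV. ?\<omega> k n * ?T m n l)) + (\<Sum>m\<in>UNIV. ?T i j m * (\<Sum>n\<in>UNIV. ?\<omega> l n * ?T m k n))
     + ((\<Sum>m\<in>UNIV. (\<Sum>n\<in>UNIV. ?\<omega> m n * ?T i j n) * ?T m k l) + (\<Sum>m\<in>UNIV. ?T i j m * (\<Sum>n\<in>UNIV. ?\<omega> m n * ?T n k l)))"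
    unfolding rot3_def distrib_left distrib_right sum.distrib by simp
  also have "(\<Sum>m\<in>UNIV. (\<Sum>n\<in>UNIV. ?\<omega> m n * ?T i j n) * ?T m k l) + (\<Sum>m\<in>UNIV. ?T i j m * (\<Sum>n\<in>UNIV. ?\<omega> m n * ?T n k l)) = 0"
    using skew_contract[where \<omega>="?\<omega>" and X="?T i j" and Y="\<lambda>m. ?T m k l", OF conn_skew[OF y]] by simp
  also have "(\<Sum>m\<in>UNIV. (\<Sum>n\<in>UNIV. ?\<omega> i n * ?T n j m) * ?T m k l) = (\<Sum>n\<in>UNIV. ?\<omega> i n * Qc y n j k l)"
    unfolding Qc_def sum_distrib_right sum_distrib_left mult.assoc by (rule sum.swap)
  also have "(\<Sum>m\<in>UNIV. (\<Sum>n\<in>UNIV. ?\<omega> j n * ?T i n m) * ?T m k l) = (\<Sum>n\<in>UNIV. ?\<omega> j n * Qc y i n k l)"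
    unfolding Qc_def sum_distrib_right sum_distrib_left mult.assoc by (rule sum.swap)
  also have "(\<Sum>m\<in>UNIV. ?T i j m * (\<Sum>n\<in>UNIV. ?\<omega> k n * ?T m n l)) = (\<Sum>n\<in>UNIV. ?\<omega> k n * Qc y i j n l)"
    unfolding Qc_def sum_distrib_left by (subst sum.swap) (simp add: mult.left_commute)
  also have "(\<Sum>m\<in>UNIV. ?T i j m * (\<Sum>n\<in>UNIV. ?\<omega> l n * ?T m k n)) = (\<Sum>n\<in>UNIV. ?\<omega> l n * Qc y i j k n)"
    unfolding Qc_def sum_distrib_left by (subst sum.swap) (simp add: mult.left_commute)
  finally show ?thesis by (simp add: rot4_def)
qed

definition Zc where "Zc y j v = psi_trace (\<lambda>a b c. Qc y a b c v) j"

lemma Zc_smooth: "smooth_on W (\<lambda>y. Zc y j v)"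
  unfolding Zc_def by (rule psi_trace_smooth[OF Qc_smooth])

lemma frame_deriv_Zc:
  assumes y: "y \<in> W"
  shows "\<partial> p (\<lambda>y. Zc y j v) y = (\<Sum>m\<in>UNIV. conn y p j m * Zc y m v) + (\<Sum>m\<in>UNIV. conn y p v m * Zc y j m)"
proof -
  have "\<partial> p (\<lambda>y. Zc y j v) y = psi_trace (\<lambda>a b c. \<Sum>m\<in>UNIV. conn y p v m * Qc y a b c m) j
    + (\<Sum>m\<in>UNIV. conn y p j m * Zc y m v)"
    unfolding Zc_def
    by (rule frame_deriv_psi_trace[where X="\<lambda>y a b c. Qc y a b c v", OF Qc_smooth y])
      (simp add: frame_deriv_Qc[OF y] rot4_def rot3_def)
  also have "psi_trace (\<lambda>a b c. \<Sum>m\<in>UNIV. conn y p v m * Qc y a b c m) j = (\<Sum>m\<in>UNIV. conn y p v m * Zc y j m)"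
    unfolding psi_trace_def Zc_def sum_distrib_left sum_distrib_right mult.assoc
    by (simp only: sum.cartesian_product,
        rule sum.reindex_bij_witness[of _ "\<lambda>(m, a, b, c). (a, b, c, m)" "\<lambda>(a, b, c, m). (m, a, b, c)"]) auto
  finally show ?thesis by simp
qed

text \<open>\<open>J.\<rho>_eq\<close> without its \<open>dt\<close> term. The minus sign comes from
  \<open>\<rho>\<close>, which has the contracted indices of the curvature in the opposite
  order.\<close>

lemma Rc_trace:
  assumes y: "y \<in> W"
  shows "(\<Sum>a\<in>UNIV. Rc y a i j a) = - Zc y i j / 2"
proof -
  interpret J: instanton_jet "Tc y" "Dc y" "Rc y" by (rule jet[OF y])
  have "6 * J.\<rho> i j = 3 * Zc y i j"
    using J.\<rho>_eq[of i j] dt_eq_0[OF y, of j i] by (simp add: J.dt_def J.Z_def Zc_def psi_trace_def Qc_def)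
  moreover have "J.\<rho> i j = - (\<Sum>a\<in>UNIV. Rc y a i j a)"
    unfolding J.\<rho>_def sum_negf[symmetric] by (intro sum.cong refl) (rule Rc_skew2[OF y])
  ultimately show ?thesis by simp
qed

text \<open>For parallel torsion \<open>A\<close> is zero, so the curvature is symmetric under
  exchange of its pairs.\<close>

lemma ricci_sym:
  assumes y: "y \<in> W"
  shows "ricci g \<Gamma> y [u, v] = ricci g \<Gamma> y [v, u]"
proof -
  interpret J: instanton_jet "Tc y" "Dc y" "Rc y" by (rule jet[OF y])
  have "Rc y a i j a = Rc y a j i a" for a i j
    using J.A_eq[of a i j a] Rc_skew1[OF y, of j a a i] Rc_skew2[OF y, of a j i a] by (simp add: J.A_def Dc_eq_0[OF y])
  then show ?thesis
    unfolding ricci_eq[OF y] by (subst sum.swap) (simp add: mult.commute)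
qed

lemma nabla_ricci_eq_0:
  assumes y: "y \<in> W" and len: "length vs = 3"
  shows "nabla \<Gamma> (ricci g \<Gamma>) y vs = 0"
proof -
  \<comment> \<open>\<open>\<kappa>\<close> agrees with the Ricci tensor on \<open>W\<close> but is
    written with the smooth coframe and \<open>Zc\<close>, from which its regularity can be read
    off; \<open>nabla_cong\<close> transfers the result.\<close>
  define \<kappa> where "\<kappa> y vs = (\<Sum>i\<in>UNIV. \<Sum>j\<in>UNIV. \<epsilon> y i (vs ! 0) * \<epsilon> y j (vs ! 1) * (- Zc y i j / 2))" for y and vs :: "r8 list"
  have \<kappa>: "ricci g \<Gamma> y vs = \<kappa> y vs" if "y \<in> W" "length vs = 2" for y vs
  proof -
    obtain u v where "vs = [u, v]" using \<open>length vs = 2\<close> by (auto simp: length_Suc_conv numeral_2_eq_2)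
    then show ?thesis using ricci_eq[OF \<open>y \<in> W\<close>] by (simp add: \<kappa>_def Rc_trace[OF \<open>y \<in> W\<close>])
  qed
  have "linear (\<lambda>u. \<epsilon> y i u * c)" if "y \<in> W" for y i c
    using linear_compose_scale_right[OF \<epsilon>_linear[OF that, of i], of c] by (simp add: mult.commute)
  then have "linear (\<lambda>u. \<epsilon> y i u * (- (b * c / 2)))" if "y \<in> W" for y i b c
    using that by blast
  then have lin: "linear (\<lambda>u. - (\<epsilon> y i u * b * c / 2))" "linear (\<lambda>u. - (b * \<epsilon> y i u * c / 2))" if "y \<in> W" for y i b c
    using that by (simp_all add: mult.assoc mult.left_commute[of b])
  have field: "tensor_field W 2 \<kappa>"
    unfolding tensor_field_def multilinear_def \<kappa>_def
  proof (intro conjI ballI allI impI)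
    fix y and vs :: "r8 list" and i :: nat assume "y \<in> W" "length vs = 2" "i < 2"
    then show "linear (\<lambda>v. \<Sum>k\<in>UNIV. \<Sum>j\<in>UNIV. \<epsilon> y k (vs[i := v] ! 0) * \<epsilon> y j (vs[i := v] ! 1) * (- Zc y k j / 2))"
      using lin by (auto simp: less_2_cases_iff intro!: linear_compose_sum)
  next
    fix vs :: "r8 list"
    have "smooth_on W (\<lambda>y. (- 1 / 2) * Zc y i j)" for i j
      by (intro smooth_on_mult smooth_on_const Zc_smooth W)
    then show "smooth_on W (\<lambda>y. \<Sum>i\<in>UNIV. \<Sum>j\<in>UNIV. \<epsilon> y i (vs ! 0) * \<epsilon> y j (vs ! 1) * (- Zc y i j / 2))"
      by (intro smooth_on_sum smooth_on_mult W \<epsilon>_smooth) simp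
  qed
  have comp: "\<kappa> y [e y i, e y j] = - Zc y i j / 2" if "y \<in> W" for y i j
    by (simp add: \<kappa>_def \<epsilon>_e[OF that] if_distrib[of "\<lambda>c. c * _"] if_distrib[of "(*) _"] if_distrib[of "\<lambda>c. - (c / 2)"] cong: if_cong)
  have "nabla \<Gamma> \<kappa> y (map (e y) [p, i, j]) = 0" for p i j
  proof -
    have "\<partial> p (\<lambda>y. \<kappa> y (map (e y) [i, j])) y = \<partial> p (\<lambda>y. (- 1 / 2) * Zc y i j) y"
      by (subst fd_cong[OF W y, of _ "\<lambda>y. (- 1 / 2) * Zc y i j"]) (simp_all add: comp)
    also have "\<dots> = - \<partial> p (\<lambda>y. Zc y i j) y / 2"
      by (subst frame_deriv_mult[OF smooth_on_const Zc_smooth y]) simp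
    finally show ?thesis
      using frame_deriv_components[OF field y, of "[i, j]" p]
      by (simp add: frame_deriv_Zc[OF y] numeral_2_eq_2 lessThan_Suc comp[OF y] sum_negf flip: sum_divide_distrib)
  qed
  then have "nabla \<Gamma> \<kappa> y (map (e y) is) = 0" if "length is = 3" for "is"
    using that by (auto simp: length_Suc_conv numeral_3_eq_3)
  then have "nabla \<Gamma> \<kappa> y vs = 0"
    using multilinear_eq_0[OF y tensor_fieldD(1)[OF tensor_field_nabla[OF W \<Gamma> field] y]] len by simp
  moreover have "nabla \<Gamma> (ricci g \<Gamma>) y vs = nabla \<Gamma> \<kappa> y vs"
    using nabla_cong[OF W y \<kappa>] len by (cases vs) auto
  ultimately show ?thesis by simp
qed

lemma nabla_dT_eq_0:
  assumes y: "y \<in> W" and len: "length vs = 5"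
  shows "nabla \<Gamma> (ext_d (torsion g \<Gamma>)) y vs = 0"
proof -
  let ?\<kappa> = "ext_d (torsion g \<Gamma>)"
  \<comment> \<open>Since \<open>d_nabla_T\<close> vanishes, dT is purely quadratic in the torsion,
    so no derivative of \<open>\<Gamma>\<close> has to be controlled.\<close>
  have \<kappa>: "?\<kappa> y [a, b, c, d] = 2 * (torsion_pairing y a b c d - torsion_pairing y a c b d + torsion_pairing y a d b c)" if "y \<in> W" for y a b c d
    using ext_d_torsion[OF that] d_nabla_T_0[OF that] by simp
  have lin: "linear (\<lambda>a. torsion_pairing y a b c d)" "linear (\<lambda>b. torsion_pairing y a b c d)" "linear (\<lambda>c. torsion_pairing y a b c d)" "linear (\<lambda>d. torsion_pairing y a b c d)"
    if y: "y \<in> W" for y a b c d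
  proof -
    have t: "linear (\<lambda>u. tor \<Gamma> y u v)" "linear (\<lambda>u. tor \<Gamma> y v u)" for v
      unfolding tor_def using smooth_connectionD(1,2)[OF \<Gamma> y] by (auto intro!: linear_compose_sub)
    have g: "linear (\<lambda>u. g y [u, b])" "linear (\<lambda>u. g y [b, u])" for b
      using multilinearD[OF tensor_fieldD(1)[OF g_field y], of "[0, b]" 0]
        multilinearD[OF tensor_fieldD(1)[OF g_field y], of "[b, 0]" 1] by simp_all
    show "linear (\<lambda>a. torsion_pairing y a b c d)" "linear (\<lambda>b. torsion_pairing y a b c d)" "linear (\<lambda>c. torsion_pairing y a b c d)" "linear (\<lambda>d. torsion_pairing y a b c d)"
      unfolding torsion_pairing_def using linear_compose[OF t(1) g(1)] linear_compose[OF t(2) g(1)]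
        linear_compose[OF t(1) g(2)] linear_compose[OF t(2) g(2)] by (simp_all add: o_def)
  qed
  have s2: "linear (\<lambda>v. 2 * f v)" if "linear f" for f :: "r8 \<Rightarrow> real"
    using linear_compose_scale_right[OF that, of 2] by simp
  have field: "tensor_field W 4 ?\<kappa>"
    unfolding tensor_field_def multilinear_def
  proof (intro conjI ballI allI impI)
    fix y and vs :: "r8 list" and i :: nat assume y: "y \<in> W" and len: "length vs = 4" and i: "i < 4"
    obtain a b c d where vs: "vs = [a, b, c, d]"
      using len by (auto simp: length_Suc_conv eval_nat_numeral)
    have "i = 0 \<or> i = 1 \<or> i = 2 \<or> i = 3" using i by auto
    then show "linear (\<lambda>v. ?\<kappa> y (vs[i := v]))"
      using \<kappa>[OF y] unfolding vs
      by (elim disjE) (simp_all add: \<kappa>[OF y] eval_nat_numeral, (intro s2[simplified] linear_compose_add linear_compose_sub lin y)+)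
  next
    fix vs :: "r8 list" assume len: "length vs = 4"
    show "smooth_on W (\<lambda>y. ?\<kappa> y vs)"
      unfolding ext_d_def
      by (intro smooth_on_sum smooth_on_mult smooth_on_const W smooth_on_fd tensor_fieldD(2)[OF T_field]) (use len in simp)
  qed
  have comp: "?\<kappa> y [e y i, e y j, e y k, e y l] = 2 * (Qc y i j k l - Qc y i k j l + Qc y i l j k)" if "y \<in> W" for y i j k l
    by (simp add: \<kappa>[OF that] torsion_pairing_eq_Qc[OF that])
  have "nabla \<Gamma> ?\<kappa> y (map (e y) [p, i, j, k, l]) = 0" for p i j k l
  proof -
    have "\<partial> p (\<lambda>y. ?\<kappa> y (map (e y) [i, j, k, l])) y = \<partial> p (\<lambda>y. 2 * (Qc y i j k l - Qc y i k j l + Qc y i l j k)) y"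
      by (subst fd_cong[OF W y, of _ "\<lambda>y. 2 * (Qc y i j k l - Qc y i k j l + Qc y i l j k)"]) (simp_all add: comp)
    also have "\<dots> = 2 * (\<partial> p (\<lambda>y. Qc y i j k l) y - \<partial> p (\<lambda>y. Qc y i k j l) y + \<partial> p (\<lambda>y. Qc y i l j k) y)"
      by (intro fd_eqI has_derivative_mult_right has_derivative_add has_derivative_diff has_derivative_fd smooth_on_differentiable[OF Qc_smooth y])
    finally show ?thesis
      using frame_deriv_components[OF field y, of "[i, j, k, l]" p]
      by (simp add: frame_deriv_Qc[OF y] rot4_def eval_nat_numeral lessThan_Suc comp[OF y])
        (simp add: algebra_simps sum.distrib sum_subtractf sum_distrib_left)
  qed
  then have "nabla \<Gamma> ?\<kappa> y (map (e y) is) = 0" if "length is = 5" for "is"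
    using that by (auto simp: length_Suc_conv eval_nat_numeral)
  then show ?thesis
    using multilinear_eq_0[OF y tensor_fieldD(1)[OF tensor_field_nabla[OF W \<Gamma> field] y]] len by simp
qed

end

subsection \<open>The Lee form\<close>
lemma sum_lists_Suc:
  "(\<Sum>is | length is = Suc k. F is) = (\<Sum>i\<in>UNIV. \<Sum>is | length is = k. F (i # is :: 8 list) :: real)"
proof -
  have "{is :: 8 list. length is = Suc k} = (\<lambda>(i, is). i # is) ` (UNIV \<times> {is. length is = k})"
    by (auto simp: length_Suc_conv)
  moreover have "inj_on (\<lambda>(i, is). i # is) (UNIV \<times> {is :: 8 list. length is = k})"
    by (auto simp: inj_on_def)
  ultimately have "(\<Sum>is | length is = Suc k. F is) = (\<Sum>(i, is)\<in>UNIV \<times> {is. length is = k}. F (i # is))"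
    by (simp add: sum.reindex case_prod_beta')
  then show ?thesis
    by (simp add: sum.cartesian_product)
qed

lemma sum_lists_append:
  "(\<Sum>is | length is = m + n. F is) = (\<Sum>is | length is = m. \<Sum>js | length js = n. F (is @ js :: 8 list) :: real)"
  by (induction m arbitrary: F) (simp_all add: sum_lists_Suc)

lemma finite_lists [simp]: "finite {is :: 8 list. length is = n}"
  using finite_lists_length_eq[of "UNIV :: 8 set" n] by simp

section \<open>Alternating functions of index lists\<close>

definition alternating_list :: "nat \<Rightarrow> (8 list \<Rightarrow> real) \<Rightarrow> bool" where
  "alternating_list n \<eta> \<longleftrightarrow>
     (\<forall>J i j. length J = n \<longrightarrow> i < j \<longrightarrow> j < n \<longrightarrow> \<eta> (J[i := J ! j, j := J ! i]) = - \<eta> J)"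

lemma permute_list_transpose:
  assumes "i < length J" "j < length J"
  shows "permute_list (Transposition.transpose i j) J = J[i := J ! j, j := J ! i]"
proof (rule nth_equalityI)
  have "Transposition.transpose i j permutes {..<length J}"
    using assms by (simp add: permutes_swap_id)
  then show "permute_list (Transposition.transpose i j) J ! k = J[i := J ! j, j := J ! i] ! k"
    if "k < length (permute_list (Transposition.transpose i j) J)" for k
    using that assms by (auto simp: permute_list_nth nth_list_update Transposition.transpose_def)
qed simp

lemma alternating_list_permute:
  assumes \<eta>: "alternating_list n \<eta>" and "p permutes {..<n}" "length J = n"
  shows "\<eta> (permute_list p J) = of_int (sign p) * \<eta> J"
  using assms(2) finite_lessThan assms(3)
proof (induction p arbitrary: J rule: permutes_induct)
  case id
  then show ?case by simp
next
  case (swap a b p)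
  have "Transposition.transpose a b permutes {..<length J}"
    using swap by (simp add: permutes_swap_id)
  have s1: "sign (Transposition.transpose a b \<circ> p) = - sign p"
    using swap by (subst sign_compose) (auto simp: sign_swap_id permutation_swap_id intro: permutes_imp_permutation[of "{..<n}"])
  have s2: "permute_list (Transposition.transpose a b \<circ> p) J = permute_list p (permute_list (Transposition.transpose a b) J)"
    using swap by (subst permute_list_compose) simp_all
  have s3: "\<eta> (permute_list (Transposition.transpose a b) J) = - \<eta> J"
  proof (cases "a < b")
    case True
    then show ?thesis
      using \<eta> swap by (simp add: permute_list_transpose alternating_list_def)
  next
    case False
    then have "b < a" using swap by simp
    then show ?thesis
      using \<eta> swap by (subst Transposition.transpose_commute) (simp add: permute_list_transpose alternating_list_def)
  qed
  show ?case
    unfolding s1 s2 using swap s3 by simp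
qed

text \<open>The generalised Kronecker symbol: the sign relating two lists that are rearrangements of
  each other without repetition, and 0 otherwise.\<close>

definition cw_idx :: "8 list \<Rightarrow> 8 list \<Rightarrow> real" where
  "cw_idx ts is = covector_wedge (map (\<lambda>a v. v $ a) ts) (map (\<lambda>a. axis a 1 :: r8) is)"

lemma cw_idx_dual:
  assumes "dual_frames \<epsilon> e" "length ts = length is"
  shows "covector_wedge (map \<epsilon> ts) (map e is) = cw_idx ts is"
  unfolding cw_idx_def by (rule covector_wedge_dual[OF assms(1) dual_frames_axis assms(2)])

lemma cw_idx_swap:
  assumes "length ts = length J" "i < length J" "j < length J" "i \<noteq> j"
  shows "cw_idx ts (J[i := J ! j, j := J ! i]) = - cw_idx ts J"
  using covector_wedge_swap[of i "map (\<lambda>a. axis a 1 :: r8) J" j "map (\<lambda>a v. v $ a) ts"] assms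
  by (simp add: cw_idx_def map_update)

lemma alternating_list_cw_idx:
  assumes "length ts = length us + n + length ws"
  shows "alternating_list n (\<lambda>J. cw_idx ts (us @ J @ ws))"
  unfolding alternating_list_def
proof (intro allI impI)
  fix J :: "8 list" and i j assume J: "length J = n" "i < j" "j < n"
  have "us @ J[i := J ! j, j := J ! i] @ ws
    = (us @ J @ ws)[length us + i := (us @ J @ ws) ! (length us + j), length us + j := (us @ J @ ws) ! (length us + i)]"
    using J by (simp add: list_update_append nth_append)
  then show "cw_idx ts (us @ J[i := J ! j, j := J ! i] @ ws) = - cw_idx ts (us @ J @ ws)"
    using cw_idx_swap[of ts "us @ J @ ws" "length us + i" "length us + j"] assms J by simp
qed

text \<open>Only the rearrangements of \<open>ts\<close> contribute to the sum over all \<open>J\<close>, each with the same value.\<close>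

lemma sum_cw_idx:
  assumes \<eta>: "alternating_list n \<eta>" and ts: "length ts = n"
  shows "(\<Sum>J | length J = n. cw_idx ts J * \<eta> J) = fact n * \<eta> ts"
proof -
  have one: "(\<Sum>J | length J = n. (\<Prod>m<n. if ts ! m = J ! \<sigma> m then 1 else 0) * \<eta> J) = of_int (sign \<sigma>) * \<eta> ts"
    if \<sigma>: "\<sigma> permutes {..<n}" for \<sigma>
  proof -
    have inv: "inv \<sigma> permutes {..<n}" by (rule permutes_inv[OF \<sigma>])
    let ?J = "permute_list (inv \<sigma>) ts"
    have "(\<Prod>m<n. if ts ! m = J ! \<sigma> m then 1 else (0 :: real)) = (if J = ?J then 1 else 0)" if J: "length J = n" for J
    proof -
      have "(\<forall>m<n. ts ! m = J ! \<sigma> m) \<longleftrightarrow> J = ?J"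
      proof
        assume a: "\<forall>m<n. ts ! m = J ! \<sigma> m"
        show "J = ?J"
        proof (rule nth_equalityI)
          fix k assume "k < length J"
          then have "inv \<sigma> k < n" "\<sigma> (inv \<sigma> k) = k"
            using permutes_in_image[OF inv, of k] permutes_inverses(1)[OF \<sigma>] J by auto
          then show "J ! k = ?J ! k"
            using a inv ts J \<open>k < length J\<close> by (simp add: permute_list_nth)
        qed (simp add: J ts)
      next
        assume "J = ?J"
        then show "\<forall>m<n. ts ! m = J ! \<sigma> m"
          using permutes_in_image[OF \<sigma>] permutes_inverses(2)[OF \<sigma>] inv ts by (simp add: permute_list_nth)
      qed
      then show ?thesis
        by (auto simp: prod_zero_iff)
    qed
    then have "(\<Sum>J | length J = n. (\<Prod>m<n. if ts ! m = J ! \<sigma> m then 1 else 0) * \<eta> J)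
      = (\<Sum>J | length J = n. if J = ?J then \<eta> ?J else 0)"
      by (intro sum.cong) auto
    also have "\<dots> = \<eta> ?J"
      using ts by simp
    also have "\<dots> = of_int (sign (inv \<sigma>)) * \<eta> ts"
      by (rule alternating_list_permute[OF \<eta> inv ts])
    also have "sign (inv \<sigma>) = sign \<sigma>"
      using \<sigma> by (simp add: permutes_imp_permutation[of "{..<n}"] sign_inverse)
    finally show ?thesis .
  qed
  have "(\<Sum>J | length J = n. cw_idx ts J * \<eta> J)
    = (\<Sum>J | length J = n. \<Sum>\<sigma> | \<sigma> permutes {..<n}. of_int (sign \<sigma>) * ((\<Prod>m<n. if ts ! m = J ! \<sigma> m then 1 else 0) * \<eta> J))"
  proof (rule sum.cong[OF refl])
    fix J :: "8 list" assume J: "J \<in> {J. length J = n}"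
    have "(\<Prod>m<n. (map (\<lambda>a v. v $ a) ts ! m) (map (\<lambda>a. axis a 1 :: r8) J ! \<sigma> m)) = (\<Prod>m<n. if ts ! m = J ! \<sigma> m then 1 else (0 :: real))"
      if "\<sigma> permutes {..<n}" for \<sigma>
      using permutes_in_image[OF that] J ts by (intro prod.cong) (auto simp: axis_def)
    then show "cw_idx ts J * \<eta> J
      = (\<Sum>\<sigma> | \<sigma> permutes {..<n}. of_int (sign \<sigma>) * ((\<Prod>m<n. if ts ! m = J ! \<sigma> m then 1 else 0) * \<eta> J))"
      using ts by (simp add: cw_idx_def covector_wedge_def sum_distrib_right mult.assoc)
  qed
  also have "\<dots> = (\<Sum>\<sigma> | \<sigma> permutes {..<n}. of_int (sign \<sigma>) * (of_int (sign \<sigma>) * \<eta> ts))"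
    by (subst sum.swap) (simp add: one flip: sum_distrib_left)
  also have "\<dots> = (\<Sum>\<sigma> | \<sigma> permutes {..<n}. \<eta> ts)"
  proof (rule sum.cong[OF refl])
    fix \<sigma> :: "nat \<Rightarrow> nat"
    have "of_int (sign \<sigma>) * of_int (sign \<sigma>) = (1 :: real)"
      by (metis of_int_1 of_int_mult sign_idempotent)
    then show "of_int (sign \<sigma>) * (of_int (sign \<sigma>) * \<eta> ts) = \<eta> ts"
      by (metis mult.assoc mult_1)
  qed
  also have "\<dots> = fact n * \<eta> ts"
    by (simp add: card_permutations)
  finally show ?thesis .
qed

text \<open>Reversal turns the expansion along the last argument into a recursion on
  \<open>Cons\<close>, which rewriting can carry out.\<close>

definition cw_rev :: "8 list \<Rightarrow> 8 list \<Rightarrow> real" where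
  "cw_rev ts is = cw_idx (rev ts) (rev is)"

lemma cw_rev_Nil: "cw_rev [] [] = 1"
  by (simp add: cw_rev_def cw_idx_def)

text \<open>For distinct entries at most one term of the expansion survives; \<open>t\<close> moves
  into the place of the entry that is used up, at the cost of a sign.\<close>

lemma cw_rev_Cons:
  assumes "distinct (t # ts)" "length ts = length us"
  shows "cw_rev (t # ts) (i # us) = (if i = t then cw_rev ts us
    else if i \<in> set ts then - cw_rev (map (\<lambda>x. if x = i then t else x) ts) us else 0)"
proof -
  let ?v = "axis i 1 :: r8" and ?us = "map (\<lambda>a. axis a 1 :: r8) (rev us)" and ?c = "\<lambda>a (v :: r8). v $ a"
  let ?n = "length us"
  have e: "cw_rev (t # ts) (i # us) = ?v $ t * covector_wedge (map ?c (rev ts)) ?us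
    - (\<Sum>b<?n. ?v $ (rev ts ! b) * covector_wedge ((map ?c (rev ts))[b := ?c t]) ?us)"
    using covector_wedge_snoc[of "map ?c (rev ts)" ?us "?c t" ?v] assms by (simp add: cw_rev_def cw_idx_def)
  show ?thesis
  proof (cases "i \<in> set ts")
    case True
    then obtain b where b: "b < ?n" "rev ts ! b = i"
      using assms(2) by (metis in_set_conv_nth length_rev set_rev)
    have d: "rev ts ! c = i \<longleftrightarrow> c = b" if "c < ?n" for c
      using that b assms nth_eq_iff_index_eq[of "rev ts" c b] by auto
    have "(\<Sum>c<?n. ?v $ (rev ts ! c) * covector_wedge ((map ?c (rev ts))[c := ?c t]) ?us)
      = (\<Sum>c<?n. if c = b then covector_wedge ((map ?c (rev ts))[b := ?c t]) ?us else 0)"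
      by (intro sum.cong) (use d in \<open>auto simp: axis_def\<close>)
    also have "\<dots> = covector_wedge ((map ?c (rev ts))[b := ?c t]) ?us"
      using b by simp
    also have "(map ?c (rev ts))[b := ?c t] = map ?c (rev (map (\<lambda>x. if x = i then t else x) ts))"
      by (rule nth_equalityI) (use assms d in \<open>auto simp: rev_map nth_list_update\<close>)
    finally show ?thesis
      using e True assms by (auto simp: axis_def cw_rev_def cw_idx_def)
  next
    case False
    then have "(\<Sum>b<?n. ?v $ (rev ts ! b) * covector_wedge ((map ?c (rev ts))[b := ?c t]) ?us) = 0"
      using assms(2) by (intro sum.neutral ballI) (auto simp: axis_def, metis length_rev nth_mem set_rev)
    then show ?thesis
      using e False by (auto simp: axis_def cw_rev_def cw_idx_def)
  qed
qed

definition vol_idx :: "8 list \<Rightarrow> real" where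
  "vol_idx is = cw_idx [0, 1, 2, 3, 4, 5, 6, 7] is"

lemma vol_idx_rev: "vol_idx is = cw_rev [7, 6, 5, 4, 3, 2, 1, 0] (rev is)"
  by (simp add: vol_idx_def cw_rev_def)

text \<open>The fourteen monomials with an arbitrary \<open>f\<close> in place of the wedge product,
  so that linear operations can be done monomial by monomial.\<close>

definition psi_terms :: "(8 list \<Rightarrow> real) \<Rightarrow> real" where
  "psi_terms f = - f [0, 1, 2, 7] + f [0, 2, 3, 6] - f [0, 3, 4, 7] - f [0, 5, 6, 7] + f [0, 1, 4, 6] + f [0, 2, 4, 5] - f [0, 1, 3, 5] - f [3, 4, 5, 6] - f [1, 4, 5, 7] - f [1, 2, 5, 6] - f [1, 2, 3, 4] - f [2, 3, 5, 7] - f [1, 3, 6, 7] + f [2, 4, 6, 7]"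

lemma psi_eq_psi_terms: "psi i j k l = psi_terms (\<lambda>t. cw_idx t [i, j, k, l])"
  by (simp add: psi_def spin7_model_def psi_terms_def cw_idx_def)

lemma psi_terms_cong: "(\<And>t. length t = 4 \<Longrightarrow> f t = f' t) \<Longrightarrow> psi_terms f = psi_terms f'"
  by (simp add: psi_terms_def)

lemma psi_terms_scale: "psi_terms (\<lambda>t. c * f t) = c * psi_terms f"
  by (simp add: psi_terms_def algebra_simps)

lemma psi_terms_minus: "psi_terms (\<lambda>t. - f t) = - psi_terms f"
  by (simp add: psi_terms_def)

lemma sum_psi_terms: "(\<Sum>J\<in>S. psi_terms (\<lambda>t. f t J) * h J) = psi_terms (\<lambda>t. \<Sum>J\<in>S. f t J * h J)"
  by (simp add: psi_terms_def sum.distrib sum_subtractf sum_negf algebra_simps)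

text \<open>The 4-form equals its Hodge dual. Moving \<open>l\<close> past the four indices of
  \<open>t\<close> is an even permutation, so no sign appears.\<close>

lemma psi_self_dual: "psi_terms (\<lambda>t. vol_idx ([i, j, k] @ t @ [l])) = psi i j k l"
proof -
  define f where "f i j k l = psi_terms (\<lambda>t. vol_idx ([i, j, k] @ t @ [l])) - psi i j k l" for i j k l
  have "f i j k l = 0"
  proof (rule alternating_eq_0[where f=f])
    fix i j k l
    have "vol_idx ([j, i, k] @ t @ [l]) = - vol_idx ([i, j, k] @ t @ [l])" "vol_idx ([i, k, j] @ t @ [l]) = - vol_idx ([i, j, k] @ t @ [l])"
      "vol_idx ([i, j, l] @ t @ [k]) = - vol_idx ([i, j, k] @ t @ [l])" if "length t = 4" for t
      using that cw_idx_swap[of "[0, 1, 2, 3, 4, 5, 6, 7]" "[i, j, k] @ t @ [l]" 0 1]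
        cw_idx_swap[of "[0, 1, 2, 3, 4, 5, 6, 7]" "[i, j, k] @ t @ [l]" 1 2]
        cw_idx_swap[of "[0, 1, 2, 3, 4, 5, 6, 7]" "[i, j, k] @ t @ [l]" 2 7]
      by (simp_all add: vol_idx_def eval_nat_numeral list_update_append nth_append)
    then have "psi_terms (\<lambda>t. vol_idx ([j, i, k] @ t @ [l])) = - psi_terms (\<lambda>t. vol_idx ([i, j, k] @ t @ [l]))"
      "psi_terms (\<lambda>t. vol_idx ([i, k, j] @ t @ [l])) = - psi_terms (\<lambda>t. vol_idx ([i, j, k] @ t @ [l]))"
      "psi_terms (\<lambda>t. vol_idx ([i, j, l] @ t @ [k])) = - psi_terms (\<lambda>t. vol_idx ([i, j, k] @ t @ [l]))"
      unfolding psi_terms_minus[symmetric] by (auto intro!: psi_terms_cong)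
    then show "f j i k l = - f i j k l" "f i k j l = - f i j k l" "f i j l k = - f i j k l"
      unfolding f_def using psi_swap(1)[of j i k l] psi_swap(2)[of i k j l] psi_swap(3)[of i j l k] by simp_all
  next
    show "\<forall>i j. idx i < idx j \<longrightarrow> (\<forall>k. idx j < idx k \<longrightarrow> (\<forall>l. idx k < idx l \<longrightarrow> f i j k l = 0))"
      by (subst forall_8, unfold idx_simps all_greater_8 f_def psi_terms_def vol_idx_rev psi_increasing, intro conjI TrueI)
        (simp_all add: cw_rev_Cons cw_rev_Nil)
  qed
  then show ?thesis by (simp add: f_def)
qed

text \<open>The contractions of the 4-form with the basis vectors, each a sum of seven monomials of
  degree 3; in this form \<open>sum_cw_idx\<close> evaluates sums over index triples.\<close>

lemma psi_last:
  "psi i j k 0 = cw_idx [1, 2, 7] [i, j, k] + cw_idx [1, 3, 5] [i, j, k] - cw_idx [1, 4, 6] [i, j, k] - cw_idx [2, 3, 6] [i, j, k] - cw_idx [2, 4, 5] [i, j, k] + cw_idx [3, 4, 7] [i, j, k] + cw_idx [5, 6, 7] [i, j, k]"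
  "psi i j k 1 = - cw_idx [0, 2, 7] [i, j, k] - cw_idx [0, 3, 5] [i, j, k] + cw_idx [0, 4, 6] [i, j, k] + cw_idx [2, 3, 4] [i, j, k] + cw_idx [2, 5, 6] [i, j, k] + cw_idx [3, 6, 7] [i, j, k] + cw_idx [4, 5, 7] [i, j, k]"
  "psi i j k 2 = cw_idx [0, 1, 7] [i, j, k] + cw_idx [0, 3, 6] [i, j, k] + cw_idx [0, 4, 5] [i, j, k] - cw_idx [1, 3, 4] [i, j, k] - cw_idx [1, 5, 6] [i, j, k] + cw_idx [3, 5, 7] [i, j, k] - cw_idx [4, 6, 7] [i, j, k]"
  "psi i j k 3 = cw_idx [0, 1, 5] [i, j, k] - cw_idx [0, 2, 6] [i, j, k] - cw_idx [0, 4, 7] [i, j, k] + cw_idx [1, 2, 4] [i, j, k] - cw_idx [1, 6, 7] [i, j, k] - cw_idx [2, 5, 7] [i, j, k] + cw_idx [4, 5, 6] [i, j, k]"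
  "psi i j k 4 = - cw_idx [0, 1, 6] [i, j, k] - cw_idx [0, 2, 5] [i, j, k] + cw_idx [0, 3, 7] [i, j, k] - cw_idx [1, 2, 3] [i, j, k] - cw_idx [1, 5, 7] [i, j, k] + cw_idx [2, 6, 7] [i, j, k] - cw_idx [3, 5, 6] [i, j, k]"
  "psi i j k 5 = - cw_idx [0, 1, 3] [i, j, k] + cw_idx [0, 2, 4] [i, j, k] - cw_idx [0, 6, 7] [i, j, k] + cw_idx [1, 2, 6] [i, j, k] + cw_idx [1, 4, 7] [i, j, k] + cw_idx [2, 3, 7] [i, j, k] + cw_idx [3, 4, 6] [i, j, k]"
  "psi i j k 6 = cw_idx [0, 1, 4] [i, j, k] + cw_idx [0, 2, 3] [i, j, k] + cw_idx [0, 5, 7] [i, j, k] - cw_idx [1, 2, 5] [i, j, k] + cw_idx [1, 3, 7] [i, j, k] - cw_idx [2, 4, 7] [i, j, k] - cw_idx [3, 4, 5] [i, j, k]"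
  "psi i j k 7 = - cw_idx [0, 1, 2] [i, j, k] - cw_idx [0, 3, 4] [i, j, k] - cw_idx [0, 5, 6] [i, j, k] - cw_idx [1, 3, 6] [i, j, k] - cw_idx [1, 4, 5] [i, j, k] - cw_idx [2, 3, 5] [i, j, k] + cw_idx [2, 4, 6] [i, j, k]"
proof -
  have cw: "cw_idx [p, q, r] [j, i, k] = - cw_idx [p, q, r] [i, j, k]" "cw_idx [p, q, r] [i, k, j] = - cw_idx [p, q, r] [i, j, k]" for p q r i j k
    using cw_idx_swap[of "[p, q, r]" "[i, j, k]" 0 1] cw_idx_swap[of "[p, q, r]" "[i, j, k]" 1 2]
    by (simp_all add: eval_nat_numeral)
  have ev: "cw_idx [p, q, r] [i, j, k] = cw_rev [r, q, p] [k, j, i]" for p q r i j k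
    by (simp add: cw_rev_def)
  show "psi i j k 0 = cw_idx [1, 2, 7] [i, j, k] + cw_idx [1, 3, 5] [i, j, k] - cw_idx [1, 4, 6] [i, j, k] - cw_idx [2, 3, 6] [i, j, k] - cw_idx [2, 4, 5] [i, j, k] + cw_idx [3, 4, 7] [i, j, k] + cw_idx [5, 6, 7] [i, j, k]"
  proof -
    define f where "f i j k = psi i j k 0 - (cw_idx [1, 2, 7] [i, j, k] + cw_idx [1, 3, 5] [i, j, k] - cw_idx [1, 4, 6] [i, j, k] - cw_idx [2, 3, 6] [i, j, k] - cw_idx [2, 4, 5] [i, j, k] + cw_idx [3, 4, 7] [i, j, k] + cw_idx [5, 6, 7] [i, j, k])" for i j k
    have "f i j k = 0"
    proof (rule alternating_eq_0_3[where f=f])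
      fix i j k show "f j i k = - f i j k" "f i k j = - f i j k"
        unfolding f_def cw[of _ _ _ j i k] cw(2)[of _ _ _ i k j] psi_swap(1)[of j i k] psi_swap(2)[of i k j] by simp_all
    next
      show "\<forall>i j. idx i < idx j \<longrightarrow> (\<forall>k. idx j < idx k \<longrightarrow> f i j k = 0)"
        by (subst forall_8, unfold idx_simps all_greater_8 f_def ev, intro conjI TrueI)
          (simp_all add: cw_rev_Cons cw_rev_Nil psi_sort psi_increasing psi_refl)
    qed
    then show ?thesis by (simp add: f_def)
  qed
  show "psi i j k 1 = - cw_idx [0, 2, 7] [i, j, k] - cw_idx [0, 3, 5] [i, j, k] + cw_idx [0, 4, 6] [i, j, k] + cw_idx [2, 3, 4] [i, j, k] + cw_idx [2, 5, 6] [i, j, k] + cw_idx [3, 6, 7] [i, j, k] + cw_idx [4, 5, 7] [i, j, k]"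
  proof -
    define f where "f i j k = psi i j k 1 - (- cw_idx [0, 2, 7] [i, j, k] - cw_idx [0, 3, 5] [i, j, k] + cw_idx [0, 4, 6] [i, j, k] + cw_idx [2, 3, 4] [i, j, k] + cw_idx [2, 5, 6] [i, j, k] + cw_idx [3, 6, 7] [i, j, k] + cw_idx [4, 5, 7] [i, j, k])" for i j k
    have "f i j k = 0"
    proof (rule alternating_eq_0_3[where f=f])
      fix i j k show "f j i k = - f i j k" "f i k j = - f i j k"
        unfolding f_def cw[of _ _ _ j i k] cw(2)[of _ _ _ i k j] psi_swap(1)[of j i k] psi_swap(2)[of i k j] by simp_all
    next
      show "\<forall>i j. idx i < idx j \<longrightarrow> (\<forall>k. idx j < idx k \<longrightarrow> f i j k = 0)"
        by (subst forall_8, unfold idx_simps all_greater_8 f_def ev, intro conjI TrueI)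
          (simp_all add: cw_rev_Cons cw_rev_Nil psi_sort psi_increasing psi_refl)
    qed
    then show ?thesis by (simp add: f_def)
  qed
  show "psi i j k 2 = cw_idx [0, 1, 7] [i, j, k] + cw_idx [0, 3, 6] [i, j, k] + cw_idx [0, 4, 5] [i, j, k] - cw_idx [1, 3, 4] [i, j, k] - cw_idx [1, 5, 6] [i, j, k] + cw_idx [3, 5, 7] [i, j, k] - cw_idx [4, 6, 7] [i, j, k]"
  proof -
    define f where "f i j k = psi i j k 2 - (cw_idx [0, 1, 7] [i, j, k] + cw_idx [0, 3, 6] [i, j, k] + cw_idx [0, 4, 5] [i, j, k] - cw_idx [1, 3, 4] [i, j, k] - cw_idx [1, 5, 6] [i, j, k] + cw_idx [3, 5, 7] [i, j, k] - cw_idx [4, 6, 7] [i, j, k])" for i j k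
    have "f i j k = 0"
    proof (rule alternating_eq_0_3[where f=f])
      fix i j k show "f j i k = - f i j k" "f i k j = - f i j k"
        unfolding f_def cw[of _ _ _ j i k] cw(2)[of _ _ _ i k j] psi_swap(1)[of j i k] psi_swap(2)[of i k j] by simp_all
    next
      show "\<forall>i j. idx i < idx j \<longrightarrow> (\<forall>k. idx j < idx k \<longrightarrow> f i j k = 0)"
        by (subst forall_8, unfold idx_simps all_greater_8 f_def ev, intro conjI TrueI)
          (simp_all add: cw_rev_Cons cw_rev_Nil psi_sort psi_increasing psi_refl)
    qed
    then show ?thesis by (simp add: f_def)
  qed
  show "psi i j k 3 = cw_idx [0, 1, 5] [i, j, k] - cw_idx [0, 2, 6] [i, j, k] - cw_idx [0, 4, 7] [i, j, k] + cw_idx [1, 2, 4] [i, j, k] - cw_idx [1, 6, 7] [i, j, k] - cw_idx [2, 5, 7] [i, j, k] + cw_idx [4, 5, 6] [i, j, k]"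
  proof -
    define f where "f i j k = psi i j k 3 - (cw_idx [0, 1, 5] [i, j, k] - cw_idx [0, 2, 6] [i, j, k] - cw_idx [0, 4, 7] [i, j, k] + cw_idx [1, 2, 4] [i, j, k] - cw_idx [1, 6, 7] [i, j, k] - cw_idx [2, 5, 7] [i, j, k] + cw_idx [4, 5, 6] [i, j, k])" for i j k
    have "f i j k = 0"
    proof (rule alternating_eq_0_3[where f=f])
      fix i j k show "f j i k = - f i j k" "f i k j = - f i j k"
        unfolding f_def cw[of _ _ _ j i k] cw(2)[of _ _ _ i k j] psi_swap(1)[of j i k] psi_swap(2)[of i k j] by simp_all
    next
      show "\<forall>i j. idx i < idx j \<longrightarrow> (\<forall>k. idx j < idx k \<longrightarrow> f i j k = 0)"
        by (subst forall_8, unfold idx_simps all_greater_8 f_def ev, intro conjI TrueI)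
          (simp_all add: cw_rev_Cons cw_rev_Nil psi_sort psi_increasing psi_refl)
    qed
    then show ?thesis by (simp add: f_def)
  qed
  show "psi i j k 4 = - cw_idx [0, 1, 6] [i, j, k] - cw_idx [0, 2, 5] [i, j, k] + cw_idx [0, 3, 7] [i, j, k] - cw_idx [1, 2, 3] [i, j, k] - cw_idx [1, 5, 7] [i, j, k] + cw_idx [2, 6, 7] [i, j, k] - cw_idx [3, 5, 6] [i, j, k]"
  proof -
    define f where "f i j k = psi i j k 4 - (- cw_idx [0, 1, 6] [i, j, k] - cw_idx [0, 2, 5] [i, j, k] + cw_idx [0, 3, 7] [i, j, k] - cw_idx [1, 2, 3] [i, j, k] - cw_idx [1, 5, 7] [i, j, k] + cw_idx [2, 6, 7] [i, j, k] - cw_idx [3, 5, 6] [i, j, k])" for i j k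
    have "f i j k = 0"
    proof (rule alternating_eq_0_3[where f=f])
      fix i j k show "f j i k = - f i j k" "f i k j = - f i j k"
        unfolding f_def cw[of _ _ _ j i k] cw(2)[of _ _ _ i k j] psi_swap(1)[of j i k] psi_swap(2)[of i k j] by simp_all
    next
      show "\<forall>i j. idx i < idx j \<longrightarrow> (\<forall>k. idx j < idx k \<longrightarrow> f i j k = 0)"
        by (subst forall_8, unfold idx_simps all_greater_8 f_def ev, intro conjI TrueI)
          (simp_all add: cw_rev_Cons cw_rev_Nil psi_sort psi_increasing psi_refl)
    qed
    then show ?thesis by (simp add: f_def)
  qed
  show "psi i j k 5 = - cw_idx [0, 1, 3] [i, j, k] + cw_idx [0, 2, 4] [i, j, k] - cw_idx [0, 6, 7] [i, j, k] + cw_idx [1, 2, 6] [i, j, k] + cw_idx [1, 4, 7] [i, j, k] + cw_idx [2, 3, 7] [i, j, k] + cw_idx [3, 4, 6] [i, j, k]"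
  proof -
    define f where "f i j k = psi i j k 5 - (- cw_idx [0, 1, 3] [i, j, k] + cw_idx [0, 2, 4] [i, j, k] - cw_idx [0, 6, 7] [i, j, k] + cw_idx [1, 2, 6] [i, j, k] + cw_idx [1, 4, 7] [i, j, k] + cw_idx [2, 3, 7] [i, j, k] + cw_idx [3, 4, 6] [i, j, k])" for i j k
    have "f i j k = 0"
    proof (rule alternating_eq_0_3[where f=f])
      fix i j k show "f j i k = - f i j k" "f i k j = - f i j k"
        unfolding f_def cw[of _ _ _ j i k] cw(2)[of _ _ _ i k j] psi_swap(1)[of j i k] psi_swap(2)[of i k j] by simp_all
    next
      show "\<forall>i j. idx i < idx j \<longrightarrow> (\<forall>k. idx j < idx k \<longrightarrow> f i j k = 0)"
        by (subst forall_8, unfold idx_simps all_greater_8 f_def ev, intro conjI TrueI)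
          (simp_all add: cw_rev_Cons cw_rev_Nil psi_sort psi_increasing psi_refl)
    qed
    then show ?thesis by (simp add: f_def)
  qed
  show "psi i j k 6 = cw_idx [0, 1, 4] [i, j, k] + cw_idx [0, 2, 3] [i, j, k] + cw_idx [0, 5, 7] [i, j, k] - cw_idx [1, 2, 5] [i, j, k] + cw_idx [1, 3, 7] [i, j, k] - cw_idx [2, 4, 7] [i, j, k] - cw_idx [3, 4, 5] [i, j, k]"
  proof -
    define f where "f i j k = psi i j k 6 - (cw_idx [0, 1, 4] [i, j, k] + cw_idx [0, 2, 3] [i, j, k] + cw_idx [0, 5, 7] [i, j, k] - cw_idx [1, 2, 5] [i, j, k] + cw_idx [1, 3, 7] [i, j, k] - cw_idx [2, 4, 7] [i, j, k] - cw_idx [3, 4, 5] [i, j, k])" for i j k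
    have "f i j k = 0"
    proof (rule alternating_eq_0_3[where f=f])
      fix i j k show "f j i k = - f i j k" "f i k j = - f i j k"
        unfolding f_def cw[of _ _ _ j i k] cw(2)[of _ _ _ i k j] psi_swap(1)[of j i k] psi_swap(2)[of i k j] by simp_all
    next
      show "\<forall>i j. idx i < idx j \<longrightarrow> (\<forall>k. idx j < idx k \<longrightarrow> f i j k = 0)"
        by (subst forall_8, unfold idx_simps all_greater_8 f_def ev, intro conjI TrueI)
          (simp_all add: cw_rev_Cons cw_rev_Nil psi_sort psi_increasing psi_refl)
    qed
    then show ?thesis by (simp add: f_def)
  qed
  show "psi i j k 7 = - cw_idx [0, 1, 2] [i, j, k] - cw_idx [0, 3, 4] [i, j, k] - cw_idx [0, 5, 6] [i, j, k] - cw_idx [1, 3, 6] [i, j, k] - cw_idx [1, 4, 5] [i, j, k] - cw_idx [2, 3, 5] [i, j, k] + cw_idx [2, 4, 6] [i, j, k]"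
  proof -
    define f where "f i j k = psi i j k 7 - (- cw_idx [0, 1, 2] [i, j, k] - cw_idx [0, 3, 4] [i, j, k] - cw_idx [0, 5, 6] [i, j, k] - cw_idx [1, 3, 6] [i, j, k] - cw_idx [1, 4, 5] [i, j, k] - cw_idx [2, 3, 5] [i, j, k] + cw_idx [2, 4, 6] [i, j, k])" for i j k
    have "f i j k = 0"
    proof (rule alternating_eq_0_3[where f=f])
      fix i j k show "f j i k = - f i j k" "f i k j = - f i j k"
        unfolding f_def cw[of _ _ _ j i k] cw(2)[of _ _ _ i k j] psi_swap(1)[of j i k] psi_swap(2)[of i k j] by simp_all
    next
      show "\<forall>i j. idx i < idx j \<longrightarrow> (\<forall>k. idx j < idx k \<longrightarrow> f i j k = 0)"
        by (subst forall_8, unfold idx_simps all_greater_8 f_def ev, intro conjI TrueI)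
          (simp_all add: cw_rev_Cons cw_rev_Nil psi_sort psi_increasing psi_refl)
    qed
    then show ?thesis by (simp add: f_def)
  qed
qed

section \<open>The exterior derivative of the 4-form, its Hodge dual, and their constants\<close>

definition hodge_5 :: "(8 list \<Rightarrow> real) \<Rightarrow> 8 list \<Rightarrow> real" where
  "hodge_5 \<eta> K = (\<Sum>J | length J = 5. \<eta> J * vol_idx (J @ K)) / 120"

text \<open>For fixed \<open>K\<close> the volume form is, up to sign, the Kronecker symbol of the
  complementary indices. The sum then has the value \<open>fact 5 = 120\<close> times one component,
  which the normalisation cancels.\<close>

lemma hodge_5_basis:
  assumes "alternating_list 5 \<eta>" "length us = 5" "\<And>J. length J = 5 \<Longrightarrow> vol_idx (J @ K) = s * cw_idx us J"
  shows "hodge_5 \<eta> K = s * \<eta> us"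
proof -
  have "(\<Sum>J | length J = 5. \<eta> J * vol_idx (J @ K)) = s * (\<Sum>J | length J = 5. cw_idx us J * \<eta> J)"
    unfolding sum_distrib_left using assms(3) by (intro sum.cong) auto
  also have "\<dots> = s * (120 * \<eta> us)"
    using sum_cw_idx[OF assms(1,2)] by (simp add: fact_numeral)
  finally show ?thesis by (simp add: hodge_5_def)
qed

text \<open>The complementary indices appear in the order that \<open>cw_rev_Cons\<close> leaves
  behind, where the current head replaces each index removed; the sign belongs to that
  order.\<close>

lemma hodge_5_values:
  assumes "alternating_list 5 \<eta>"
  shows
    "hodge_5 \<eta> [0, 1, 2] = - \<eta> [5, 6, 7, 3, 4]"
    "hodge_5 \<eta> [0, 1, 3] = - \<eta> [5, 6, 2, 7, 4]"
    "hodge_5 \<eta> [0, 1, 4] = - \<eta> [5, 6, 2, 3, 7]"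
    "hodge_5 \<eta> [0, 1, 5] = - \<eta> [7, 6, 2, 3, 4]"
    "hodge_5 \<eta> [0, 1, 6] = - \<eta> [5, 7, 2, 3, 4]"
    "hodge_5 \<eta> [0, 1, 7] = \<eta> [5, 6, 2, 3, 4]"
    "hodge_5 \<eta> [0, 2, 3] = - \<eta> [5, 1, 6, 7, 4]"
    "hodge_5 \<eta> [0, 2, 4] = - \<eta> [5, 1, 6, 3, 7]"
    "hodge_5 \<eta> [0, 2, 5] = - \<eta> [7, 1, 6, 3, 4]"
    "hodge_5 \<eta> [0, 2, 6] = - \<eta> [5, 1, 7, 3, 4]"
    "hodge_5 \<eta> [0, 2, 7] = \<eta> [5, 1, 6, 3, 4]"
    "hodge_5 \<eta> [0, 3, 4] = - \<eta> [5, 1, 2, 6, 7]"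
    "hodge_5 \<eta> [0, 3, 5] = - \<eta> [7, 1, 2, 6, 4]"
    "hodge_5 \<eta> [0, 3, 6] = - \<eta> [5, 1, 2, 7, 4]"
    "hodge_5 \<eta> [0, 3, 7] = \<eta> [5, 1, 2, 6, 4]"
    "hodge_5 \<eta> [0, 4, 5] = - \<eta> [7, 1, 2, 3, 6]"
    "hodge_5 \<eta> [0, 4, 6] = - \<eta> [5, 1, 2, 3, 7]"
    "hodge_5 \<eta> [0, 4, 7] = \<eta> [5, 1, 2, 3, 6]"
    "hodge_5 \<eta> [0, 5, 6] = - \<eta> [7, 1, 2, 3, 4]"
    "hodge_5 \<eta> [0, 5, 7] = \<eta> [6, 1, 2, 3, 4]"
    "hodge_5 \<eta> [0, 6, 7] = - \<eta> [5, 1, 2, 3, 4]"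
    "hodge_5 \<eta> [1, 2, 3] = - \<eta> [0, 5, 6, 7, 4]"
    "hodge_5 \<eta> [1, 2, 4] = - \<eta> [0, 5, 6, 3, 7]"
    "hodge_5 \<eta> [1, 2, 5] = - \<eta> [0, 7, 6, 3, 4]"
    "hodge_5 \<eta> [1, 2, 6] = - \<eta> [0, 5, 7, 3, 4]"
    "hodge_5 \<eta> [1, 2, 7] = \<eta> [0, 5, 6, 3, 4]"
    "hodge_5 \<eta> [1, 3, 4] = - \<eta> [0, 5, 2, 6, 7]"
    "hodge_5 \<eta> [1, 3, 5] = - \<eta> [0, 7, 2, 6, 4]"
    "hodge_5 \<eta> [1, 3, 6] = - \<eta> [0, 5, 2, 7, 4]"
    "hodge_5 \<eta> [1, 3, 7] = \<eta> [0, 5, 2, 6, 4]"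
    "hodge_5 \<eta> [1, 4, 5] = - \<eta> [0, 7, 2, 3, 6]"
    "hodge_5 \<eta> [1, 4, 6] = - \<eta> [0, 5, 2, 3, 7]"
    "hodge_5 \<eta> [1, 4, 7] = \<eta> [0, 5, 2, 3, 6]"
    "hodge_5 \<eta> [1, 5, 6] = - \<eta> [0, 7, 2, 3, 4]"
    "hodge_5 \<eta> [1, 5, 7] = \<eta> [0, 6, 2, 3, 4]"
    "hodge_5 \<eta> [1, 6, 7] = - \<eta> [0, 5, 2, 3, 4]"
    "hodge_5 \<eta> [2, 3, 4] = - \<eta> [0, 1, 5, 6, 7]"
    "hodge_5 \<eta> [2, 3, 5] = - \<eta> [0, 1, 7, 6, 4]"
    "hodge_5 \<eta> [2, 3, 6] = - \<eta> [0, 1, 5, 7, 4]"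
    "hodge_5 \<eta> [2, 3, 7] = \<eta> [0, 1, 5, 6, 4]"
    "hodge_5 \<eta> [2, 4, 5] = - \<eta> [0, 1, 7, 3, 6]"
    "hodge_5 \<eta> [2, 4, 6] = - \<eta> [0, 1, 5, 3, 7]"
    "hodge_5 \<eta> [2, 4, 7] = \<eta> [0, 1, 5, 3, 6]"
    "hodge_5 \<eta> [2, 5, 6] = - \<eta> [0, 1, 7, 3, 4]"
    "hodge_5 \<eta> [2, 5, 7] = \<eta> [0, 1, 6, 3, 4]"
    "hodge_5 \<eta> [2, 6, 7] = - \<eta> [0, 1, 5, 3, 4]"
    "hodge_5 \<eta> [3, 4, 5] = - \<eta> [0, 1, 2, 7, 6]"
    "hodge_5 \<eta> [3, 4, 6] = - \<eta> [0, 1, 2, 5, 7]"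
    "hodge_5 \<eta> [3, 4, 7] = \<eta> [0, 1, 2, 5, 6]"
    "hodge_5 \<eta> [3, 5, 6] = - \<eta> [0, 1, 2, 7, 4]"
    "hodge_5 \<eta> [3, 5, 7] = \<eta> [0, 1, 2, 6, 4]"
    "hodge_5 \<eta> [3, 6, 7] = - \<eta> [0, 1, 2, 5, 4]"
    "hodge_5 \<eta> [4, 5, 6] = - \<eta> [0, 1, 2, 3, 7]"
    "hodge_5 \<eta> [4, 5, 7] = \<eta> [0, 1, 2, 3, 6]"
    "hodge_5 \<eta> [4, 6, 7] = - \<eta> [0, 1, 2, 3, 5]"
    "hodge_5 \<eta> [5, 6, 7] = \<eta> [0, 1, 2, 3, 4]"
  by (rule hodge_5_basis[OF assms, where s=1, simplified] hodge_5_basis[OF assms, where s="- 1", simplified],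
      simp, simp add: vol_idx_rev cw_rev_Cons, simp add: cw_rev_def)+

lemma alternating_list_3_hodge_5: "alternating_list 3 (hodge_5 \<eta>)"
  unfolding alternating_list_def
proof (intro allI impI)
  fix K :: "8 list" and i j :: nat assume K: "length K = 3" "i < j" "j < 3"
  have "vol_idx (J @ K[i := K ! j, j := K ! i]) = - vol_idx (J @ K)" if "length J = 5" for J
    using alternating_list_cw_idx[of "[0, 1, 2, 3, 4, 5, 6, 7]" J 3 "[]"] K that
    by (simp add: vol_idx_def alternating_list_def)
  then have "(\<Sum>J | length J = 5. \<eta> J * vol_idx (J @ K[i := K ! j, j := K ! i])) = (\<Sum>J | length J = 5. - (\<eta> J * vol_idx (J @ K)))"
    by (intro sum.cong) auto
  then show "hodge_5 \<eta> (K[i := K ! j, j := K ! i]) = - hodge_5 \<eta> K"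
    by (simp add: hodge_5_def sum_negf)
qed

definition psi_list :: "8 list \<Rightarrow> real" where
  "psi_list J = psi_terms (\<lambda>t. cw_idx t J)"

lemma sum_psi_vol:
  assumes "length K = 3"
  shows "(\<Sum>J | length J = 4. psi_list J * vol_idx (K @ J @ [l])) = 24 * psi (K ! 0) (K ! 1) (K ! 2) l"
proof -
  obtain i j k where K: "K = [i, j, k]"
    using assms by (auto simp: length_Suc_conv numeral_3_eq_3)
  have "(\<Sum>J | length J = 4. psi_list J * vol_idx (K @ J @ [l])) = psi_terms (\<lambda>t. \<Sum>J | length J = 4. cw_idx t J * vol_idx (K @ J @ [l]))"
    unfolding psi_list_def by (rule sum_psi_terms)
  also have "\<dots> = psi_terms (\<lambda>t. 24 * vol_idx ([i, j, k] @ t @ [l]))"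
  proof (rule psi_terms_cong)
    fix t :: "8 list" assume "length t = 4"
    then show "(\<Sum>J | length J = 4. cw_idx t J * vol_idx (K @ J @ [l])) = 24 * vol_idx ([i, j, k] @ t @ [l])"
      using sum_cw_idx[of 4 "\<lambda>J. vol_idx (K @ J @ [l])" t]
        alternating_list_cw_idx[of "[0, 1, 2, 3, 4, 5, 6, 7]" K 4 "[l]"]
      by (simp add: vol_idx_def K fact_numeral)
  qed
  also have "\<dots> = 24 * psi i j k l"
    unfolding psi_terms_scale psi_self_dual ..
  finally show ?thesis by (simp add: K)
qed

text \<open>The components of the exterior derivative of the 4-form in an adapted frame. As the
  4-form is parallel, only torsion terms remain, one for each of the ten index pairs; see
  \<open>d_Psi_e\<close>.\<close>

definition d_psi :: "(8 \<Rightarrow> 8 \<Rightarrow> 8 \<Rightarrow> real) \<Rightarrow> 8 \<Rightarrow> 8 \<Rightarrow> 8 \<Rightarrow> 8 \<Rightarrow> 8 \<Rightarrow> real" where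
  "d_psi T a b c d f = (\<Sum>m\<in>UNIV. T a b m * psi m c d f - T a c m * psi m b d f + T a d m * psi m b c f - T a f m * psi m b c d + T b c m * psi m a d f - T b d m * psi m a c f + T b f m * psi m a c d + T c d m * psi m a b f - T c f m * psi m a b d + T d f m * psi m a b c)"

definition d_psi_list :: "(8 \<Rightarrow> 8 \<Rightarrow> 8 \<Rightarrow> real) \<Rightarrow> 8 list \<Rightarrow> real" where
  "d_psi_list T J = d_psi T (J ! 0) (J ! 1) (J ! 2) (J ! 3) (J ! 4)"

lemma d_psi_swap:
  assumes T: "alternating3 T"
  shows "d_psi T b a c d f = - d_psi T a b c d f" "d_psi T a c b d f = - d_psi T a b c d f"
    "d_psi T a b d c f = - d_psi T a b c d f" "d_psi T a b c f d = - d_psi T a b c d f"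
proof -
  note t = alternating3D(1)[OF T]
  show "d_psi T b a c d f = - d_psi T a b c d f"
    unfolding d_psi_def sum_negf[symmetric]
    by (intro sum.cong refl) (simp add: t[of b a] psi_swap(2)[of _ b a])
  show "d_psi T a c b d f = - d_psi T a b c d f"
    unfolding d_psi_def sum_negf[symmetric]
    by (intro sum.cong refl) (simp add: t[of c b] psi_swap(2)[of _ c b] psi_swap(3)[of _ _ c b])
  show "d_psi T a b d c f = - d_psi T a b c d f"
    unfolding d_psi_def sum_negf[symmetric]
    by (intro sum.cong refl) (simp add: t[of d c] psi_swap(2)[of _ d c] psi_swap(3)[of _ _ d c])
  show "d_psi T a b c f d = - d_psi T a b c d f"
    unfolding d_psi_def sum_negf[symmetric]
    by (intro sum.cong refl) (simp add: t[of f d] psi_swap(3)[of _ _ f d])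
qed

lemma alternating_list_d_psi:
  assumes T: "alternating3 T"
  shows "alternating_list 5 (d_psi_list T)"
  unfolding alternating_list_def
proof (intro allI impI)
  fix J :: "8 list" and i j :: nat assume J: "length J = 5" and ij: "i < j" "j < 5"
  obtain a b c d f where K: "J = [a, b, c, d, f]"
    using J by (auto simp: length_Suc_conv eval_nat_numeral)
  note s = d_psi_swap[OF T]
  \<comment> \<open>\<open>alternating_list\<close> asks for all transpositions; the distant ones
    are composed from adjacent ones.\<close>
  have 02: "d_psi T c b a d f = - d_psi T a b c d f" for a b c d f
    using s(1)[of c b a d f] s(2)[of b a c d f] s(1)[of b a c d f] s(2)[of b c a d f] s(1)[of a b c d f] by linarith
  have 13: "d_psi T a d c b f = - d_psi T a b c d f" for a b c d f
    using s(2)[of a d c b f] s(3)[of a c b d f] s(2)[of a c b d f] s(3)[of a c d b f] s(2)[of a b c d f] by linarith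
  have 24: "d_psi T a b f d c = - d_psi T a b c d f" for a b c d f
    using s(3)[of a b f d c] s(4)[of a b d c f] s(3)[of a b d c f] s(4)[of a b d f c] s(3)[of a b c d f] by linarith
  have 03: "d_psi T d b c a f = - d_psi T a b c d f" for a b c d f
    using s(3)[of d b a c f] s(3)[of d b c a f] 02[of d b a c f] 02[of a b d c f] s(3)[of a b d c f] s(3)[of a b c d f] by linarith
  have 14: "d_psi T a f c d b = - d_psi T a b c d f" for a b c d f
    using s(4)[of a f c b d] s(4)[of a f c d b] 13[of a f c b d] 13[of a b c f d] s(4)[of a b c f d] s(4)[of a b c d f] by linarith
  have 04: "d_psi T f b c d a = - d_psi T a b c d f" for a b c d f
    using s(4)[of f b c a d] s(4)[of f b c d a] 03[of f b c a d] 03[of a b c f d] s(4)[of a b c f d] s(4)[of a b c d f] by linarith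
  have "j = 1 \<or> j = 2 \<or> j = 3 \<or> j = 4" "i = 0 \<or> i = 1 \<or> i = 2 \<or> i = 3"
    using ij by auto
  then show "d_psi_list T (J[i := J ! j, j := J ! i]) = - d_psi_list T J"
    using ij s(1)[of b a c d f] s(2)[of a c b d f] s(3)[of a b d c f] s(4)[of a b c f d] 02[of c b a d f] 13[of a d c b f]
      24[of a b f d c] 03[of d b c a f] 14[of a f c d b] 04[of f b c d a]
    by (elim disjE) (simp_all add: d_psi_list_def K eval_nat_numeral)
qed

text \<open>144 is 24 times 6: the sum over \<open>J\<close> gives \<open>fact 4\<close> times the
  self-dual 4-form, and contracting the Hodge dual of \<open>d_psi\<close> with \<open>psi\<close>
  gives \<open>6 * psi_trace\<close>, which is evaluated for each of the eight values of
  \<open>l\<close>.\<close>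

lemma sum_hodge_psi_vol:
  assumes T: "alternating3 T"
  shows "(\<Sum>I | length I = 7. hodge_5 (d_psi_list T) (take 3 I) * psi_list (drop 3 I) * vol_idx (I @ [l])) = 144 * psi_trace T l"
proof -
  define h where "h = hodge_5 (d_psi_list T)"
  have "(\<Sum>I | length I = 7. h (take 3 I) * psi_list (drop 3 I) * vol_idx (I @ [l]))
    = (\<Sum>I | length I = 3 + 4. h (take 3 I) * psi_list (drop 3 I) * vol_idx (I @ [l]))"
    by simp
  also have "\<dots> = (\<Sum>K | length K = 3. \<Sum>J | length J = 4. h K * (psi_list J * vol_idx (K @ J @ [l])))"
    unfolding sum_lists_append by (intro sum.cong refl) (simp add: mult.assoc)
  also have "\<dots> = 24 * (\<Sum>K | length K = 3. h K * psi (K ! 0) (K ! 1) (K ! 2) l)"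
    unfolding sum_distrib_left[symmetric] by (simp add: sum_psi_vol sum_distrib_left mult.left_commute)
  finally have S: "(\<Sum>I | length I = 7. h (take 3 I) * psi_list (drop 3 I) * vol_idx (I @ [l]))
     = 24 * (\<Sum>K | length K = 3. h K * psi (K ! 0) (K ! 1) (K ! 2) l)" .
  have X: "(\<Sum>K | length K = 3. h K * cw_idx [p, q, r] [K ! 0, K ! Suc 0, K ! 2]) = 6 * h [p, q, r]" for p q r
  proof -
    have "(\<Sum>K | length K = 3. h K * cw_idx [p, q, r] [K ! 0, K ! Suc 0, K ! 2]) = (\<Sum>K | length K = 3. cw_idx [p, q, r] K * h K)"
    proof (rule sum.cong[OF refl])
      fix K :: "8 list" assume "K \<in> {K. length K = 3}"
      then obtain i j k where "K = [i, j, k]"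
        by (auto simp: length_Suc_conv numeral_3_eq_3)
      then show "h K * cw_idx [p, q, r] [K ! 0, K ! Suc 0, K ! 2] = cw_idx [p, q, r] K * h K"
        by (simp add: mult.commute)
    qed
    then show ?thesis
      using sum_cw_idx[OF alternating_list_3_hodge_5, of "[p, q, r]"] by (simp add: h_def fact_numeral)
  qed
  have "\<forall>l. (\<Sum>K | length K = 3. h K * psi (K ! 0) (K ! 1) (K ! 2) l) = 6 * psi_trace T l"
    unfolding forall_8 psi_last
    by (simp add: distrib_left right_diff_distrib sum.distrib sum_subtractf sum_negf X)
      (simp add: h_def hodge_5_values[OF alternating_list_d_psi[OF T]] d_psi_list_def d_psi_def sum_8 psi_trace_explicit[OF T]
        alternating3_sort[OF T] psi_sort psi_increasing psi_refl)
  then show ?thesis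
    using S by (simp add: h_def)
qed

section \<open>Multilinearity of the exterior operations, and frame sums of wedge products\<close>

lemma linear_divide:
  fixes f :: "r8 \<Rightarrow> real"
  shows "linear f \<Longrightarrow> linear (\<lambda>v. f v / c)"
  using linear_compose_scale_right[of f "1 / c"] by simp

lemma multilinear_ext_d:
  assumes W: "open W" and \<omega>: "tensor_field W n \<omega>" and x: "x \<in> W"
  shows "multilinear (Suc n) (ext_d \<omega> x)"
  unfolding multilinear_def
proof (intro allI impI)
  fix vs :: "r8 list" and i assume vs: "length vs = Suc n" and i: "i < Suc n"
  let ?rest = "\<lambda>k vs. take k vs @ drop (Suc k) vs"
  have rest: "length (?rest k vs) = n" if "k < Suc n" for k
    using vs that by simp
  have "linear (\<lambda>v. fd (\<lambda>y. \<omega> y (?rest k (vs[i := v]))) x (vs[i := v] ! k))" if k: "k < Suc n" for k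
  proof (cases "k = i")
    case True
    have "linear (fd (\<lambda>y. \<omega> y (?rest k vs)) x)"
      by (intro linear_frechet_derivative smooth_on_differentiable[OF tensor_fieldD(2)[OF \<omega> rest[OF k]] x])
    then show ?thesis using True vs i by simp
  next
    case False
    \<comment> \<open>The position of slot \<open>i\<close> after slot \<open>k\<close> has been
      deleted from the list.\<close>
    define j where "j = (if i < k then i else i - 1)"
    have j: "j < n" using False i k by (auto simp: j_def)
    have "?rest k (vs[i := v]) = (?rest k vs)[j := v]" for v
      using False vs i k by (auto simp: j_def list_update_append take_update_swap drop_update_swap list_update_beyond)
    then show ?thesis
      using False linear_fd_slot[OF W \<omega> x rest[OF k] j] by simp
  qed
  then have "linear (\<lambda>v. (- 1) ^ k * fd (\<lambda>y. \<omega> y (?rest k (vs[i := v]))) x (vs[i := v] ! k))" if "k < Suc n" for k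
    using linear_compose_scale_right[of _ "(- 1) ^ k"] that by fastforce
  then show "linear (\<lambda>v. ext_d \<omega> x (vs[i := v]))"
    using vs by (simp add: ext_d_def linear_compose_sum del: sum.lessThan_Suc)
qed

lemma multilinear_covector_wedge:
  assumes "\<And>a. a \<in> set \<alpha>s \<Longrightarrow> linear a"
  shows "multilinear (length \<alpha>s) (covector_wedge \<alpha>s)"
  unfolding multilinear_def
proof (intro allI impI)
  fix vs :: "r8 list" and i assume vs: "length vs = length \<alpha>s" and i: "i < length \<alpha>s"
  let ?n = "length \<alpha>s"
  have "linear (\<lambda>v. of_int (sign \<sigma>) * (\<Prod>m<?n. (\<alpha>s ! m) (vs[i := v] ! \<sigma> m)))" if \<sigma>: "\<sigma> permutes {..<?n}" for \<sigma>
  proof -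
    let ?m = "inv \<sigma> i"
    have m: "?m < ?n" "\<sigma> ?m = i"
      using permutes_in_image[OF permutes_inv[OF \<sigma>], of i] permutes_inverses(1)[OF \<sigma>] i by auto
    have "(\<Prod>m<?n. (\<alpha>s ! m) (vs[i := v] ! \<sigma> m)) = (\<alpha>s ! ?m) v * (\<Prod>m\<in>{..<?n} - {?m}. (\<alpha>s ! m) (vs ! \<sigma> m))" for v
    proof -
      have "(\<Prod>m\<in>{..<?n} - {?m}. (\<alpha>s ! m) (vs[i := v] ! \<sigma> m)) = (\<Prod>m\<in>{..<?n} - {?m}. (\<alpha>s ! m) (vs ! \<sigma> m))"
      proof (intro prod.cong refl)
        fix m assume "m \<in> {..<?n} - {?m}"
        then have "\<sigma> m \<noteq> i"
          using permutes_inverses(2)[OF \<sigma>, of m] by auto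
        then show "(\<alpha>s ! m) (vs[i := v] ! \<sigma> m) = (\<alpha>s ! m) (vs ! \<sigma> m)" by simp
      qed
      then show ?thesis
        using m i vs by (subst prod.remove[of _ ?m]) auto
    qed
    moreover have "linear (\<alpha>s ! ?m)"
      using assms m(1) by simp
    ultimately show ?thesis
      using linear_compose_scale_right[of "\<alpha>s ! ?m" "of_int (sign \<sigma>) * (\<Prod>m\<in>{..<?n} - {?m}. (\<alpha>s ! m) (vs ! \<sigma> m))"]
      by (simp add: ac_simps)
  qed
  then show "linear (\<lambda>v. covector_wedge \<alpha>s (vs[i := v]))"
    unfolding covector_wedge_def by (intro linear_compose_sum) auto
qed

lemma multilinear_wedge:
  assumes \<alpha>: "multilinear k \<alpha>" and \<beta>: "multilinear l \<beta>"
  shows "multilinear (k + l) (wedge k l \<alpha> \<beta>)"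
  unfolding multilinear_def
proof (intro allI impI)
  fix vs :: "r8 list" and i assume vs: "length vs = k + l" and i: "i < k + l"
  have "linear (\<lambda>v. of_int (sign \<sigma>) * \<alpha> (map (\<lambda>j. vs[i := v] ! \<sigma> j) [0..<k]) * \<beta> (map (\<lambda>j. vs[i := v] ! \<sigma> j) [k..<k + l]))"
    if \<sigma>: "\<sigma> permutes {..<k + l}" for \<sigma>
  proof -
    let ?m = "inv \<sigma> i"
    have m: "?m < k + l" "\<sigma> ?m = i"
      using permutes_in_image[OF permutes_inv[OF \<sigma>], of i] permutes_inverses(1)[OF \<sigma>] i by auto
    have n: "\<sigma> j = i \<longleftrightarrow> j = ?m" for j
      using permutes_inverses[OF \<sigma>] by metis
    have nth: "vs[i := v] ! \<sigma> j = (if j = ?m then v else vs ! \<sigma> j)" for v j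
      using n[of j] m(2) i vs by (cases "j = ?m") simp_all
    have mul: "linear (\<lambda>v. c * f v * b)" if "linear f" for f :: "r8 \<Rightarrow> real" and b c
      using linear_compose_scale_right[OF that, of "c * b"] by (simp add: ac_simps)
    show ?thesis
    proof (cases "?m < k")
      case True
      have E: "map (\<lambda>j. vs[i := v] ! \<sigma> j) [0..<k] = (map (\<lambda>j. vs ! \<sigma> j) [0..<k])[?m := v]"
        "map (\<lambda>j. vs[i := v] ! \<sigma> j) [k..<k + l] = map (\<lambda>j. vs ! \<sigma> j) [k..<k + l]" for v
        using True by (auto intro!: nth_equalityI simp: nth nth_list_update)
      show ?thesis
        unfolding E by (intro mul multilinearD[OF \<alpha>]) (use True in simp_all)
    next
      case False
      have E: "map (\<lambda>j. vs[i := v] ! \<sigma> j) [0..<k] = map (\<lambda>j. vs ! \<sigma> j) [0..<k]"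
        "map (\<lambda>j. vs[i := v] ! \<sigma> j) [k..<k + l] = (map (\<lambda>j. vs ! \<sigma> j) [k..<k + l])[?m - k := v]" for v
        using False by (auto intro!: nth_equalityI simp: nth nth_list_update)
      have "linear (\<lambda>v. \<beta> ((map (\<lambda>j. vs ! \<sigma> j) [k..<k + l])[?m - k := v]))"
        by (intro multilinearD[OF \<beta>]) (use False m(1) in simp_all)
      then show ?thesis
        unfolding E using linear_compose_scale_right by fastforce
    qed
  qed
  then show "linear (\<lambda>v. wedge k l \<alpha> \<beta> (vs[i := v]))"
    unfolding wedge_def by (intro linear_divide linear_compose_sum) auto
qed

lemma multilinear_append:
  assumes "multilinear (m + n) \<alpha>"
  shows "length ws = n \<Longrightarrow> multilinear m (\<lambda>us. \<alpha> (us @ ws))" "length us = m \<Longrightarrow> multilinear n (\<lambda>ws. \<alpha> (us @ ws))"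
proof -
  show "multilinear m (\<lambda>us. \<alpha> (us @ ws))" if "length ws = n"
    unfolding multilinear_def
  proof (intro allI impI)
    fix us :: "r8 list" and i assume "length us = m" "i < m"
    then show "linear (\<lambda>v. \<alpha> (us[i := v] @ ws))"
      using multilinearD[OF assms, of "us @ ws" i] that by (simp add: list_update_append)
  qed
  show "multilinear n (\<lambda>ws. \<alpha> (us @ ws))" if "length us = m"
    unfolding multilinear_def
  proof (intro allI impI)
    fix ws :: "r8 list" and i assume "length ws = n" "i < n"
    then show "linear (\<lambda>v. \<alpha> (us @ ws[i := v]))"
      using multilinearD[OF assms, of "us @ ws" "m + i"] that by (simp add: list_update_append)
  qed
qed

lemma multilinear_hodge:
  assumes "\<And>us. length us = k \<Longrightarrow> multilinear n (\<lambda>ws. vol (us @ ws))"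
  shows "multilinear n (hodge g vol k \<alpha>)"
  unfolding multilinear_def
proof (intro allI impI)
  fix ws :: "r8 list" and i assume ws: "length ws = n" "i < n"
  show "linear (\<lambda>v. hodge g vol k \<alpha> (ws[i := v]))"
    unfolding hodge_def
  proof (intro linear_divide linear_compose_sum ballI)
    fix "is" :: "8 list" assume "is \<in> {is. length is = k}"
    then show "linear (\<lambda>v. \<alpha> (map (some_frame g) is) * vol (map (some_frame g) is @ ws[i := v]))"
      using linear_compose_scale_right[OF multilinearD[OF assms ws]] by simp
  qed
qed

lemma wedge_permute_list:
  assumes "length I = k + l"
  shows "wedge k l \<alpha> \<beta> (map e I) = (\<Sum>\<sigma> | \<sigma> permutes {..<k + l}. of_int (sign \<sigma>)
     * \<alpha> (map e (take k (permute_list \<sigma> I))) * \<beta> (map e (drop k (permute_list \<sigma> I)))) / (fact k * fact l)"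
proof -
  have "map (\<lambda>i. map e I ! \<sigma> i) [0..<k] = map e (take k (permute_list \<sigma> I))"
    "map (\<lambda>i. map e I ! \<sigma> i) [k..<k + l] = map e (drop k (permute_list \<sigma> I))" if "\<sigma> permutes {..<k + l}" for \<sigma>
  proof -
    have nth: "map e I ! \<sigma> i = e (I ! \<sigma> i)" if "i < k + l" for i
      using permutes_in_image[OF \<open>\<sigma> permutes {..<k + l}\<close>, of i] assms that by simp
    show "map (\<lambda>i. map e I ! \<sigma> i) [0..<k] = map e (take k (permute_list \<sigma> I))"
      "map (\<lambda>i. map e I ! \<sigma> i) [k..<k + l] = map e (drop k (permute_list \<sigma> I))"
      by (simp_all add: permute_list_def assms take_map drop_map nth)
  qed
  then show ?thesis
    unfolding wedge_def by (intro arg_cong2[where f="(/)"] sum.cong refl) auto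
qed

text \<open>Against an alternating \<open>\<eta>\<close> every permutation in the wedge product
  contributes the same amount: reindexing the lists absorbs it, and the signs cancel.\<close>

lemma sum_wedge_alternating:
  assumes \<eta>: "alternating_list (k + l) \<eta>"
  shows "(\<Sum>I | length I = k + l. wedge k l \<alpha> \<beta> (map e I) * \<eta> I)
    = fact (k + l) / (fact k * fact l) * (\<Sum>I | length I = k + l. \<alpha> (map e (take k I)) * \<beta> (map e (drop k I)) * \<eta> I)"
proof -
  let ?L = "{I :: 8 list. length I = k + l}"
  let ?F = "\<lambda>I. \<alpha> (map e (take k I)) * \<beta> (map e (drop k I))"
  have one: "(\<Sum>I\<in>?L. of_int (sign \<sigma>) * ?F (permute_list \<sigma> I) * \<eta> I) = (\<Sum>I\<in>?L. ?F I * \<eta> I)"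
    if \<sigma>: "\<sigma> permutes {..<k + l}" for \<sigma>
  proof -
    have inv: "inv \<sigma> permutes {..<k + l}" by (rule permutes_inv[OF \<sigma>])
    have "(\<Sum>I\<in>?L. of_int (sign \<sigma>) * ?F (permute_list \<sigma> I) * \<eta> I) = (\<Sum>I\<in>?L. ?F (permute_list \<sigma> I) * \<eta> (permute_list \<sigma> I))"
      using alternating_list_permute[OF \<eta> \<sigma>] by (intro sum.cong) auto
    also have "\<dots> = (\<Sum>I\<in>?L. ?F I * \<eta> I)"
    proof (rule sum.reindex_bij_witness[where i="permute_list (inv \<sigma>)" and j="permute_list \<sigma>"])
      fix I :: "8 list" assume "I \<in> ?L"
      then have I: "length I = k + l" by simp
      show "permute_list (inv \<sigma>) (permute_list \<sigma> I) = I"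
        using permute_list_compose[of "inv \<sigma>" I \<sigma>] \<sigma> inv I permutes_inv_o(1)[OF \<sigma>] by simp
      show "permute_list \<sigma> (permute_list (inv \<sigma>) I) = I"
        using permute_list_compose[of \<sigma> I "inv \<sigma>"] \<sigma> inv I permutes_inv_o(2)[OF \<sigma>] by simp
      show "permute_list \<sigma> I \<in> ?L" "permute_list (inv \<sigma>) I \<in> ?L"
        using I by simp_all
    qed simp
    finally show ?thesis .
  qed
  have "(\<Sum>I\<in>?L. wedge k l \<alpha> \<beta> (map e I) * \<eta> I)
    = (\<Sum>I\<in>?L. \<Sum>\<sigma> | \<sigma> permutes {..<k + l}. of_int (sign \<sigma>) * ?F (permute_list \<sigma> I) * \<eta> I) / (fact k * fact l)"
    unfolding sum_divide_distrib by (intro sum.cong refl) (simp add: wedge_permute_list sum_distrib_right sum_divide_distrib mult.assoc)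
  also have "(\<Sum>I\<in>?L. \<Sum>\<sigma> | \<sigma> permutes {..<k + l}. of_int (sign \<sigma>) * ?F (permute_list \<sigma> I) * \<eta> I)
    = (\<Sum>\<sigma> | \<sigma> permutes {..<k + l}. \<Sum>I\<in>?L. ?F I * \<eta> I)"
    by (subst sum.swap) (intro sum.cong refl one, simp)
  finally show ?thesis
    by (simp add: card_permutations)
qed

section \<open>The Lee form in the adapted frame\<close>

context spin7_chart
begin

text \<open>\<open>orthonormal_trace\<close>, one slot at a time. It replaces the arbitrary frame in
  \<open>hodge\<close> by the adapted one.\<close>

lemma sum_lists_orthonormal:
  assumes y: "y \<in> W" and f: "orthonormal_frame (g y) f" and "multilinear n \<alpha>" "multilinear n \<beta>"
  shows "(\<Sum>is | length is = n. \<alpha> (map f is) * \<beta> (map f is)) = (\<Sum>is | length is = n. \<alpha> (map (e y) is) * \<beta> (map (e y) is))"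
  using assms(3,4)
proof (induction n arbitrary: \<alpha> \<beta>)
  case 0
  then show ?case by simp
next
  case (Suc n)
  have l: "multilinear n (\<lambda>vs. \<gamma> (u # vs))" if "multilinear (Suc n) \<gamma>" for \<gamma> u
    using multilinear_append(2)[of 1 n \<gamma> "[u]"] that by simp
  have s: "linear (\<lambda>u. \<gamma> (u # vs))" if "multilinear (Suc n) \<gamma>" "length vs = n" for \<gamma> vs
    using multilinearD[OF that(1), of "0 # vs" 0] that(2) by simp
  have "(\<Sum>is | length is = Suc n. \<alpha> (map f is) * \<beta> (map f is))
    = (\<Sum>i\<in>UNIV. \<Sum>is | length is = n. \<alpha> (f i # map (e y) is) * \<beta> (f i # map (e y) is))"
    unfolding sum_lists_Suc using Suc.IH[OF l[OF Suc.prems(1)] l[OF Suc.prems(2)]] by simp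
  also have "\<dots> = (\<Sum>is | length is = n. \<Sum>i\<in>UNIV. \<alpha> (f i # map (e y) is) * \<beta> (f i # map (e y) is))"
    by (rule sum.swap)
  also have "\<dots> = (\<Sum>is | length is = n. \<Sum>i\<in>UNIV. \<alpha> (e y i # map (e y) is) * \<beta> (e y i # map (e y) is))"
  proof (rule sum.cong[OF refl])
    fix "is" :: "8 list" assume "is \<in> {is. length is = n}"
    then have "linear (\<lambda>u. \<alpha> (u # map (e y) is) * c)" "linear (\<lambda>u. c * \<beta> (u # map (e y) is))" for c
      using linear_compose_scale_right[OF s[OF Suc.prems(1)], of _ c] linear_compose_scale_right[OF s[OF Suc.prems(2)], of _ c]
      by (simp_all add: mult.commute)
    then show "(\<Sum>i\<in>UNIV. \<alpha> (f i # map (e y) is) * \<beta> (f i # map (e y) is)) = (\<Sum>i\<in>UNIV. \<alpha> (e y i # map (e y) is) * \<beta> (e y i # map (e y) is))"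
      by (intro orthonormal_trace[OF y f, of "\<lambda>u v. \<alpha> (u # map (e y) is) * \<beta> (v # map (e y) is)"])
  qed
  also have "\<dots> = (\<Sum>is | length is = Suc n. \<alpha> (map (e y) is) * \<beta> (map (e y) is))"
    unfolding sum_lists_Suc by (subst sum.swap) simp
  finally show ?case .
qed

lemma vol_multilinear: "y \<in> W \<Longrightarrow> multilinear 8 (vol y)"
proof -
  assume y: "y \<in> W"
  have "linear a" if "a \<in> set (map (\<epsilon> y) [0, 1, 2, 3, 4, 5, 6, 7])" for a
    using that \<epsilon>_linear[OF y] by auto
  from multilinear_covector_wedge[of "map (\<epsilon> y) [0, 1, 2, 3, 4, 5, 6, 7]", OF this]
  have "multilinear 8 (covector_wedge (map (\<epsilon> y) [0, 1, 2, 3, 4, 5, 6, 7]))"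
    by (simp add: eval_nat_numeral)
  then show ?thesis
    using y by (simp add: multilinear_def vol_eq)
qed

lemma vol_e: "y \<in> W \<Longrightarrow> length is = 8 \<Longrightarrow> vol y (map (e y) is) = vol_idx is"
  using cw_idx_dual[OF dual, of y "[0, 1, 2, 3, 4, 5, 6, 7]" "is"] by (simp add: vol_eq vol_idx_def)

lemma hodge_eq:
  assumes y: "y \<in> W" and \<alpha>: "multilinear k \<alpha>" and "k + length ws = 8"
  shows "hodge (g y) (vol y) k \<alpha> ws = (\<Sum>is | length is = k. \<alpha> (map (e y) is) * vol y (map (e y) is @ ws)) / fact k"
  unfolding hodge_def
  using sum_lists_orthonormal[OF y orthonormal_some_frame[OF y] \<alpha> multilinear_append(1), of "length ws" "vol y" ws]
    vol_multilinear[OF y] assms(3) by simp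

text \<open>Parallelism turns each derivative of \<open>\<Psi>\<close> into connection terms
  \<open>G\<close>; alternation combines \<open>G a b\<close> and \<open>G b a\<close> into the
  torsion.\<close>

lemma d_Psi_e:
  assumes y: "y \<in> W" and "length J = 5"
  shows "ext_d \<Psi> y (map (e y) J) = d_psi_list (Tc y) J"
proof -
  define G where "G a b m = \<epsilon> y m (\<Gamma> y (e y a) (e y b))" for a b m
  have T: "Tc y a b m = G a b m - G b a m" for a b m
    by (simp add: G_def \<epsilon>_tor[OF y, symmetric] tor_def linear_diff[OF \<epsilon>_linear[OF y]])
  have d: "fd (\<lambda>z. \<Psi> z [e y p, e y q, e y r, e y s]) y (e y a)
    = (\<Sum>m\<in>UNIV. G a p m * psi m q r s - G a q m * psi m p r s + G a r m * psi m p q s - G a s m * psi m p q r)" for a p q r s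
  proof -
    let ?vs = "[e y p, e y q, e y r, e y s]"
    have "fd (\<lambda>z. \<Psi> z ?vs) y (e y a) = (\<Sum>i<4. \<Psi> y (?vs[i := \<Gamma> y (e y a) (?vs ! i)]))"
      using \<Psi>_par[OF y, of "e y a # ?vs"] by (simp add: nabla_Cons lessThan_Suc eval_nat_numeral)
    also have "\<dots> = (\<Sum>i<4. \<Sum>m\<in>UNIV. \<epsilon> y m (\<Gamma> y (e y a) (?vs ! i)) * \<Psi> y (?vs[i := e y m]))"
      by (intro sum.cong refl multilinear_expand[OF y tensor_fieldD(1)[OF \<Psi>_field y]]) simp_all
    also have "\<dots> = (\<Sum>m\<in>UNIV. G a p m * psi m q r s + G a q m * psi p m r s + G a r m * psi p q m s + G a s m * psi p q r m)"
      by (simp add: eval_nat_numeral lessThan_Suc \<Psi>_e[OF y] G_def sum.distrib)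
    also have "\<dots> = (\<Sum>m\<in>UNIV. G a p m * psi m q r s - G a q m * psi m p r s + G a r m * psi m p q s - G a s m * psi m p q r)"
    proof (rule sum.cong[OF refl])
      fix m
      have "psi p m r s = - psi m p r s" "psi p q m s = psi m p q s" "psi p q r m = - psi m p q r"
        using psi_swap(1)[of p m r s] psi_cyc[of p q m s] psi_front[of m p q r] by simp_all
      then show "G a p m * psi m q r s + G a q m * psi p m r s + G a r m * psi p q m s + G a s m * psi p q r m
        = G a p m * psi m q r s - G a q m * psi m p r s + G a r m * psi m p q s - G a s m * psi m p q r" by simp
    qed
    finally show ?thesis .
  qed
  obtain a b c r s where J: "J = [a, b, c, r, s]"
    using assms(2) by (auto simp: length_Suc_conv eval_nat_numeral)
  show ?thesis
    unfolding J by (simp add: ext_d_def d_psi_list_def d_psi_def lessThan_Suc eval_nat_numeral d T sum.distrib[symmetric] sum_subtractf[symmetric] flip: sum_negf)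
      (intro sum.cong refl, simp add: algebra_simps)
qed

text \<open>The constants cancel: the wedge product contributes
  \<open>fact 7 / (fact 3 * fact 4)\<close>, the index sum 144, and the last Hodge star divides by
  \<open>fact 7\<close>. Only the factor -1/7 of the Lee form is left.\<close>

lemma lee_form_eq:
  assumes y: "y \<in> W"
  shows "lee_form \<Psi> g vol y [w] = - (\<Sum>d\<in>UNIV. \<epsilon> y d w * psi_trace (Tc y) d) / 7"
proof -
  let ?\<beta> = "hodge (g y) (vol y) 5 (ext_d \<Psi> y)"
  have d\<Psi>: "multilinear 5 (ext_d \<Psi> y)"
    using multilinear_ext_d[OF W \<Psi>_field y] by simp
  have v: "multilinear 3 (\<lambda>ws. vol y (us @ ws))" if "length us = 5" for us
    using multilinear_append(2)[of 5 3 "vol y" us] vol_multilinear[OF y] that by simp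
  have v1: "multilinear 1 (\<lambda>ws. vol y (us @ ws))" if "length us = 7" for us
    using multilinear_append(2)[of 7 1 "vol y" us] vol_multilinear[OF y] that by simp
  have \<beta>: "multilinear 3 ?\<beta>"
    by (rule multilinear_hodge[OF v])
  have w: "multilinear 7 (wedge 3 4 ?\<beta> (\<Psi> y))"
    using multilinear_wedge[OF \<beta> tensor_fieldD(1)[OF \<Psi>_field y]] by simp
  have \<beta>e: "?\<beta> (map (e y) K) = hodge_5 (d_psi_list (Tc y)) K" if "length K = 3" for K
  proof -
    have "(\<Sum>J | length J = 5. ext_d \<Psi> y (map (e y) J) * vol y (map (e y) J @ map (e y) K))
      = (\<Sum>J | length J = 5. d_psi_list (Tc y) J * vol_idx (J @ K))"
      using that by (intro sum.cong refl) (simp add: d_Psi_e[OF y] vol_e[OF y] flip: map_append)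
    then show ?thesis
      using hodge_eq[OF y d\<Psi>, of "map (e y) K"] that by (simp add: hodge_5_def fact_numeral)
  qed
  have \<Psi>e: "\<Psi> y (map (e y) J) = psi_list J" if "length J = 4" for J
    using that by (auto simp: length_Suc_conv eval_nat_numeral \<Psi>_e[OF y] psi_list_def psi_eq_psi_terms)
  have e: "lee_form \<Psi> g vol y [e y l] = - psi_trace (Tc y) l / 7" for l
  proof -
    have "hodge (g y) (vol y) 7 (wedge 3 4 ?\<beta> (\<Psi> y)) [e y l]
      = (\<Sum>I | length I = 7. wedge 3 4 ?\<beta> (\<Psi> y) (map (e y) I) * vol y (map (e y) I @ [e y l])) / fact 7"
      by (rule hodge_eq[OF y w]) simp
    also have "(\<Sum>I | length I = 7. wedge 3 4 ?\<beta> (\<Psi> y) (map (e y) I) * vol y (map (e y) I @ [e y l]))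
      = (\<Sum>I | length I = 3 + 4. wedge 3 4 ?\<beta> (\<Psi> y) (map (e y) I) * vol_idx (I @ [l]))"
    proof (rule sum.cong)
      fix I :: "8 list" assume "I \<in> {I. length I = 3 + 4}"
      then show "wedge 3 4 ?\<beta> (\<Psi> y) (map (e y) I) * vol y (map (e y) I @ [e y l]) = wedge 3 4 ?\<beta> (\<Psi> y) (map (e y) I) * vol_idx (I @ [l])"
        using vol_e[OF y, of "I @ [l]"] by simp
    qed simp
    also have "\<dots> = fact (3 + 4) / (fact 3 * fact 4)
      * (\<Sum>I | length I = 3 + 4. ?\<beta> (map (e y) (take 3 I)) * \<Psi> y (map (e y) (drop 3 I)) * vol_idx (I @ [l]))"
      using alternating_list_cw_idx[of "[0, 1, 2, 3, 4, 5, 6, 7]" "[]" 7 "[l]"]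
      by (intro sum_wedge_alternating) (simp add: vol_idx_def)
    also have "(\<Sum>I | length I = 3 + 4. ?\<beta> (map (e y) (take 3 I)) * \<Psi> y (map (e y) (drop 3 I)) * vol_idx (I @ [l]))
      = (\<Sum>I | length I = 7. hodge_5 (d_psi_list (Tc y)) (take 3 I) * psi_list (drop 3 I) * vol_idx (I @ [l]))"
      by (intro sum.cong) (simp_all add: \<beta>e \<Psi>e)
    also have "\<dots> = 144 * psi_trace (Tc y) l"
      by (rule sum_hodge_psi_vol[OF Tc_alt[OF y]])
    finally show ?thesis
      by (simp add: lee_form_def fact_numeral)
  qed
  have "multilinear 1 (hodge (g y) (vol y) 7 (wedge 3 4 ?\<beta> (\<Psi> y)))"
    by (rule multilinear_hodge[OF v1])
  from multilinear_expand[OF y this, of "[0]" 0 w]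
  have "lee_form \<Psi> g vol y [w] = - (1 / 7) * (\<Sum>d\<in>UNIV. \<epsilon> y d w * hodge (g y) (vol y) 7 (wedge 3 4 ?\<beta> (\<Psi> y)) [e y d])"
    by (simp add: lee_form_def)
  also have "\<dots> = (\<Sum>d\<in>UNIV. \<epsilon> y d w * lee_form \<Psi> g vol y [e y d])"
    unfolding lee_form_def sum_distrib_left by (intro sum.cong refl) simp
  finally have "lee_form \<Psi> g vol y [w] = (\<Sum>d\<in>UNIV. \<epsilon> y d w * lee_form \<Psi> g vol y [e y d])" .
  then show ?thesis
    by (simp add: e sum_divide_distrib sum_negf)
qed

lemma frame_lee_closed:
  assumes y: "y \<in> W" and closed: "\<And>u v. ext_d (lee_form \<Psi> g vol) y [u, v] = 0"
  shows "psi_trace (Dc y i) j - psi_trace (Dc y j) i + (\<Sum>m\<in>UNIV. Tc y i j m * psi_trace (Tc y) m) = 0"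
proof -
  define \<tau> where "\<tau> y vs = (\<Sum>d\<in>UNIV. \<epsilon> y d (vs ! 0) * psi_trace (Tc y) d)" for y and vs :: "r8 list"
  have t: "smooth_on W (\<lambda>y. psi_trace (Tc y) d)" for d
    by (rule psi_trace_smooth[OF Tc_smooth])
  have "linear (\<lambda>v. \<epsilon> y d v * c)" if "y \<in> W" for y d c
    using linear_compose_scale_right[OF \<epsilon>_linear[OF that, of d], of c] by (simp add: mult.commute)
  then have field: "tensor_field W 1 \<tau>"
    unfolding tensor_field_def multilinear_def \<tau>_def
    by (auto intro!: linear_compose_sum smooth_on_sum smooth_on_mult W \<epsilon>_smooth t)
  have comp: "\<tau> y [e y i] = psi_trace (Tc y) i" if "y \<in> W" for y i
    by (simp add: \<tau>_def \<epsilon>_e[OF that] if_distrib[of "\<lambda>c. c * _"] cong: if_cong)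
  have n: "nabla \<Gamma> \<tau> y [e y p, e y i] = psi_trace (Dc y p) i" for p i
  proof -
    have "\<partial> p (\<lambda>y. \<tau> y (map (e y) [i])) y = \<partial> p (\<lambda>y. psi_trace (Tc y) i) y"
      by (subst fd_cong[OF W y, of _ "\<lambda>y. psi_trace (Tc y) i"]) (simp_all add: comp)
    then show ?thesis
      using frame_deriv_components[OF field y, of "[i]" p] frame_deriv_psi_trace_Tc[OF y, of i p] by (simp add: comp[OF y])
  qed
  have d: "fd (\<lambda>y. \<tau> y [v]) y u - fd (\<lambda>y. \<tau> y [u]) y v = 0" for u v
  proof -
    have l: "fd (\<lambda>y. lee_form \<Psi> g vol y [v]) y u = (- 1 / 7) * fd (\<lambda>y. \<tau> y [v]) y u" for u v
    proof -
      have "fd (\<lambda>y. lee_form \<Psi> g vol y [v]) y u = fd (\<lambda>y. (- 1 / 7) * \<tau> y [v]) y u"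
        by (subst fd_cong[OF W y, of _ "\<lambda>y. (- 1 / 7) * \<tau> y [v]"]) (simp_all add: lee_form_eq \<tau>_def)
      also have "\<dots> = (- 1 / 7) * fd (\<lambda>y. \<tau> y [v]) y u"
        by (intro fd_eqI has_derivative_mult_right has_derivative_fd smooth_on_differentiable[OF tensor_fieldD(2)[OF field] y]) simp
      finally show ?thesis .
    qed
    show ?thesis
      using closed[of u v] by (simp add: ext_d_def lessThan_Suc l)
  qed
  \<comment> \<open>The difference between the coordinate derivatives and the covariant ones is
    \<open>\<tau>\<close> applied to the torsion, which supplies the last term.\<close>
  have "\<tau> y [tor \<Gamma> y (e y i) (e y j)] = (\<Sum>m\<in>UNIV. Tc y i j m * psi_trace (Tc y) m)"
    by (simp add: \<tau>_def \<epsilon>_tor[OF y])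
  moreover have "\<tau> y [tor \<Gamma> y (e y i) (e y j)] = \<tau> y [\<Gamma> y (e y i) (e y j)] - \<tau> y [\<Gamma> y (e y j) (e y i)]"
    using multilinear_add(2)[OF tensor_fieldD(1)[OF field y], of "[0]" 0] by (simp add: tor_def)
  ultimately show ?thesis
    unfolding n[symmetric] using d[of "e y j" "e y i"] by (simp add: nabla_Cons)
qed

end

subsection \<open>The main theorem\<close>
text \<open>All assertions are pointwise statements about local representatives, so a neighbourhood
  of each point with a smooth adapted coframe is enough.\<close>

lemma ex_spin7_chart:
  assumes "spin7_structure A \<Psi>" "induced_metric_volume A \<Psi> g vol" "torsion_connection A \<Psi> g \<Gamma>"
    and c: "c \<in> A" and x: "x \<in> img c"
  obtains W \<epsilon> where "x \<in> W" "W \<subseteq> img c" "spin7_chart W \<epsilon> (\<Psi> c) (g c) (vol c) (\<Gamma> c)"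
proof -
  obtain W \<epsilon> where W: "open W" "x \<in> W" "W \<subseteq> img c"
    and \<epsilon>: "\<And>i v. smooth_on W (\<lambda>y. \<epsilon> y i v)" "\<And>y. y \<in> W \<Longrightarrow> adapted_coframe (\<Psi> c y) (\<epsilon> y)"
    using assms(1) c x unfolding spin7_structure_def by meson
  have img: "y \<in> img c" if "y \<in> W" for y using that W by blast
  have "spin7_chart W \<epsilon> (\<Psi> c) (g c) (vol c) (\<Gamma> c)"
  proof
    show "tensor_field W 4 (\<Psi> c)"
      using assms(1) c img unfolding spin7_structure_def differential_form_def tensor_field_def
      by (auto intro: is_form_multilinear smooth_on_subset[OF W(3)])
    show "smooth_connection W (\<Gamma> c)"
      using assms(3) c img unfolding torsion_connection_def linear_connection_def smooth_connection_def
      by (auto intro: smooth_on_subset[OF W(3)])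
    fix y assume y: "y \<in> W"
    show "adapted_coframe (\<Psi> c y) (\<epsilon> y)" by (rule \<epsilon>(2)[OF y])
    show "g c y [u, v] = (\<Sum>i\<in>UNIV. \<epsilon> y i u * \<epsilon> y i v)" for u v
      using assms(2) c img[OF y] \<epsilon>(2)[OF y] unfolding induced_metric_volume_def by blast
    show "vol c y vs = covector_wedge (map (\<epsilon> y) [0, 1, 2, 3, 4, 5, 6, 7]) vs" if "length vs = 8" for vs
      using assms(2) c img[OF y] \<epsilon>(2)[OF y] that unfolding induced_metric_volume_def by simp
    show "nabla (\<Gamma> c) (g c) y [u, v, z] = 0" for u v z
      using assms(3) c img[OF y] by (simp add: torsion_connection_def parallel_def vanishes_def)
    show "nabla (\<Gamma> c) (\<Psi> c) y vs = 0" if "length vs = 5" for vs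
      using assms(3) c img[OF y] that by (simp add: torsion_connection_def parallel_def vanishes_def)
    show "is_form 3 (torsion (g c) (\<Gamma> c) y)"
      using assms(3) c img[OF y] by (simp add: torsion_connection_def)
  qed (use W \<epsilon> in auto)
  then show ?thesis using that W by blast
qed

theorem theorem1p6:
  fixes A :: "('a::{t2_space, second_countable_topology}) chart set"
    and \<Psi> g vol :: "'a chart \<Rightarrow> local_field"
    and \<Gamma> :: "'a chart \<Rightarrow> local_connection"
  assumes "smooth_atlas A"
    and "spin7_structure A \<Psi>"
    and "induced_metric_volume A \<Psi> g vol"
    and "torsion_connection A \<Psi> g \<Gamma>"
  shows
    "(vanishes A 4 (\<lambda>c. d_nabla_T (g c) (\<Gamma> c)) \<longleftrightarrow>
        (\<forall>c\<in>A. \<forall>x\<in>img c. \<forall>vs. length vs = 4 \<longrightarrow>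
           ext_d (torsion (g c) (\<Gamma> c)) x vs = 2 * sigma_T (g c) (\<Gamma> c) x vs)) \<and>
     (vanishes A 2 (\<lambda>c. ext_d (lee_form (\<Psi> c) (g c) (vol c))) \<and>
      spin7_instanton A \<Psi> g \<Gamma> \<and>
      vanishes A 4 (\<lambda>c. d_nabla_T (g c) (\<Gamma> c)) \<longrightarrow>
        parallel A 3 \<Gamma> (\<lambda>c. torsion (g c) (\<Gamma> c)) \<and>
        (\<forall>c\<in>A. \<forall>x\<in>img c. \<forall>u v. ricci (g c) (\<Gamma> c) x [u, v] = ricci (g c) (\<Gamma> c) x [v, u]) \<and>
        parallel A 2 \<Gamma> (\<lambda>c. ricci (g c) (\<Gamma> c)) \<and>
        parallel A 4 \<Gamma> (\<lambda>c. ext_d (torsion (g c) (\<Gamma> c))))"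
proof (intro conjI impI)
  have "ext_d (torsion (g c) (\<Gamma> c)) x vs = d_nabla_T (g c) (\<Gamma> c) x vs + 2 * sigma_T (g c) (\<Gamma> c) x vs"
    if c: "c \<in> A" and x: "x \<in> img c" and vs: "length vs = 4" for c x vs
  proof -
    obtain W \<epsilon> where W: "x \<in> W" "spin7_chart W \<epsilon> (\<Psi> c) (g c) (vol c) (\<Gamma> c)"
      by (rule ex_spin7_chart[OF assms(2-4) c x])
    obtain a1 a2 a3 a4 where "vs = [a1, a2, a3, a4]"
      using vs by (auto simp: length_Suc_conv eval_nat_numeral)
    then show ?thesis
      using spin7_chart.ext_d_torsion[OF W(2,1)] spin7_chart.sigma_T_eq[OF W(2,1)] by simp
  qed
  then show "vanishes A 4 (\<lambda>c. d_nabla_T (g c) (\<Gamma> c)) \<longleftrightarrow>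
        (\<forall>c\<in>A. \<forall>x\<in>img c. \<forall>vs. length vs = 4 \<longrightarrow>
           ext_d (torsion (g c) (\<Gamma> c)) x vs = 2 * sigma_T (g c) (\<Gamma> c) x vs)"
    unfolding vanishes_def by (metis (no_types, lifting) add_0 add_cancel_left_left)
next
  assume H: "vanishes A 2 (\<lambda>c. ext_d (lee_form (\<Psi> c) (g c) (vol c))) \<and>
      spin7_instanton A \<Psi> g \<Gamma> \<and> vanishes A 4 (\<lambda>c. d_nabla_T (g c) (\<Gamma> c))"
  have chart: "\<exists>W \<epsilon>. x \<in> W \<and> closed_instanton_chart W \<epsilon> (\<Psi> c) (g c) (vol c) (\<Gamma> c)"
    if c: "c \<in> A" and x: "x \<in> img c" for c x
  proof -
    obtain W \<epsilon> where ch: "x \<in> W" "W \<subseteq> img c" "spin7_chart W \<epsilon> (\<Psi> c) (g c) (vol c) (\<Gamma> c)"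
      by (rule ex_spin7_chart[OF assms(2-4) c x])
    interpret spin7_chart W \<epsilon> "\<Psi> c" "g c" "vol c" "\<Gamma> c" by (rule ch(3))
    have "closed_instanton_chart W \<epsilon> (\<Psi> c) (g c) (vol c) (\<Gamma> c)"
    proof unfold_locales
      fix y assume y: "y \<in> W"
      then have img: "y \<in> img c" using ch(2) by blast
      show "d_nabla_T (g c) (\<Gamma> c) y [u, v, z, a] = 0" for u v z a
        using H c img by (simp add: vanishes_def)
      \<comment> \<open>The instanton condition speaks of every orthonormal frame. It is read in the
        adapted one, where the 4-form has the components \<open>psi\<close>.\<close>
      show "self_dual (\<lambda>k l. Rc y k l i j)" for i j
        using H c img orthonormal_e[OF y] unfolding spin7_instanton_def self_dual_def
        by (simp add: Rc_def flip: \<Psi>_e[OF y])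
      show "psi_trace (Dc y i) j - psi_trace (Dc y j) i + (\<Sum>m\<in>UNIV. Tc y i j m * psi_trace (Tc y) m) = 0" for i j
        using H c img by (intro frame_lee_closed[OF y]) (simp add: vanishes_def)
    qed
    then show ?thesis using ch(1) by blast
  qed
  show "parallel A 3 \<Gamma> (\<lambda>c. torsion (g c) (\<Gamma> c))"
    unfolding parallel_def vanishes_def using chart closed_instanton_chart.nabla_T_eq_0 by fastforce
  show "\<forall>c\<in>A. \<forall>x\<in>img c. \<forall>u v. ricci (g c) (\<Gamma> c) x [u, v] = ricci (g c) (\<Gamma> c) x [v, u]"
    using chart closed_instanton_chart.ricci_sym by fastforce
  show "parallel A 2 \<Gamma> (\<lambda>c. ricci (g c) (\<Gamma> c))"
    unfolding parallel_def vanishes_def using chart closed_instanton_chart.nabla_ricci_eq_0 by fastforce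
  show "parallel A 4 \<Gamma> (\<lambda>c. ext_d (torsion (g c) (\<Gamma> c)))"
    unfolding parallel_def vanishes_def using chart closed_instanton_chart.nabla_dT_eq_0 by fastforce
qed

end
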